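(* Let $K$ be a field of characteristic zero and let a Poisson algebra $\mathcal{A}=S^{-1}(P_n/I)$ be a regular domain of essentially finite type over $K$, where $I=(f_1,\ldots,f_m)$ is a prime but not maximal ideal of $P_n=K[x_1,\ldots,x_n]$. Let $d$ be the rank of $\mathcal{C}_{\mathcal{A}}=(\{x_i,x_j\})$ and $r$ the rank of the Jacobian matrix $\big(\frac{\partial f_i}{\partial x_j}\big)$. Then the following statements are equivalent: (1) $\ker(\pi_{\mathcal{A}})=0$ (that is, $\pi_{\mathcal{A}}:\mathcal{U}(\mathcal{A})\simeq P\mathcal{D}(\mathcal{A})$). (2) $\kappa_{\mathcal{A}}=0$. (3) $d=n-r$ and $(\partial_{\mathbf{i};\mathbf{j},j_\nu},\delta_{\mathbf{i}',i'_\mu;\mathbf{j}'})=0$ for all $\mathbf{i}\in\mathbb{I}_r$, $\mathbf{j}\in\mathbb{J}_r$, $\mathbf{i}'\in\mathbb{I}_{\mathcal{A}}(d)$, $\mathbf{j}'\in\mathbb{J}_{\mathcal{A}}(d)$, $\nu=r+1,\ldots,n$ and $\mu=d+1,\ldots,n$, where for $\mathbf{j}=(j_1,\ldots,j_r)$ and $\mathbf{i}'=(i'_1,\ldots,i'_d)$, $\{j_{r+1},\ldots,j_n\}=\{1,\ldots,n\}\setminus\{j_1,\ldots,j_r\}$ and $\{i'_{d+1},\ldots,i'_n\}=\{1,\ldots,n\}\setminus\{i'_1,\ldots,i'_d\}$.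
   Context: A Poisson algebra over $K$ is a commutative associative (unital) $K$-algebra with a $K$-bilinear Lie bracket $\{\cdot,\cdot\}$ satisfying $\{a,xy\}=\{a,x\}y+x\{a,y\}$. An algebra of essentially finite type is a localization of an affine commutative algebra. Poisson enveloping algebra: $(\mathcal{U}(\mathcal{A}),\alpha,\beta)$ is the universal triple with $\mathcal{U}(\mathcal{A})$ an associative algebra, $\alpha:\mathcal{A}\to\mathcal{U}(\mathcal{A})$ an algebra homomorphism, $\beta:\mathcal{A}\to\mathcal{U}(\mathcal{A})$ a Lie algebra homomorphism, $[\beta(a),\alpha(b)]=\alpha(\{a,b\})$ and $\beta(ab)=\beta(a)\alpha(b)+\alpha(a)\beta(b)$. One writes $a=\alpha(a)$, $\delta_a=\beta(a)$, $\delta_i=\delta_{x_i}$. $P\mathcal{D}(\mathcal{A})$ is the subalgebra of $\mathrm{End}_K(\mathcal{A})$ generated by the multiplications by elements of $\mathcal{A}$ and all derivations $\{a,\cdot\}$, $a\in\mathcal{A}$; $\pi_{\mathcal{A}}:\mathcal{U}(\mathcal{A})\to P\mathcal{D}(\mathcal{A})$ is the epimorphism $a\mapsto a$, $\delta_b\mapsto\{b,\cdot\}$. Ranks are over the field of fractions of $\mathcal{A}$. For $\mathbf{i}=(i_1<\cdots<i_r)$ in $\{1,\ldots,m\}$ and $\mathbf{j}=(j_1<\cdots<j_r)$ in $\{1,\ldots,n\}$, $\Delta(\mathbf{i},\mathbf{j})$ is the corresponding $r\times r$ minor of the Jacobian matrix (rows $\mathbf{i}$, columns $\mathbf{j}$).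 $\mathbb{I}_r$ (resp. $\mathbb{J}_r$) is the set of all $\mathbf{i}$ (resp. $\mathbf{j}$) for which $\Delta(\mathbf{i},\mathbf{j}')\ne0$ for some $\mathbf{j}'$ (resp. $\Delta(\mathbf{i}',\mathbf{j})\neq0$ for some $\mathbf{i}'$). For $\mathbf{i}\in\mathbb{I}_r$, $\mathbf{j}\in\mathbb{J}_r$ and $j_\nu\notin\{j_1,\ldots,j_r\}$, $\partial_{\mathbf{i};\mathbf{j},j_\nu}$ is the derivation of $\mathcal{A}$ given by the determinant (expanded along the last row) of the $(r+1)\times(r+1)$ matrix whose first $r$ rows are $\big(\frac{\partial f_{i_s}}{\partial x_{j_1}},\ldots,\frac{\partial f_{i_s}}{\partial x_{j_r}},\frac{\partial f_{i_s}}{\partial x_{j_\nu}}\big)$, $s=1,\ldots,r$, and whose last row is $(\partial_{j_1},\ldots,\partial_{j_r},\partial_{j_\nu})$, $\partial_j=\partial/\partial x_j$. For increasing $d$-tuples $\mathbf{i},\mathbf{j}$ of elements of $\{1,\ldots,n\}$ let $\mu(\mathbf{i},\mathbf{j})=\det(\{x_{i_s},x_{j_t}\})_{s,t=1}^d$. $\mathbb{I}_{\mathcal{A}}(d)$ (resp. $\mathbb{J}_{\mathcal{A}}(d)$) is the set of $\mathbf{i}$ (resp. $\mathbf{j}$) with $\mu(\mathbf{i},\mathbf{j})\neq0$ for some $\mathbf{j}$ (resp. some $\mathbf{i}$); in fact $\mathbb{I}_{\mathcal{A}}(d)=\mathbb{J}_{\mathcal{A}}(d)$. For $\mathbf{i},\mathbf{j}$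 in this set and $i_\nu\in\{1,\ldots,n\}\setminus\{i_1,\ldots,i_d\}$, $$\delta_{\mathbf{i},i_\nu;\mathbf{j}}=\mu(\mathbf{i},\mathbf{j})\delta_{i_\nu}+\sum_{s=1}^d(-1)^{s+d+1}\mu(i_1,\ldots,\widehat{i_s},\ldots,i_d,i_\nu;\mathbf{j})\,\delta_{i_s}\in\mathcal{U}(\mathcal{A}),$$ i.e. the determinant of the $(d+1)\times(d+1)$ matrix with rows $(\{x_{i},x_{j_1}\},\ldots,\{x_{i},x_{j_d}\},\delta_{i})$, $i=i_1,\ldots,i_d,i_\nu$. $\kappa_{\mathcal{A}}$ is the two-sided ideal of $\mathcal{U}(\mathcal{A})$ generated by all the elements $\delta_{\mathbf{i},i_\nu;\mathbf{j}}$. (If $r=0$ or $d=0$ the corresponding tuples are empty and the empty minor is $1$.) The module of Kähler differentials $\Omega_{\mathcal{A}}$ is identified with the left $\mathcal{A}$-submodule $\sum_i\mathcal{A}\delta_i$ of $\mathcal{U}(\mathcal{A})$ via $dx_i\leftrightarrow\delta_i$, and the pairing $\mathrm{Der}_K(\mathcal{A})\times\Omega_{\mathcal{A}}\to\mathcal{A}$ is $(\partial,\sum_i b_i\delta_i)=\sum_i b_i\,\partial(x_i)$.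
   Formalization: The Leibniz relation of U(A) is taken as β(ab)=α(a)β(b)+α(b)β(a); the printed β(ab)=β(a)α(b)+α(a)β(b) forces 2α({a,b})=0, so π_A would not exist for a nonzero bracket. *)

theory Defs
  imports
    "HOL-Algebra.Algebra"
    "HOL-Library.Poly_Mapping"
    "HOL-Library.Extended_Nat"
    "HOL-Computational_Algebra.Fraction_Field"
    "Jordan_Normal_Form.Determinant"
    "Jordan_Normal_Form.DL_Rank"
begin

hide_const (open) Ring_Hom.ring_hom Poly_Mapping.degree Poly_Mapping.range Poly_Mapping.map

section \<open>Poisson algebras and derivations\<close>

locale comm_algebra = vector_space scale
  for scale :: "'k::field \<Rightarrow> 'a::comm_ring_1 \<Rightarrow> 'a" +
  assumes scale_mult_left: "scale c x * y = scale c (x * y)"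

locale poisson_algebra = comm_algebra scale
  for scale :: "'k::field \<Rightarrow> 'a::comm_ring_1 \<Rightarrow> 'a" +
  fixes bracket :: "'a \<Rightarrow> 'a \<Rightarrow> 'a"
  assumes bracket_linear_left: "Vector_Spaces.linear scale scale (\<lambda>a. bracket a b)"
    and bracket_linear_right: "Vector_Spaces.linear scale scale (bracket a)"
    and bracket_self: "bracket a a = 0"
    and bracket_jacobi:
      "bracket a (bracket b c) + bracket b (bracket c a) + bracket c (bracket a b) = 0"
    and bracket_leibniz: "bracket a (x * y) = bracket a x * y + x * bracket a y"

definition derivations :: "('k::field \<Rightarrow> 'a::comm_ring_1 \<Rightarrow> 'a) \<Rightarrow> ('a \<Rightarrow> 'a) set" where
  "derivations scale =
     {D. Vector_Spaces.linear scale scale D \<and> (\<forall>x y. D (x * y) = D x * y + x * D y)}"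


section \<open>Associative algebras and the free algebra\<close>

text \<open>A (not necessarily commutative) \<open>K\<close>-algebra is a ring \<open>B\<close> with a structure map
  \<open>\<eta>\<close> from \<open>K\<close> to the centre of \<open>B\<close>.\<close>

locale assoc_algebra = ring B
  for B :: "('b, 'm) ring_scheme" (structure) and \<eta> :: "'k::field \<Rightarrow> 'b" +
  assumes unit_hom: "\<eta> \<in> ring_hom class_ring B"
    and unit_central: "b \<in> carrier B \<Longrightarrow> \<eta> c \<otimes> b = b \<otimes> \<eta> c"

text \<open>Lists under concatenation are the free monoid, so \<open>'g list \<Rightarrow>\<^sub>0 'k\<close> with its
  convolution product is the free associative \<open>'k\<close>-algebra on \<open>'g\<close>.\<close>

instantiation list :: (type) monoid_add
begin
definition "0 = []"
definition "xs + ys = xs @ ys"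
instance by standard (simp_all add: zero_list_def plus_list_def)
end

abbreviation free_const :: "'k::field \<Rightarrow> 'g list \<Rightarrow>\<^sub>0 'k" where
  "free_const c \<equiv> Poly_Mapping.single [] c"

abbreviation free_var :: "'g \<Rightarrow> 'g list \<Rightarrow>\<^sub>0 'k::field" where
  "free_var g \<equiv> Poly_Mapping.single [g] 1"

definition free_eval ::
    "('b, 'm) ring_scheme \<Rightarrow> ('k::field \<Rightarrow> 'b) \<Rightarrow> ('g \<Rightarrow> 'b) \<Rightarrow> ('g list \<Rightarrow>\<^sub>0 'k) \<Rightarrow> 'b" where
  "free_eval B \<eta> \<gamma> p =
     (\<Oplus>\<^bsub>B\<^esub>w\<in>Poly_Mapping.keys p.
        \<eta> (Poly_Mapping.lookup p w) \<otimes>\<^bsub>B\<^esub> foldr (\<lambda>g b. \<gamma> g \<otimes>\<^bsub>B\<^esub> b) w \<one>\<^bsub>B\<^esub>)"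


section \<open>The Poisson enveloping algebra\<close>

text \<open>The Leibniz relation is \<open>\<beta>(ab) = \<alpha>(a)\<beta>(b) + \<alpha>(b)\<beta>(a)\<close>, i.e.
  \<open>\<delta>\<^bsub>ab\<^esub> = a\<delta>\<^bsub>b\<^esub> + b\<delta>\<^bsub>a\<^esub>\<close>. The variant \<open>\<beta>(ab) = \<beta>(a)\<alpha>(b) + \<alpha>(a)\<beta>(b)\<close> would, together
  with \<open>[\<beta>(a), \<alpha>(b)] = \<alpha>{a,b}\<close> and symmetry in \<open>a, b\<close>, force \<open>2\<alpha>{a,b} = 0\<close>; it does not
  hold for the derivations \<open>{a, \<cdot>}\<close> of the algebra.\<close>

definition poisson_triple ::
    "('k::field \<Rightarrow> 'a::comm_ring_1 \<Rightarrow> 'a) \<Rightarrow> ('a \<Rightarrow> 'a \<Rightarrow> 'a) \<Rightarrow>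
     ('b, 'm) ring_scheme \<Rightarrow> ('k \<Rightarrow> 'b) \<Rightarrow> ('a \<Rightarrow> 'b) \<Rightarrow> ('a \<Rightarrow> 'b) \<Rightarrow> bool" where
  "poisson_triple scale bracket B \<eta> \<alpha> \<beta> \<longleftrightarrow>
     assoc_algebra B \<eta> \<and>
     \<alpha> \<in> ring_hom class_ring B \<and>
     (\<forall>c a. \<alpha> (scale c a) = \<eta> c \<otimes>\<^bsub>B\<^esub> \<alpha> a) \<and>
     range \<beta> \<subseteq> carrier B \<and>
     (\<forall>a b. \<beta> (a + b) = \<beta> a \<oplus>\<^bsub>B\<^esub> \<beta> b) \<and>
     (\<forall>c a. \<beta> (scale c a) = \<eta> c \<otimes>\<^bsub>B\<^esub> \<beta> a) \<and>
     (\<forall>a b. \<beta> (bracket a b) = \<beta> a \<otimes>\<^bsub>B\<^esub> \<beta> b \<ominus>\<^bsub>B\<^esub> \<beta> b \<otimes>\<^bsub>B\<^esub> \<beta> a) \<and>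
     (\<forall>a b. \<beta> a \<otimes>\<^bsub>B\<^esub> \<alpha> b \<ominus>\<^bsub>B\<^esub> \<alpha> b \<otimes>\<^bsub>B\<^esub> \<beta> a = \<alpha> (bracket a b)) \<and>
     (\<forall>a b. \<beta> (a * b) = \<alpha> a \<otimes>\<^bsub>B\<^esub> \<beta> b \<oplus>\<^bsub>B\<^esub> \<alpha> b \<otimes>\<^bsub>B\<^esub> \<beta> a)"

datatype 'a pea_gen = Alpha 'a | Beta 'a

definition pea_relations ::
    "('k::field \<Rightarrow> 'a::comm_ring_1 \<Rightarrow> 'a) \<Rightarrow> ('a \<Rightarrow> 'a \<Rightarrow> 'a) \<Rightarrow> ('a pea_gen list \<Rightarrow>\<^sub>0 'k) set" where
  "pea_relations scale bracket =
    (let A = (\<lambda>a. free_var (Alpha a)); B = (\<lambda>a. free_var (Beta a)) in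
      {A 1 - 1}
      \<union> (\<Union>a b. {A (a + b) - (A a + A b),
                A (a * b) - A a * A b,
                B (a + b) - (B a + B b),
                B (bracket a b) - (B a * B b - B b * B a),
                A (bracket a b) - (B a * A b - A b * B a),
                B (a * b) - (A a * B b + A b * B a)})
      \<union> (\<Union>c a. {A (scale c a) - free_const c * A a,
                B (scale c a) - free_const c * B a}))"

definition pea_ideal ::
    "('k::field \<Rightarrow> 'a::comm_ring_1 \<Rightarrow> 'a) \<Rightarrow> ('a \<Rightarrow> 'a \<Rightarrow> 'a) \<Rightarrow> ('a pea_gen list \<Rightarrow>\<^sub>0 'k) set" where
  "pea_ideal scale bracket = Idl\<^bsub>class_ring\<^esub> (pea_relations scale bracket)"

definition pea ::
    "('k::field \<Rightarrow> 'a::comm_ring_1 \<Rightarrow> 'a) \<Rightarrow> ('a \<Rightarrow> 'a \<Rightarrow> 'a) \<Rightarrow> ('a pea_gen list \<Rightarrow>\<^sub>0 'k) set ring" where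
  "pea scale bracket = class_ring Quot (pea_ideal scale bracket)"

definition pea_unit ::
    "('k::field \<Rightarrow> 'a::comm_ring_1 \<Rightarrow> 'a) \<Rightarrow> ('a \<Rightarrow> 'a \<Rightarrow> 'a) \<Rightarrow> 'k \<Rightarrow> ('a pea_gen list \<Rightarrow>\<^sub>0 'k) set" where
  "pea_unit scale bracket c = pea_ideal scale bracket +>\<^bsub>class_ring\<^esub> free_const c"

definition pea_alpha ::
    "('k::field \<Rightarrow> 'a::comm_ring_1 \<Rightarrow> 'a) \<Rightarrow> ('a \<Rightarrow> 'a \<Rightarrow> 'a) \<Rightarrow> 'a \<Rightarrow> ('a pea_gen list \<Rightarrow>\<^sub>0 'k) set" where
  "pea_alpha scale bracket a = pea_ideal scale bracket +>\<^bsub>class_ring\<^esub> free_var (Alpha a)"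

definition pea_beta ::
    "('k::field \<Rightarrow> 'a::comm_ring_1 \<Rightarrow> 'a) \<Rightarrow> ('a \<Rightarrow> 'a \<Rightarrow> 'a) \<Rightarrow> 'a \<Rightarrow> ('a pea_gen list \<Rightarrow>\<^sub>0 'k) set" where
  "pea_beta scale bracket a = pea_ideal scale bracket +>\<^bsub>class_ring\<^esub> free_var (Beta a)"

text \<open>The homomorphism from the enveloping algebra induced by a triple \<open>(B, \<alpha>, \<beta>)\<close>; see
  \<open>pea_universal\<close> below.\<close>

definition pea_lift ::
    "('b, 'm) ring_scheme \<Rightarrow> ('k::field \<Rightarrow> 'b) \<Rightarrow> ('a \<Rightarrow> 'b) \<Rightarrow> ('a \<Rightarrow> 'b) \<Rightarrow>
     ('a pea_gen list \<Rightarrow>\<^sub>0 'k) set \<Rightarrow> 'b" where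
  "pea_lift B \<eta> \<alpha> \<beta> u = the_elem (free_eval B \<eta> (case_pea_gen \<alpha> \<beta>) ` u)"


section \<open>Poisson differential operators\<close>

definition End_ring :: "('k::field \<Rightarrow> 'a::ab_group_add \<Rightarrow> 'a) \<Rightarrow> ('a \<Rightarrow> 'a) ring" where
  "End_ring scale =
     \<lparr>carrier = {F. Vector_Spaces.linear scale scale F}, monoid.mult = (\<circ>), one = id,
      ring.zero = (\<lambda>x. 0), add = (\<lambda>F G x. F x + G x)\<rparr>"

text \<open>The multiplications include the scalars, so the generated subring is the generated
  subalgebra.\<close>

definition PD_ring ::
    "('k::field \<Rightarrow> 'a::comm_ring_1 \<Rightarrow> 'a) \<Rightarrow> ('a \<Rightarrow> 'a \<Rightarrow> 'a) \<Rightarrow> ('a \<Rightarrow> 'a) ring" where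
  "PD_ring scale bracket = End_ring scale
     \<lparr>carrier := generate_ring (End_ring scale) (range (\<lambda>a. (*) a) \<union> range bracket)\<rparr>"

definition poisson_pi ::
    "('k::field \<Rightarrow> 'a::comm_ring_1 \<Rightarrow> 'a) \<Rightarrow> ('a \<Rightarrow> 'a \<Rightarrow> 'a) \<Rightarrow>
     ('a pea_gen list \<Rightarrow>\<^sub>0 'k) set \<Rightarrow> ('a \<Rightarrow> 'a)" where
  "poisson_pi scale bracket = pea_lift (PD_ring scale bracket) scale (\<lambda>a. (*) a) bracket"


section \<open>Universal property of the enveloping algebra\<close>

lemma update_eq_single_add:
  "a \<notin> Poly_Mapping.keys f \<Longrightarrow> Poly_Mapping.update a b f = Poly_Mapping.single a b + f"
  by (rule poly_mapping_eqI)
     (auto simp: lookup_update lookup_add lookup_single when_def in_keys_iff)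

context assoc_algebra
begin

lemma unit_facts:
  "\<eta> c \<in> carrier B" "\<eta> (c + c') = \<eta> c \<oplus> \<eta> c'" "\<eta> (c * c') = \<eta> c \<otimes> \<eta> c'"
  "\<eta> 1 = \<one>" "\<eta> 0 = \<zero>"
proof -
  show 1: "\<eta> c \<in> carrier B" for c using ring_hom_closed[OF unit_hom] by simp
  show a: "\<eta> (c + c') = \<eta> c \<oplus> \<eta> c'" for c c' using ring_hom_add[OF unit_hom] by simp
  show "\<eta> (c * c') = \<eta> c \<otimes> \<eta> c'" using ring_hom_mult[OF unit_hom] by simp
  show "\<eta> 1 = \<one>" using ring_hom_one[OF unit_hom] by simp
  show "\<eta> 0 = \<zero>" using a[of 0 0] 1[of 0] by (metis add.l_cancel_one' add_0)
qed

lemma free_eval_word_closed: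
  "range \<gamma> \<subseteq> carrier B \<Longrightarrow> foldr (\<lambda>g b. \<gamma> g \<otimes> b) w \<one> \<in> carrier B"
  by (induction w) auto

lemma free_eval_word_append:
  assumes "range \<gamma> \<subseteq> carrier B"
  shows "foldr (\<lambda>g b. \<gamma> g \<otimes> b) (v @ w) \<one> =
    foldr (\<lambda>g b. \<gamma> g \<otimes> b) v \<one> \<otimes> foldr (\<lambda>g b. \<gamma> g \<otimes> b) w \<one>"
proof (induction v)
  case (Cons g v)
  then show ?case
    using assms free_eval_word_closed[OF assms] by (auto simp: m_assoc image_subset_iff)
qed (use free_eval_word_closed[OF assms] in simp)

lemma free_eval_closed: "range \<gamma> \<subseteq> carrier B \<Longrightarrow> free_eval B \<eta> \<gamma> p \<in> carrier B"
  unfolding free_eval_def by (intro finsum_closed) (auto simp: unit_facts free_eval_word_closed)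

lemma free_eval_superset:
  assumes "range \<gamma> \<subseteq> carrier B" "finite W" "Poly_Mapping.keys p \<subseteq> W"
  shows "free_eval B \<eta> \<gamma> p =
    (\<Oplus>w\<in>W. \<eta> (Poly_Mapping.lookup p w) \<otimes> foldr (\<lambda>g b. \<gamma> g \<otimes> b) w \<one>)"
  unfolding free_eval_def
  by (rule add.finprod_mono_neutral_cong_left)
     (use assms free_eval_word_closed[OF assms(1)] in \<open>auto simp: unit_facts in_keys_iff\<close>)

lemma free_eval_add:
  assumes "range \<gamma> \<subseteq> carrier B"
  shows "free_eval B \<eta> \<gamma> (p + q) = free_eval B \<eta> \<gamma> p \<oplus> free_eval B \<eta> \<gamma> q"
proof -
  let ?W = "Poly_Mapping.keys p \<union> Poly_Mapping.keys q"
  let ?v = "\<lambda>w. foldr (\<lambda>g b. \<gamma> g \<otimes> b) w \<one>"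
  have "free_eval B \<eta> \<gamma> (p + q) = (\<Oplus>w\<in>?W. \<eta> (Poly_Mapping.lookup (p + q) w) \<otimes> ?v w)"
    by (rule free_eval_superset[OF assms]) (auto simp: Poly_Mapping.keys_add)
  also have "\<dots> = (\<Oplus>w\<in>?W. \<eta> (Poly_Mapping.lookup p w) \<otimes> ?v w \<oplus> \<eta> (Poly_Mapping.lookup q w) \<otimes> ?v w)"
    by (rule finsum_cong')
       (auto simp: unit_facts lookup_add free_eval_word_closed[OF assms] l_distr)
  also have "\<dots> = (\<Oplus>w\<in>?W. \<eta> (Poly_Mapping.lookup p w) \<otimes> ?v w) \<oplus>
                  (\<Oplus>w\<in>?W. \<eta> (Poly_Mapping.lookup q w) \<otimes> ?v w)"
    by (rule finsum_addf) (auto simp: unit_facts free_eval_word_closed[OF assms])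
  also have "\<dots> = free_eval B \<eta> \<gamma> p \<oplus> free_eval B \<eta> \<gamma> q"
    by (simp add: free_eval_superset[OF assms, of ?W])
  finally show ?thesis .
qed

lemma free_eval_single:
  assumes "range \<gamma> \<subseteq> carrier B"
  shows "free_eval B \<eta> \<gamma> (Poly_Mapping.single w c) =
    \<eta> c \<otimes> foldr (\<lambda>g b. \<gamma> g \<otimes> b) w \<one>"
  by (subst free_eval_superset[OF assms, of "{w}"])
     (use assms in \<open>auto simp: unit_facts free_eval_word_closed\<close>)

lemma free_eval_mult:
  assumes \<gamma>: "range \<gamma> \<subseteq> carrier B"
  shows "free_eval B \<eta> \<gamma> (p * q) = free_eval B \<eta> \<gamma> p \<otimes> free_eval B \<eta> \<gamma> q"
proof -
  note closed = free_eval_closed[OF \<gamma>] free_eval_word_closed[OF \<gamma>] unit_facts(1)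
  have zero: "free_eval B \<eta> \<gamma> 0 = \<zero>" by (simp add: free_eval_def)
  have single: "free_eval B \<eta> \<gamma> (Poly_Mapping.single v c * q) =
      free_eval B \<eta> \<gamma> (Poly_Mapping.single v c) \<otimes> free_eval B \<eta> \<gamma> q" for v c
  proof (induction q rule: update_induct)
    case const
    then show ?case using closed by (simp add: zero)
  next
    case (update q w c')
    have "\<eta> c \<otimes> \<eta> c' \<otimes> (foldr (\<lambda>g b. \<gamma> g \<otimes> b) v \<one> \<otimes> foldr (\<lambda>g b. \<gamma> g \<otimes> b) w \<one>) =
      \<eta> c \<otimes> foldr (\<lambda>g b. \<gamma> g \<otimes> b) v \<one> \<otimes> (\<eta> c' \<otimes> foldr (\<lambda>g b. \<gamma> g \<otimes> b) w \<one>)"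
      using closed unit_central[of "foldr (\<lambda>g b. \<gamma> g \<otimes> b) v \<one>" c']
      by (metis m_assoc m_closed)
    then show ?case using update closed
      by (simp add: update_eq_single_add distrib_left mult_single plus_list_def free_eval_add[OF \<gamma>]
          r_distr free_eval_single[OF \<gamma>] free_eval_word_append[OF \<gamma>] unit_facts
          del: foldr_append)
  qed
  show ?thesis
  proof (induction p rule: update_induct)
    case const
    then show ?case using closed by (simp add: zero)
  next
    case (update p w c)
    then show ?case using closed
      by (simp add: update_eq_single_add distrib_right free_eval_add[OF \<gamma>] single l_distr)
  qed
qed

lemma free_eval_hom:
  assumes "range \<gamma> \<subseteq> carrier B"
  shows "free_eval B \<eta> \<gamma> \<in> ring_hom class_ring B"
proof (rule ring_hom_memI)
  show "free_eval B \<eta> \<gamma> \<one>\<^bsub>class_ring\<^esub> = \<one>"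
    using free_eval_single[OF assms, of "[]" 1] by (simp add: unit_facts single_one[symmetric] zero_list_def del: single_one)
qed (auto simp: free_eval_closed free_eval_add free_eval_mult assms)

end

lemma pea_ideal_ideal: "ideal (pea_ideal scale bracket) class_ring"
  unfolding pea_ideal_def by (rule ring.genideal_ideal[OF class_ring.ring_axioms]) simp

lemma pea_proj_hom: "(+>\<^bsub>class_ring\<^esub>) (pea_ideal scale bracket) \<in> ring_hom class_ring (pea scale bracket)"
  unfolding pea_def by (rule ideal.rcos_ring_hom[OF pea_ideal_ideal])

lemma pea_ring: "ring (pea scale bracket)"
  unfolding pea_def by (rule ideal.quotient_is_ring[OF pea_ideal_ideal])


lemma pea_proj_eqI:
  assumes "p - q \<in> pea_relations scale bracket"
  shows "pea_ideal scale bracket +>\<^bsub>class_ring\<^esub> p = pea_ideal scale bracket +>\<^bsub>class_ring\<^esub> q"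
proof -
  interpret J: ideal "pea_ideal scale bracket" class_ring by (rule pea_ideal_ideal)
  have "p - q \<in> pea_ideal scale bracket"
    using assms ring.genideal_self[OF class_ring.ring_axioms, of "pea_relations scale bracket"]
    by (auto simp: pea_ideal_def)
  then have "p \<ominus>\<^bsub>class_ring\<^esub> q \<in> pea_ideal scale bracket"
    by (simp add: a_minus_def class_ring_simps)
  then show ?thesis
    using ring.quotient_eq_iff_same_a_r_cos[OF class_ring.ring_axioms pea_ideal_ideal, of p q] by simp
qed

lemma pea_triple:
  fixes scale :: "'k::field \<Rightarrow> 'a::comm_ring_1 \<Rightarrow> 'a"
  shows "poisson_triple scale bracket (pea scale bracket)
     (pea_unit scale bracket) (pea_alpha scale bracket) (pea_beta scale bracket)"
proof -
  define U where "U = pea scale bracket"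
  define \<pi> where "\<pi> p = pea_ideal scale bracket +>\<^bsub>class_ring\<^esub> p" for p
  define A B :: "'a \<Rightarrow> 'a pea_gen list \<Rightarrow>\<^sub>0 'k"
    where "A a = free_var (Alpha a)" and "B a = free_var (Beta a)" for a
  interpret U: ring U unfolding U_def by (rule pea_ring)
  have hom: "\<pi> \<in> ring_hom class_ring U"
    unfolding U_def \<pi>_def by (rule pea_proj_hom)
  have closed: "\<pi> p \<in> carrier U" for p using ring_hom_closed[OF hom] by simp
  have add: "\<pi> (p + q) = \<pi> p \<oplus>\<^bsub>U\<^esub> \<pi> q" for p q using ring_hom_add[OF hom] by simp
  have mult: "\<pi> (p * q) = \<pi> p \<otimes>\<^bsub>U\<^esub> \<pi> q" for p q using ring_hom_mult[OF hom] by simp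
  have one: "\<pi> 1 = \<one>\<^bsub>U\<^esub>" using ring_hom_one[OF hom] by simp
  have minus: "\<pi> (p - q) = \<pi> p \<ominus>\<^bsub>U\<^esub> \<pi> q" for p q
    using add[of "p - q" q] closed by (simp add: U.minus_eq U.a_assoc U.r_neg)
  have rel: "p - q \<in> pea_relations scale bracket \<Longrightarrow> \<pi> p = \<pi> q" for p q
    unfolding \<pi>_def by (rule pea_proj_eqI)
  note R = pea_relations_def Let_def A_def[symmetric] B_def[symmetric]
  have central: "free_const c * p = p * free_const c" for c and p :: "'a pea_gen list \<Rightarrow>\<^sub>0 'k"
    by (induction p rule: update_induct)
       (simp_all add: update_eq_single_add distrib_left distrib_right mult_single plus_list_def mult.commute)
  have "assoc_algebra U (pea_unit scale bracket)"
  proof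
    show "pea_unit scale bracket \<in> ring_hom class_ring U"
    proof (rule ring_hom_memI)
      show "pea_unit scale bracket \<one>\<^bsub>class_ring\<^esub> = \<one>\<^bsub>U\<^esub>"
      proof -
        have "pea_unit scale bracket 1 = \<pi> 1"
          unfolding pea_unit_def \<pi>_def single_one[symmetric] zero_list_def ..
        then show ?thesis by (simp add: one)
      qed
    qed (use closed in \<open>simp_all add: pea_unit_def \<pi>_def[symmetric] plus_list_def mult_single
          single_add flip: mult add\<close>)
    show "pea_unit scale bracket c \<otimes>\<^bsub>U\<^esub> b = b \<otimes>\<^bsub>U\<^esub> pea_unit scale bracket c"
      if "b \<in> carrier U" for b c
    proof -
      from that obtain p where "b = \<pi> p"
        unfolding U_def pea_def \<pi>_def FactRing_def A_RCOSETS_def' by auto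
      then show ?thesis
        by (simp add: pea_unit_def \<pi>_def[symmetric] central flip: mult)
    qed
  qed
  moreover have "pea_alpha scale bracket \<in> ring_hom class_ring U"
  proof (rule ring_hom_memI)
    have "\<pi> (A 1) = \<pi> 1" by (rule rel) (simp add: R)
    then show "pea_alpha scale bracket \<one>\<^bsub>class_ring\<^esub> = \<one>\<^bsub>U\<^esub>"
      by (simp add: pea_alpha_def \<pi>_def[symmetric] A_def one)
    fix a b
    have "\<pi> (A (a * b)) = \<pi> (A a * A b)" "\<pi> (A (a + b)) = \<pi> (A a + A b)"
      by (rule rel, force simp: R)+
    then show "pea_alpha scale bracket (a \<otimes>\<^bsub>class_ring\<^esub> b) =
        pea_alpha scale bracket a \<otimes>\<^bsub>U\<^esub> pea_alpha scale bracket b"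
      and "pea_alpha scale bracket (a \<oplus>\<^bsub>class_ring\<^esub> b) =
        pea_alpha scale bracket a \<oplus>\<^bsub>U\<^esub> pea_alpha scale bracket b"
      by (simp_all add: pea_alpha_def \<pi>_def[symmetric] A_def add mult)
  qed (use closed in \<open>simp add: pea_alpha_def \<pi>_def[symmetric]\<close>)
  moreover have
    "\<pi> (A (scale c a)) = \<pi> (free_const c * A a)" "\<pi> (B (scale c a)) = \<pi> (free_const c * B a)"
    "\<pi> (B (a + b)) = \<pi> (B a + B b)"
    "\<pi> (B (bracket a b)) = \<pi> (B a * B b - B b * B a)"
    "\<pi> (A (bracket a b)) = \<pi> (B a * A b - A b * B a)"
    "\<pi> (B (a * b)) = \<pi> (A a * B b + A b * B a)" for a b c
    by (rule rel, force simp: R)+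
  ultimately show ?thesis
    unfolding poisson_triple_def U_def[symmetric] pea_unit_def pea_alpha_def pea_beta_def
      \<pi>_def[symmetric] A_def[symmetric] B_def[symmetric]
    using closed by (auto simp: add mult minus)
qed

theorem pea_universal:
  assumes "poisson_triple scale bracket B \<eta> \<alpha> \<beta>"
  shows "pea_lift B \<eta> \<alpha> \<beta> \<in> ring_hom (pea scale bracket) B"
    and "pea_lift B \<eta> \<alpha> \<beta> (pea_unit scale bracket c) = \<eta> c"
    and "pea_lift B \<eta> \<alpha> \<beta> (pea_alpha scale bracket a) = \<alpha> a"
    and "pea_lift B \<eta> \<alpha> \<beta> (pea_beta scale bracket a) = \<beta> a"
    and "\<lbrakk>h \<in> ring_hom (pea scale bracket) B;
          \<And>c. h (pea_unit scale bracket c) = \<eta> c; \<And>a. h (pea_alpha scale bracket a) = \<alpha> a;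
          \<And>a. h (pea_beta scale bracket a) = \<beta> a; u \<in> carrier (pea scale bracket)\<rbrakk>
         \<Longrightarrow> h u = pea_lift B \<eta> \<alpha> \<beta> u"
proof -
  interpret B: assoc_algebra B \<eta> using assms by (simp add: poisson_triple_def)
  let ?\<gamma> = "case_pea_gen \<alpha> \<beta>"
  define F where "F = free_eval B \<eta> ?\<gamma>"
  define J where "J = pea_ideal scale bracket"
  define \<pi> where "\<pi> p = J +>\<^bsub>class_ring\<^esub> p" for p
  have \<alpha>: "\<alpha> \<in> ring_hom class_ring B"
    and \<beta>: "range \<beta> \<subseteq> carrier B"
    and rels: "\<And>c a. \<alpha> (scale c a) = \<eta> c \<otimes>\<^bsub>B\<^esub> \<alpha> a"
      "\<And>a b. \<beta> (a + b) = \<beta> a \<oplus>\<^bsub>B\<^esub> \<beta> b" "\<And>c a. \<beta> (scale c a) = \<eta> c \<otimes>\<^bsub>B\<^esub> \<beta> a"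
      "\<And>a b. \<beta> (bracket a b) = \<beta> a \<otimes>\<^bsub>B\<^esub> \<beta> b \<ominus>\<^bsub>B\<^esub> \<beta> b \<otimes>\<^bsub>B\<^esub> \<beta> a"
      "\<And>a b. \<alpha> (bracket a b) = \<beta> a \<otimes>\<^bsub>B\<^esub> \<alpha> b \<ominus>\<^bsub>B\<^esub> \<alpha> b \<otimes>\<^bsub>B\<^esub> \<beta> a"
      "\<And>a b. \<beta> (a * b) = \<alpha> a \<otimes>\<^bsub>B\<^esub> \<beta> b \<oplus>\<^bsub>B\<^esub> \<alpha> b \<otimes>\<^bsub>B\<^esub> \<beta> a"
    using assms by (simp_all add: poisson_triple_def)
  have \<alpha>_rels: "\<alpha> a \<in> carrier B" "\<alpha> (a + b) = \<alpha> a \<oplus>\<^bsub>B\<^esub> \<alpha> b" "\<alpha> (a * b) = \<alpha> a \<otimes>\<^bsub>B\<^esub> \<alpha> b"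
    "\<alpha> 1 = \<one>\<^bsub>B\<^esub>" for a b
    using ring_hom_closed[OF \<alpha>] ring_hom_add[OF \<alpha>] ring_hom_mult[OF \<alpha>] ring_hom_one[OF \<alpha>] by simp_all
  have \<beta>_closed: "\<beta> a \<in> carrier B" for a using \<beta> by auto
  have \<gamma>: "range ?\<gamma> \<subseteq> carrier B"
    using \<alpha>_rels(1) \<beta>_closed by (auto split: pea_gen.splits)
  have hom: "F \<in> ring_hom class_ring B" unfolding F_def by (rule B.free_eval_hom[OF \<gamma>])
  have closed: "F p \<in> carrier B" for p using ring_hom_closed[OF hom] by simp
  have add: "F (p + q) = F p \<oplus>\<^bsub>B\<^esub> F q" for p q using ring_hom_add[OF hom] by simp
  have mult: "F (p * q) = F p \<otimes>\<^bsub>B\<^esub> F q" for p q using ring_hom_mult[OF hom] by simp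
  have one: "F 1 = \<one>\<^bsub>B\<^esub>" using ring_hom_one[OF hom] by simp
  have minus: "F (p - q) = F p \<ominus>\<^bsub>B\<^esub> F q" for p q
    using add[of "p - q" q] closed by (simp add: B.minus_eq B.a_assoc B.r_neg)
  have vars: "F (free_var (Alpha a)) = \<alpha> a" "F (free_var (Beta a)) = \<beta> a" "F (free_const c) = \<eta> c"
    for a c
    unfolding F_def using \<alpha>_rels(1) \<beta>_closed by (simp_all add: B.free_eval_single[OF \<gamma>] B.unit_facts)
  interpret F: ring_hom_ring class_ring B F
    by (rule ring_hom_ringI2[OF class_ring.ring_axioms B.ring_axioms hom])
  interpret J: ideal J class_ring unfolding J_def by (rule pea_ideal_ideal)
  have "pea_relations scale bracket \<subseteq> a_kernel class_ring B F"
    unfolding pea_relations_def Let_def a_kernel_def'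
    using closed \<alpha>_rels \<beta>_closed
    by (auto simp: minus add mult one vars rels B.r_right_minus_eq B.unit_facts)
  then have J_kernel: "J \<subseteq> a_kernel class_ring B F"
    unfolding J_def pea_ideal_def
    by (rule ring.genideal_minimal[OF class_ring.ring_axioms F.kernel_is_ideal])
  have lift: "pea_lift B \<eta> \<alpha> \<beta> (\<pi> p) = F p" for p
  proof -
    have "F q = F p" if "q \<in> \<pi> p" for q
    proof -
      from that obtain j where "j \<in> J" "q = j + p"
        unfolding \<pi>_def a_r_coset_def' by auto
      moreover from this have "F j = \<zero>\<^bsub>B\<^esub>"
        using J_kernel unfolding a_kernel_def' by blast
      ultimately show ?thesis by (metis add B.l_zero closed)
    qed
    moreover have "p \<in> \<pi> p" using J.a_rcos_self[of p] by (simp add: \<pi>_def)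
    ultimately have "F ` \<pi> p = {F p}" by blast
    then show ?thesis
      unfolding pea_lift_def F_def[symmetric] by (metis the_elem_eq)
  qed
  have carrier: "\<exists>p. u = \<pi> p" if "u \<in> carrier (pea scale bracket)" for u
    using that unfolding pea_def \<pi>_def J_def FactRing_def A_RCOSETS_def' by auto
  have \<pi>: "\<pi> \<in> ring_hom class_ring (pea scale bracket)"
    unfolding \<pi>_def J_def by (rule pea_proj_hom)
  have \<pi>_simps: "\<pi> p \<oplus>\<^bsub>pea scale bracket\<^esub> \<pi> q = \<pi> (p + q)"
    "\<pi> p \<otimes>\<^bsub>pea scale bracket\<^esub> \<pi> q = \<pi> (p * q)" "\<one>\<^bsub>pea scale bracket\<^esub> = \<pi> 1" for p q
    using ring_hom_add[OF \<pi>] ring_hom_mult[OF \<pi>] ring_hom_one[OF \<pi>] by simp_all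
  show "pea_lift B \<eta> \<alpha> \<beta> \<in> ring_hom (pea scale bracket) B"
  proof (rule ring_hom_memI)
    show "pea_lift B \<eta> \<alpha> \<beta> \<one>\<^bsub>pea scale bracket\<^esub> = \<one>\<^bsub>B\<^esub>"
      by (simp add: \<pi>_simps lift one)
  qed (auto dest!: carrier simp: \<pi>_simps lift closed add mult)
  show "pea_lift B \<eta> \<alpha> \<beta> (pea_unit scale bracket c) = \<eta> c"
    and "pea_lift B \<eta> \<alpha> \<beta> (pea_alpha scale bracket a) = \<alpha> a"
    and "pea_lift B \<eta> \<alpha> \<beta> (pea_beta scale bracket a) = \<beta> a"
    by (simp_all add: pea_unit_def pea_alpha_def pea_beta_def lift vars flip: J_def \<pi>_def)
  show "h u = pea_lift B \<eta> \<alpha> \<beta> u"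
    if h: "h \<in> ring_hom (pea scale bracket) B"
      and gens: "\<And>c. h (pea_unit scale bracket c) = \<eta> c" "\<And>a. h (pea_alpha scale bracket a) = \<alpha> a"
        "\<And>a. h (pea_beta scale bracket a) = \<beta> a"
      and u: "u \<in> carrier (pea scale bracket)"
  proof -
    have G: "h \<circ> \<pi> \<in> ring_hom class_ring B" by (rule ring_hom_trans[OF \<pi> h])
    have G_add: "h (\<pi> (p + q)) = h (\<pi> p) \<oplus>\<^bsub>B\<^esub> h (\<pi> q)"
      and G_mult: "h (\<pi> (p * q)) = h (\<pi> p) \<otimes>\<^bsub>B\<^esub> h (\<pi> q)" for p q
      using ring_hom_add[OF G] ring_hom_mult[OF G] by simp_all
    have gens': "h (\<pi> (free_const c)) = F (free_const c)" "h (\<pi> (free_var g)) = F (free_var g)" for c g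
      using gens by (cases g; simp add: vars pea_unit_def pea_alpha_def pea_beta_def flip: J_def \<pi>_def)+
    have word: "h (\<pi> (Poly_Mapping.single w c)) = F (Poly_Mapping.single w c)" for w c
    proof (induction w)
      case (Cons g w)
      have "Poly_Mapping.single (g # w) c = free_var g * Poly_Mapping.single w c"
        by (simp add: mult_single plus_list_def)
      then show ?case using Cons by (simp add: G_mult mult gens')
    qed (rule gens')
    have "h (\<pi> p) = F p" for p
    proof (induction p rule: update_induct)
      case const
      show ?case using word[of "[]" 0] by simp
    qed (simp add: update_eq_single_add G_add add word)
    then show ?thesis using carrier[OF u] lift by auto
  qed
qed

lemma End_ring_ring:
  assumes "vector_space scale"
  shows "ring (End_ring scale)"
proof -
  interpret vector_space_pair scale scale using assms by (simp add: vector_space_pair_def)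
  show ?thesis
  proof (rule ringI)
    show "abelian_group (End_ring scale)"
    proof (rule abelian_groupI)
      fix F assume "F \<in> carrier (End_ring scale)"
      then show "\<exists>G\<in>carrier (End_ring scale). G \<oplus>\<^bsub>End_ring scale\<^esub> F = \<zero>\<^bsub>End_ring scale\<^esub>"
        by (intro bexI[of _ "\<lambda>x. - F x"]) (auto simp: End_ring_def linear_compose_neg)
    qed (auto simp: End_ring_def linear_compose_add linear_zero add.assoc add.commute)
    show "monoid (End_ring scale)"
      by (rule monoidI) (auto simp: End_ring_def comp_assoc intro: Vector_Spaces.linear_compose vs1.linear_id)
  qed (auto simp: End_ring_def linear_add fun_eq_iff)
qed

lemma (in poisson_algebra) PD_triple:
  "poisson_triple scale bracket (PD_ring scale bracket) scale (\<lambda>a. (*) a) bracket"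
proof -
  interpret E: ring "End_ring scale" by (rule End_ring_ring) unfold_locales
  interpret vector_space_pair scale scale by unfold_locales
  define H where "H = range (\<lambda>a::'a. (*) a) \<union> range bracket"
  have mult_linear: "Vector_Spaces.linear scale scale ((*) a)" for a
    by unfold_locales
      (simp_all add: scale_mult_left distrib_left mult.commute[of a])
  have H: "H \<subseteq> carrier (End_ring scale)"
    using mult_linear bracket_linear_right by (auto simp: H_def End_ring_def)
  have PD: "PD_ring scale bracket = End_ring scale\<lparr>carrier := generate_ring (End_ring scale) H\<rparr>"
    by (simp add: PD_ring_def H_def)
  interpret P: ring "PD_ring scale bracket"
    unfolding PD by (rule E.generate_ring_is_ring[OF H])
  have carr: "a \<in> H \<Longrightarrow> a \<in> carrier (PD_ring scale bracket)" for a
    unfolding PD by (simp add: generate_ring.incl)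
  have lin: "F \<in> carrier (PD_ring scale bracket) \<Longrightarrow> Vector_Spaces.linear scale scale F" for F
    using E.generate_ring_in_carrier[OF H] unfolding PD by (auto simp: End_ring_def)
  have scale_mult: "scale c = (*) (scale c 1)" for c
    by (rule ext) (simp add: scale_mult_left)
  have ops: "F \<otimes>\<^bsub>PD_ring scale bracket\<^esub> G = F \<circ> G" "F \<oplus>\<^bsub>PD_ring scale bracket\<^esub> G = (\<lambda>x. F x + G x)"
    "\<one>\<^bsub>PD_ring scale bracket\<^esub> = id" "\<zero>\<^bsub>PD_ring scale bracket\<^esub> = (\<lambda>x. 0)" for F G
    by (simp_all add: PD_ring_def End_ring_def)
  have minus: "F \<ominus>\<^bsub>PD_ring scale bracket\<^esub> G = K" if "F \<in> carrier (PD_ring scale bracket)"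
    "G \<in> carrier (PD_ring scale bracket)" "K \<in> carrier (PD_ring scale bracket)" "\<And>x. F x = K x + G x" for F G K
  proof -
    have "F = K \<oplus>\<^bsub>PD_ring scale bracket\<^esub> G" using that by (auto simp: ops)
    then show ?thesis using that by (simp add: P.minus_eq P.a_assoc P.r_neg)
  qed
  have closed: "(*) a \<in> carrier (PD_ring scale bracket)" "bracket a \<in> carrier (PD_ring scale bracket)" for a
    by (auto intro!: carr simp: H_def)
  have closed': "F \<circ> G \<in> carrier (PD_ring scale bracket)"
    if "F \<in> carrier (PD_ring scale bracket)" "G \<in> carrier (PD_ring scale bracket)" for F G
    using P.m_closed[OF that] by (simp add: ops)
  have br_add: "bracket (a + b) x = bracket a x + bracket b x"
    "bracket (scale c a) x = scale c (bracket a x)"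
    "bracket x (a + b) = bracket x a + bracket x b" for a b c x
    using linear_add[OF bracket_linear_left] linear_scale[OF bracket_linear_left]
      linear_add[OF bracket_linear_right] by auto
  have skew: "bracket a b = - bracket b a" for a b
    using bracket_self[of "a + b"] bracket_self[of a] bracket_self[of b]
    by (simp add: br_add eq_neg_iff_add_eq_0 add.commute)
  have br_neg: "bracket a (- b) = - bracket a b" for a b
    using linear_neg[OF bracket_linear_right] .
  have jac: "bracket a (bracket b x) = bracket (bracket a b) x + bracket b (bracket a x)" for a b x
    using bracket_jacobi[of a b x] skew[of x "bracket a b"] skew[of x a]
    by (simp add: br_neg algebra_simps)
  have leib: "bracket (a * b) x = a * bracket b x + b * bracket a x" for a b x
    using bracket_leibniz[of x a b] skew[of x] by (simp add: algebra_simps)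
  have "assoc_algebra (PD_ring scale bracket) scale"
  proof
    show "scale \<in> ring_hom class_ring (PD_ring scale bracket)"
    proof (rule ring_hom_memI)
      show "scale c \<in> carrier (PD_ring scale bracket)" for c
        by (subst scale_mult) (rule closed(1))
    qed (auto simp: ops scale_left_distrib fun_eq_iff)
  qed (use lin in \<open>auto simp: ops fun_eq_iff linear_scale\<close>)
  moreover have "(\<lambda>a. (*) a) \<in> ring_hom class_ring (PD_ring scale bracket)"
    by (rule ring_hom_memI) (use closed in \<open>auto simp: ops fun_eq_iff mult.assoc distrib_right\<close>)
  moreover have "(bracket a \<circ> bracket b) \<ominus>\<^bsub>PD_ring scale bracket\<^esub> (bracket b \<circ> bracket a) = bracket (bracket a b)" for a b
    by (rule minus) (simp_all add: closed closed' jac[of a b])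
  moreover have "(bracket a \<circ> (*) b) \<ominus>\<^bsub>PD_ring scale bracket\<^esub> ((*) b \<circ> bracket a) = (*) (bracket a b)" for a b
    by (rule minus) (simp_all add: closed closed' bracket_leibniz)
  ultimately show ?thesis
    unfolding poisson_triple_def
    using closed by (auto simp: ops fun_eq_iff scale_mult_left br_add leib)
qed

lemma (in poisson_algebra) poisson_pi:
  "poisson_pi scale bracket \<in> ring_hom (pea scale bracket) (PD_ring scale bracket)"
  "poisson_pi scale bracket (pea_alpha scale bracket a) = (*) a"
  "poisson_pi scale bracket (pea_beta scale bracket a) = bracket a"
  unfolding poisson_pi_def by (rule pea_universal[OF PD_triple])+


section \<open>Regular domains\<close>

definition krull_dim :: "('a, 'm) ring_scheme \<Rightarrow> enat" where
  "krull_dim R = Sup {enat k | k. \<exists>P. (\<forall>i\<le>k. primeideal (P i) R) \<and> (\<forall>i<k. P i \<subset> P (Suc i))}"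

definition min_generators :: "('a, 'm) ring_scheme \<Rightarrow> 'a set \<Rightarrow> nat" where
  "min_generators R I = (LEAST k. \<exists>G \<subseteq> carrier R. finite G \<and> card G = k \<and> I = Idl\<^bsub>R\<^esub> G)"

definition regular_local_ring :: "('a, 'm) ring_scheme \<Rightarrow> bool" where
  "regular_local_ring R \<longleftrightarrow> cring R \<and> noetherian_ring R \<and>
     (\<exists>M. {J. maximalideal J R} = {M} \<and> krull_dim R = enat (min_generators R M))"

definition localization_at :: "'a::idom set \<Rightarrow> 'a fract ring" where
  "localization_at P = class_ring\<lparr>carrier := {Fraction_Field.Fract a s | a s. s \<notin> P}\<rparr>"

definition regular_domain :: "'a::idom itself \<Rightarrow> bool" where
  "regular_domain (T :: 'a itself) \<longleftrightarrow> noetherian_ring (class_ring :: 'a ring) \<and>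
     (\<forall>P :: 'a set. primeideal P class_ring \<longrightarrow> regular_local_ring (localization_at P))"


section \<open>Polynomials and localization\<close>

text \<open>\<open>(nat \<Rightarrow>\<^sub>0 nat) \<Rightarrow>\<^sub>0 'k\<close> has a variable for every natural number; \<open>mpoly_ring n\<close> is the
  subring \<open>K[x\<^sub>1, \<dots>, x\<^sub>n]\<close>.\<close>

type_synonym 'k mpoly = "(nat \<Rightarrow>\<^sub>0 nat) \<Rightarrow>\<^sub>0 'k"

definition mpoly_ring :: "nat \<Rightarrow> 'k::field mpoly ring" where
  "mpoly_ring n = class_ring
     \<lparr>carrier := {p. \<forall>m\<in>Poly_Mapping.keys p. Poly_Mapping.keys m \<subseteq> {1..n}}\<rparr>"

definition pvar :: "nat \<Rightarrow> 'k::field mpoly" where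
  "pvar i = Poly_Mapping.single (Poly_Mapping.single i 1) 1"

definition pconst :: "'k::field \<Rightarrow> 'k mpoly" where
  "pconst c = Poly_Mapping.single 0 c"

definition partial_deriv :: "nat \<Rightarrow> 'k::field mpoly \<Rightarrow> 'k mpoly" where
  "partial_deriv j p = (\<Sum>m\<in>Poly_Mapping.keys p.
     Poly_Mapping.single (m - Poly_Mapping.single j 1)
       (of_nat (Poly_Mapping.lookup m j) * Poly_Mapping.lookup p m))"

definition is_localization ::
    "('r, 'm) ring_scheme \<Rightarrow> 'r set \<Rightarrow> ('a, 'l) ring_scheme \<Rightarrow> ('r \<Rightarrow> 'a) \<Rightarrow> bool" where
  "is_localization R S A \<iota> \<longleftrightarrow>
     submonoid S R \<and> \<iota> \<in> ring_hom R A \<and>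
     (\<forall>s\<in>S. \<iota> s \<in> Units A) \<and>
     (\<forall>a\<in>carrier A. \<exists>r\<in>carrier R. \<exists>s\<in>S. a \<otimes>\<^bsub>A\<^esub> \<iota> s = \<iota> r) \<and>
     (\<forall>r\<in>carrier R. \<iota> r = \<zero>\<^bsub>A\<^esub> \<longleftrightarrow> (\<exists>s\<in>S. s \<otimes>\<^bsub>R\<^esub> r = \<zero>\<^bsub>R\<^esub>))"


section \<open>Minors\<close>

text \<open>A matrix is given by its entries \<open>M i j\<close> with indices starting at \<open>1\<close>; tuples of
  indices are lists (whose positions start at \<open>0\<close>).\<close>

definition frac_rank :: "nat \<Rightarrow> nat \<Rightarrow> (nat \<Rightarrow> nat \<Rightarrow> 'a::idom) \<Rightarrow> nat" where
  "frac_rank m n M =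
     vec_space.rank m (mat m n (\<lambda>(i, j). Fraction_Field.Fract (M (Suc i) (Suc j)) 1))"

definition minor :: "(nat \<Rightarrow> nat \<Rightarrow> 'a::comm_ring_1) \<Rightarrow> nat list \<Rightarrow> nat list \<Rightarrow> 'a" where
  "minor M is js = det (mat (length is) (length js) (\<lambda>(s, t). M (is ! s) (js ! t)))"

definition incr_tuples :: "nat \<Rightarrow> nat \<Rightarrow> nat list set" where
  "incr_tuples k N = {is. length is = k \<and> sorted_wrt (<) is \<and> set is \<subseteq> {1..N}}"

definition minor_rows :: "nat \<Rightarrow> nat \<Rightarrow> (nat \<Rightarrow> nat \<Rightarrow> 'a::comm_ring_1) \<Rightarrow> nat \<Rightarrow> nat list set" where
  "minor_rows m n M k = {is \<in> incr_tuples k m. \<exists>js \<in> incr_tuples k n. minor M is js \<noteq> 0}"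

definition minor_cols :: "nat \<Rightarrow> nat \<Rightarrow> (nat \<Rightarrow> nat \<Rightarrow> 'a::comm_ring_1) \<Rightarrow> nat \<Rightarrow> nat list set" where
  "minor_cols m n M k = {js \<in> incr_tuples k n. \<exists>is \<in> incr_tuples k m. minor M is js \<noteq> 0}"


section \<open>The derivations and the elements defined by minors\<close>

text \<open>Below, \<open>\<phi>\<close> is the canonical map \<open>P\<^sub>n \<rightarrow> A\<close> and \<open>x i\<close> is the image of the \<open>i\<close>-th
  variable.\<close>

definition jacobian :: "('k::field mpoly \<Rightarrow> 'a) \<Rightarrow> (nat \<Rightarrow> 'k mpoly) \<Rightarrow> nat \<Rightarrow> nat \<Rightarrow> 'a" where
  "jacobian \<phi> f i j = \<phi> (partial_deriv j (f i))"

definition poisson_matrix :: "('a \<Rightarrow> 'a \<Rightarrow> 'a) \<Rightarrow> (nat \<Rightarrow> 'a) \<Rightarrow> nat \<Rightarrow> nat \<Rightarrow> 'a" where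
  "poisson_matrix bracket x i j = bracket (x i) (x j)"

text \<open>The derivation is determined by its values on the images of polynomials, where the last
  row of the determinant becomes a row of partial derivatives.\<close>

definition jacobian_derivation ::
    "('k::field \<Rightarrow> 'a::comm_ring_1 \<Rightarrow> 'a) \<Rightarrow> nat \<Rightarrow> ('k mpoly \<Rightarrow> 'a) \<Rightarrow> (nat \<Rightarrow> 'k mpoly) \<Rightarrow>
     nat list \<Rightarrow> nat list \<Rightarrow> nat \<Rightarrow> 'a \<Rightarrow> 'a" where
  "jacobian_derivation scale n \<phi> f is js j\<nu> =
     (THE D. D \<in> derivations scale \<and>
        (\<forall>p\<in>carrier (mpoly_ring n). D (\<phi> p) =
           det (mat (length is + 1) (length js + 1) (\<lambda>(s, t).
             let j = (js @ [j\<nu>]) ! t in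
             if s < length is then jacobian \<phi> f (is ! s) j else \<phi> (partial_deriv j p)))))"

definition poisson_delta ::
    "('k::field \<Rightarrow> 'a::comm_ring_1 \<Rightarrow> 'a) \<Rightarrow> ('a \<Rightarrow> 'a \<Rightarrow> 'a) \<Rightarrow> (nat \<Rightarrow> 'a) \<Rightarrow>
     nat list \<Rightarrow> nat \<Rightarrow> nat list \<Rightarrow> ('a pea_gen list \<Rightarrow>\<^sub>0 'k) set" where
  "poisson_delta scale bracket x is i\<nu> js =
     (let U = pea scale bracket; \<alpha> = pea_alpha scale bracket; \<delta> = (\<lambda>i. pea_beta scale bracket (x i));
          \<mu> = minor (poisson_matrix bracket x); d = length is
      in \<alpha> (\<mu> is js) \<otimes>\<^bsub>U\<^esub> \<delta> i\<nu> \<oplus>\<^bsub>U\<^esub>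
         (\<Oplus>\<^bsub>U\<^esub>s\<in>{1..d}.
            \<alpha> ((-1) ^ (s + d + 1) * \<mu> (take (s - 1) is @ drop s is @ [i\<nu>]) js)
            \<otimes>\<^bsub>U\<^esub> \<delta> (is ! (s - 1))))"

definition poisson_kappa ::
    "('k::field \<Rightarrow> 'a::idom \<Rightarrow> 'a) \<Rightarrow> ('a \<Rightarrow> 'a \<Rightarrow> 'a) \<Rightarrow> nat \<Rightarrow> (nat \<Rightarrow> 'a) \<Rightarrow>
     ('a pea_gen list \<Rightarrow>\<^sub>0 'k) set set" where
  "poisson_kappa scale bracket n x =
     (let C = poisson_matrix bracket x; d = frac_rank n n C in
      Idl\<^bsub>pea scale bracket\<^esub>
        {poisson_delta scale bracket x is i\<nu> js | is i\<nu> js.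
           is \<in> minor_rows n n C d \<and> js \<in> minor_cols n n C d \<and> i\<nu> \<in> {1..n} - set is})"

text \<open>The pairing of derivations with the elements \<open>\<Sum>\<^sub>i b\<^sub>i\<delta>\<^sub>i\<close> of the enveloping algebra, the left
  submodule identified with the Kaehler differentials.\<close>

definition kaehler_pairing ::
    "('k::field \<Rightarrow> 'a::comm_ring_1 \<Rightarrow> 'a) \<Rightarrow> ('a \<Rightarrow> 'a \<Rightarrow> 'a) \<Rightarrow> nat \<Rightarrow> (nat \<Rightarrow> 'a) \<Rightarrow>
     ('a \<Rightarrow> 'a) \<Rightarrow> ('a pea_gen list \<Rightarrow>\<^sub>0 'k) set \<Rightarrow> 'a" where
  "kaehler_pairing scale bracket n x D \<omega> =
     (THE c. \<exists>b. \<omega> = (\<Oplus>\<^bsub>pea scale bracket\<^esub>i\<in>{1..n}.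
                      pea_alpha scale bracket (b i) \<otimes>\<^bsub>pea scale bracket\<^esub> pea_beta scale bracket (x i)) \<and>
                c = (\<Sum>i=1..n. b i * D (x i)))"

end

theory Submission
  imports Defs
begin

text \<open>Let \<open>F\<close> be the field of fractions of \<open>A\<close> and \<open>t = n - r\<close>. The derivations from \<open>A\<close> to \<open>F\<close> have a
  basis dual to \<open>t\<close> of the variables, so the differentials over \<open>F\<close> form a Lie--Rinehart algebra of
  rank \<open>t\<close>. As in the Poincare--Birkhoff--Witt theorem, the enveloping algebra acts on polynomials in
  \<open>t\<close> indeterminates over \<open>F\<close>, and this action shows that a form \<open>\<Sum> a\<^sub>i db\<^sub>i\<close> which is zero in the enveloping
  algebra is zero as a differential over \<open>F\<close>. Hence \<open>\<kappa> = 0\<close> forces all \<open>dx\<^sub>i\<close> into the span of \<open>d\<close> of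
  them, which gives \<open>d = t\<close>. The generators of \<open>\<kappa>\<close> are killed by \<open>\<pi>\<close> because the minors of order \<open>d + 1\<close>
  vanish, so \<open>ker \<pi> = 0\<close> implies \<open>\<kappa> = 0\<close>.

  Now let \<open>d = t\<close>. At a prime \<open>P\<close>, a maximal set of variables that is algebraically independent
  modulo \<open>P\<close> together with a minimal system of generators of \<open>P\<close> has at most \<open>t\<close> elements: by regularity,
  replacing the generators by elements of a chain of primes of the same length gives a family that is
  algebraically independent over \<open>K\<close>. Their differentials generate all differentials locally, by
  Nakayama's lemma. So elements of the enveloping algebra have local normal forms with polynomial
  symbols. Since the Poisson matrix has rank \<open>t\<close>, commutators with elements of \<open>A\<close> detect symbols and
  lower the order; therefore an element of \<open>ker \<pi>\<close> is zero locally at every \<open>P\<close>, and so it is zero.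
  Similarly, a form in \<open>ker \<pi>\<close> is zero over \<open>F\<close> and pairs to zero with every derivation.\<close>

hide_const (open) Module.smult UnivPoly.coeff UnivPoly.monom

section \<open>Additive maps on finitely supported functions\<close>

text \<open>The equation \<open>d = t\<close> is the hub: \<kappa> = 0 forces it, and from it follow
  both faithfulness of \<pi> and the pairing condition. Two obstacles shape the proof. First, the
  enveloping algebra is given by generators and relations, so showing that an element is nonzero
  needs a model. The model lives over the fraction field, where the differentials are free; it sees
  the coordinates of a form there, but not torsion. Secondly, faithfulness has to deal with torsion,
  and regularity is given only as the equality of a Krull dimension and a number of generators,
  which must be compared with the number t of independent derivations. Derivations themselves make
  the bridge: in characteristic zero they extend along any element and take arbitrary values on
  algebraically independent ones, so no independent family is longer than t. No global basis is
  needed for faithfulness: the elements of A that annihilate a given element of the enveloping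
  algebra form an ideal, and this ideal contains 1 as soon as no prime contains it. At each prime
  all computations may therefore be multiplied by elements outside of it.\<close>

lemma sum_keys_superset:
  assumes "\<And>v. h v 0 = 0" "finite W" "Poly_Mapping.keys p \<subseteq> W"
  shows "(\<Sum>v\<in>Poly_Mapping.keys p. h v (Poly_Mapping.lookup p v)) = (\<Sum>v\<in>W. h v (Poly_Mapping.lookup p v))"
  by (rule sum.mono_neutral_left) (use assms in \<open>auto simp: in_keys_iff\<close>)

text \<open>Cancellation may shrink the key set of a sum, so everything is summed over the union of
  the two key sets, where the extra terms are \<open>h v 0 = 0\<close>. This gives additivity of all
  operators below that are defined by a sum over \<open>keys\<close>.\<close>

lemma sum_keys_add:
  fixes h :: "'v \<Rightarrow> 'b::comm_monoid_add \<Rightarrow> 'c::comm_monoid_add"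
  assumes h: "\<And>v. h v 0 = 0" "\<And>v a b. h v (a + b) = h v a + h v b"
  shows "(\<Sum>v\<in>Poly_Mapping.keys (p + q). h v (Poly_Mapping.lookup (p + q) v)) =
    (\<Sum>v\<in>Poly_Mapping.keys p. h v (Poly_Mapping.lookup p v)) +
    (\<Sum>v\<in>Poly_Mapping.keys q. h v (Poly_Mapping.lookup q v))"
proof -
  let ?W = "Poly_Mapping.keys p \<union> Poly_Mapping.keys q"
  have "(\<Sum>v\<in>Poly_Mapping.keys (p + q). h v (Poly_Mapping.lookup (p + q) v)) =
    (\<Sum>v\<in>?W. h v (Poly_Mapping.lookup (p + q) v))"
    by (rule sum_keys_superset[where h = h]) (auto simp: h Poly_Mapping.keys_add)
  also have "\<dots> = (\<Sum>v\<in>?W. h v (Poly_Mapping.lookup p v)) + (\<Sum>v\<in>?W. h v (Poly_Mapping.lookup q v))"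
    by (simp add: lookup_add h sum.distrib)
  finally show ?thesis
    by (simp add: sum_keys_superset[where h = h and p = p and W = ?W]
        sum_keys_superset[where h = h and p = q and W = ?W] h)
qed

lemma sum_keys_single:
  assumes "h v 0 = 0"
  shows "(\<Sum>w\<in>Poly_Mapping.keys (Poly_Mapping.single v a). h w (Poly_Mapping.lookup (Poly_Mapping.single v a) w)) = h v a"
  using assms by simp

lemma pm_induct [case_names zero add]:
  fixes p :: "'v \<Rightarrow>\<^sub>0 'b::comm_monoid_add"
  assumes "P 0" "\<And>v a p. v \<notin> Poly_Mapping.keys p \<Longrightarrow> P p \<Longrightarrow> P (Poly_Mapping.single v a + p)"
  shows "P p"
proof (induction p rule: update_induct)
  case const
  then show ?case using assms(1) .
next
  case (update p v a)
  then show ?case using assms(2)[of v p a] by (simp add: update_eq_single_add)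
qed

section \<open>The Poincare--Birkhoff--Witt representation\<close>

abbreviation cst :: "'f::comm_ring_1 \<Rightarrow> nat multiset \<Rightarrow>\<^sub>0 'f" where
  "cst a \<equiv> Poly_Mapping.single {#} a"

abbreviation mon :: "nat multiset \<Rightarrow> nat multiset \<Rightarrow>\<^sub>0 'f::comm_ring_1" where
  "mon v \<equiv> Poly_Mapping.single v 1"

lemma cst_mult_single: "cst a * Poly_Mapping.single v b = Poly_Mapping.single v (a * b)"
  by (simp add: mult_single zero_multiset_def[symmetric] del: zero_multiset_def)

lemma cst_mult: "cst (a * b) = cst a * cst b"
  by (simp add: cst_mult_single)

lemma cst_sum: "cst (sum f S) = (\<Sum>s\<in>S. cst (f s))"
  by (induction S rule: infinite_finite_induct) (simp_all add: single_add)

lemma cst_1: "cst 1 = 1"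
  by (metis single_one zero_multiset_def)

definition deg_le :: "nat \<Rightarrow> (nat multiset \<Rightarrow>\<^sub>0 'f::comm_ring_1) \<Rightarrow> bool" where
  "deg_le d p \<longleftrightarrow> (\<forall>v\<in>Poly_Mapping.keys p. size v \<le> d)"

lemma deg_le_add: "deg_le d p \<Longrightarrow> deg_le d q \<Longrightarrow> deg_le d (p + q)"
  using Poly_Mapping.keys_add[of p q] unfolding deg_le_def by blast

lemma deg_le_sum: "(\<And>i. i \<in> S \<Longrightarrow> deg_le d (p i)) \<Longrightarrow> deg_le d (sum p S)"
  by (induction S rule: infinite_finite_induct) (auto simp: deg_le_add, auto simp: deg_le_def)

lemma deg_le_single: "size v \<le> d \<Longrightarrow> deg_le d (Poly_Mapping.single v a)"
  by (simp add: deg_le_def)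

lemma deg_le_cst_mult: "deg_le d p \<Longrightarrow> deg_le d (cst a * p)"
  by (auto simp: deg_le_def dest!: subsetD[OF keys_mult] split: if_splits)

lemma deg_le_mono: "deg_le d p \<Longrightarrow> d \<le> d' \<Longrightarrow> deg_le d' p"
  by (auto simp: deg_le_def)

lemma Min_mset_less:
  assumes "j \<in># \<mu>" "j < (i::nat)"
  shows "Min_mset \<mu> \<in># \<mu>" "Min_mset \<mu> < i" "\<forall>j\<in>#\<mu>. Min_mset \<mu> \<le> j"
proof -
  show "Min_mset \<mu> \<in># \<mu>" using assms by (intro Min_in) auto
  show le: "\<forall>j\<in>#\<mu>. Min_mset \<mu> \<le> j" by auto
  show "Min_mset \<mu> < i" using le assms by (meson le_less_trans)
qed

text \<open>A Lie-Rinehart algebra in coordinates: basis elements e_i with anchors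
  \<open>\<rho> i\<close> and [e_i, e_j] equal to the sum of the \<open>c i j l\<close> e_l. Since
  the bracket is not linear over the ring, the Jacobi identity carries the terms
  \<open>\<rho> i (c j k l)\<close>; it is the coefficient of e_l in [e_i, [e_j, e_k]] plus its
  cyclic images. \<open>c_self\<close> is separate from \<open>c_skew\<close> because 2 need not be
  cancellable.\<close>

locale lie_rinehart =
  fixes \<rho> :: "nat \<Rightarrow> 'f::comm_ring_1 \<Rightarrow> 'f" and c :: "nat \<Rightarrow> nat \<Rightarrow> nat \<Rightarrow> 'f" and t :: nat
  assumes anchor_add: "\<rho> i (a + b) = \<rho> i a + \<rho> i b"
    and anchor_mult: "\<rho> i (a * b) = \<rho> i a * b + a * \<rho> i b"
    and anchor_comm: "\<rho> i (\<rho> j a) - \<rho> j (\<rho> i a) = (\<Sum>l<t. c i j l * \<rho> l a)"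
    and c_skew: "c i j l = - c j i l"
    and c_self: "c i i l = 0"
    and c_jacobi: "(\<rho> i (c j k l) + (\<Sum>m<t. c j k m * c i m l)) +
       (\<rho> j (c k i l) + (\<Sum>m<t. c k i m * c j m l)) +
       (\<rho> k (c i j l) + (\<Sum>m<t. c i j m * c k m l)) = 0"
begin

lemma anchor_0: "\<rho> i 0 = 0"
  using anchor_add[of i 0 0] by simp

lemma anchor_1: "\<rho> i 1 = 0"
  using anchor_mult[of i 1 1] by simp

text \<open>The operator of the \<open>i\<close>-th basis element on monomials. In the Leibniz term the
  coefficients of degree above \<open>size \<mu>\<close> are cut off only to make the recursion terminate; by
  \<open>gen_lead\<close> there are none.\<close>

function gen :: "nat \<Rightarrow> nat multiset \<Rightarrow> nat multiset \<Rightarrow>\<^sub>0 'f" where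
  "gen i \<mu> =
    (if \<forall>j\<in>#\<mu>. i \<le> j then mon (add_mset i \<mu>)
     else let k = Min_mset \<mu>; \<mu>' = \<mu> - {#k#}; q = gen i \<mu>' in
       (\<Sum>\<nu>\<in>Poly_Mapping.keys q. if size \<nu> \<le> size \<mu>
          then Poly_Mapping.single \<nu> (\<rho> k (Poly_Mapping.lookup q \<nu>)) + cst (Poly_Mapping.lookup q \<nu>) * gen k \<nu>
          else 0) +
       (\<Sum>l<t. cst (c i k l) * gen l \<mu>'))"
  by pat_completeness auto
text \<open>Calls on \<open>\<mu>'\<close> lower the size. A call \<open>gen k \<nu>\<close> may
  keep the size because of the cut-off, but then k is the minimum of \<open>\<mu>\<close> and
  smaller than i.\<close>

termination
proof (relation "measures [\<lambda>(i, \<mu>). size \<mu>, \<lambda>(i, \<mu>). i]")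
  fix i :: nat and \<mu> :: "nat multiset"
  assume "\<not> (\<forall>j\<in>#\<mu>. i \<le> j)"
  then obtain j where j: "j \<in># \<mu>" "j < i" by (auto simp: not_le)
  note Min = Min_mset_less[OF j]
  { fix k \<mu>' assume *: "k = Min_mset \<mu>" "\<mu>' = \<mu> - {#k#}"
    then have "size \<mu>' < size \<mu>" using Min by (simp add: size_Diff1_less)
    then show "((i, \<mu>'), i, \<mu>) \<in> measures [\<lambda>(i, \<mu>). size \<mu>, \<lambda>(i, \<mu>). i]"
      and "((l, \<mu>'), i, \<mu>) \<in> measures [\<lambda>(i, \<mu>). size \<mu>, \<lambda>(i, \<mu>). i]" for l by auto
    show "((k, \<nu>), i, \<mu>) \<in> measures [\<lambda>(i, \<mu>). size \<mu>, \<lambda>(i, \<mu>). i]" if "size \<nu> \<le> size \<mu>" for \<nu> :: "nat multiset"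
      using that Min * by auto }
qed auto

declare gen.simps [simp del]

definition op :: "nat \<Rightarrow> (nat multiset \<Rightarrow>\<^sub>0 'f) \<Rightarrow> nat multiset \<Rightarrow>\<^sub>0 'f" where
  "op i p = (\<Sum>\<nu>\<in>Poly_Mapping.keys p.
     Poly_Mapping.single \<nu> (\<rho> i (Poly_Mapping.lookup p \<nu>)) + cst (Poly_Mapping.lookup p \<nu>) * gen i \<nu>)"

lemma op_add: "op i (p + q) = op i p + op i q"
  unfolding op_def
  by (rule sum_keys_add) (simp_all add: anchor_0 anchor_add single_add algebra_simps)

lemma op_single: "op i (Poly_Mapping.single \<nu> a) = Poly_Mapping.single \<nu> (\<rho> i a) + cst a * gen i \<nu>"
  unfolding op_def by (subst sum_keys_single) (simp_all add: anchor_0)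

lemma op_mon: "op i (mon \<nu>) = gen i \<nu>"
  by (simp add: op_single anchor_1 cst_1)

lemma op_0: "op i 0 = 0"
  by (simp add: op_def)

lemma op_sum: "op i (sum p S) = (\<Sum>s\<in>S. op i (p s))"
  by (induction S rule: infinite_finite_induct) (simp_all add: op_0 op_add)

lemma op_diff: "op i (p - q) = op i p - op i q"
  using op_add[of i "p - q" q] by simp

lemma op_cst_mult: "op i (cst a * p) = cst (\<rho> i a) * p + cst a * op i p"
proof (induction p rule: pm_induct)
  case (add v b p)
  have "op i (cst a * Poly_Mapping.single v b) = cst (\<rho> i a) * Poly_Mapping.single v b + cst a * op i (Poly_Mapping.single v b)"
    by (simp add: cst_mult_single op_single anchor_mult single_add distrib_left flip: mult.assoc)
  with add show ?case by (simp add: op_add distrib_left)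
qed (simp add: op_0)

lemma op_deg:
  assumes "deg_le d p" and "\<And>\<nu>. size \<nu> \<le> d \<Longrightarrow> deg_le (Suc d) (gen i \<nu>)"
  shows "deg_le (Suc d) (op i p)"
  unfolding op_def
  by (intro deg_le_sum deg_le_add deg_le_single deg_le_cst_mult assms(2))
     (use assms(1) in \<open>auto simp: deg_le_def le_Suc_eq\<close>)

lemma gen_le: "\<forall>j\<in>#\<mu>. i \<le> j \<Longrightarrow> gen i \<mu> = mon (add_mset i \<mu>)"
  by (simp add: gen.simps[of i \<mu>])

text \<open>The leading term of \<open>gen i \<mu>\<close> is the commutative product. Hence the
  cut-off in the recursion is never active, and the recursion becomes e_i e_k = e_k e_i + [e_i, e_k]
  applied to a monomial whose factors are all at least k.\<close>

lemma gen_lead: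
  "deg_le (size \<mu>) (gen i \<mu> - mon (add_mset i \<mu>))"
  "\<forall>j\<in>#\<mu>. k \<le> j \<Longrightarrow> k < i \<Longrightarrow> gen i (add_mset k \<mu>) = op k (gen i \<mu>) + (\<Sum>l<t. cst (c i k l) * gen l \<mu>)"
proof -
  \<comment> \<open>The degree bound for this i and \<mu> is a premise, so that the induction
    proving the bound can already use the clean recursion for smaller monomials.\<close>
  have *: "gen i (add_mset k \<mu>) = op k (gen i \<mu>) + (\<Sum>l<t. cst (c i k l) * gen l \<mu>)"
    if "\<forall>j\<in>#\<mu>. k \<le> j" "k < i" "deg_le (size \<mu>) (gen i \<mu> - mon (add_mset i \<mu>))" for i k \<mu>
  proof -
    have "deg_le (Suc (size \<mu>)) (gen i \<mu> - mon (add_mset i \<mu>) + mon (add_mset i \<mu>))"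
      by (intro deg_le_add deg_le_mono[OF that(3)] deg_le_single) auto
    then have d: "size \<nu> \<le> Suc (size \<mu>)" if "\<nu> \<in> Poly_Mapping.keys (gen i \<mu>)" for \<nu>
      using that by (simp add: deg_le_def)
    have "Min_mset (add_mset k \<mu>) = k"
      using that(1) by (intro Min_eqI) auto
    moreover have "\<not> (\<forall>j\<in>#add_mset k \<mu>. i \<le> j)" using that(2) by auto
    ultimately show ?thesis
      unfolding gen.simps[of i "add_mset k \<mu>"] by (simp only: if_False Let_def op_def) (simp add: d)
  qed
  have **: "deg_le (size \<mu>) (gen i \<mu> - mon (add_mset i \<mu>))" for i \<mu>
  proof (induction "size \<mu>" arbitrary: i \<mu> rule: less_induct)
    case less
    have IH: "deg_le (Suc (size \<nu>)) (gen j \<nu>)" if "size \<nu> < size \<mu>" for j \<nu>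
      using deg_le_add[OF deg_le_mono[OF less[OF that, of j]] deg_le_single[of "add_mset j \<nu>" _ 1]]
      by fastforce
    show ?case
    proof (cases "\<forall>j\<in>#\<mu>. i \<le> j")
      case True
      then show ?thesis by (simp add: gen_le deg_le_def)
    next
      case False
      define k where "k = Min_mset \<mu>"
      define \<mu>' where "\<mu>' = \<mu> - {#k#}"
      obtain j where j: "j \<in># \<mu>" "j < i" using False by (auto simp: not_le)
      then have k: "k \<in># \<mu>" "k < i" "\<forall>j\<in>#\<mu>. k \<le> j"
        unfolding k_def by (rule Min_mset_less)+
      have \<mu>: "\<mu> = add_mset k \<mu>'" using k by (simp add: \<mu>'_def)
      have k': "\<forall>j\<in>#\<mu>'. k \<le> j" using k \<mu> by auto
      define low where "low = gen i \<mu>' - mon (add_mset i \<mu>')"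
      have low: "deg_le (size \<mu>') low" unfolding low_def by (rule less) (simp add: \<mu>)
      have "gen i \<mu> = op k (mon (add_mset i \<mu>') + low) + (\<Sum>l<t. cst (c i k l) * gen l \<mu>')"
        using *[OF k' k(2) low[unfolded low_def]] \<mu> by (simp add: low_def)
      also have "op k (mon (add_mset i \<mu>') + low) = mon (add_mset i \<mu>) + op k low"
        using k k' by (simp add: op_add op_mon gen_le \<mu> add_mset_commute)
      finally have "gen i \<mu> - mon (add_mset i \<mu>) = op k low + (\<Sum>l<t. cst (c i k l) * gen l \<mu>')"
        by simp
      moreover have "deg_le (size \<mu>) \<dots>"
        unfolding \<mu> size_add_mset
        by (intro deg_le_add op_deg low deg_le_sum deg_le_cst_mult IH deg_le_mono[OF IH]) (auto simp: \<mu>)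
      ultimately show ?thesis by simp
    qed
  qed
  show "deg_le (size \<mu>) (gen i \<mu> - mon (add_mset i \<mu>))" by (rule **)
  show "\<forall>j\<in>#\<mu>. k \<le> j \<Longrightarrow> k < i \<Longrightarrow> gen i (add_mset k \<mu>) = op k (gen i \<mu>) + (\<Sum>l<t. cst (c i k l) * gen l \<mu>)"
    by (rule *) (auto intro: **)
qed

section \<open>Vanishing of the curvature of the action\<close>

definition curv :: "nat \<Rightarrow> nat \<Rightarrow> (nat multiset \<Rightarrow>\<^sub>0 'f) \<Rightarrow> nat multiset \<Rightarrow>\<^sub>0 'f" where
  "curv i j p = op i (op j p) - op j (op i p) - (\<Sum>l<t. cst (c i j l) * op l p)"

lemma curv_add: "curv i j (p + q) = curv i j p + curv i j q"
  by (simp add: curv_def op_add sum.distrib algebra_simps)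

lemma curv_skew: "curv i j p = - curv j i p"
  by (simp add: curv_def c_skew[of i j] single_uminus sum_negf)

lemma curv_self: "curv i i p = 0"
  by (simp add: curv_def c_self)

text \<open>The curvature is linear over the ring: the terms in which the coefficient is
  differentiated twice cancel by \<open>anchor_comm\<close>, the mixed ones by symmetry. So it is
  enough to let it vanish on monomials.\<close>

lemma curv_cst_mult: "curv i j (cst a * p) = cst a * curv i j p"
proof -
  have "cst (\<rho> i (\<rho> j a)) - cst (\<rho> j (\<rho> i a)) = (\<Sum>l<t. cst (c i j l) * cst (\<rho> l a))"
    unfolding single_diff[symmetric] anchor_comm
    by (induction t) (simp_all add: single_add cst_mult)
  then have "(cst (\<rho> i (\<rho> j a)) - cst (\<rho> j (\<rho> i a))) * p = (\<Sum>l<t. cst (c i j l) * (cst (\<rho> l a) * p))"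
    by (simp add: sum_distrib_right mult.assoc)
  moreover have "(\<Sum>l<t. cst (c i j l) * op l (cst a * p)) =
     (\<Sum>l<t. cst (c i j l) * (cst (\<rho> l a) * p)) + cst a * (\<Sum>l<t. cst (c i j l) * op l p)"
    unfolding op_cst_mult by (simp add: algebra_simps sum.distrib sum_distrib_left)
  ultimately show ?thesis
    unfolding curv_def op_cst_mult op_add by (simp add: algebra_simps)
qed

lemma curv_0I:
  assumes "\<And>\<nu>. \<nu> \<in> Poly_Mapping.keys p \<Longrightarrow> curv i j (mon \<nu>) = 0"
  shows "curv i j p = 0"
  using assms
proof (induction p rule: pm_induct)
  case zero
  then show ?case by (simp add: curv_def op_0)
next
  case (add v a p)
  show ?case
  proof (cases "a = 0")
    case False
    have "Poly_Mapping.keys (Poly_Mapping.single v a + p) = insert v (Poly_Mapping.keys p)"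
      using add.hyps False by (auto simp: in_keys_iff lookup_add lookup_single when_def split: if_splits)
    then have "curv i j (mon v) = 0" "curv i j p = 0" using add by auto
    moreover have "Poly_Mapping.single v a = cst a * mon v" by (simp add: cst_mult_single)
    ultimately show ?thesis by (simp only: curv_add curv_cst_mult mult_zero_right add_0)
  qed (use add in simp)
qed

text \<open>Induction on the size of the monomial. By skew symmetry one may take j < i. If j is at
  most every factor of \<mu>, the recursion of \<open>gen\<close> is the claim. Otherwise the
  minimal factor k satisfies k < j < i, and \<mu> is e_k applied to a smaller monomial w; moving e_k
  to the front reduces the claim to the Jacobi identity on w.\<close>

theorem curv_eq_0: "curv i j p = 0"
proof (rule curv_0I)
  fix \<mu>
  show "curv i j (mon \<mu>) = 0"
  proof (induction "size \<mu>" arbitrary: i j \<mu> rule: less_induct)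
    case less
    have small: "curv i j p = 0" if "deg_le d p" "d < size \<mu>" for i j p d
      by (rule curv_0I, rule less) (use that in \<open>auto simp: deg_le_def\<close>)
    have A: "curv i j (mon \<nu>) = 0" if "\<forall>l\<in>#\<nu>. j \<le> l" "j < i" for i j \<nu>
    proof -
      have "op i (op j (mon \<nu>)) = op j (op i (mon \<nu>)) + (\<Sum>l<t. cst (c i j l) * op l (mon \<nu>))"
        using that by (simp add: op_mon gen_le[of \<nu> j] gen_lead(2))
      then show ?thesis by (simp add: curv_def)
    qed
    have main: "curv i j (mon \<mu>) = 0" if "j < i" for i j
    proof (cases "\<forall>l\<in>#\<mu>. j \<le> l")
      case True
      then show ?thesis using A that by blast
    next
      case False
      define k where "k = Min_mset \<mu>"
      obtain l where "l \<in># \<mu>" "l < j" using False by (auto simp: not_le)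
      then have k: "k \<in># \<mu>" "k < j" "\<forall>j\<in>#\<mu>. k \<le> j"
        unfolding k_def by (rule Min_mset_less)+
      define \<mu>' where "\<mu>' = \<mu> - {#k#}"
      define w where "w = (mon \<mu>' :: nat multiset \<Rightarrow>\<^sub>0 'f)"
      have \<mu>: "\<mu> = add_mset k \<mu>'" using k by (simp add: \<mu>'_def)
      have k': "\<forall>j\<in>#\<mu>'. k \<le> j" using k \<mu> by auto
      have w: "curv i j w = 0" for i j
        unfolding w_def by (rule less) (simp add: \<mu>)
      have kw: "op k w = mon \<mu>" using k' by (simp add: w_def op_mon gen_le \<mu>)
      \<comment> \<open>Here \<open>op j' w\<close> is a monomial with all factors at least k, to
        which \<open>A\<close> applies, plus terms of smaller size than \<mu>, which the induction
        covers.\<close>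
      have B: "curv i' k (op j' w) = 0" if "k < i'" "k < j'" for i' j'
      proof -
        have "op j' w = mon (add_mset j' \<mu>') + (gen j' \<mu>' - mon (add_mset j' \<mu>'))"
          by (simp add: w_def op_mon)
        moreover have "curv i' k (gen j' \<mu>' - mon (add_mset j' \<mu>')) = 0"
          by (rule small[OF gen_lead(1)]) (simp add: \<mu>)
        moreover have "curv i' k (mon (add_mset j' \<mu>')) = 0"
          by (rule A) (use that k' in auto)
        ultimately show ?thesis by (simp only: curv_add add_0)
      qed
      define S where "S i j p = (\<Sum>l<t. cst (c i j l) * op l p)" for i j p
      have comm: "op i (op j p) = op j (op i p) + S i j p" if "curv i j p = 0" for i j p
        using that by (simp add: curv_def S_def diff_eq_eq add.commute)
      define R where "R i j k = (\<Sum>l<t. cst (\<rho> i (c j k l)) * op l w)" for i j k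
      define Q where "Q i j k = (\<Sum>l<t. cst (\<Sum>m<t. c j k m * c i m l) * op l w)" for i j k
      \<comment> \<open>Applying e_i to [e_j, e_k] w gives the reversed product plus [e_i,
        [e_j, e_k]] w; the latter splits into \<open>R\<close>, where the structure constants are
        differentiated, and \<open>Q\<close>, where they are multiplied.\<close>
      have opS: "op i (S j k w) = R i j k + S j k (op i w) + Q i j k" for i j k
      proof -
        have "(\<Sum>m<t. cst (c j k m) * S i m w) = (\<Sum>m<t. \<Sum>l<t. cst (c j k m * c i m l) * op l w)"
          by (simp add: S_def sum_distrib_left cst_mult mult.assoc)
        also have "\<dots> = (\<Sum>l<t. \<Sum>m<t. cst (c j k m * c i m l) * op l w)"
          by (rule sum.swap)
        also have "\<dots> = Q i j k"
          unfolding Q_def by (simp only: sum_distrib_right[symmetric] cst_sum)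
        finally have "(\<Sum>l<t. cst (c j k l) * op i (op l w)) = S j k (op i w) + Q i j k"
          unfolding comm[OF w, of i] by (simp add: distrib_left sum.distrib S_def[of _ _ "op _ w"])
        then show ?thesis
          unfolding S_def[of _ _ w] op_sum op_cst_mult by (simp add: sum.distrib R_def)
      qed
      have i: "k < i" using k that by simp
      have S_skew: "S i j p = - S j i p" for i j p
        by (simp add: S_def c_skew[of i j] single_uminus sum_negf)
      have "op i (op j (op k w)) = op k (op i (op j w)) + S i k (op j w) + op i (S j k w)"
        using comm[OF B[OF i k(2)]] by (simp add: comm[OF w, of j k] op_add)
      moreover have "op j (op i (op k w)) = op k (op j (op i w)) + S j k (op i w) + op j (S i k w)"
        using comm[OF B[OF k(2) i]] by (simp add: comm[OF w, of i k] op_add)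
      moreover have "op k (op i (op j w)) - op k (op j (op i w)) = op k (S i j w)"
        by (simp add: comm[OF w, of i j] op_add)
      moreover have "op j (S k i w) = - op j (S i k w)" "S k i (op j w) = - S i k (op j w)"
        using op_diff[of j 0 "S i k w"] by (simp_all add: S_skew[of k i] op_0)
      moreover have "curv i j (op k w) = op i (op j (op k w)) - op j (op i (op k w)) - S i j (op k w)"
        by (simp only: curv_def S_def)
      \<comment> \<open>All triple products cancel, because \<open>B\<close> moves e_k past e_i and
        e_j also on \<open>op j w\<close> and \<open>op i w\<close>. Only the double brackets
        remain.\<close>
      ultimately have "curv i j (op k w) = op k (S i j w) - S i j (op k w) + (op i (S j k w) - S j k (op i w))
          + (op j (S k i w) - S k i (op j w))"
        by (simp add: diff_eq_eq)
      also have "\<dots> = (R i j k + Q i j k) + (R j k i + Q j k i) + (R k i j + Q k i j)"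
        by (simp add: opS)
      also have "\<dots> = (\<Sum>l<t. cst ((\<rho> i (c j k l) + (\<Sum>m<t. c j k m * c i m l)) +
       (\<rho> j (c k i l) + (\<Sum>m<t. c k i m * c j m l)) +
       (\<rho> k (c i j l) + (\<Sum>m<t. c i j m * c k m l))) * op l w)"
        by (simp add: R_def Q_def single_add distrib_right sum.distrib)
      also have "\<dots> = 0" by (simp add: c_jacobi)
      finally show ?thesis by (simp add: kw)
    qed
    consider "j < i" | "i < j" | "i = j" by linarith
    then show ?case
    proof cases
      case 1
      then show ?thesis by (rule main)
    next
      case 2
      then show ?thesis using main[OF 2] curv_skew[of i j] by simp
    next
      case 3
      then show ?thesis by (simp add: curv_self)
    qed
  qed
qed

lemma op_comm: "op i (op j p) - op j (op i p) = (\<Sum>l<t. cst (c i j l) * op l p)"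
  using curv_eq_0[of i j p] by (simp add: curv_def)

end

section \<open>Computing in the free algebra modulo the relations\<close>

definition pea_class ::
    "('k::field \<Rightarrow> 'a::comm_ring_1 \<Rightarrow> 'a) \<Rightarrow> ('a \<Rightarrow> 'a \<Rightarrow> 'a) \<Rightarrow>
     ('a pea_gen list \<Rightarrow>\<^sub>0 'k) \<Rightarrow> ('a pea_gen list \<Rightarrow>\<^sub>0 'k) set" where
  "pea_class scale bracket p = pea_ideal scale bracket +>\<^bsub>class_ring\<^esub> p"

context
  fixes scale :: "'k::field \<Rightarrow> 'a::comm_ring_1 \<Rightarrow> 'a" and bracket :: "'a \<Rightarrow> 'a \<Rightarrow> 'a"
begin

interpretation J: ideal "pea_ideal scale bracket" class_ring
  by (rule pea_ideal_ideal)

lemma pea_ideal_zero: "0 \<in> pea_ideal scale bracket"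
  using J.zero_closed by simp

lemma pea_ideal_add: "u \<in> pea_ideal scale bracket \<Longrightarrow> v \<in> pea_ideal scale bracket \<Longrightarrow> u + v \<in> pea_ideal scale bracket"
  using J.a_closed by simp

lemma pea_ideal_lmult: "u \<in> pea_ideal scale bracket \<Longrightarrow> v * u \<in> pea_ideal scale bracket"
  using J.I_l_closed[of u v] by simp

lemma pea_ideal_rmult: "u \<in> pea_ideal scale bracket \<Longrightarrow> u * v \<in> pea_ideal scale bracket"
  using J.I_r_closed[of u v] by simp

lemma pea_ideal_uminus: "u \<in> pea_ideal scale bracket \<Longrightarrow> - u \<in> pea_ideal scale bracket"
  using pea_ideal_lmult[of u "-1"] by simp

lemma pea_ideal_diff: "u \<in> pea_ideal scale bracket \<Longrightarrow> v \<in> pea_ideal scale bracket \<Longrightarrow> u - v \<in> pea_ideal scale bracket"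
  using pea_ideal_add[of u "- v"] pea_ideal_uminus by simp

lemma pea_class_eq_iff:
  "pea_class scale bracket p = pea_class scale bracket q \<longleftrightarrow> p - q \<in> pea_ideal scale bracket"
  using ring.quotient_eq_iff_same_a_r_cos[OF class_ring.ring_axioms pea_ideal_ideal, of p q scale bracket]
  by (simp add: pea_class_def a_minus_def class_ring_simps)

lemma pea_class_hom: "pea_class scale bracket \<in> ring_hom class_ring (pea scale bracket)"
  unfolding pea_class_def by (rule pea_proj_hom)

lemma pea_class_closed: "pea_class scale bracket p \<in> carrier (pea scale bracket)"
  using ring_hom_closed[OF pea_class_hom] by simp

lemma pea_class_add: "pea_class scale bracket (p + q) = pea_class scale bracket p \<oplus>\<^bsub>pea scale bracket\<^esub> pea_class scale bracket q"
  using ring_hom_add[OF pea_class_hom] by simp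

lemma pea_class_mult: "pea_class scale bracket (p * q) = pea_class scale bracket p \<otimes>\<^bsub>pea scale bracket\<^esub> pea_class scale bracket q"
  using ring_hom_mult[OF pea_class_hom] by simp

lemma pea_class_0: "pea_class scale bracket 0 = \<zero>\<^bsub>pea scale bracket\<^esub>"
  using ring_hom_zero[OF pea_class_hom class_ring.ring_axioms pea_ring] by simp

lemma pea_class_eq_0: "pea_class scale bracket p = \<zero>\<^bsub>pea scale bracket\<^esub> \<longleftrightarrow> p \<in> pea_ideal scale bracket"
  using pea_class_eq_iff[of p 0] by (simp add: pea_class_0)

lemma pea_class_sum:
  assumes "finite S"
  shows "pea_class scale bracket (sum f S) = (\<Oplus>\<^bsub>pea scale bracket\<^esub>s\<in>S. pea_class scale bracket (f s))"
proof -
  interpret U: ring "pea scale bracket" by (rule pea_ring)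
  show ?thesis using assms
    by (induction S) (simp_all add: pea_class_0 pea_class_add pea_class_closed)
qed

lemma pea_class_surj: "u \<in> carrier (pea scale bracket) \<Longrightarrow> \<exists>p. u = pea_class scale bracket p"
  unfolding pea_def pea_class_def FactRing_def A_RCOSETS_def' by auto

lemma pea_alpha_class: "pea_alpha scale bracket a = pea_class scale bracket (free_var (Alpha a))"
  by (simp add: pea_alpha_def pea_class_def)

lemma pea_beta_class: "pea_beta scale bracket a = pea_class scale bracket (free_var (Beta a))"
  by (simp add: pea_beta_def pea_class_def)

text \<open>Calculations stay in the free algebra, which is a ring type with its simplification
  rules, and only the final congruence refers to the quotient ring with its explicit
  carrier.\<close>

definition pea_cong :: "('a pea_gen list \<Rightarrow>\<^sub>0 'k) \<Rightarrow> ('a pea_gen list \<Rightarrow>\<^sub>0 'k) \<Rightarrow> bool"  (infix \<open>\<doteq>\<close> 50)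
  where "p \<doteq> q \<longleftrightarrow> p - q \<in> pea_ideal scale bracket"

lemma cong_refl [simp]: "p \<doteq> p"
  by (simp add: pea_cong_def pea_ideal_zero)

lemma cong_sym: "p \<doteq> q \<Longrightarrow> q \<doteq> p"
  using pea_ideal_uminus[of "p - q"] by (simp add: pea_cong_def)

lemma cong_trans [trans]: "p \<doteq> q \<Longrightarrow> q \<doteq> r \<Longrightarrow> p \<doteq> r"
  using pea_ideal_add[of "p - q" "q - r"] by (simp add: pea_cong_def)

lemma cong_eq_trans [trans]: "p \<doteq> q \<Longrightarrow> q = r \<Longrightarrow> p \<doteq> r" "p = q \<Longrightarrow> q \<doteq> r \<Longrightarrow> p \<doteq> r"
  by simp_all

lemma cong_add: "p \<doteq> q \<Longrightarrow> p' \<doteq> q' \<Longrightarrow> p + p' \<doteq> q + q'"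
  using pea_ideal_add[of "p - q" "p' - q'"] by (simp add: pea_cong_def algebra_simps)

lemma cong_diff: "p \<doteq> q \<Longrightarrow> p' \<doteq> q' \<Longrightarrow> p - p' \<doteq> q - q'"
  using pea_ideal_diff[of "p - q" "p' - q'"] by (simp add: pea_cong_def algebra_simps)

lemma cong_mult: "p \<doteq> q \<Longrightarrow> p' \<doteq> q' \<Longrightarrow> p * p' \<doteq> q * q'"
  using pea_ideal_add[OF pea_ideal_rmult[of "p - q" p'] pea_ideal_lmult[of "p' - q'" q]]
  by (simp add: pea_cong_def algebra_simps)

lemma cong_sum: "(\<And>i. i \<in> S \<Longrightarrow> f i \<doteq> g i) \<Longrightarrow> sum f S \<doteq> sum g S"
  by (induction S rule: infinite_finite_induct) (simp_all add: cong_add)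

lemma cong_rel: "p - q \<in> pea_relations scale bracket \<Longrightarrow> p \<doteq> q"
  using pea_proj_eqI[of p q scale bracket] by (simp add: pea_class_eq_iff pea_cong_def flip: pea_class_def)

abbreviation Av :: "'a \<Rightarrow> 'a pea_gen list \<Rightarrow>\<^sub>0 'k" where "Av a \<equiv> free_var (Alpha a)"
abbreviation Bv :: "'a \<Rightarrow> 'a pea_gen list \<Rightarrow>\<^sub>0 'k" where "Bv a \<equiv> free_var (Beta a)"

lemma cong_relations:
  "Av 1 \<doteq> 1"
  "Av (a + b) \<doteq> Av a + Av b"
  "Av (a * b) \<doteq> Av a * Av b"
  "Bv (a + b) \<doteq> Bv a + Bv b"
  "Bv (bracket a b) \<doteq> Bv a * Bv b - Bv b * Bv a"
  "Av (bracket a b) \<doteq> Bv a * Av b - Av b * Bv a"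
  "Bv (a * b) \<doteq> Av a * Bv b + Av b * Bv a"
  "Av (scale x a) \<doteq> free_const x * Av a"
  "Bv (scale x a) \<doteq> free_const x * Bv a"
  by (rule cong_rel, unfold pea_relations_def Let_def, force)+

lemma Av_0: "Av 0 \<doteq> 0"
  using cong_diff[OF cong_relations(2)[of 0 0] cong_refl, of "Av 0"] by (simp add: cong_sym)

lemma Bv_0: "Bv 0 \<doteq> 0"
  using cong_diff[OF cong_relations(4)[of 0 0] cong_refl, of "Bv 0"] by (simp add: cong_sym)

lemma Av_sum: "Av (sum f S) \<doteq> (\<Sum>i\<in>S. Av (f i))"
  by (induction S rule: infinite_finite_induct)
     (auto simp: Av_0 intro: cong_trans[OF cong_relations(2) cong_add])

lemma Bv_sum: "Bv (sum f S) \<doteq> (\<Sum>i\<in>S. Bv (f i))"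
  by (induction S rule: infinite_finite_induct)
     (auto simp: Bv_0 intro: cong_trans[OF cong_relations(4) cong_add])

lemma Av_uminus: "Av (- a) \<doteq> - Av a"
  using cong_diff[OF cong_trans[OF cong_sym[OF cong_relations(2)[of "- a" a]]] cong_refl, of 0 "Av a"] Av_0
  by simp

lemma Bv_Av: "Bv a * Av b \<doteq> Av b * Bv a + Av (bracket a b)"
  using cong_add[OF cong_refl cong_sym[OF cong_relations(6)[of a b]], of "Av b * Bv a"]
  by simp

lemma Bv_Bv: "Bv a * Bv b \<doteq> Bv b * Bv a + Bv (bracket a b)"
  using cong_add[OF cong_refl cong_sym[OF cong_relations(5)[of a b]], of "Bv b * Bv a"]
  by simp

end

text \<open>Scalars need no case of their own: modulo the relations the constant c is the generator
  \<open>Alpha (scale c 1)\<close>. Words are then built by left multiplication with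
  generators.\<close>

lemma pea_induct [case_names cong add one alpha beta]:
  fixes scale :: "'k::field \<Rightarrow> 'a::comm_ring_1 \<Rightarrow> 'a"
  assumes cong: "\<And>p q. pea_cong scale bracket p q \<Longrightarrow> P p \<Longrightarrow> P q"
    and add: "\<And>p q. P p \<Longrightarrow> P q \<Longrightarrow> P (p + q)"
    and one: "P 1"
    and alpha: "\<And>a p. P p \<Longrightarrow> P (free_var (Alpha a) * p)"
    and beta: "\<And>a p. P p \<Longrightarrow> P (free_var (Beta a) * p)"
  shows "P p"
proof -
  have const: "pea_cong scale bracket (free_var (Alpha (scale x 1)) * q) (free_const x * q)" for x q
    using cong_mult[OF cong_trans[OF cong_relations(8)[of scale bracket x 1]
      cong_mult[OF cong_refl cong_relations(1)]] cong_refl, of q] by simp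
  have word: "P (Poly_Mapping.single w x)" for w x
  proof -
    have 1: "P (Poly_Mapping.single w 1)" for w
    proof (induction w)
      case Nil
      then show ?case using one by (metis single_one zero_list_def)
    next
      case (Cons g w)
      have "Poly_Mapping.single (g # w) (1::'k) = free_var g * Poly_Mapping.single w 1"
        by (simp add: mult_single plus_list_def)
      then show ?case using alpha beta Cons by (cases g) simp_all
    qed
    have "Poly_Mapping.single w x = free_const x * Poly_Mapping.single w 1"
      by (simp add: mult_single plus_list_def)
    then show ?thesis using cong[OF const alpha[OF 1]] by simp
  qed
  show ?thesis
  proof (induction p rule: pm_induct)
    case zero
    show ?case using word[of "[]" 0] by simp
  next
    case (add v a p)
    then show ?case by (intro assms(2) word)
  qed
qed

text \<open>Shared by the two representations of the proof, the one on the algebra itself by Poisson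
  differential operators and the one on polynomials over the fraction field. \<open>ev\<close>
  evaluates representatives from the free algebra as operators.\<close>

locale operator_triple =
  fixes scale :: "'k::field \<Rightarrow> 'a::comm_ring_1 \<Rightarrow> 'a" and bracket :: "'a \<Rightarrow> 'a \<Rightarrow> 'a"
    and R :: "('v::ab_group_add \<Rightarrow> 'v) ring" and \<eta> \<alpha> \<beta>
  assumes triple: "poisson_triple scale bracket R \<eta> \<alpha> \<beta>"
    and ops: "F \<otimes>\<^bsub>R\<^esub> G = F \<circ> G" "F \<oplus>\<^bsub>R\<^esub> G = (\<lambda>v. F v + G v)" "\<one>\<^bsub>R\<^esub> = id" "\<zero>\<^bsub>R\<^esub> = (\<lambda>v. 0)"
begin

definition ev :: "('a pea_gen list \<Rightarrow>\<^sub>0 'k) \<Rightarrow> 'v \<Rightarrow> 'v" where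
  "ev p = pea_lift R \<eta> \<alpha> \<beta> (pea_class scale bracket p)"

lemma ev_gens: "ev (free_var (Alpha a)) = \<alpha> a" "ev (free_var (Beta a)) = \<beta> a"
  using pea_universal(3,4)[OF triple] by (simp_all add: ev_def pea_alpha_class pea_beta_class)

lemma ev_hom: "ev \<in> ring_hom class_ring R"
  unfolding ev_def using ring_hom_trans[OF pea_class_hom pea_universal(1)[OF triple]] by (simp add: comp_def)

lemma ev_add: "ev (p + q) v = ev p v + ev q v"
  using ring_hom_add[OF ev_hom] by (simp add: ops)

lemma ev_mult: "ev (p * q) v = ev p (ev q v)"
  using ring_hom_mult[OF ev_hom] by (simp add: ops)

lemma ev_0: "ev 0 v = 0"
  using ev_add[of 0 0 v] by simp

lemma ev_diff: "ev (p - q) v = ev p v - ev q v"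
  using ev_add[of "p - q" q v] by simp

lemma ev_sum: "ev (sum f S) v = (\<Sum>s\<in>S. ev (f s) v)"
  by (induction S rule: infinite_finite_induct) (simp_all add: ev_0 ev_add)

lemma ev_ideal: "p \<in> pea_ideal scale bracket \<Longrightarrow> ev p v = 0"
  using pea_class_eq_0[of scale bracket p] ev_0[of v] by (simp add: ev_def pea_class_0)

lemma ev_cong: "pea_cong scale bracket p q \<Longrightarrow> ev p v = ev q v"
  using ev_ideal[of "p - q" v] by (simp add: pea_cong_def ev_diff)

end

context poisson_algebra
begin

lemma bracket_linear:
  "bracket (a + b) x = bracket a x + bracket b x"
  "bracket x (a + b) = bracket x a + bracket x b"
  "bracket (scale c a) x = scale c (bracket a x)"
  "bracket x (scale c a) = scale c (bracket x a)"
proof -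
  interpret vector_space_pair scale scale by unfold_locales
  show "bracket (a + b) x = bracket a x + bracket b x" "bracket x (a + b) = bracket x a + bracket x b"
    "bracket (scale c a) x = scale c (bracket a x)" "bracket x (scale c a) = scale c (bracket x a)"
    using linear_add[OF bracket_linear_left] linear_scale[OF bracket_linear_left]
      linear_add[OF bracket_linear_right] linear_scale[OF bracket_linear_right] by auto
qed

lemmas bracket_add_left = bracket_linear(1) and bracket_add_right = bracket_linear(2)
  and bracket_scale_left = bracket_linear(3) and bracket_scale_right = bracket_linear(4)

lemma bracket_skew: "bracket a b = - bracket b a"
  using bracket_self[of "a + b"] bracket_self[of a] bracket_self[of b]
  by (simp add: bracket_add_left bracket_add_right eq_neg_iff_add_eq_0 add.commute)

lemma bracket_0: "bracket 0 a = 0" "bracket a 0 = 0"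
  using bracket_add_left[of 0 0 a] bracket_add_right[of a 0 0] by simp_all

lemma bracket_uminus: "bracket (- a) b = - bracket a b" "bracket a (- b) = - bracket a b"
  using bracket_add_left[of a "- a" b] bracket_add_right[of a b "- b"]
  by (simp_all add: bracket_0 eq_neg_iff_add_eq_0 add.commute)

lemma bracket_1: "bracket a 1 = 0" "bracket 1 a = 0"
  using bracket_leibniz[of a 1 1] bracket_skew[of 1 a] by simp_all

lemma bracket_const: "bracket a (scale c 1) = 0" "bracket (scale c 1) a = 0"
  by (simp_all add: bracket_scale_left bracket_scale_right bracket_1)

lemma bracket_bracket: "bracket (bracket a b) x = bracket a (bracket b x) - bracket b (bracket a x)"
  using bracket_jacobi[of a b x] bracket_skew[of x "bracket a b"] bracket_skew[of x a]
  by (simp add: bracket_uminus algebra_simps)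

lemma PD_ops:
  "F \<otimes>\<^bsub>PD_ring scale bracket\<^esub> G = F \<circ> G" "F \<oplus>\<^bsub>PD_ring scale bracket\<^esub> G = (\<lambda>x. F x + G x)"
  "\<one>\<^bsub>PD_ring scale bracket\<^esub> = id" "\<zero>\<^bsub>PD_ring scale bracket\<^esub> = (\<lambda>x. 0)"
  by (simp_all add: PD_ring_def End_ring_def)

end

sublocale poisson_algebra \<subseteq> pi: operator_triple scale bracket "PD_ring scale bracket" scale "\<lambda>a. (*) a" bracket
  by unfold_locales (rule PD_triple, rule PD_ops, rule PD_ops, rule PD_ops, rule PD_ops)

section \<open>Derivations of the field of fractions\<close>

abbreviation emb :: "'a::idom \<Rightarrow> 'a fract" where "emb a \<equiv> Fraction_Field.Fract a 1"

lemma emb_simps: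
  "emb (a + b) = emb a + emb b" "emb (a * b) = emb a * emb b" "emb (- a) = - emb a"
  "emb (a - b) = emb a - emb b" "emb 0 = 0" "emb 1 = 1" "emb a = emb b \<longleftrightarrow> a = b" "emb a = 0 \<longleftrightarrow> a = 0"
  by (simp_all add: eq_fract Zero_fract_def One_fract_def)

declare Fraction_Field.add_fract [simp del] Fraction_Field.mult_fract [simp del]
  Fraction_Field.minus_fract [simp del] Fraction_Field.diff_fract [simp del]

lemma emb_sum: "emb (sum f S) = (\<Sum>s\<in>S. emb (f s))"
  by (induction S rule: infinite_finite_induct) (simp_all add: emb_simps)

lemma fract_quotient:
  obtains a s where "x = emb a / emb s" "s \<noteq> 0"
proof (cases x rule: Fract_cases)
  case (Fract a b)
  then show ?thesis using that[of a b] by simp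
qed

locale fract_derivation =
  fixes \<Delta> :: "'a::idom fract \<Rightarrow> 'a fract"
  assumes add: "\<Delta> (x + y) = \<Delta> x + \<Delta> y" and mult: "\<Delta> (x * y) = \<Delta> x * y + x * \<Delta> y"
begin

lemma zero: "\<Delta> 0 = 0"
  using add[of 0 0] by (metis add.right_neutral add_left_cancel)

lemma one: "\<Delta> 1 = 0"
  using mult[of 1 1] by (metis add.right_neutral add_left_cancel mult_1 mult_1_right)

lemma uminus: "\<Delta> (- x) = - \<Delta> x"
  using add[of x "- x"] by (simp add: zero eq_neg_iff_add_eq_0 add.commute)

lemma diff: "\<Delta> (x - y) = \<Delta> x - \<Delta> y"
  using add[of x "- y"] by (simp add: uminus)

lemma sum: "\<Delta> (sum f S) = (\<Sum>s\<in>S. \<Delta> (f s))"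
  by (induction S rule: infinite_finite_induct) (simp_all add: zero add)

lemma div:
  assumes "s \<noteq> 0"
  shows "\<Delta> (emb a / emb s) = (\<Delta> (emb a) - emb a / emb s * \<Delta> (emb s)) / emb s"
proof -
  have s: "emb s \<noteq> 0" using assms by (simp add: emb_simps)
  then have "\<Delta> (emb a) = \<Delta> (emb a / emb s * emb s)" by (metis nonzero_divide_eq_eq)
  then show ?thesis using s by (simp only: mult) (simp add: nonzero_eq_divide_eq)
qed

end

lemma fract_derivation_eqI:
  assumes "fract_derivation \<Delta>" "fract_derivation \<Delta>'" "\<And>a. \<Delta> (emb a) = \<Delta>' (emb a)"
  shows "\<Delta> x = \<Delta>' x"
  by (cases x rule: fract_quotient)
     (simp add: fract_derivation.div[OF assms(1)] fract_derivation.div[OF assms(2)] assms(3) del: divide_fract)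

section \<open>The enveloping algebra acts on polynomials over the field of fractions\<close>

text \<open>Coordinates for the differentials over the fraction field: the forms
  d(\<open>z k\<close>) with k < t are a basis, and \<open>D k (emb b)\<close> is the coefficient of
  d(\<open>z k\<close>) in db. Everything is set to zero from t on, so that the identities of
  \<open>lie_rinehart\<close> hold for all natural numbers as indices.\<close>

locale poisson_frame = poisson_algebra scale bracket
  for scale :: "'k::field \<Rightarrow> 'a::idom \<Rightarrow> 'a" and bracket +
  fixes t :: nat and z :: "nat \<Rightarrow> 'a" and D :: "nat \<Rightarrow> 'a fract \<Rightarrow> 'a fract"
  assumes D_deriv: "fract_derivation (D k)"
    and D_const: "D k (emb (scale x 1)) = 0"
    and D_comm: "D i (D j y) = D j (D i y)"
    and D_dual: "i < t \<Longrightarrow> k < t \<Longrightarrow> D k (emb (z i)) = (if i = k then 1 else 0)"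
    and D_out: "k \<ge> t \<Longrightarrow> D k y = 0"
    and z_out: "k \<ge> t \<Longrightarrow> z k = 0"
    and frame: "emb (bracket a b) = (\<Sum>k<t. \<Sum>l<t. D k (emb a) * D l (emb b) * emb (bracket (z k) (z l)))"
begin

definition \<Lambda> :: "nat \<Rightarrow> nat \<Rightarrow> 'a fract" where
  "\<Lambda> i j = emb (bracket (z i) (z j))"

text \<open>The Hamiltonian derivation of \<open>z i\<close>, extended to the fraction field and
  written in the coordinates \<open>D l\<close>.\<close>

definition \<rho> :: "nat \<Rightarrow> 'a fract \<Rightarrow> 'a fract" where
  "\<rho> i x = (\<Sum>l<t. \<Lambda> i l * D l x)"

lemmas D_simps = fract_derivation.add[OF D_deriv] fract_derivation.mult[OF D_deriv]
  fract_derivation.zero[OF D_deriv] fract_derivation.uminus[OF D_deriv]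
  fract_derivation.diff[OF D_deriv] fract_derivation.sum[OF D_deriv] 

lemma \<rho>_deriv: "fract_derivation (\<rho> i)"
  by unfold_locales (simp_all add: \<rho>_def D_simps algebra_simps sum.distrib sum_distrib_left)

lemma \<rho>_emb: "\<rho> i (emb a) = emb (bracket (z i) a)"
proof (cases "i < t")
  case True
  have "emb (bracket (z i) a) = (\<Sum>k<t. if i = k then (\<Sum>l<t. D l (emb a) * \<Lambda> k l) else 0)"
    unfolding frame[of "z i" a] \<Lambda>_def by (rule sum.cong) (use True D_dual in auto)
  then show ?thesis using True by (simp add: \<rho>_def mult.commute)
next
  case False
  then show ?thesis by (simp add: \<rho>_def z_out bracket_0 emb_simps \<Lambda>_def)
qed

lemma emb_bracket: "emb (bracket b a) = (\<Sum>k<t. D k (emb b) * \<rho> k (emb a))"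
  unfolding frame[of b a] \<rho>_def by (simp add: sum_distrib_left mult_ac \<Lambda>_def)

text \<open>The bracket of differentials is [dz_i, dz_j] = d{z_i, z_j}, so the structure constants
  are the coordinates of d{z_i, z_j}.\<close>

sublocale lr: lie_rinehart \<rho> "\<lambda>i j k. D k (\<Lambda> i j)" t
proof
  interpret \<rho>: fract_derivation "\<rho> i" for i by (rule \<rho>_deriv)
  fix i j k l :: nat and a b :: "'a fract"
  show "\<rho> i (a + b) = \<rho> i a + \<rho> i b" "\<rho> i (a * b) = \<rho> i a * b + a * \<rho> i b"
    by (rule \<rho>.add \<rho>.mult)+
  show "\<rho> i (\<rho> j a) - \<rho> j (\<rho> i a) = (\<Sum>k<t. D k (\<Lambda> i j) * \<rho> k a)"
  proof (rule fract_derivation_eqI[where x = a])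
    show "fract_derivation (\<lambda>a. \<rho> i (\<rho> j a) - \<rho> j (\<rho> i a))"
      by unfold_locales (simp_all add: \<rho>.add \<rho>.mult algebra_simps)
    show "fract_derivation (\<lambda>a. \<Sum>k<t. D k (\<Lambda> i j) * \<rho> k a)"
      by unfold_locales (simp_all add: \<rho>.add \<rho>.mult algebra_simps sum.distrib sum_distrib_left)
    show "\<rho> i (\<rho> j (emb a)) - \<rho> j (\<rho> i (emb a)) = (\<Sum>k<t. D k (\<Lambda> i j) * \<rho> k (emb a))" for a
      unfolding \<Lambda>_def emb_bracket[symmetric]
      by (simp only: \<rho>_emb bracket_bracket[of "z i" "z j" a] emb_simps)
  qed
  show "D l (\<Lambda> i j) = - D l (\<Lambda> j i)"
    unfolding \<Lambda>_def by (subst bracket_skew) (simp only: emb_simps D_simps)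
  show "D l (\<Lambda> i i) = 0"
    by (simp only: \<Lambda>_def bracket_self emb_simps D_simps)
  \<comment> \<open>The two terms combine to the l-th coordinate of d{z_i, {z_j, z_k}}, by the
    product rule and \<open>D_comm\<close>. The Jacobi identity of the structure constants thus
    becomes that of the Poisson bracket.\<close>
  have *: "\<rho> i (D l (\<Lambda> j k)) + (\<Sum>m<t. D m (\<Lambda> j k) * D l (\<Lambda> i m)) = D l (emb (bracket (z i) (bracket (z j) (z k))))"
    for i j k
  proof -
    have "\<rho> i (\<Lambda> j k) = emb (bracket (z i) (bracket (z j) (z k)))"
      unfolding \<Lambda>_def by (rule \<rho>_emb)
    then have "emb (bracket (z i) (bracket (z j) (z k))) = (\<Sum>m<t. \<Lambda> i m * D m (\<Lambda> j k))"
      by (simp only: \<rho>_def)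
    then show ?thesis
      by (simp add: \<rho>_def D_simps sum.distrib D_comm[of l] mult.commute)
  qed
  show "\<rho> i (D l (\<Lambda> j k)) + (\<Sum>m<t. D m (\<Lambda> j k) * D l (\<Lambda> i m)) +
       (\<rho> j (D l (\<Lambda> k i)) + (\<Sum>m<t. D m (\<Lambda> k i) * D l (\<Lambda> j m))) +
       (\<rho> k (D l (\<Lambda> i j)) + (\<Sum>m<t. D m (\<Lambda> i j) * D l (\<Lambda> k m))) = 0"
    unfolding * D_simps(1)[symmetric] emb_simps(1)[symmetric] bracket_jacobi
    by (simp only: emb_simps D_simps)
qed

section \<open>The representation on polynomials over the fraction field\<close>

definition mscale :: "'k \<Rightarrow> (nat multiset \<Rightarrow>\<^sub>0 'a fract) \<Rightarrow> nat multiset \<Rightarrow>\<^sub>0 'a fract" where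
  "mscale x p = cst (emb (scale x 1)) * p"

definition malpha :: "'a \<Rightarrow> (nat multiset \<Rightarrow>\<^sub>0 'a fract) \<Rightarrow> nat multiset \<Rightarrow>\<^sub>0 'a fract" where
  "malpha a p = cst (emb a) * p"

definition mbeta :: "'a \<Rightarrow> (nat multiset \<Rightarrow>\<^sub>0 'a fract) \<Rightarrow> nat multiset \<Rightarrow>\<^sub>0 'a fract" where
  "mbeta a p = (\<Sum>k<t. cst (D k (emb a)) * lr.op k p)"

lemma scale_1: "scale (x + y) 1 = scale x 1 + scale y 1" "scale (x * y) 1 = scale x 1 * scale y 1"
  "scale 1 1 = 1" "scale x a = scale x 1 * a"
  by (simp_all add: scale_left_distrib scale_mult_left)

lemma mscale_vector_space: "vector_space mscale"
  by unfold_locales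
     (simp_all only: mscale_def distrib_left scale_1(1-3) emb_simps single_add distrib_right cst_mult cst_1 mult_1_left mult.assoc)

lemma malpha_linear: "Vector_Spaces.linear mscale mscale (malpha a)"
  using mscale_vector_space
  by (simp add: Vector_Spaces.linear_def module_hom_iff module_iff_vector_space malpha_def mscale_def
      algebra_simps)

lemma \<rho>_const: "\<rho> i (emb (scale x 1)) = 0"
  by (simp add: \<rho>_emb bracket_const emb_simps)

lemma mbeta_linear: "Vector_Spaces.linear mscale mscale (mbeta a)"
  using mscale_vector_space
  by (simp add: Vector_Spaces.linear_def module_hom_iff module_iff_vector_space mbeta_def mscale_def lr.op_add
      lr.op_cst_mult \<rho>_const distrib_left sum.distrib sum_distrib_left mult.left_commute)

lemma mbeta_malpha: "mbeta a (malpha b p) = malpha b (mbeta a p) + malpha (bracket a b) p"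
  unfolding mbeta_def malpha_def lr.op_cst_mult emb_bracket
  by (simp add: distrib_left sum.distrib sum_distrib_left sum_distrib_right cst_sum cst_mult mult_ac)

text \<open>The commutator of the operators of da and db has three parts: coefficients of db
  differentiated along da, coefficients of da differentiated along db, and commutators of basis
  operators. By \<open>lr.op_comm\<close> all are of first order, and \<open>e3\<close> recognizes
  their sum as the coordinates of d{a, b}.\<close>

lemma mbeta_mbeta: "mbeta a (mbeta b p) = mbeta b (mbeta a p) + mbeta (bracket a b) p"
proof -
  let ?a = "\<lambda>k. D k (emb a)" and ?b = "\<lambda>k. D k (emb b)"
  have exp: "mbeta a (mbeta b p) = (\<Sum>l<t. cst (\<Sum>k<t. D k (emb a) * \<rho> k (D l (emb b))) * lr.op l p) +
      (\<Sum>k<t. \<Sum>l<t. cst (D k (emb a) * D l (emb b)) * lr.op k (lr.op l p))" for a b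
  proof -
    have "mbeta a (mbeta b p) = (\<Sum>k<t. \<Sum>l<t. cst (D k (emb a) * \<rho> k (D l (emb b))) * lr.op l p) +
      (\<Sum>k<t. \<Sum>l<t. cst (D k (emb a) * D l (emb b)) * lr.op k (lr.op l p))"
      by (simp add: mbeta_def lr.op_sum lr.op_cst_mult sum_distrib_left distrib_left sum.distrib cst_mult mult.assoc)
    also have "(\<Sum>k<t. \<Sum>l<t. cst (D k (emb a) * \<rho> k (D l (emb b))) * lr.op l p) =
       (\<Sum>l<t. cst (\<Sum>k<t. D k (emb a) * \<rho> k (D l (emb b))) * lr.op l p)"
      by (subst sum.swap) (simp only: cst_sum sum_distrib_right)
    finally show ?thesis .
  qed
  have e1: "(\<Sum>k<t. \<Sum>l<t. cst (?b k * ?a l) * lr.op k (lr.op l p)) = (\<Sum>k<t. \<Sum>l<t. cst (?a k * ?b l) * lr.op l (lr.op k p))"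
    by (subst sum.swap) (simp add: mult.commute)
  have e2: "(\<Sum>k<t. \<Sum>l<t. cst (?a k * ?b l) * lr.op k (lr.op l p)) - (\<Sum>k<t. \<Sum>l<t. cst (?a k * ?b l) * lr.op l (lr.op k p))
    = (\<Sum>m<t. cst (\<Sum>k<t. \<Sum>l<t. ?a k * ?b l * D m (\<Lambda> k l)) * lr.op m p)"
  proof -
    have "(\<Sum>k<t. \<Sum>l<t. cst (?a k * ?b l) * lr.op k (lr.op l p)) - (\<Sum>k<t. \<Sum>l<t. cst (?a k * ?b l) * lr.op l (lr.op k p))
      = (\<Sum>k<t. \<Sum>l<t. \<Sum>m<t. cst (?a k * ?b l * D m (\<Lambda> k l)) * lr.op m p)"
      by (simp only: sum_subtractf[symmetric] right_diff_distrib[symmetric] lr.op_comm sum_distrib_left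
          mult.assoc[symmetric] cst_mult[symmetric])
    also have "\<dots> = (\<Sum>k<t. \<Sum>m<t. \<Sum>l<t. cst (?a k * ?b l * D m (\<Lambda> k l)) * lr.op m p)"
      by (rule sum.cong[OF refl], rule sum.swap)
    also have "\<dots> = (\<Sum>m<t. cst (\<Sum>k<t. \<Sum>l<t. ?a k * ?b l * D m (\<Lambda> k l)) * lr.op m p)"
      by (subst sum.swap) (simp only: cst_sum sum_distrib_right)
    finally show ?thesis .
  qed
  \<comment> \<open>Apply \<open>D m\<close> to the coordinate formula for {a, b}. The part where it
    hits the coordinates of a takes the required form because the \<open>D k\<close> commute, and it
    gets its sign from the skew symmetry of \<open>\<Lambda>\<close>.\<close>
  have e3: "D m (emb (bracket a b)) =
    (\<Sum>k<t. ?a k * \<rho> k (D m (emb b))) - (\<Sum>k<t. ?b k * \<rho> k (D m (emb a))) + (\<Sum>k<t. \<Sum>l<t. ?a k * ?b l * D m (\<Lambda> k l))" for m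
  proof -
    have "(\<Sum>k<t. ?b k * \<rho> k (D m (emb a))) = (\<Sum>k<t. \<Sum>l<t. ?b k * \<Lambda> k l * D l (D m (emb a)))"
      by (simp add: \<rho>_def sum_distrib_left mult.assoc)
    also have "\<dots> = (\<Sum>k<t. \<Sum>l<t. ?b l * \<Lambda> l k * D k (D m (emb a)))"
      by (rule sum.swap)
    also have "\<dots> = - (\<Sum>k<t. \<Sum>l<t. D m (?a k) * ?b l * \<Lambda> k l)"
    proof -
      have neg: "\<Lambda> l k = - \<Lambda> k l" for l k
        unfolding \<Lambda>_def by (subst bracket_skew) (simp only: emb_simps)
      have "?b l * \<Lambda> l k * D k (D m (emb a)) = - (D m (?a k) * ?b l * \<Lambda> k l)" for k l
        by (simp add: D_comm[of m k] neg[of l k])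
      then show ?thesis by (simp add: sum_negf)
    qed
    finally have "(\<Sum>k<t. \<Sum>l<t. D m (?a k) * ?b l * \<Lambda> k l) = - (\<Sum>k<t. ?b k * \<rho> k (D m (emb a)))" by simp
    moreover have "(\<Sum>k<t. \<Sum>l<t. ?a k * D m (?b l) * \<Lambda> k l) = (\<Sum>k<t. ?a k * \<rho> k (D m (emb b)))"
      by (simp add: \<rho>_def sum_distrib_left D_comm[of m] mult_ac)
    ultimately show ?thesis
      unfolding frame[of a b] \<Lambda>_def[symmetric] D_simps distrib_right sum.distrib by simp
  qed
  have e4: "mbeta (bracket a b) p = (\<Sum>l<t. cst (\<Sum>k<t. ?a k * \<rho> k (D l (emb b))) * lr.op l p) -
    (\<Sum>l<t. cst (\<Sum>k<t. ?b k * \<rho> k (D l (emb a))) * lr.op l p) +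
    (\<Sum>m<t. cst (\<Sum>k<t. \<Sum>l<t. ?a k * ?b l * D m (\<Lambda> k l)) * lr.op m p)"
    unfolding mbeta_def e3
    by (simp only: single_add single_diff distrib_right left_diff_distrib sum.distrib sum_subtractf)
  have "sa + u = sb + v + (sa - sb + w)" if "u - v = w" for sa sb u v w :: "nat multiset \<Rightarrow>\<^sub>0 'a fract"
    using that by auto
  from this[OF e2] show ?thesis
    unfolding exp[of a b] exp[of b a] e1 e4 .
qed

definition mring :: "((nat multiset \<Rightarrow>\<^sub>0 'a fract) \<Rightarrow> nat multiset \<Rightarrow>\<^sub>0 'a fract) ring" where
  "mring = End_ring mscale"

lemma mring_ops:
  "F \<otimes>\<^bsub>mring\<^esub> G = F \<circ> G" "F \<oplus>\<^bsub>mring\<^esub> G = (\<lambda>x. F x + G x)"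
  "\<one>\<^bsub>mring\<^esub> = id" "\<zero>\<^bsub>mring\<^esub> = (\<lambda>x. 0)"
  by (simp_all add: mring_def End_ring_def)

lemma mring_triple: "poisson_triple scale bracket mring mscale malpha mbeta"
proof -
  interpret E: ring mring unfolding mring_def by (rule End_ring_ring[OF mscale_vector_space])
  have closed: "malpha a \<in> carrier mring" "mbeta a \<in> carrier mring" for a
    using malpha_linear mbeta_linear by (simp_all add: mring_def End_ring_def)
  have mscale: "mscale x = malpha (scale x 1)" for x
    by (simp add: fun_eq_iff mscale_def malpha_def)
  have lin: "F (mscale x p) = mscale x (F p)" if "F \<in> carrier mring" for F x p
  proof -
    have "Vector_Spaces.linear mscale mscale F" using that by (simp add: mring_def End_ring_def)
    then show ?thesis by (simp add: Vector_Spaces.linear_def module_hom_iff)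
  qed
  have minus: "F \<ominus>\<^bsub>mring\<^esub> G = K" if "F \<in> carrier mring" "G \<in> carrier mring" "K \<in> carrier mring"
    "\<And>x. F x = K x + G x" for F G K
  proof -
    have "F = K \<oplus>\<^bsub>mring\<^esub> G" using that by (auto simp: mring_ops)
    then show ?thesis using that by (simp add: E.minus_eq E.a_assoc E.r_neg)
  qed
  have comp: "F \<circ> G \<in> carrier mring" if "F \<in> carrier mring" "G \<in> carrier mring" for F G
    using E.m_closed[OF that] by (simp add: mring_ops)
  have alpha: "malpha \<in> ring_hom class_ring mring"
    by (rule ring_hom_memI)
       (use closed in \<open>auto simp: mring_ops fun_eq_iff malpha_def emb_simps cst_mult cst_1 single_add distrib_right mult.assoc\<close>)
  have "assoc_algebra mring mscale"
  proof
    show "mscale \<in> ring_hom class_ring mring"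
      by (rule ring_hom_memI)
         (use closed in \<open>auto simp: mscale mring_ops fun_eq_iff malpha_def emb_simps cst_mult cst_1 single_add distrib_right mult.assoc scale_1(1-3)\<close>)
  qed (use lin in \<open>auto simp: mring_ops fun_eq_iff\<close>)
  moreover have "(mbeta a \<circ> mbeta b) \<ominus>\<^bsub>mring\<^esub> (mbeta b \<circ> mbeta a) = mbeta (bracket a b)" for a b
    by (rule minus) (simp_all add: closed comp mbeta_mbeta[of a b])
  moreover have "(mbeta a \<circ> malpha b) \<ominus>\<^bsub>mring\<^esub> (malpha b \<circ> mbeta a) = malpha (bracket a b)" for a b
    by (rule minus) (simp_all add: closed comp mbeta_malpha)
  moreover have "mbeta (scale x a) = mscale x \<circ> mbeta a" for x a
    by (simp only: fun_eq_iff mscale_def mbeta_def scale_1(4)[of x a] emb_simps D_simps D_const comp_apply)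
       (simp add: sum_distrib_left cst_mult mult.assoc)
  moreover have "malpha (scale x a) = mscale x \<circ> malpha a" for x a
    by (simp only: fun_eq_iff mscale_def malpha_def scale_1(4)[of x a] emb_simps cst_mult comp_apply mult.assoc) simp
  ultimately show ?thesis
    unfolding poisson_triple_def mring_ops
    using closed alpha
    by (auto simp: fun_eq_iff mbeta_def malpha_def emb_simps D_simps cst_mult single_add algebra_simps sum.distrib sum_distrib_left)
qed

sublocale mod: operator_triple scale bracket mring mscale malpha mbeta
  by unfold_locales (rule mring_triple, rule mring_ops, rule mring_ops, rule mring_ops, rule mring_ops)

text \<open>Applied to \<open>1\<close>, an element \<open>\<Sum> a\<^sub>i \<beta>(b\<^sub>i)\<close> of the enveloping algebra yields the coordinates of the
  corresponding differential form, so no nonzero such form over the field of fractions vanishes.\<close>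

lemma form_coordinates:
  assumes "(\<Sum>i\<in>S. free_var (Alpha (a i)) * free_var (Beta (b i))) \<in> pea_ideal scale bracket"
  shows "(\<Sum>i\<in>S. emb (a i) * D k (emb (b i))) = 0"
proof (cases "k < t")
  case True
  have 1: "lr.op k 1 = mon {#k#}" for k
    using lr.op_mon[of k "{#}"] lr.gen_le[of "{#}" k] by (simp add: cst_1)
  have "(\<Sum>i\<in>S. malpha (a i) (mbeta (b i) 1)) = 0"
    using mod.ev_ideal[OF assms, of 1] by (simp add: mod.ev_sum mod.ev_mult mod.ev_gens)
  then have "Poly_Mapping.lookup (\<Sum>i\<in>S. malpha (a i) (mbeta (b i) 1)) {#k#} = 0" by simp
  moreover have "Poly_Mapping.lookup (malpha a (mbeta b 1)) {#k#} = emb a * D k (emb b)" for a b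
  proof -
    have "malpha a (mbeta b 1) = (\<Sum>k<t. Poly_Mapping.single {#k#} (emb a * D k (emb b)))"
      by (simp add: malpha_def mbeta_def 1 cst_mult_single sum_distrib_left)
    then show ?thesis using True by (simp add: lookup_sum lookup_single when_def)
  qed
  ultimately show ?thesis by (simp add: lookup_sum)
qed (simp add: D_out)

end

section \<open>Determinants and rank\<close>

text \<open>More unknowns than equations: one elimination step per equation, with
  \<open>P i0 k0\<close> as pivot. Index sets are arbitrary finite sets, which spares an enumeration
  in the applications.\<close>

lemma underdetermined_system:
  fixes P :: "'i \<Rightarrow> 'k \<Rightarrow> 'f::field"
  assumes "finite T" "finite S" "card T < card S"
  shows "\<exists>c. (\<exists>i\<in>S. c i \<noteq> 0) \<and> (\<forall>k\<in>T. (\<Sum>i\<in>S. c i * P i k) = 0)"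
  using assms
proof (induction T arbitrary: S P rule: finite_induct)
  case empty
  then have "S \<noteq> {}" by auto
  then show ?case by (intro exI[of _ "\<lambda>_. 1"]) auto
next
  case (insert k0 T)
  show ?case
  proof (cases "\<forall>i\<in>S. P i k0 = 0")
    case True
    obtain c where "\<exists>i\<in>S. c i \<noteq> 0" "\<forall>k\<in>T. (\<Sum>i\<in>S. c i * P i k) = 0"
      using insert.IH[of S P] insert.prems insert.hyps by auto
    then show ?thesis using True by (intro exI[of _ c]) simp
  next
    case False
    then obtain i0 where i0: "i0 \<in> S" "P i0 k0 \<noteq> 0" by blast
    define S' where "S' = S - {i0}"
    have S': "finite S'" "i0 \<notin> S'" "S = insert i0 S'" using i0 insert.prems by (auto simp: S'_def)
    have "card T < card S'" using insert.prems insert.hyps i0 by (simp add: S'_def)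
    then obtain c where c: "\<exists>i\<in>S'. c i \<noteq> 0"
      "\<forall>k\<in>T. (\<Sum>i\<in>S'. c i * (P i k - P i k0 / P i0 k0 * P i0 k)) = 0"
      using insert.IH[of S' "\<lambda>i k. P i k - P i k0 / P i0 k0 * P i0 k"] S' by auto
    \<comment> \<open>The value at i0 solves equation k0; the other equations were reduced by the
      pivot row so that they are not disturbed.\<close>
    define c' where "c' = c(i0 := - (\<Sum>i\<in>S'. c i * P i k0) / P i0 k0)"
    have eq: "(\<Sum>i\<in>S. c' i * P i k) = (\<Sum>i\<in>S'. c i * (P i k - P i k0 / P i0 k0 * P i0 k))" for k
    proof -
      have "(\<Sum>i\<in>S. c' i * P i k) = c' i0 * P i0 k + (\<Sum>i\<in>S'. c i * P i k)"
        using S' by (simp add: c'_def) (intro sum.cong, auto)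
      then show ?thesis
        by (simp add: c'_def right_diff_distrib sum_subtractf sum_distrib_right sum_distrib_left sum_divide_distrib mult_ac)
    qed
    have "(\<Sum>i\<in>S. c' i * P i k0) = 0" unfolding eq using i0 by simp
    moreover have "\<exists>i\<in>S. c' i \<noteq> 0" using c(1) S' by (auto simp: c'_def)
    ultimately show ?thesis using c(2) eq by (intro exI[of _ c']) auto
  qed
qed

lemma det_right_kernel:
  fixes f :: "nat \<Rightarrow> nat \<Rightarrow> 'f::field"
  shows "det (mat d d (\<lambda>(i, j). f i j)) = 0 \<longleftrightarrow> (\<exists>v. (\<exists>j<d. v j \<noteq> 0) \<and> (\<forall>i<d. (\<Sum>j<d. f i j * v j) = 0))"
proof -
  have prod: "mat d d (\<lambda>(i, j). f i j) *\<^sub>v v = 0\<^sub>v d \<longleftrightarrow> (\<forall>i<d. (\<Sum>j<d. f i j * v $ j) = 0)"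
    if "v \<in> carrier_vec d" for v
    using that by (auto simp: vec_eq_iff scalar_prod_def atLeast0LessThan)
  have nz: "v \<noteq> 0\<^sub>v d \<longleftrightarrow> (\<exists>j<d. v $ j \<noteq> 0)" if "v \<in> carrier_vec d" for v :: "'f vec"
    using that by (auto simp: vec_eq_iff)
  show ?thesis
    unfolding det_0_iff_vec_prod_zero[OF mat_carrier]
  proof
    assume "\<exists>v. v \<in> carrier_vec d \<and> v \<noteq> 0\<^sub>v d \<and> mat d d (\<lambda>(i, j). f i j) *\<^sub>v v = 0\<^sub>v d"
    then obtain v where v: "v \<in> carrier_vec d" "v \<noteq> 0\<^sub>v d" "mat d d (\<lambda>(i, j). f i j) *\<^sub>v v = 0\<^sub>v d"
      by blast
    show "\<exists>v. (\<exists>j<d. v j \<noteq> 0) \<and> (\<forall>i<d. (\<Sum>j<d. f i j * v j) = 0)"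
      using v(2,3) unfolding prod[OF v(1)] nz[OF v(1)] by (intro exI[of _ "\<lambda>j. v $ j"]) blast
  next
    assume "\<exists>v. (\<exists>j<d. v j \<noteq> 0) \<and> (\<forall>i<d. (\<Sum>j<d. f i j * v j) = 0)"
    then obtain v where v: "\<exists>j<d. v j \<noteq> 0" "\<forall>i<d. (\<Sum>j<d. f i j * v j) = 0" by blast
    have "vec d v \<noteq> 0\<^sub>v d"
    proof
      assume eq: "vec d v = 0\<^sub>v d"
      obtain j where j: "j < d" "v j \<noteq> 0" using v(1) by blast
      have "vec d v $ j = 0\<^sub>v d $ j" by (simp only: eq)
      then show False using j by simp
    qed
    then show "\<exists>v. v \<in> carrier_vec d \<and> v \<noteq> 0\<^sub>v d \<and> mat d d (\<lambda>(i, j). f i j) *\<^sub>v v = 0\<^sub>v d"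
      using iffD2[OF prod[of "vec d v"]] v
      by (intro exI[of _ "vec d v"] conjI) simp_all
  qed
qed

lemma det_left_kernel:
  fixes f :: "nat \<Rightarrow> nat \<Rightarrow> 'f::field"
  shows "det (mat d d (\<lambda>(i, j). f i j)) = 0 \<longleftrightarrow> (\<exists>u. (\<exists>i<d. u i \<noteq> 0) \<and> (\<forall>j<d. (\<Sum>i<d. u i * f i j) = 0))"
proof -
  have "det (mat d d (\<lambda>(i, j). f i j)) = det (mat d d (\<lambda>(i, j). f j i))"
    by (subst det_transpose[OF mat_carrier, symmetric]) (rule arg_cong[of _ _ det], auto)
  then show ?thesis using det_right_kernel[of d "\<lambda>i j. f j i"] by (simp add: mult.commute)
qed

text \<open>The matrix factors through the index set \<open>T\<close>. If \<open>T\<close> had fewer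
  than d elements, the rows of P would be linearly dependent, and the same dependence would hold for
  the rows of the product.\<close>

lemma det_factor_card:
  fixes P :: "nat \<Rightarrow> 'k \<Rightarrow> 'f::field"
  assumes det: "det (mat d d (\<lambda>(i, j). \<Sum>k\<in>T. P i k * Q k j)) \<noteq> 0" and T: "finite T"
  shows "d \<le> card T"
proof (rule ccontr)
  assume "\<not> d \<le> card T"
  then obtain c where c: "\<exists>i<d. c i \<noteq> 0" "\<forall>k\<in>T. (\<Sum>i<d. c i * P i k) = 0"
    using underdetermined_system[of T "{..<d}" P] T by auto
  have "(\<Sum>i<d. c i * (\<Sum>k\<in>T. P i k * Q k j)) = 0" for j
  proof -
    have "(\<Sum>i<d. c i * (\<Sum>k\<in>T. P i k * Q k j)) = (\<Sum>k\<in>T. (\<Sum>i<d. c i * P i k) * Q k j)"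
      by (simp only: sum_distrib_left sum_distrib_right mult.assoc) (rule sum.swap)
    then show ?thesis using c(2) by simp
  qed
  then show False using det c(1) by (auto simp: det_left_kernel[of d])
qed

text \<open>If the middle index set has exactly d elements, both factors are invertible; in
  particular the rows of Q are independent. This is how a nonzero maximal minor of the Poisson
  matrix gives independence of Hamiltonian derivations.\<close>

lemma det_factor_kernel:
  fixes P :: "nat \<Rightarrow> 'k \<Rightarrow> 'f::field"
  assumes det: "det (mat d d (\<lambda>(i, j). \<Sum>k\<in>T. P i k * Q k j)) \<noteq> 0" and T: "finite T" "card T = d"
    and c: "\<And>j. j < d \<Longrightarrow> (\<Sum>k\<in>T. c k * Q k j) = 0" and k: "k \<in> T"
  shows "c k = 0"
proof (rule ccontr)
  assume k0: "c k \<noteq> 0"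
  \<comment> \<open>A nonzero combination u of the rows of P proportional to c is wanted. After
    scaling by the entry at k, proportionality amounts to only card T - 1 < d linear equations. Then
    u annihilates the product matrix because c annihilates Q.\<close>
  have "card (T - {k}) < card {..<d}" using T k by (metis card_Diff1_less card_lessThan)
  then obtain u where u: "\<exists>i<d. u i \<noteq> 0" "\<forall>l\<in>T - {k}. (\<Sum>i<d. u i * (P i l - P i k / c k * c l)) = 0"
    using underdetermined_system[of "T - {k}" "{..<d}" "\<lambda>i l. P i l - P i k / c k * c l"] T by auto
  define b where "b = (\<Sum>i<d. u i * P i k / c k)"
  have *: "(\<Sum>i<d. u i * P i l) = b * c l" if "l \<in> T" for l
  proof (cases "l = k")
    case True
    then show ?thesis using k0 by (simp add: b_def sum_distrib_right)
  next
    case False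
    then have "(\<Sum>i<d. u i * (P i l - P i k / c k * c l)) = 0" using u that by blast
    then show ?thesis by (simp add: b_def right_diff_distrib sum_subtractf sum_distrib_right sum_distrib_left mult_ac)
  qed
  have "(\<Sum>i<d. u i * (\<Sum>k\<in>T. P i k * Q k j)) = 0" if "j < d" for j
  proof -
    have "(\<Sum>i<d. u i * (\<Sum>k\<in>T. P i k * Q k j)) = (\<Sum>k\<in>T. (\<Sum>i<d. u i * P i k) * Q k j)"
      by (simp only: sum_distrib_left sum_distrib_right mult.assoc) (rule sum.swap)
    also have "\<dots> = b * (\<Sum>k\<in>T. c k * Q k j)"
      unfolding sum_distrib_left by (rule sum.cong) (auto simp: *)
    finally show ?thesis using c that by simp
  qed
  then show False using det u(1) by (auto simp: det_left_kernel[of d])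
qed

lemma minor_emb: "minor (\<lambda>i j. emb (M i j)) is js = emb (minor M is js)"
proof -
  interpret comm_ring_hom "emb :: 'a \<Rightarrow> 'a fract"
    by unfold_locales (simp_all add: emb_simps)
  show ?thesis
    unfolding minor_def hom_det[symmetric] by (rule arg_cong[of _ _ det]) auto
qed

section \<open>Rank as the largest order of a nonzero minor\<close>

context
  fixes M :: "nat \<Rightarrow> nat \<Rightarrow> 'f::field" and m n :: nat
begin

private abbreviation "A \<equiv> mat m n (\<lambda>(i, j). M (Suc i) (Suc j))"

private abbreviation "cmat js \<equiv> mat m (length js) (\<lambda>(i, s). M (Suc i) (js ! s))"

private lemma cols_cmat: "cols (cmat js) = map (\<lambda>j. col A (j - 1)) js" if "set js \<subseteq> {1..n}" for js
proof (rule nth_equalityI)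
  fix s assume "s < length (cols (cmat js))"
  then have s: "s < length js" by simp
  then have "js ! s \<in> {1..n}" using that nth_mem by blast
  then show "cols (cmat js) ! s = map (\<lambda>j. col A (j - 1)) js ! s" using s by (intro eq_vecI) auto
qed simp

private lemma cmat_kernel: "cmat js *\<^sub>v v = 0\<^sub>v m \<longleftrightarrow> (\<forall>i\<in>{1..m}. (\<Sum>s<length js. M i (js ! s) * v $ s) = 0)"
  if "v \<in> carrier_vec (length js)" for v :: "'f vec"
proof -
  have "cmat js *\<^sub>v v = 0\<^sub>v m \<longleftrightarrow> (\<forall>i<m. (\<Sum>s<length js. M (Suc i) (js ! s) * v $ s) = 0)"
    using that by (auto simp: vec_eq_iff scalar_prod_def atLeast0LessThan)
  also have "\<dots> \<longleftrightarrow> (\<forall>i\<in>{1..m}. (\<Sum>s<length js. M i (js ! s) * v $ s) = 0)"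
    unfolding image_Suc_lessThan[symmetric] by auto
  finally show ?thesis .
qed

lemma minor_le_rank:
  assumes minor: "minor M is js \<noteq> 0" and len: "length is = length js"
    and sets: "set is \<subseteq> {1..m}" "set js \<subseteq> {1..n}"
  shows "length js \<le> vec_space.rank m A"
proof -
  interpret vs: vec_space "TYPE('f)" m .
  have ker: "v = 0\<^sub>v (length js)" if v: "v \<in> carrier_vec (length js)" "cmat js *\<^sub>v v = 0\<^sub>v m" for v :: "'f vec"
  proof (rule ccontr)
    assume "v \<noteq> 0\<^sub>v (length js)"
    then have "\<exists>s<length js. v $ s \<noteq> 0" using v(1) by (auto simp: vec_eq_iff)
    moreover have "\<forall>i<length is. (\<Sum>s<length js. M (is ! i) (js ! s) * v $ s) = 0"
      using v(2) sets(1) unfolding cmat_kernel[OF v(1)] by (meson nth_mem subsetD)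
    ultimately have "minor M is js = 0"
      unfolding minor_def len det_right_kernel by (intro exI[of _ "\<lambda>s. v $ s"]) (simp add: len)
    with minor show False ..
  qed
  \<comment> \<open>Independence in the vector space is stated for sets of columns, so repetitions
    must be excluded first: two equal columns would put a difference of unit vectors into the
    kernel.\<close>
  have dist: "distinct (cols (cmat js))"
    unfolding distinct_conv_nth
  proof (intro allI impI notI)
    fix s s' assume s: "s < length (cols (cmat js))" "s' < length (cols (cmat js))" "s \<noteq> s'"
      and eq: "cols (cmat js) ! s = cols (cmat js) ! s'"
    define v :: "'f vec" where "v = unit_vec (length js) s - unit_vec (length js) s'"
    have v: "v \<in> carrier_vec (length js)" by (simp add: v_def)
    have "M i (js ! s) = M i (js ! s')" if "i \<in> {1..m}" for i
    proof -
      have "col (cmat js) s $ (i - 1) = col (cmat js) s' $ (i - 1)" using eq s by simp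
      then show ?thesis using that s by (cases i) auto
    qed
    then have "cmat js *\<^sub>v v = 0\<^sub>v m"
      unfolding cmat_kernel[OF v]
    proof (intro ballI)
      fix i assume i: "i \<in> {1..m}"
      have "(\<Sum>t<length js. M i (js ! t) * v $ t) =
        (\<Sum>t<length js. if t = s then M i (js ! s) else 0) - (\<Sum>t<length js. if t = s' then M i (js ! s') else 0)"
        unfolding sum_subtractf[symmetric] by (rule sum.cong) (use s in \<open>auto simp: v_def unit_vec_def\<close>)
      also have "\<dots> = 0" using s \<open>i \<in> {1..m} \<Longrightarrow> M i (js ! s) = M i (js ! s')\<close> i by simp
      finally show "(\<Sum>t<length js. M i (js ! t) * v $ t) = 0" .
    qed
    then have "v = 0\<^sub>v (length js)" by (rule ker[OF v])
    then have "v $ s = 0" using s by simp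
    then show False using s by (simp add: v_def)
  qed
  have cm: "cmat js \<in> carrier_mat m (length js)" by simp
  have "vs.lin_indpt (set (cols (cmat js)))"
    using vs.lin_depE[OF cm _ dist] ker by metis
  moreover have "set (cols (cmat js)) \<subseteq> set (cols A)"
  proof -
    have "col A (j - 1) \<in> set (cols A)" if "j \<in> set js" for j
    proof -
      have "j \<in> {1..n}" using that sets(2) by blast
      then show ?thesis unfolding cols_def set_map by (intro imageI) auto
    qed
    then show ?thesis unfolding cols_cmat[OF sets(2)] by auto
  qed
  ultimately have "card (set (cols (cmat js))) \<le> vs.rank A"
    by (intro vs.rank_ge_card_indpt) auto
  then show ?thesis using distinct_card[OF dist] by simp
qed

text \<open>Take a maximal independent set of r columns and then a set R of rows, of least size, on
  which these columns still have trivial kernel. R has at least r elements, as otherwise the system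
  is underdetermined. It has at most r: by minimality each row i of R has a vector that is not
  killed by i but by all other rows of R, and these vectors are independent in dimension r.\<close>

lemma ex_minor_rank:
  "\<exists>is\<in>incr_tuples (vec_space.rank m A) m. \<exists>js\<in>incr_tuples (vec_space.rank m A) n. minor M is js \<noteq> 0"
proof -
  interpret vs: vec_space "TYPE('f)" m .
  define r where "r = vs.rank A"
  obtain S where S: "maximal S (\<lambda>T. T \<subseteq> set (cols A) \<and> vs.lin_indpt T)"
    using maximal_exists_superset[of "set (cols A)" "\<lambda>T. T \<subseteq> set (cols A) \<and> vs.lin_indpt T" "{}"]
    using vs.finite_lin_indpt2[of "{}"] by auto
  have r: "r = card S" unfolding r_def by (rule vs.rank_card_indpt[OF mat_carrier S])
  have S': "S \<subseteq> set (cols A)" "vs.lin_indpt S" using S by (auto simp: maximal_def)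
  have "S \<subseteq> (\<lambda>j. col A (j - 1)) ` {1..n}"
  proof
    fix x assume "x \<in> S"
    then have "x \<in> set (cols A)" using S'(1) by blast
    then obtain j where "j < n" "x = col A j" by (auto simp: cols_def)
    then show "x \<in> (\<lambda>j. col A (j - 1)) ` {1..n}" by (intro image_eqI[of _ _ "Suc j"]) auto
  qed
  then obtain U where U: "U \<subseteq> {1..n}" "inj_on (\<lambda>j. col A (j - 1)) U" "S = (\<lambda>j. col A (j - 1)) ` U"
    using subset_image_inj[of S "\<lambda>j. col A (j - 1)"] by auto
  define js where "js = sorted_list_of_set U"
  have fU: "finite U" using U(1) finite_subset by blast
  have js: "set js = U" "distinct js" "length js = r"
    using fU U by (simp_all add: js_def r card_image)
  have cols: "cols (cmat js) = map (\<lambda>j. col A (j - 1)) js" by (rule cols_cmat) (use js U in auto)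
  have dist: "distinct (cols (cmat js))" unfolding cols using js U by (simp add: distinct_map)
  have ker: "\<forall>s<r. v s = 0" if v: "\<forall>i\<in>{1..m}. (\<Sum>s<r. M i (js ! s) * v s) = 0" for v
  proof (rule ccontr)
    assume "\<not> (\<forall>s<r. v s = 0)"
    then have "vec r v \<noteq> 0\<^sub>v r" by (auto simp: vec_eq_iff)
    moreover have "cmat js *\<^sub>v vec r v = 0\<^sub>v m"
      using v cmat_kernel[of "vec r v" js] js by simp
    ultimately have "vs.lin_dep (set (cols (cmat js)))"
      using js dist by (intro vs.lin_depI[of _ r "vec r v"]) auto
    moreover have "set (cols (cmat js)) = S" unfolding cols using js U by simp
    ultimately show False using S'(2) by simp
  qed
  define Q where "Q R \<longleftrightarrow> R \<subseteq> {1..m} \<and> (\<forall>v. (\<forall>i\<in>R. (\<Sum>s<r. M i (js ! s) * v s) = 0) \<longrightarrow> (\<forall>s<r. v s = 0))" for R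
  have "Q {1..m}" unfolding Q_def using ker by blast
  then obtain R where R: "Q R" "\<And>R'. Q R' \<Longrightarrow> card R \<le> card R'"
    using ex_has_least_nat[of Q "{1..m}" card] by blast
  have fR: "finite R" using R(1) finite_subset unfolding Q_def by blast
  have "r \<le> card R"
  proof (rule ccontr)
    assume "\<not> r \<le> card R"
    then obtain v where "\<exists>s<r. v s \<noteq> 0" "\<forall>i\<in>R. (\<Sum>s<r. v s * M i (js ! s)) = 0"
      using underdetermined_system[OF fR, of "{..<r}" "\<lambda>s i. M i (js ! s)"] by auto
    then show False using R(1) by (auto simp: Q_def mult.commute)
  qed
  moreover have "card R \<le> r"
  proof (rule ccontr)
    assume "\<not> card R \<le> r"
    have "\<exists>v. (\<forall>i'\<in>R - {i}. (\<Sum>s<r. M i' (js ! s) * v s) = 0) \<and> (\<Sum>s<r. M i (js ! s) * v s) \<noteq> 0" if "i \<in> R" for i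
    proof -
      have "card (R - {i}) < card R" using that fR by (rule card_Diff1_less[rotated])
      then have "\<not> Q (R - {i})" using R(2) leD by blast
      then obtain v where v: "\<forall>i'\<in>R - {i}. (\<Sum>s<r. M i' (js ! s) * v s) = 0" "\<not> (\<forall>s<r. v s = 0)"
        using R(1) unfolding Q_def by blast
      moreover have "(\<Sum>s<r. M i (js ! s) * v s) \<noteq> 0"
      proof
        assume "(\<Sum>s<r. M i (js ! s) * v s) = 0"
        then have "\<forall>i'\<in>R. (\<Sum>s<r. M i' (js ! s) * v s) = 0" using v(1) by auto
        then show False using v(2) R(1) unfolding Q_def by blast
      qed
      ultimately show ?thesis by blast
    qed
    then obtain v where v: "\<And>i i'. i \<in> R \<Longrightarrow> i' \<in> R - {i} \<Longrightarrow> (\<Sum>s<r. M i' (js ! s) * v i s) = 0"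
      "\<And>i. i \<in> R \<Longrightarrow> (\<Sum>s<r. M i (js ! s) * v i s) \<noteq> 0" by metis
    obtain c where c: "\<exists>i\<in>R. c i \<noteq> 0" "\<forall>s\<in>{..<r}. (\<Sum>i\<in>R. c i * v i s) = 0"
      using underdetermined_system[of "{..<r}" R v] fR \<open>\<not> card R \<le> r\<close> by auto
    then obtain i0 where i0: "i0 \<in> R" "c i0 \<noteq> 0" by blast
    have "(\<Sum>i\<in>R. c i * (\<Sum>s<r. M i0 (js ! s) * v i s)) = (\<Sum>s<r. M i0 (js ! s) * (\<Sum>i\<in>R. c i * v i s))"
      by (simp only: sum_distrib_left mult.left_commute) (rule sum.swap)
    also have "\<dots> = 0" using c(2) by simp
    finally have "(\<Sum>i\<in>R. c i * (\<Sum>s<r. M i0 (js ! s) * v i s)) = 0" .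
    moreover have "(\<Sum>i\<in>R. c i * (\<Sum>s<r. M i0 (js ! s) * v i s)) = (\<Sum>i\<in>R. if i = i0 then c i * (\<Sum>s<r. M i0 (js ! s) * v i s) else 0)"
      by (rule sum.cong) (use v(1) i0 in auto)
    ultimately show False using fR i0 v(2)[OF i0(1)] by simp
  qed
  ultimately have cR: "card R = r" by simp
  define "is" where "is = sorted_list_of_set R"
  have is': "set is = R" "length is = r" using fR cR by (simp_all add: is_def)
  have "minor M is js \<noteq> 0"
  proof
    assume "minor M is js = 0"
    then obtain v where v: "\<exists>s<r. v s \<noteq> 0" "\<forall>i<r. (\<Sum>s<r. M (is ! i) (js ! s) * v s) = 0"
      unfolding minor_def is'(2) js(3) det_right_kernel by blast
    have "\<forall>i\<in>R. (\<Sum>s<r. M i (js ! s) * v s) = 0"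
      using v(2) is' by (metis in_set_conv_nth)
    then show False using v(1) R(1) unfolding Q_def by blast
  qed
  moreover have "is \<in> incr_tuples r m" "js \<in> incr_tuples r n"
    using is' js fR fU R(1) U(1) by (auto simp: incr_tuples_def Q_def is_def js_def)
  ultimately show ?thesis unfolding r_def[symmetric] by blast
qed

end

lemma minor_zero_above_rank:
  assumes "length is = length js" "frac_rank m n M < length js" "set is \<subseteq> {1..m}" "set js \<subseteq> {1..n}"
  shows "minor M is js = 0"
  using minor_le_rank[of "\<lambda>i j. emb (M i j)" "is" js m n] assms
  by (auto simp: frac_rank_def minor_emb emb_simps)

lemma ex_minor_frac_rank:
  "\<exists>is\<in>incr_tuples (frac_rank m n M) m. \<exists>js\<in>incr_tuples (frac_rank m n M) n. minor M is js \<noteq> 0"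
  using ex_minor_rank[of m n "\<lambda>i j. emb (M i j)"] by (simp add: frac_rank_def minor_emb emb_simps)

section \<open>Adjoining elements and extending derivations\<close>

definition subalg :: "'a::comm_ring_1 set \<Rightarrow> bool" where
  "subalg E \<longleftrightarrow> 0 \<in> E \<and> 1 \<in> E \<and> (\<forall>a\<in>E. - a \<in> E) \<and> (\<forall>a\<in>E. \<forall>b\<in>E. a + b \<in> E \<and> a * b \<in> E)"

definition pol :: "'a::comm_ring_1 set \<Rightarrow> 'a poly set" where
  "pol E = {P. \<forall>i. coeff P i \<in> E}"

definition adjoin :: "'a::comm_ring_1 set \<Rightarrow> 'a \<Rightarrow> 'a set" where
  "adjoin E y = (\<lambda>P. poly P y) ` pol E"

text \<open>For I = {0} this is transcendence over E; for a prime I it is transcendence of the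
  residue class over the residues of E. Constant polynomials are included, so no nonzero element of
  E may lie in I.\<close>

definition transc :: "'a::comm_ring_1 \<Rightarrow> 'a set \<Rightarrow> 'a set \<Rightarrow> bool" where
  "transc y E I \<longleftrightarrow> (\<forall>Q\<in>pol E. poly Q y \<in> I \<longrightarrow> Q = 0)"

lemma subalg_0: "subalg E \<Longrightarrow> 0 \<in> E"
  and subalg_1: "subalg E \<Longrightarrow> 1 \<in> E"
  and subalg_uminus: "subalg E \<Longrightarrow> a \<in> E \<Longrightarrow> - a \<in> E"
  and subalg_add: "subalg E \<Longrightarrow> a \<in> E \<Longrightarrow> b \<in> E \<Longrightarrow> a + b \<in> E"
  and subalg_mult: "subalg E \<Longrightarrow> a \<in> E \<Longrightarrow> b \<in> E \<Longrightarrow> a * b \<in> E"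
  by (simp_all add: subalg_def)

lemma subalg_sum: "subalg E \<Longrightarrow> (\<And>i. i \<in> S \<Longrightarrow> f i \<in> E) \<Longrightarrow> sum f S \<in> E"
  by (induction S rule: infinite_finite_induct) (auto simp: subalg_0 subalg_add)

lemma subalg_of_nat: "subalg E \<Longrightarrow> of_nat k \<in> E"
  by (induction k) (auto simp: subalg_0 subalg_1 subalg_add)

lemma pol_pCons: "0 \<in> E \<Longrightarrow> pCons a P \<in> pol E \<longleftrightarrow> a \<in> E \<and> P \<in> pol E"
  by (auto simp: pol_def coeff_pCons split: nat.splits)

lemma pol_0: "0 \<in> E \<Longrightarrow> 0 \<in> pol E"
  by (simp add: pol_def)

lemma pol_add: "subalg E \<Longrightarrow> P \<in> pol E \<Longrightarrow> Q \<in> pol E \<Longrightarrow> P + Q \<in> pol E"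
  by (simp add: pol_def subalg_add)

lemma pol_uminus: "subalg E \<Longrightarrow> P \<in> pol E \<Longrightarrow> - P \<in> pol E"
  by (simp add: pol_def subalg_uminus)

lemma pol_diff: "subalg E \<Longrightarrow> P \<in> pol E \<Longrightarrow> Q \<in> pol E \<Longrightarrow> P - Q \<in> pol E"
  using pol_add[of E P "- Q"] pol_uminus[of E Q] by simp

lemma pol_mult: "subalg E \<Longrightarrow> P \<in> pol E \<Longrightarrow> Q \<in> pol E \<Longrightarrow> P * Q \<in> pol E"
  by (simp add: pol_def coeff_mult subalg_sum subalg_mult)

lemma pol_smult: "subalg E \<Longrightarrow> a \<in> E \<Longrightarrow> Q \<in> pol E \<Longrightarrow> Polynomial.smult a Q \<in> pol E"
  by (simp add: pol_def subalg_mult)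

lemma pol_monom: "subalg E \<Longrightarrow> a \<in> E \<Longrightarrow> monom a k \<in> pol E"
  by (simp add: pol_def subalg_0)

lemma pol_pderiv: "subalg E \<Longrightarrow> P \<in> pol (E :: 'a::idom set) \<Longrightarrow> pderiv P \<in> pol E"
  by (simp add: pol_def coeff_pderiv subalg_mult subalg_add subalg_1 subalg_of_nat del: of_nat_Suc)

lemma pol_mono: "E \<subseteq> E' \<Longrightarrow> pol E \<subseteq> pol E'"
  by (auto simp: pol_def)

lemma subset_adjoin: "subalg E \<Longrightarrow> E \<subseteq> adjoin E y"
  unfolding adjoin_def by (rule subsetI, rule image_eqI[of _ _ "[:_:]"]) (auto simp: pol_pCons subalg_0 pol_0)

lemma self_in_adjoin: "subalg E \<Longrightarrow> y \<in> adjoin E y"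
  unfolding adjoin_def by (rule image_eqI[of _ _ "[:0, 1:]"]) (auto simp: pol_pCons subalg_0 subalg_1 pol_0)

lemma subalg_adjoin:
  assumes "subalg E"
  shows "subalg (adjoin E y)"
proof -
  have "0 \<in> adjoin E y" "1 \<in> adjoin E y"
    using subset_adjoin[OF assms] assms subalg_0 subalg_1 by blast+
  moreover have "- a \<in> adjoin E y" if a: "a \<in> adjoin E y" for a
  proof -
    obtain P where "P \<in> pol E" "a = poly P y" using a by (auto simp: adjoin_def)
    then show ?thesis unfolding adjoin_def using pol_uminus[OF assms] by (intro image_eqI[of _ _ "- P"]) auto
  qed
  moreover have "a + b \<in> adjoin E y \<and> a * b \<in> adjoin E y" if ab: "a \<in> adjoin E y" "b \<in> adjoin E y" for a b
  proof -
    obtain P Q where "P \<in> pol E" "a = poly P y" "Q \<in> pol E" "b = poly Q y" using ab by (auto simp: adjoin_def)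
    then show ?thesis unfolding adjoin_def using pol_add[OF assms] pol_mult[OF assms]
      by (intro conjI image_eqI[of _ _ "P + Q"] image_eqI[of _ _ "P * Q"]) auto
  qed
  ultimately show ?thesis by (simp add: subalg_def)
qed

section \<open>Extending a derivation by one element\<close>

definition der_on :: "'a::idom set \<Rightarrow> ('a \<Rightarrow> 'a fract) \<Rightarrow> bool" where
  "der_on E D \<longleftrightarrow> (\<forall>a\<in>E. \<forall>b\<in>E. D (a + b) = D a + D b \<and> D (a * b) = D a * emb b + emb a * D b)"

context
  fixes E :: "'a::idom set" and D :: "'a \<Rightarrow> 'a fract" and y :: 'a
  assumes E: "subalg E" and D: "der_on E D"
begin

private lemma D_0: "D 0 = 0"
proof -
  have "D (0 + 0) = D 0 + D 0" using D subalg_0[OF E] unfolding der_on_def by blast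
  then show ?thesis by (metis add.right_neutral add_left_cancel)
qed

text \<open>The value at P(y) of the extension that takes y to \<eta>: apply D to the coefficients
  and add \<eta> times P'(y).\<close>

private definition ext :: "'a fract \<Rightarrow> 'a poly \<Rightarrow> 'a fract" where
  "ext \<eta> P = poly (map_poly D P) (emb y) + \<eta> * emb (poly (pderiv P) y)"

private lemma ext_0: "ext \<eta> 0 = 0"
  by (simp add: ext_def emb_simps)

private lemma ext_pCons: "ext \<eta> (pCons a P) = D a + emb y * ext \<eta> P + \<eta> * emb (poly P y)"
  by (simp add: ext_def map_poly_pCons D_0 pderiv_pCons emb_simps algebra_simps)

private lemma ext_add:
  assumes "P \<in> pol E" "Q \<in> pol E"
  shows "ext \<eta> (P + Q) = ext \<eta> P + ext \<eta> Q"
  using assms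
proof (induction P Q rule: poly_induct2)
  case (pCons a p b q)
  then have "D (a + b) = D a + D b"
    using D by (auto simp: der_on_def pol_pCons subalg_0[OF E])
  with pCons show ?case
    by (simp add: ext_pCons pol_pCons subalg_0[OF E] emb_simps algebra_simps)
qed (simp add: ext_0)

private lemma ext_smult:
  assumes "a \<in> E" "Q \<in> pol E"
  shows "ext \<eta> (Polynomial.smult a Q) = emb a * ext \<eta> Q + D a * emb (poly Q y)"
  using assms(2)
proof (induction Q)
  case (pCons b q)
  then have "D (a * b) = D a * emb b + emb a * D b"
    using D assms(1) by (auto simp: der_on_def pol_pCons subalg_0[OF E])
  with pCons show ?case
    by (simp add: ext_pCons pol_pCons subalg_0[OF E] emb_simps algebra_simps)
qed (simp add: ext_0 emb_simps)

private lemma ext_mult: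
  assumes "P \<in> pol E" "Q \<in> pol E"
  shows "ext \<eta> (P * Q) = ext \<eta> P * emb (poly Q y) + emb (poly P y) * ext \<eta> Q"
  using assms
proof (induction P)
  case (pCons a p)
  then have a: "a \<in> E" "p \<in> pol E" by (simp_all add: pol_pCons subalg_0[OF E])
  have "ext \<eta> (pCons a p * Q) = ext \<eta> (Polynomial.smult a Q) + ext \<eta> (pCons 0 (p * Q))"
    unfolding mult_pCons_left
    by (intro ext_add pol_smult E a pCons.prems) (simp add: pol_pCons subalg_0[OF E] pol_mult E a pCons.prems)
  also have "\<dots> = emb a * ext \<eta> Q + D a * emb (poly Q y) + (emb y * ext \<eta> (p * Q) + \<eta> * emb (poly (p * Q) y))"
    by (simp add: ext_smult a pCons.prems ext_pCons[of _ 0] D_0)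
  also have "\<dots> = ext \<eta> (pCons a p) * emb (poly Q y) + emb (poly (pCons a p) y) * ext \<eta> Q"
    using pCons.IH a pCons.prems by (simp add: ext_pCons[of _ a] emb_simps algebra_simps)
  finally show ?case .
qed (simp add: ext_0 emb_simps)

text \<open>If \<open>y\<close> is algebraic, the value of the extension at \<open>y\<close> is forced by a relation of minimal
  degree, and pseudo-division by it shows consistency with all other relations.\<close>

private lemma ext_consistent:
  assumes char0: "\<And>k. of_nat (Suc k) \<noteq> (0::'a)"
  shows "\<exists>\<eta>. (\<forall>P\<in>pol E. poly P y = 0 \<longrightarrow> ext \<eta> P = 0) \<and> (transc y E {0} \<longrightarrow> \<eta> = \<eta>0)"
proof (cases "transc y E {0}")
  case True
  then show ?thesis by (auto simp: transc_def ext_0 intro!: exI[of _ \<eta>0])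
next
  case False
  then obtain P0' where "P0' \<in> pol E \<and> poly P0' y = 0 \<and> P0' \<noteq> 0" by (auto simp: transc_def)
  from ex_has_least_nat[of "\<lambda>P. P \<in> pol E \<and> poly P y = 0 \<and> P \<noteq> 0", OF this, of degree]
  obtain P0 where P0: "P0 \<in> pol E" "poly P0 y = 0" "P0 \<noteq> 0"
    and min: "\<And>P. P \<in> pol E \<Longrightarrow> poly P y = 0 \<Longrightarrow> P \<noteq> 0 \<Longrightarrow> degree P0 \<le> degree P"
    by blast
  have deg: "degree P0 > 0"
  proof (rule ccontr)
    assume "\<not> degree P0 > 0"
    then obtain a where "P0 = [:a:]" by (metis degree_eq_zeroE not_gr_zero)
    then show False using P0 by simp
  qed
  then obtain k where k: "degree P0 = Suc k" using not0_implies_Suc by auto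
  have "coeff P0 (Suc k) \<noteq> 0" using P0(3) k by (metis leading_coeff_0_iff)
  then have "coeff (pderiv P0) k \<noteq> 0"
    using char0[of k] by (simp add: coeff_pderiv del: of_nat_Suc)
  moreover have "degree (pderiv P0) \<le> k"
    by (rule degree_le) (simp add: coeff_pderiv coeff_eq_0 k)
  \<comment> \<open>In characteristic zero the derivative of P0 is nonzero and of smaller degree, so
    by minimality it is not a relation. Hence \<eta> can be solved for.\<close>
  ultimately have pd: "poly (pderiv P0) y \<noteq> 0"
    using min[OF pol_pderiv[OF E P0(1)]] k by fastforce
  define \<eta> where "\<eta> = - poly (map_poly D P0) (emb y) / emb (poly (pderiv P0) y)"
  have e0: "ext \<eta> P0 = 0" using pd by (simp add: ext_def \<eta>_def emb_simps)
  have "ext \<eta> P = 0" if "P \<in> pol E" "poly P y = 0" for P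
    using that
  proof (induction "degree P" arbitrary: P rule: less_induct)
    case less
    show ?case
    proof (cases "P = 0")
      case False
      define a where "a = lead_coeff P0"
      define M where "M = monom (lead_coeff P) (degree P - degree P0)"
      define R where "R = Polynomial.smult a P - M * P0"
      have a: "a \<in> E" "a \<noteq> 0" using P0 by (auto simp: a_def pol_def)
      have M: "M \<in> pol E" unfolding M_def by (rule pol_monom[OF E]) (use less.prems in \<open>simp add: pol_def\<close>)
      have R: "R \<in> pol E" "poly R y = 0"
        using less.prems P0 by (auto simp: R_def intro!: pol_diff pol_smult pol_mult E a M)
      have le: "degree P0 \<le> degree P" using min less.prems False by blast
      have "degree R \<le> degree P"
        unfolding R_def M_def
        by (intro degree_diff_le degree_smult_le order.trans[OF degree_mult_le]
            order.trans[OF add_right_mono[OF degree_monom_le]]) (use le in auto)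
      moreover have "coeff R (degree P) = 0"
      proof -
        have "coeff (M * P0) (degree P) = lead_coeff P * a"
          using le coeff_monom_mult[of "lead_coeff P" "degree P - degree P0" P0 "degree P"] by (simp add: M_def a_def)
        then show ?thesis by (simp add: R_def)
      qed
      ultimately have "R = 0 \<or> degree R < degree P" by (rule eq_zero_or_degree_less)
      then have "ext \<eta> R = 0" using less.hyps R ext_0 by blast
      have "ext \<eta> (Polynomial.smult a P) = ext \<eta> (R + M * P0)" by (simp add: R_def)
      also have "\<dots> = 0"
        using R M P0 e0 \<open>ext \<eta> R = 0\<close> by (simp add: ext_add ext_mult pol_mult E emb_simps)
      finally show ?thesis using a less.prems by (simp add: ext_smult emb_simps)
    qed (simp add: ext_0)
  qed
  then show ?thesis using False by blast
qed

text \<open>A polynomial in y is chosen for each element of the extension; by consistency the choice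
  does not matter. The value \<eta>0 at y can be prescribed exactly when y is
  transcendental.\<close>

lemma derivation_extension:
  assumes char0: "\<And>k. of_nat (Suc k) \<noteq> (0::'a)"
  obtains D' where "der_on (adjoin E y) D'" "\<And>a. a \<in> E \<Longrightarrow> D' a = D a"
    "transc y E {0} \<Longrightarrow> D' y = \<eta>0"
proof -
  obtain \<eta> where \<eta>: "\<And>P. P \<in> pol E \<Longrightarrow> poly P y = 0 \<Longrightarrow> ext \<eta> P = 0" "transc y E {0} \<Longrightarrow> \<eta> = \<eta>0"
    using ext_consistent[OF char0] by blast
  define D' where "D' a = ext \<eta> (SOME P. P \<in> pol E \<and> poly P y = a)" for a
  have D': "D' (poly P y) = ext \<eta> P" if P: "P \<in> pol E" for P
  proof -
    define Q where "Q = (SOME Q. Q \<in> pol E \<and> poly Q y = poly P y)"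
    have Q: "Q \<in> pol E" "poly Q y = poly P y"
      using someI[of "\<lambda>Q. Q \<in> pol E \<and> poly Q y = poly P y" P] P by (auto simp: Q_def)
    have "ext \<eta> (Q - P) = 0" by (rule \<eta>(1)) (use P Q in \<open>auto intro: pol_diff E\<close>)
    then have "ext \<eta> Q = ext \<eta> P"
      using ext_add[of "Q - P" P \<eta>] P Q by (simp add: pol_diff E)
    then show ?thesis by (simp add: D'_def Q_def)
  qed
  show ?thesis
  proof (rule that[of D'])
    show "der_on (adjoin E y) D'"
      unfolding der_on_def adjoin_def
      by (auto simp: D' ext_add ext_mult pol_add pol_mult E simp flip: poly_add poly_mult)
    show "D' a = D a" if "a \<in> E" for a
      using D'[of "[:a:]"] that by (simp add: pol_pCons subalg_0[OF E] pol_0 ext_pCons ext_0 emb_simps)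
    show "D' y = \<eta>0" if "transc y E {0}"
    proof -
      have "D 1 = 0"
      proof -
        have "D (1 * 1) = D 1 * emb 1 + emb 1 * D 1" using D subalg_1[OF E] unfolding der_on_def by blast
        then show ?thesis by (simp only: emb_simps mult_1 mult_1_right) (metis add.right_neutral add_left_cancel)
      qed
      then have "D' (poly [:0, 1:] y) = \<eta>"
        by (subst D') (simp_all add: pol_pCons subalg_0[OF E] subalg_1[OF E] pol_0 ext_pCons ext_0 emb_simps D_0)
      then show ?thesis using \<eta>(2)[OF that] by simp
    qed
  qed
qed

end

section \<open>Algebraically independent lists\<close>

fun adjoins :: "'a::comm_ring_1 set \<Rightarrow> 'a list \<Rightarrow> 'a set" where
  "adjoins E [] = E" | "adjoins E (y # ys) = adjoins (adjoin E y) ys"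

text \<open>Algebraic independence of the list over E modulo I, stated one element at a time: this
  is the form in which derivations are extended and chains of primes supply elements.\<close>

fun tower :: "'a::comm_ring_1 set \<Rightarrow> 'a list \<Rightarrow> 'a set \<Rightarrow> bool" where
  "tower E [] I \<longleftrightarrow> True" | "tower E (y # ys) I \<longleftrightarrow> transc y E I \<and> tower (adjoin E y) ys I"

lemma subalg_adjoins: "subalg E \<Longrightarrow> subalg (adjoins E ys)"
  by (induction ys arbitrary: E) (auto simp: subalg_adjoin)

lemma subset_adjoins: "subalg E \<Longrightarrow> E \<subseteq> adjoins E ys"
  by (induction ys arbitrary: E) (simp, metis adjoins.simps(2) order.trans subalg_adjoin subset_adjoin)

lemma set_subset_adjoins: "subalg E \<Longrightarrow> set ys \<subseteq> adjoins E ys"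
proof (induction ys arbitrary: E)
  case (Cons y ys)
  then show ?case
    using Cons.IH[OF subalg_adjoin[OF Cons.prems], of y] self_in_adjoin[OF Cons.prems, of y]
      subset_adjoins[OF subalg_adjoin[OF Cons.prems], of y ys] by auto
qed simp

lemma tower_append: "tower E (xs @ ys) I \<longleftrightarrow> tower E xs I \<and> tower (adjoins E xs) ys I"
  by (induction xs arbitrary: E) auto

lemma tower_mono: "I \<subseteq> I' \<Longrightarrow> tower E ys I' \<Longrightarrow> tower E ys I"
  by (induction ys arbitrary: E) (auto simp: transc_def)

text \<open>The extension exists along every list, while the prescribed values are reached only on
  an independent one. Both uses occur: first to get dual derivations, then to reach the generators
  of the algebra.\<close>

lemma tower_derivation:
  fixes E :: "'a::idom set"
  assumes char0: "\<And>k. of_nat (Suc k) \<noteq> (0::'a)" and "subalg E" "der_on E D"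
  obtains D' where "der_on (adjoins E ys) D'" "\<And>a. a \<in> E \<Longrightarrow> D' a = D a"
    "\<And>k. tower E ys {0} \<Longrightarrow> k < length ys \<Longrightarrow> D' (ys ! k) = \<eta> k"
proof -
  have "\<exists>D'. der_on (adjoins E ys) D' \<and> (\<forall>a\<in>E. D' a = D a) \<and>
      (tower E ys {0} \<longrightarrow> (\<forall>k<length ys. D' (ys ! k) = \<eta> k))"
    using assms(2,3)
  proof (induction ys arbitrary: E D \<eta>)
    case (Cons y ys)
    obtain D1 where D1: "der_on (adjoin E y) D1" "\<And>a. a \<in> E \<Longrightarrow> D1 a = D a"
      "transc y E {0} \<Longrightarrow> D1 y = \<eta> 0"
      using derivation_extension[OF Cons.prems char0, of y "\<eta> 0"] by metis
    obtain D2 where D2: "der_on (adjoins (adjoin E y) ys) D2" "\<And>a. a \<in> adjoin E y \<Longrightarrow> D2 a = D1 a"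
      "tower (adjoin E y) ys {0} \<Longrightarrow> (\<forall>k<length ys. D2 (ys ! k) = \<eta> (Suc k))"
      using Cons.IH[OF subalg_adjoin[OF Cons.prems(1)] D1(1), of "\<lambda>k. \<eta> (Suc k)"] by blast
    have "D2 ((y # ys) ! k) = \<eta> k" if "tower E (y # ys) {0}" "k < length (y # ys)" for k
      using that D2(2)[OF self_in_adjoin[OF Cons.prems(1)]] D2(3) D1(3) by (cases k) auto
    moreover have "D2 a = D a" if "a \<in> E" for a
      using that D2(2) D1(2) subset_adjoin[OF Cons.prems(1)] by (metis subsetD)
    ultimately show ?case using D2(1) by (intro exI[of _ D2]) auto
  qed auto
  then obtain D' where "der_on (adjoins E ys) D'" "\<forall>a\<in>E. D' a = D a"
    "tower E ys {0} \<longrightarrow> (\<forall>k<length ys. D' (ys ! k) = \<eta> k)" by blast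
  then show ?thesis by (intro that[of D']) simp_all
qed

text \<open>Prime ideals enter only through the following closure properties.\<close>

definition primeish :: "'a::comm_ring_1 set \<Rightarrow> bool" where
  "primeish P \<longleftrightarrow> 0 \<in> P \<and> 1 \<notin> P \<and> (\<forall>a\<in>P. \<forall>b\<in>P. a + b \<in> P) \<and> (\<forall>a\<in>P. \<forall>b. b * a \<in> P) \<and>
     (\<forall>a b. a * b \<in> P \<longrightarrow> a \<in> P \<or> b \<in> P)"

lemma adjoin_disjoint:
  assumes "transc y E I" "0 \<in> E" "0 \<in> I"
  shows "adjoin E y \<inter> I = {0}"
proof -
  have "0 \<in> adjoin E y" unfolding adjoin_def by (rule image_eqI[of _ _ 0]) (use assms pol_0 in auto)
  then show ?thesis using assms by (auto simp: adjoin_def transc_def)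
qed

lemma adjoins_disjoint:
  "tower E ys I \<Longrightarrow> subalg E \<Longrightarrow> 0 \<in> I \<Longrightarrow> E \<inter> I = {0} \<Longrightarrow> adjoins E ys \<inter> I = {0}"
proof (induction ys arbitrary: E)
  case (Cons y ys)
  show ?case
    using Cons.IH[OF _ subalg_adjoin[OF Cons.prems(2)] Cons.prems(3) adjoin_disjoint[of y E I]] Cons.prems
    by (simp add: subalg_0)
qed simp

text \<open>Suppose Q(g) lies in P. Modulo P' only the constant coefficient remains, and it is zero
  because E meets P' trivially. So Q = X q and g q(g) is in P; as g is outside of P, q(g) is in P
  and the argument repeats.\<close>

lemma transc_chain_element:
  assumes "primeish P" "primeish P'" "P \<subseteq> P'" "g \<in> P'" "g \<notin> P" "0 \<in> E" "E \<inter> P' = {0}"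
  shows "transc g E P"
proof -
  have "Q = 0" if "Q \<in> pol E" "poly Q g \<in> P" for Q
    using that
  proof (induction Q)
    case (pCons a q)
    then have a: "a \<in> E" "q \<in> pol E" using assms(6) by (simp_all add: pol_pCons)
    have s: "a + g * poly q g \<in> P'" using pCons.prems assms(3) by auto
    have g: "(- poly q g) * g \<in> P'" using assms(2,4) unfolding primeish_def by blast
    have "(a + g * poly q g) + (- poly q g) * g \<in> P'"
      using s g assms(2) unfolding primeish_def by blast
    then have "a = 0" using a assms(7) by (auto simp: algebra_simps)
    then have "g * poly q g \<in> P" using pCons.prems by simp
    then have "poly q g \<in> P" using assms(1,5) unfolding primeish_def by blast
    then show ?case using pCons.IH a \<open>a = 0\<close> by simp
  qed auto
  then show ?thesis by (auto simp: transc_def)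
qed

text \<open>Elements are picked from the top of the chain downwards: an element of
  \<open>P (Suc h)\<close> outside of \<open>P h\<close> is transcendental modulo
  \<open>P h\<close>, and so the enlarged algebra meets \<open>P h\<close> trivially, as the next
  step requires.\<close>

lemma chain_tower:
  assumes "\<And>i. i \<le> h \<Longrightarrow> primeish (P i)" "\<And>i. i < h \<Longrightarrow> P i \<subset> P (Suc i)" "subalg E" "E \<inter> P h = {0}"
  shows "\<exists>gs. length gs = h \<and> tower E gs (P 0)"
  using assms
proof (induction h arbitrary: E)
  case (Suc h)
  obtain g where g: "g \<in> P (Suc h)" "g \<notin> P h" using Suc.prems(2)[of h] by blast
  have t: "transc g E (P h)"
    by (rule transc_chain_element[of _ "P (Suc h)"]) (use Suc.prems g in \<open>auto simp: subalg_0\<close>)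
  have 0: "0 \<in> P h" using Suc.prems(1)[of h] by (simp add: primeish_def)
  have "\<exists>gs. length gs = h \<and> tower (adjoin E g) gs (P 0)"
    by (rule Suc.IH) (use Suc.prems adjoin_disjoint[OF t _ 0] in \<open>auto simp: subalg_adjoin subalg_0\<close>)
  then obtain gs where gs: "length gs = h" "tower (adjoin E g) gs (P 0)" by blast
  note step = Suc.prems(2)
  have "P 0 \<subseteq> P i" if "i \<le> h" for i
    using that
  proof (induction i)
    case (Suc j)
    then have "P j \<subset> P (Suc j)" by (intro step) simp
    with Suc show ?case by auto
  qed simp
  then have "P 0 \<subseteq> P h" by simp
  then have "transc g E (P 0)" using t by (auto simp: transc_def)
  then show ?case using gs by (intro exI[of _ "g # gs"]) simp
qed (auto intro: exI[of _ "[]"])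

text \<open>Greedy choice along the list. An element rejected at its turn stays algebraic over every
  larger subalgebra, and an accepted x is a root of X - x afterwards.\<close>

lemma maximal_tower:
  assumes "subalg E" "0 \<in> I"
  shows "\<exists>ys. set ys \<subseteq> set xs \<and> tower E ys I \<and> (\<forall>x\<in>set xs. \<not> transc x (adjoins E ys) I)"
  using assms(1)
proof (induction xs arbitrary: E)
  case (Cons x xs)
  show ?case
  proof (cases "transc x E I")
    case True
    obtain ys where ys: "set ys \<subseteq> set xs" "tower (adjoin E x) ys I" "\<forall>x'\<in>set xs. \<not> transc x' (adjoins (adjoin E x) ys) I"
      using Cons.IH[OF subalg_adjoin[OF Cons.prems]] by blast
    have sub: "subalg (adjoins (adjoin E x) ys)" by (intro subalg_adjoins subalg_adjoin Cons.prems)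
    have "x \<in> adjoins (adjoin E x) ys"
      using subset_adjoins[OF subalg_adjoin[OF Cons.prems]] self_in_adjoin[OF Cons.prems] by blast
    then have "[:- x, 1:] \<in> pol (adjoins (adjoin E x) ys)"
      using sub by (simp add: pol_pCons subalg_0 subalg_1 subalg_uminus pol_0)
    then have "\<not> transc x (adjoins (adjoin E x) ys) I"
      using assms(2) unfolding transc_def by (auto intro!: bexI[of _ "[:- x, 1:]"])
    then show ?thesis using ys True by (intro exI[of _ "x # ys"]) auto
  next
    case False
    obtain ys where ys: "set ys \<subseteq> set xs" "tower E ys I" "\<forall>x'\<in>set xs. \<not> transc x' (adjoins E ys) I"
      using Cons.IH[OF Cons.prems] by blast
    have "\<not> transc x (adjoins E ys) I"
      using False pol_mono[OF subset_adjoins[OF Cons.prems, of ys]] unfolding transc_def by blast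
    then show ?thesis using ys by (intro exI[of _ ys]) auto
  qed
qed (auto intro: exI[of _ "[]"])

declare Fraction_Field.divide_fract [simp del]

section \<open>Regular domains\<close>

lemma primeish_primeideal:
  assumes "primeideal (P :: 'a::comm_ring_1 set) class_ring"
  shows "primeish P"
proof -
  interpret P: primeideal P class_ring by (rule assms)
  have "1 \<notin> P" using P.one_imp_carrier P.I_notcarr by auto
  moreover have "0 \<in> P" using P.zero_closed by simp
  moreover have "a + b \<in> P" if "a \<in> P" "b \<in> P" for a b using P.a_closed[OF that] by simp
  moreover have "b * a \<in> P" if "a \<in> P" for a b using P.I_l_closed[OF that, of b] by simp
  moreover have "a \<in> P \<or> b \<in> P" if "a * b \<in> P" for a b using P.I_prime[of a b] that by simp
  ultimately show ?thesis unfolding primeish_def by blast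
qed

lemma primeish_mult: "primeish P \<Longrightarrow> a \<notin> P \<Longrightarrow> b \<notin> P \<Longrightarrow> a * b \<notin> P"
  unfolding primeish_def by blast

lemma primeish_prod: "primeish P \<Longrightarrow> (\<And>i. i \<in> S \<Longrightarrow> f i \<notin> P) \<Longrightarrow> prod f S \<notin> P"
proof (induction S rule: infinite_finite_induct)
  case (insert x F)
  then show ?case using primeish_mult[of P "f x" "prod f F"] by simp
qed (simp_all add: primeish_def)

section \<open>Ideals of the localization at a prime and their contractions\<close>

context
  fixes m :: "'a::idom set"
  assumes prime: "primeish m"
begin

private definition Loc :: "'a fract set" where
  "Loc = {Fraction_Field.Fract a s | a s. s \<notin> m}"

private lemma nz: "s \<notin> m \<Longrightarrow> s \<noteq> 0"
  using prime by (auto simp: primeish_def)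

private lemma Loc_iff: "x \<in> Loc \<longleftrightarrow> (\<exists>a s. s \<notin> m \<and> x = emb a / emb s)"
  by (auto simp: Loc_def divide_fract)

private lemma mult_notin: "s \<notin> m \<Longrightarrow> s' \<notin> m \<Longrightarrow> s * s' \<notin> m"
  using prime by (auto simp: primeish_def)

private lemma emb_Loc: "emb a \<in> Loc"
  using prime by (auto simp: Loc_def primeish_def)

private abbreviation "R \<equiv> localization_at m"

private lemma R_ops: "carrier R = Loc" "x \<otimes>\<^bsub>R\<^esub> y = x * y" "x \<oplus>\<^bsub>R\<^esub> y = x + y" "\<one>\<^bsub>R\<^esub> = 1" "\<zero>\<^bsub>R\<^esub> = 0"
  by (simp_all add: localization_at_def Loc_def)

private lemma R_idealI:
  assumes R: "cring R" and Y: "Y \<subseteq> Loc" "0 \<in> Y" "\<And>x y. x \<in> Y \<Longrightarrow> y \<in> Y \<Longrightarrow> x + y \<in> Y"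
    "\<And>r x. r \<in> Loc \<Longrightarrow> x \<in> Y \<Longrightarrow> r * x \<in> Y"
  shows "ideal Y R"
proof -
  interpret R: cring R by (rule R)
  have neg: "\<ominus>\<^bsub>R\<^esub> x = - x" "- x \<in> Y" if "x \<in> Y" for x
  proof -
    have "(- 1) * x \<in> Y" using Y(4)[of "emb (- 1)" x] that emb_Loc[of "- 1"] by (simp add: emb_simps)
    then show "- x \<in> Y" by simp
    then show "\<ominus>\<^bsub>R\<^esub> x = - x"
      using that Y(1) by (intro R.minus_equality) (auto simp: R_ops)
  qed
  show ?thesis
  proof (rule idealI[OF R.ring_axioms])
    show "subgroup Y (add_monoid R)"
    proof (rule group.subgroupI[OF R.a_group])
      show "inv\<^bsub>add_monoid R\<^esub> x \<in> Y" if "x \<in> Y" for x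
        using neg[OF that] by (simp only: a_inv_def)
    qed (use Y in \<open>auto simp: R_ops\<close>)
    fix a x assume "a \<in> Y" "x \<in> carrier R"
    then have "x * a \<in> Y" by (intro Y(4)) (simp_all add: R_ops)
    then show "x \<otimes>\<^bsub>R\<^esub> a \<in> Y" "a \<otimes>\<^bsub>R\<^esub> x \<in> Y" by (simp_all add: R_ops mult.commute)
  qed
qed

private lemma R_ideal_closed:
  assumes "ideal Q R"
  shows "0 \<in> Q" "x \<in> Q \<Longrightarrow> y \<in> Q \<Longrightarrow> x + y \<in> Q" "r \<in> Loc \<Longrightarrow> x \<in> Q \<Longrightarrow> r * x \<in> Q" "x \<in> Q \<Longrightarrow> x \<in> Loc"
proof -
  interpret Q: ideal Q R by (rule assms)
  show "0 \<in> Q" using additive_subgroup.zero_closed[OF ideal.axioms(1)[OF assms]] by (simp add: R_ops)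
  show "x \<in> Q \<Longrightarrow> y \<in> Q \<Longrightarrow> x + y \<in> Q" using additive_subgroup.a_closed[OF ideal.axioms(1)[OF assms]] by (simp add: R_ops)
  show "r \<in> Loc \<Longrightarrow> x \<in> Q \<Longrightarrow> r * x \<in> Q" using Q.I_l_closed by (simp add: R_ops)
  show "x \<in> Q \<Longrightarrow> x \<in> Loc" using Q.Icarr by (simp add: R_ops)
qed

private lemma R_proper:
  assumes Q: "ideal Q R" "Q \<noteq> carrier R" and s: "a \<notin> m" "s \<notin> m"
  shows "emb a / emb s \<notin> Q"
proof
  assume "emb a / emb s \<in> Q"
  moreover have "emb s / emb a \<in> Loc" using s by (auto simp: Loc_iff)
  ultimately have "emb s / emb a * (emb a / emb s) \<in> Q" using R_ideal_closed(3)[OF Q(1)] by blast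
  then have "1 \<in> Q" using s nz by (simp add: emb_simps)
  then have "Q = carrier R" using ideal.one_imp_carrier[OF Q(1)] by (simp add: R_ops)
  then show False using Q(2) by simp
qed

private lemma contract:
  assumes "primeideal Q R"
  shows "primeish {a. emb a \<in> Q}" "{a. emb a \<in> Q} \<subseteq> m"
proof -
  interpret Q: primeideal Q R by (rule assms)
  note cl = R_ideal_closed[OF Q.is_ideal]
  have notcarr: "Q \<noteq> carrier R" using Q.I_notcarr by simp
  show "{a. emb a \<in> Q} \<subseteq> m"
  proof
    fix a assume a: "a \<in> {a. emb a \<in> Q}"
    show "a \<in> m"
      using R_proper[OF Q.is_ideal notcarr, of a 1] a prime
      by (auto simp: primeish_def emb_simps)
  qed
  then have "1 \<notin> {a. emb a \<in> Q}" using prime by (auto simp: primeish_def)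
  moreover have "emb a \<in> Q \<or> emb b \<in> Q" if "emb (a * b) \<in> Q" for a b
    using Q.I_prime[of "emb a" "emb b"] that by (simp add: R_ops emb_Loc emb_simps)
  ultimately show "primeish {a. emb a \<in> Q}"
    using cl emb_Loc by (auto simp: primeish_def emb_simps)
qed

private lemma contract_strict:
  assumes "ideal Q R" "ideal Q' R" "Q \<subset> Q'"
  shows "{a. emb a \<in> Q} \<subset> {a. emb a \<in> Q'}"
proof -
  obtain x where x: "x \<in> Q'" "x \<notin> Q" using assms by blast
  then obtain a s where s: "s \<notin> m" "x = emb a / emb s"
    using R_ideal_closed(4)[OF assms(2)] Loc_iff by blast
  have "emb s \<noteq> 0" using nz[OF s(1)] by (simp add: emb_simps)
  then have "emb s * x = emb a" "1 / emb s * emb a = x" by (simp_all add: s(2))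
  moreover have "1 / emb s \<in> Loc" unfolding Loc_iff using s(1) by (metis emb_simps(6))
  ultimately have "emb a \<in> Q'" "emb a \<notin> Q"
    using R_ideal_closed(3)[OF assms(2) emb_Loc x(1), of s] R_ideal_closed(3)[OF assms(1), of "1 / emb s" "emb a"] x
    by auto
  then show ?thesis using assms(3) by blast
qed

text \<open>Regularity translated into the algebra: h is both the least number of generators of the
  maximal ideal and the Krull dimension. The g i are numerators of generators, and the P i are
  contractions of a chain of primes of length h in the local ring.\<close>

lemma regular_local_chain:
  assumes reg: "regular_local_ring (localization_at m)"
  shows "\<exists>h g P. (\<forall>i<h. g i \<in> m) \<and> (\<forall>a\<in>m. \<exists>s c. s \<notin> m \<and> s * a = (\<Sum>i<h. c i * g i)) \<and>
    (\<forall>i\<le>h. primeish (P i)) \<and> (\<forall>i<h. P i \<subset> P (Suc i)) \<and> P h \<subseteq> m"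
proof -
  have R: "cring R" and noeth: "noetherian_ring R" using reg by (simp_all add: regular_local_ring_def)
  interpret R: cring R by (rule R)
  obtain M where M: "{J. maximalideal J R} = {M}" and kd: "krull_dim R = enat (min_generators R M)"
    using reg by (auto simp: regular_local_ring_def)
  have max: "maximalideal M R" using M by blast
  interpret M: maximalideal M R by (rule max)
  define h where "h = min_generators R M"
  \<comment> \<open>The non-units. \<open>M\<close> consists of non-units and \<open>M0\<close> is a
    proper ideal, so maximality gives equality.\<close>
  define M0 where "M0 = {emb a / emb s | a s. a \<in> m \<and> s \<notin> m}"
  have sub: "M \<subseteq> M0"
  proof
    fix x assume x: "x \<in> M"
    then obtain a s where s: "s \<notin> m" "x = emb a / emb s"
      using R_ideal_closed(4)[OF M.is_ideal] Loc_iff by blast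
    then have "a \<in> m" using R_proper[OF M.is_ideal M.I_notcarr[symmetric], of a s] x by blast
    then show "x \<in> M0" using s by (auto simp: M0_def)
  qed
  have "ideal M0 R"
  proof (rule R_idealI[OF R])
    show "M0 \<subseteq> Loc" unfolding M0_def using Loc_iff by blast
    have "0 \<in> m" "1 \<notin> m" using prime by (auto simp: primeish_def)
    then have "0 = emb 0 / emb 1 \<and> 0 \<in> m \<and> 1 \<notin> m" by (simp add: emb_simps)
    then show "0 \<in> M0" unfolding M0_def by blast
    show "x + y \<in> M0" if xy: "x \<in> M0" "y \<in> M0" for x y
    proof -
      obtain a s b u where x: "a \<in> m" "s \<notin> m" "x = emb a / emb s" and y: "b \<in> m" "u \<notin> m" "y = emb b / emb u"
        using xy by (auto simp: M0_def)
      have "x + y = emb (u * a + s * b) / emb (s * u)"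
        using x y nz by (simp add: emb_simps add_frac_eq mult.commute)
      moreover have "u * a + s * b \<in> m" using x y prime by (auto simp: primeish_def)
      ultimately show ?thesis using mult_notin[OF x(2) y(2)] by (auto simp: M0_def)
    qed
    show "r * x \<in> M0" if xy: "r \<in> Loc" "x \<in> M0" for r x
    proof -
      obtain a s b u where x: "s \<notin> m" "r = emb a / emb s" and y: "b \<in> m" "u \<notin> m" "x = emb b / emb u"
        using xy by (auto simp: M0_def Loc_iff)
      have "r * x = emb (a * b) / emb (s * u)"
        using x y by (simp add: emb_simps)
      moreover have "a * b \<in> m" using y prime by (auto simp: primeish_def)
      ultimately show ?thesis using mult_notin[OF x(1) y(2)] by (auto simp: M0_def)
    qed
  qed
  moreover have "M0 \<noteq> carrier R"
  proof
    assume "M0 = carrier R"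
    then have "emb 1 \<in> M0" using emb_Loc by (simp add: R_ops)
    then obtain a s where as: "a \<in> m" "s \<notin> m" "emb 1 = emb a / emb s" by (auto simp: M0_def)
    then have "emb s = emb a" using nz[OF as(2)] by (simp add: emb_simps)
    then show False using as by (simp add: emb_simps)
  qed
  moreover have "M0 \<subseteq> carrier R" unfolding M0_def R_ops using Loc_iff by blast
  ultimately have M_eq: "M = M0" using M.I_maximal[of M0] sub by blast
  define Gen where "Gen k G \<longleftrightarrow> G \<subseteq> carrier R \<and> finite G \<and> card G = k \<and> M = Idl\<^bsub>R\<^esub> G" for k G
  have "\<exists>k G. Gen k G"
    using noetherian_ring.finetely_gen[OF noeth M.is_ideal] unfolding Gen_def by blast
  then have "\<exists>G. Gen h G"
    unfolding h_def min_generators_def Gen_def by (rule LeastI_ex)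
  then obtain G where G: "G \<subseteq> Loc" "finite G" "card G = h" "M = Idl\<^bsub>R\<^esub> G"
    by (auto simp: Gen_def R_ops)
  obtain e where e: "bij_betw e {..<h} G" using ex_bij_betw_nat_finite[OF G(2)] G(3) by (auto simp: atLeast0LessThan)
  have eG: "e i \<in> G" if "i < h" for i using e that by (auto simp: bij_betw_def)
  have "\<exists>a s. a \<in> m \<and> s \<notin> m \<and> e i = emb a / emb s" if "i < h" for i
  proof -
    have "e i \<in> M" using eG[OF that] G(1) R.genideal_self[of G] G(4) by (auto simp: R_ops)
    then show ?thesis unfolding M_eq M0_def by blast
  qed
  then obtain g u where gu: "\<And>i. i < h \<Longrightarrow> g i \<in> m \<and> u i \<notin> m \<and> e i = emb (g i) / emb (u i)" by metis
  have comb: "\<exists>s c. s \<notin> m \<and> s * a = (\<Sum>i<h. c i * g i)" if a: "a \<in> m" for a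
  proof -
    \<comment> \<open>The combinations of the generators form an ideal containing \<open>G\<close>,
      which turns the abstract generated ideal into explicit sums.\<close>
    define T where "T = {\<Sum>i<h. r i * e i | r. \<forall>i. r i \<in> Loc}"
    have Loc_closed: "0 \<in> Loc" "x \<in> Loc \<Longrightarrow> y \<in> Loc \<Longrightarrow> x + y \<in> Loc" "x \<in> Loc \<Longrightarrow> y \<in> Loc \<Longrightarrow> x * y \<in> Loc" for x y
      using R.zero_closed R.a_closed[of x y] R.m_closed[of x y] by (simp_all add: R_ops)
    have "ideal T R"
    proof (rule R_idealI[OF R])
      show "T \<subseteq> Loc"
      proof
        fix x assume "x \<in> T"
        then obtain r where r: "\<forall>i. r i \<in> Loc" "x = (\<Sum>i<h. r i * e i)" by (auto simp: T_def)
        have "(\<Sum>i\<in>A. r i * e i) \<in> Loc" if "A \<subseteq> {..<h}" for A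
          using finite_subset[OF that finite_lessThan] that
          by (induction A) (use r eG G(1) in \<open>auto intro!: Loc_closed\<close>)
        then show "x \<in> Loc" using r by simp
      qed
      show "0 \<in> T" unfolding T_def using Loc_closed(1) by (auto intro!: exI[of _ "\<lambda>_. 0"])
      show "x + y \<in> T" if xy: "x \<in> T" "y \<in> T" for x y
      proof -
        obtain r r' where "\<forall>i. r i \<in> Loc" "x = (\<Sum>i<h. r i * e i)" "\<forall>i. r' i \<in> Loc" "y = (\<Sum>i<h. r' i * e i)"
          using xy by (auto simp: T_def)
        then show ?thesis unfolding T_def
          by (auto simp: distrib_right sum.distrib Loc_closed intro!: exI[of _ "\<lambda>i. r i + r' i"])
      qed
      show "b * x \<in> T" if bx: "b \<in> Loc" "x \<in> T" for b x
      proof -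
        obtain r where "\<forall>i. r i \<in> Loc" "x = (\<Sum>i<h. r i * e i)"
          using bx by (auto simp: T_def)
        then show ?thesis unfolding T_def using bx
          by (auto simp: sum_distrib_left mult.assoc Loc_closed intro!: exI[of _ "\<lambda>i. b * r i"])
      qed
    qed
    moreover have "G \<subseteq> T"
    proof
      fix y assume "y \<in> G"
      then obtain j where j: "j < h" "y = e j" using e by (auto simp: bij_betw_def)
      have "y = (\<Sum>i<h. (if i = j then 1 else 0) * e i)" using j by (simp add: if_distrib[of "\<lambda>b. b * _"] cong: if_cong)
      moreover have "(if i = j then 1 else 0) \<in> Loc" for i
        using Loc_closed(1) emb_Loc[of 1] by (simp add: emb_simps)
      ultimately show "y \<in> T" unfolding T_def by (intro CollectI exI[of _ "\<lambda>i. if i = j then 1 else 0"]) simp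
    qed
    ultimately have "M \<subseteq> T" unfolding G(4) by (rule R.genideal_minimal)
    moreover have "emb a \<in> M"
    proof -
      have "emb a = emb a / emb 1 \<and> a \<in> m \<and> 1 \<notin> m" using a prime by (simp add: emb_simps primeish_def)
      then show ?thesis unfolding M_eq M0_def by blast
    qed
    ultimately obtain r where r: "\<forall>i. r i \<in> Loc" "emb a = (\<Sum>i<h. r i * e i)" by (auto simp: T_def)
    then obtain b v where bv: "\<And>i. v i \<notin> m \<and> r i = emb (b i) / emb (v i)" unfolding Loc_iff by metis
    \<comment> \<open>A common denominator for the coefficients \<open>r i\<close> and the
      generators \<open>e i\<close>, none of whose factors is in m.\<close>
    define s where "s = (\<Prod>i<h. v i * u i)"
    define c where "c i = b i * (\<Prod>j\<in>{..<h} - {i}. v j * u j)" for i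
    have "s \<notin> m" unfolding s_def by (rule primeish_prod[OF prime]) (use bv gu mult_notin in auto)
    moreover have "emb (s * a) = emb (\<Sum>i<h. c i * g i)"
    proof -
      have "emb s * (r i * e i) = emb (c i * g i)" if i: "i < h" for i
      proof -
        have "s = v i * u i * (\<Prod>j\<in>{..<h} - {i}. v j * u j)"
          unfolding s_def using i by (simp add: prod.remove)
        moreover have "emb (v i) \<noteq> 0" "emb (u i) \<noteq> 0" using bv[of i] gu[OF i] nz by (auto simp: emb_simps)
        ultimately show ?thesis using bv[of i] gu[OF i]
          by (simp add: c_def emb_simps)
      qed
      then have "(\<Sum>i<h. emb s * (r i * e i)) = (\<Sum>i<h. emb (c i * g i))" by (intro sum.cong) auto
      then show ?thesis by (simp add: emb_simps r(2) sum_distrib_left emb_sum)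
    qed
    ultimately show ?thesis by (metis emb_simps(7))
  qed
  define C where "C = {enat k | k. \<exists>P. (\<forall>i\<le>k. primeideal (P i) R) \<and> (\<forall>i<k. P i \<subset> P (Suc i))}"
  have "Sup C = enat h" using kd by (simp add: krull_dim_def C_def h_def)
  moreover have "C \<noteq> {}"
  proof -
    have "primeideal M R" by (rule R.maximalideal_prime[OF max])
    then have "enat 0 \<in> C" unfolding C_def by (auto intro!: exI[of _ "\<lambda>_. M"])
    then show ?thesis by blast
  qed
  \<comment> \<open>A finite supremum of a nonempty set of extended naturals is attained, so a chain
    of length exactly h exists.\<close>
  ultimately have "enat h \<in> C" by (auto simp: Sup_enat_def split: if_splits dest: Max_in)
  then obtain Q where Q: "\<And>i. i \<le> h \<Longrightarrow> primeideal (Q i) R" "\<And>i. i < h \<Longrightarrow> Q i \<subset> Q (Suc i)"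
    by (auto simp: C_def)
  define P where "P i = {a. emb a \<in> Q i}" for i
  have "\<forall>i<h. P i \<subset> P (Suc i)"
    unfolding P_def
  proof (intro allI impI)
    fix i assume "i < h"
    then have "ideal (Q i) R" "ideal (Q (Suc i)) R" "Q i \<subset> Q (Suc i)"
      using primeideal.axioms(1)[OF Q(1)] Q(2) by simp_all
    then show "{a. emb a \<in> Q i} \<subset> {a. emb a \<in> Q (Suc i)}" by (rule contract_strict)
  qed
  moreover have "\<forall>i\<le>h. primeish (P i)" "P h \<subseteq> m" unfolding P_def using contract Q by auto
  ultimately show ?thesis using gu comb by (intro exI[of _ h] exI[of _ g] exI[of _ P]) blast
qed

end

section \<open>Polynomials and partial derivatives\<close>

lemma partial_deriv_add: "partial_deriv j (p + q) = partial_deriv j p + partial_deriv j q"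
  unfolding partial_deriv_def by (rule sum_keys_add) (simp_all add: distrib_left single_add)

lemma partial_deriv_single:
  "partial_deriv j (Poly_Mapping.single v a) =
    Poly_Mapping.single (v - Poly_Mapping.single j 1) (of_nat (Poly_Mapping.lookup v j) * a)"
  unfolding partial_deriv_def by (subst sum_keys_single) simp_all

lemma partial_deriv_0: "partial_deriv j 0 = 0"
  by (simp add: partial_deriv_def)

lemma partial_deriv_const: "partial_deriv j (pconst a) = 0"
  by (simp add: pconst_def partial_deriv_single)

lemma partial_deriv_var: "partial_deriv j (pvar i) = (if i = j then 1 else 0)"
  by (simp add: pvar_def partial_deriv_single lookup_single when_def)

lemma partial_deriv_mult: "partial_deriv j (p * q) = partial_deriv j p * q + p * partial_deriv j q"
proof -
  \<comment> \<open>Subtraction of exponents is truncated. Where the exponent of j is zero the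
    identity may fail, but there the coefficient of the derivative is zero.\<close>
  have shift: "v + w - Poly_Mapping.single j 1 = (v - Poly_Mapping.single j 1) + w"
    if "Poly_Mapping.lookup v j \<noteq> 0" for v w :: "nat \<Rightarrow>\<^sub>0 nat"
    using that by (intro poly_mapping_eqI) (auto simp: lookup_add lookup_minus lookup_single when_def)
  have mono: "partial_deriv j (Poly_Mapping.single v a * Poly_Mapping.single w b) =
      partial_deriv j (Poly_Mapping.single v a) * Poly_Mapping.single w b +
      Poly_Mapping.single v a * partial_deriv j (Poly_Mapping.single w b)" for v w a and b :: 'a
  proof -
    have "Poly_Mapping.single (v - Poly_Mapping.single j 1 + w) (of_nat (Poly_Mapping.lookup v j) * a * b) =
       Poly_Mapping.single (v + w - Poly_Mapping.single j 1) (of_nat (Poly_Mapping.lookup v j) * a * b)"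
      using shift[of v w] by (cases "Poly_Mapping.lookup v j = 0") simp_all
    moreover have "Poly_Mapping.single (v + (w - Poly_Mapping.single j 1)) (of_nat (Poly_Mapping.lookup w j) * a * b) =
       Poly_Mapping.single (v + w - Poly_Mapping.single j 1) (of_nat (Poly_Mapping.lookup w j) * a * b)"
      using shift[of w v] by (cases "Poly_Mapping.lookup w j = 0") (simp_all add: add.commute)
    ultimately show ?thesis
      by (simp add: mult_single partial_deriv_single lookup_add single_add[symmetric] algebra_simps)
  qed
  show ?thesis
  proof (induction p rule: pm_induct)
    case (add v a p)
    have "partial_deriv j (Poly_Mapping.single v a * q) =
       partial_deriv j (Poly_Mapping.single v a) * q + Poly_Mapping.single v a * partial_deriv j q"
      by (induction q rule: pm_induct) (simp_all add: partial_deriv_0 partial_deriv_add mono algebra_simps)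
    with add show ?case by (simp add: partial_deriv_add algebra_simps)
  qed (simp add: partial_deriv_0)
qed

lemma mpoly_ring_ops:
  "p \<otimes>\<^bsub>mpoly_ring n\<^esub> q = p * q" "p \<oplus>\<^bsub>mpoly_ring n\<^esub> q = p + q" "\<one>\<^bsub>mpoly_ring n\<^esub> = 1" "\<zero>\<^bsub>mpoly_ring n\<^esub> = 0"
  by (simp_all add: mpoly_ring_def)

lemma mpoly_carrier: "p \<in> carrier (mpoly_ring n) \<longleftrightarrow> (\<forall>v\<in>Poly_Mapping.keys p. Poly_Mapping.keys v \<subseteq> {1..n})"
  by (simp add: mpoly_ring_def)

lemma pconst_carrier: "pconst a \<in> carrier (mpoly_ring n)"
  by (simp add: mpoly_carrier pconst_def)

lemma pvar_carrier: "i \<in> {1..n} \<Longrightarrow> pvar i \<in> carrier (mpoly_ring n)"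
  by (simp add: mpoly_carrier pvar_def)

lemma mpoly_add_carrier:
  "p \<in> carrier (mpoly_ring n) \<Longrightarrow> q \<in> carrier (mpoly_ring n) \<Longrightarrow> p + q \<in> carrier (mpoly_ring n)"
  using Poly_Mapping.keys_add[of p q] unfolding mpoly_carrier by blast

lemma mpoly_mult_carrier:
  assumes "p \<in> carrier (mpoly_ring n)" "q \<in> carrier (mpoly_ring n)"
  shows "p * q \<in> carrier (mpoly_ring n)"
  unfolding mpoly_carrier
proof
  fix v assume "v \<in> Poly_Mapping.keys (p * q)"
  then obtain a b where "v = a + b" "a \<in> Poly_Mapping.keys p" "b \<in> Poly_Mapping.keys q"
    using keys_mult[of p q] by auto
  then show "Poly_Mapping.keys v \<subseteq> {1..n}"
    using assms Poly_Mapping.keys_add[of a b] unfolding mpoly_carrier by blast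
qed

lemma mpoly_induct [consumes 1, case_names const var add mult]:
  fixes p :: "'a::field mpoly"
  assumes p: "p \<in> carrier (mpoly_ring n)"
    and const: "\<And>a. P (pconst a)" and var: "\<And>i. i \<in> {1..n} \<Longrightarrow> P (pvar i)"
    and add: "\<And>p q. p \<in> carrier (mpoly_ring n) \<Longrightarrow> q \<in> carrier (mpoly_ring n) \<Longrightarrow> P p \<Longrightarrow> P q \<Longrightarrow> P (p + q)"
    and mult: "\<And>p q. p \<in> carrier (mpoly_ring n) \<Longrightarrow> q \<in> carrier (mpoly_ring n) \<Longrightarrow> P p \<Longrightarrow> P q \<Longrightarrow> P (p * q)"
  shows "P p"
proof -
  have one: "pconst 1 = 1" by (simp add: pconst_def)
  have powers: "Poly_Mapping.single (Poly_Mapping.single i k) (1::'a) \<in> carrier (mpoly_ring n) \<and>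
      P (Poly_Mapping.single (Poly_Mapping.single i k) 1)" if "i \<in> {1..n}" for i k
  proof (induction k)
    case 0
    then show ?case using const[of 1] pconst_carrier[of 1 n] by (simp add: pconst_def)
  next
    case (Suc k)
    have eq: "Poly_Mapping.single (Poly_Mapping.single i (Suc k)) 1 =
      pvar i * Poly_Mapping.single (Poly_Mapping.single i k) (1 :: 'a)"
      by (simp add: pvar_def mult_single single_add[symmetric])
    show ?case unfolding eq
      by (intro conjI mult mpoly_mult_carrier pvar_carrier var) (use Suc that in auto)
  qed
  have monomials: "Poly_Mapping.keys v \<subseteq> {1..n} \<longrightarrow> Poly_Mapping.single v (1::'a) \<in> carrier (mpoly_ring n) \<and> P (Poly_Mapping.single v 1)" for v
  proof (induction v rule: pm_induct)
    case zero
    then show ?case using const[of 1] pconst_carrier[of 1 n] by (simp add: pconst_def)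
  next
    case (add i k v)
    show ?case
    proof (cases "k = 0")
      case False
      have "Poly_Mapping.keys (Poly_Mapping.single i k + v) = insert i (Poly_Mapping.keys v)"
        using add.hyps False by (auto simp: in_keys_iff lookup_add lookup_single when_def split: if_splits)
      moreover have "Poly_Mapping.single (Poly_Mapping.single i k + v) (1 :: 'a) =
        Poly_Mapping.single (Poly_Mapping.single i k) 1 * Poly_Mapping.single v 1"
        by (simp add: mult_single)
      ultimately show ?thesis using add.IH powers[of i k] by (auto intro: mult mpoly_mult_carrier)
    qed (use add.IH in simp)
  qed
  from p show ?thesis
  proof (induction p rule: pm_induct)
    case zero
    show ?case using const[of 0] by (simp add: pconst_def)
  next
    case (add v a p)
    show ?case
    proof (cases "a = 0")
      case False
      have keys: "Poly_Mapping.keys (Poly_Mapping.single v a + p) = insert v (Poly_Mapping.keys p)"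
        using add.hyps False by (auto simp: in_keys_iff lookup_add lookup_single when_def split: if_splits)
      have "Poly_Mapping.single v a = pconst a * Poly_Mapping.single v 1"
        by (simp add: pconst_def mult_single)
      moreover have "Poly_Mapping.keys v \<subseteq> {1..n}" "p \<in> carrier (mpoly_ring n)"
        using add.prems unfolding mpoly_carrier keys by auto
      ultimately show ?thesis
        using monomials[of v] const add.IH by (auto intro!: mult assms(4) mpoly_mult_carrier pconst_carrier)
    qed (use add in simp)
  qed
qed

lemma partial_deriv_carrier:
  assumes "p \<in> carrier (mpoly_ring n)"
  shows "partial_deriv j p \<in> carrier (mpoly_ring n)"
  using assms
proof (induction rule: mpoly_induct)
  case (const a)
  show ?case unfolding partial_deriv_const using pconst_carrier[of 0 n] by (simp add: pconst_def)
next
  case (var i)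
  then show ?case using pconst_carrier[of "0::'a" n] pconst_carrier[of "1::'a" n]
    by (simp add: partial_deriv_var pconst_def)
next
  case (add p q)
  then show ?case by (simp add: partial_deriv_add mpoly_add_carrier)
next
  case (mult p q)
  then show ?case by (simp add: partial_deriv_mult mpoly_add_carrier mpoly_mult_carrier)
qed

section \<open>Derivations of the coordinate algebra\<close>

locale poisson_affine = poisson_algebra scale bracket
  for scale :: "'k::field_char_0 \<Rightarrow> 'a::idom \<Rightarrow> 'a" and bracket +
  fixes n m :: nat and f :: "nat \<Rightarrow> 'k mpoly" and I :: "'k mpoly set" and S :: "'k mpoly set set"
    and \<iota> :: "'k mpoly set \<Rightarrow> 'a" and \<phi> :: "'k mpoly \<Rightarrow> 'a" and x :: "nat \<Rightarrow> 'a"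
  assumes f: "\<forall>i\<in>{1..m}. f i \<in> carrier (mpoly_ring n)"
    and I: "I = Idl\<^bsub>mpoly_ring n\<^esub> (f ` {1..m})"
    and prime: "primeideal I (mpoly_ring n)"
    and localization: "is_localization (mpoly_ring n Quot I) S class_ring \<iota>"
    and localization_K: "\<forall>c. \<iota> (I +>\<^bsub>mpoly_ring n\<^esub> pconst c) = scale c 1"
    and \<phi>: "\<phi> = (\<lambda>p. \<iota> (I +>\<^bsub>mpoly_ring n\<^esub> p))"
    and x: "x = (\<lambda>i. \<phi> (pvar i))"
begin

abbreviation "C \<equiv> carrier (mpoly_ring n :: 'k mpoly ring)"

sublocale prime_I: primeideal I "mpoly_ring n"
  by (rule prime)

lemma phi_hom: "\<phi> \<in> ring_hom (mpoly_ring n) class_ring"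
proof -
  have "\<iota> \<in> ring_hom (mpoly_ring n Quot I) class_ring" using localization by (simp add: is_localization_def)
  from ring_hom_trans[OF prime_I.rcos_ring_hom this] show ?thesis by (simp add: \<phi> comp_def)
qed

lemma phi_add: "p \<in> C \<Longrightarrow> q \<in> C \<Longrightarrow> \<phi> (p + q) = \<phi> p + \<phi> q"
  using ring_hom_add[OF phi_hom] by (simp add: mpoly_ring_ops)

lemma phi_mult: "p \<in> C \<Longrightarrow> q \<in> C \<Longrightarrow> \<phi> (p * q) = \<phi> p * \<phi> q"
  using ring_hom_mult[OF phi_hom] by (simp add: mpoly_ring_ops)

lemma phi_1: "\<phi> 1 = 1"
  using ring_hom_one[OF phi_hom] by (simp add: mpoly_ring_ops)

lemma phi_const: "\<phi> (pconst c) = scale c 1"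
  using localization_K by (simp add: \<phi>)

lemma phi_0: "\<phi> 0 = 0"
  using phi_const[of 0] by (simp add: pconst_def)

lemma phi_var: "\<phi> (pvar i) = x i"
  by (simp add: x)

lemma mpoly_diff_carrier: "p \<in> C \<Longrightarrow> q \<in> C \<Longrightarrow> p - q \<in> C"
  using mpoly_add_carrier[of p n "pconst (-1) * q"] mpoly_mult_carrier[OF pconst_carrier, of q n "-1"]
  by (simp add: pconst_def single_uminus)

text \<open>The quotient by I is a domain, and no element of S is zero in it because \<iota> maps S
  to units. Hence localization kills nothing, and the kernel of the canonical map is I.\<close>

lemma phi_ker:
  assumes p: "p \<in> C"
  shows "\<phi> p = 0 \<longleftrightarrow> p \<in> I"
proof -
  let ?Q = "mpoly_ring n Quot I"
  let ?p = "I +>\<^bsub>mpoly_ring n\<^esub> p"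
  interpret Q: domain ?Q by (rule prime_I.quotient_is_domain)
  have pQ: "?p \<in> carrier ?Q" using ring_hom_closed[OF prime_I.rcos_ring_hom p] by simp
  have loc: "submonoid S ?Q" "\<And>s. s \<in> S \<Longrightarrow> \<iota> s \<in> Units class_ring" "\<iota> \<in> ring_hom ?Q class_ring"
    "\<And>r. r \<in> carrier ?Q \<Longrightarrow> \<iota> r = 0 \<longleftrightarrow> (\<exists>s\<in>S. s \<otimes>\<^bsub>?Q\<^esub> r = \<zero>\<^bsub>?Q\<^esub>)"
    using localization by (auto simp: is_localization_def)
  have zero: "\<iota> \<zero>\<^bsub>?Q\<^esub> = 0"
    using ring_hom_zero[OF loc(3) Q.ring_axioms class_ring.ring_axioms] by simp
  have "\<phi> p = 0 \<longleftrightarrow> ?p = \<zero>\<^bsub>?Q\<^esub>"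
  proof
    assume "\<phi> p = 0"
    then obtain s where s: "s \<in> S" "s \<otimes>\<^bsub>?Q\<^esub> ?p = \<zero>\<^bsub>?Q\<^esub>" using loc(4)[OF pQ] by (auto simp: \<phi>)
    have "s \<noteq> \<zero>\<^bsub>?Q\<^esub>" using loc(2)[OF s(1)] zero by (auto simp: Units_def)
    moreover have "s \<in> carrier ?Q" using submonoid.subset[OF loc(1)] s(1) by blast
    ultimately show "?p = \<zero>\<^bsub>?Q\<^esub>" using Q.integral[OF s(2)] pQ by blast
  qed (simp add: \<phi> zero)
  also have "\<dots> \<longleftrightarrow> p \<in> I"
    using p prime_I.a_rcos_const prime_I.a_rcos_self by (auto simp: FactRing_def)
  finally show ?thesis .
qed

lemma phi_f: "i \<in> {1..m} \<Longrightarrow> \<phi> (f i) = 0"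
proof -
  assume i: "i \<in> {1..m}"
  have "f ` {1..m} \<subseteq> C" using f by blast
  then have "f i \<in> I" unfolding I using prime_I.genideal_self[of "f ` {1..m}"] i by blast
  then show ?thesis using phi_ker f i by blast
qed

lemma fraction_rep:
  obtains p s where "p \<in> C" "s \<in> C" "a * \<phi> s = \<phi> p" "\<phi> s dvd 1"
proof -
  let ?Q = "mpoly_ring n Quot I"
  have "\<forall>a::'a. \<exists>r\<in>carrier ?Q. \<exists>s\<in>S. a * \<iota> s = \<iota> r"
    using localization by (simp add: is_localization_def)
  then obtain r s where rs: "r \<in> carrier ?Q" "s \<in> S" "a * \<iota> s = \<iota> r" by blast
  have "\<iota> s \<in> Units class_ring" using localization rs(2) by (auto simp: is_localization_def)
  then have u: "\<iota> s dvd 1" by (auto simp: Units_def dvd_def)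
  have "s \<in> carrier ?Q"
    using localization submonoid.subset[of S ?Q] rs(2) by (auto simp: is_localization_def)
  then obtain q where q: "q \<in> C" "s = I +>\<^bsub>mpoly_ring n\<^esub> q" by (auto simp: FactRing_def A_RCOSETS_def')
  obtain p where p: "p \<in> C" "r = I +>\<^bsub>mpoly_ring n\<^esub> p" using rs(1) by (auto simp: FactRing_def A_RCOSETS_def')
  show ?thesis using that[OF p(1) q(1)] rs(3) u by (simp add: \<phi> p q)
qed

section \<open>Tangent vectors and the derivations that they define\<close>

definition Del :: "(nat \<Rightarrow> 'a fract) \<Rightarrow> 'k mpoly \<Rightarrow> 'a fract" where
  "Del v p = (\<Sum>j=1..n. v j * emb (\<phi> (partial_deriv j p)))"

lemma Del_add: "p \<in> C \<Longrightarrow> q \<in> C \<Longrightarrow> Del v (p + q) = Del v p + Del v q"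
  by (simp add: Del_def partial_deriv_add phi_add partial_deriv_carrier emb_simps distrib_left sum.distrib)

lemma Del_mult: "p \<in> C \<Longrightarrow> q \<in> C \<Longrightarrow> Del v (p * q) = Del v p * emb (\<phi> q) + emb (\<phi> p) * Del v q"
  by (simp add: Del_def partial_deriv_mult phi_add phi_mult partial_deriv_carrier mpoly_mult_carrier
      emb_simps distrib_left sum.distrib sum_distrib_left sum_distrib_right mult_ac)

lemma Del_const: "Del v (pconst c) = 0"
  by (simp add: Del_def partial_deriv_const phi_0 emb_simps)

lemma Del_var: "j \<in> {1..n} \<Longrightarrow> Del v (pvar j) = v j"
proof -
  assume j: "j \<in> {1..n}"
  have "Del v (pvar j) = (\<Sum>i=1..n. if i = j then v i else 0)"
    unfolding Del_def by (rule sum.cong) (auto simp: partial_deriv_var phi_0 phi_1 emb_simps)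
  then show ?thesis using j by simp
qed

text \<open>The condition on the components v under which the vector field \<open>Del v\<close>
  descends from polynomials to the algebra.\<close>

definition tangent :: "(nat \<Rightarrow> 'a fract) \<Rightarrow> bool" where
  "tangent v \<longleftrightarrow> (\<forall>i\<in>{1..m}. Del v (f i) = 0)"

text \<open>The set of p with both \<open>\<phi> p = 0\<close> and \<open>Del v p = 0\<close> is an
  ideal. The first condition is what makes the second stable under multiplication, by the product
  rule.\<close>

lemma tangent_I:
  assumes "tangent v" "p \<in> I"
  shows "Del v p = 0"
proof -
  let ?T = "{p \<in> C. \<phi> p = 0 \<and> Del v p = 0}"
  have neg: "\<ominus>\<^bsub>mpoly_ring n\<^esub> p = pconst (-1) * p" if "p \<in> C" for p
  proof (rule prime_I.minus_equality)
    show "pconst (- 1) * p \<oplus>\<^bsub>mpoly_ring n\<^esub> p = \<zero>\<^bsub>mpoly_ring n\<^esub>"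
      by (simp add: mpoly_ring_ops pconst_def single_uminus)
  qed (use that in \<open>auto simp: mpoly_mult_carrier pconst_carrier\<close>)
  have "0 \<in> C" using pconst_carrier[of 0 n] by (simp add: pconst_def)
  then have 0: "0 \<in> ?T" using Del_const[of v 0] by (simp add: phi_0 pconst_def)
  have "ideal ?T (mpoly_ring n)"
  proof (rule idealI[OF prime_I.ring_axioms])
    show "subgroup ?T (add_monoid (mpoly_ring n))"
    proof (rule group.subgroupI[OF prime_I.a_group])
      show "inv\<^bsub>add_monoid (mpoly_ring n)\<^esub> p \<in> ?T" if "p \<in> ?T" for p
        using that neg[of p] by (simp add: a_inv_def mpoly_mult_carrier pconst_carrier phi_mult Del_mult emb_simps)
      show "?T \<noteq> {}" using 0 by blast
    qed (auto simp: mpoly_ring_ops mpoly_add_carrier phi_add Del_add)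
  qed (auto simp: mpoly_ring_ops mpoly_mult_carrier phi_mult Del_mult emb_simps)
  moreover have "f ` {1..m} \<subseteq> ?T" using assms(1) f phi_f by (auto simp: tangent_def)
  ultimately have "I \<subseteq> ?T" unfolding I by (rule prime_I.genideal_minimal)
  then show ?thesis using assms(2) by blast
qed

text \<open>The quotient rule defines the derivation on fractions of images of polynomials. Two
  representations p/s and p'/s' of the same element have p s' - p' s in I, so
  \<open>tangent_I\<close> makes their values agree.\<close>

lemma tangent_derivation:
  assumes v: "tangent v"
  obtains \<Delta> where "fract_derivation \<Delta>" "\<And>p. p \<in> C \<Longrightarrow> \<Delta> (emb (\<phi> p)) = Del v p"
proof -
  define e where "e p = emb (\<phi> p)" for p
  have e: "e (p + q) = e p + e q" "e (p * q) = e p * e q" if "p \<in> C" "q \<in> C" for p q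
    using that by (simp_all add: e_def phi_add phi_mult emb_simps)
  have Dm: "Del v (p * q) = Del v p * e q + e p * Del v q" if "p \<in> C" "q \<in> C" for p q
    using that by (simp add: e_def Del_mult)
  define rep where "rep y p s \<longleftrightarrow> p \<in> C \<and> s \<in> C \<and> e s \<noteq> 0 \<and> y * e s = e p" for y p s
  have "\<exists>p s. rep y p s" for y
  proof -
    obtain a b where ab: "y = emb a / emb b" "b \<noteq> 0" by (rule fract_quotient)
    obtain p s where ps: "p \<in> C" "s \<in> C" "a * \<phi> s = \<phi> p" "\<phi> s dvd 1" by (rule fraction_rep)
    obtain q u where qu: "q \<in> C" "u \<in> C" "b * \<phi> u = \<phi> q" "\<phi> u dvd 1" by (rule fraction_rep)
    have nz: "emb b \<noteq> 0" "e s \<noteq> 0" "e u \<noteq> 0" using ab ps(4) qu(4) by (auto simp: e_def emb_simps)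
    have eq: "emb a * e s = e p" "emb b * e u = e q" unfolding e_def emb_simps(2)[symmetric] ps(3) qu(3) by (rule refl)+
    have "e q \<noteq> 0" using nz by (simp flip: eq)
    then have "rep y (p * u) (q * s)"
      unfolding rep_def using ps qu nz by (simp add: e mpoly_mult_carrier ab(1)) (simp flip: eq)
    then show ?thesis by blast
  qed
  then obtain P Q where PQ: "\<And>y. rep y (P y) (Q y)" by metis
  define \<Delta> where "\<Delta> y = (Del v (P y) - y * Del v (Q y)) / e (Q y)" for y
  have \<Delta>: "\<Delta> y = (Del v p - y * Del v s) / e s" if "rep y p s" for y p s
  proof -
    define p' s' where "p' = P y" and "s' = Q y"
    have r: "p \<in> C" "s \<in> C" "e s \<noteq> 0" "y * e s = e p" "p' \<in> C" "s' \<in> C" "e s' \<noteq> 0" "y * e s' = e p'"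
      using that PQ[of y] by (auto simp: rep_def p'_def s'_def)
    have "e (p * s') = e (p' * s)" using r by (simp add: e) (simp flip: r(4,8))
    moreover have "p * s' - p' * s \<in> C" using r by (intro mpoly_diff_carrier mpoly_mult_carrier)
    moreover have "e (p * s' - p' * s) + e (p' * s) = e (p * s')"
      using e(1)[OF \<open>p * s' - p' * s \<in> C\<close>, of "p' * s"] r by (simp add: mpoly_mult_carrier)
    ultimately have "p * s' - p' * s \<in> I" using phi_ker by (simp add: e_def emb_simps)
    then have "Del v (p * s' - p' * s) = 0" by (rule tangent_I[OF v])
    then have "Del v (p * s') = Del v (p' * s)"
      using Del_add[OF \<open>p * s' - p' * s \<in> C\<close>, of "p' * s" v] r by (simp add: mpoly_mult_carrier)
    then have "Del v p * e s' + e p * Del v s' = Del v p' * e s + e p' * Del v s"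
      using r by (simp add: Dm)
    then have "(Del v p - y * Del v s) * e s' = (Del v p' - y * Del v s') * e s"
      by (simp add: algebra_simps flip: r(4,8))
    then show ?thesis using r by (simp add: \<Delta>_def p'_def s'_def frac_eq_eq)
  qed
  have "\<Delta> (y + y') = \<Delta> y + \<Delta> y' \<and> \<Delta> (y * y') = \<Delta> y * y' + y * \<Delta> y'" for y y'
  proof -
    define p s p' s' where "p = P y" and "s = Q y" and "p' = P y'" and "s' = Q y'"
    have r: "p \<in> C" "s \<in> C" "e s \<noteq> 0" "e p = y * e s" "p' \<in> C" "s' \<in> C" "e s' \<noteq> 0" "e p' = y' * e s'"
      and r': "rep y p s" "rep y' p' s'"
      using PQ[of y] PQ[of y'] by (auto simp: rep_def p_def s_def p'_def s'_def)
    have 1: "rep (y + y') (p * s' + p' * s) (s * s')" "rep (y * y') (p * p') (s * s')"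
      unfolding rep_def using r by (simp_all add: mpoly_mult_carrier mpoly_add_carrier e algebra_simps)
    show ?thesis
      unfolding \<Delta>[OF 1(1)] \<Delta>[OF 1(2)] \<Delta>[OF r'(1)] \<Delta>[OF r'(2)] using r
      by (simp add: mpoly_mult_carrier Del_add Dm e field_simps)
  qed
  then have "fract_derivation \<Delta>" by unfold_locales auto
  moreover have "\<Delta> (emb (\<phi> p)) = Del v p" if "p \<in> C" for p
  proof -
    have "1 \<in> C" "Del v 1 = 0" using pconst_carrier[of 1 n] Del_const[of v 1] by (simp_all add: pconst_def)
    moreover have "rep (emb (\<phi> p)) p 1" using that calculation by (simp add: rep_def e_def phi_1 emb_simps)
    ultimately show ?thesis using \<Delta> by (simp add: e_def phi_1 emb_simps)
  qed
  ultimately show ?thesis by (rule that)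
qed

lemma derivation_phi:
  assumes B: "der_on B D" "\<phi> ` C \<subseteq> B" "\<And>c. D (scale c 1) = 0" and p: "p \<in> C"
  shows "D (\<phi> p) = Del (\<lambda>j. D (x j)) p"
  using p
proof (induction rule: mpoly_induct)
  case (add p q)
  moreover have "\<phi> p \<in> B" "\<phi> q \<in> B" using add B(2) by auto
  ultimately show ?case using B(1) by (simp add: der_on_def phi_add Del_add)
next
  case (mult p q)
  moreover have "\<phi> p \<in> B" "\<phi> q \<in> B" using mult B(2) by auto
  ultimately show ?case using B(1) by (simp add: der_on_def phi_mult Del_mult)
qed (simp_all add: phi_const B(3) Del_const phi_var Del_var)

lemma derivation_tangent:
  assumes B: "der_on B D" "\<phi> ` C \<subseteq> B" "\<And>c. D (scale c 1) = 0"
  shows "tangent (\<lambda>j. D (x j))"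
  unfolding tangent_def
proof
  fix i assume i: "i \<in> {1..m}"
  have "Del (\<lambda>j. D (x j)) (f i) = D (scale 0 1)"
    using derivation_phi[OF B, of "f i"] f phi_f[OF i] i by simp
  then show "Del (\<lambda>j. D (x j)) (f i) = 0" using B(3)[of 0] by simp
qed

lemma fract_derivation_der_on: "fract_derivation \<Delta> \<Longrightarrow> der_on UNIV (\<lambda>a. \<Delta> (emb a))"
  by (simp add: der_on_def emb_simps fract_derivation.add fract_derivation.mult)

lemma derivation_eqI:
  assumes "der_on UNIV D" "der_on UNIV D'" "\<And>c. D (scale c 1) = 0" "\<And>c. D' (scale c 1) = 0"
    "\<And>j. j \<in> {1..n} \<Longrightarrow> D (x j) = D' (x j)"
  shows "D a = D' a"
proof -
  have phi: "D (\<phi> p) = D' (\<phi> p)" if "p \<in> C" for p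
    using derivation_phi[OF assms(1) _ assms(3) that] derivation_phi[OF assms(2) _ assms(4) that] assms(5)
    by (simp add: Del_def)
  obtain p s where ps: "p \<in> C" "s \<in> C" "a * \<phi> s = \<phi> p" "\<phi> s dvd 1" by (rule fraction_rep)
  have "emb (\<phi> s) \<noteq> 0" using ps(4) by (auto simp: emb_simps)
  moreover have "D a * emb (\<phi> s) + emb a * D (\<phi> s) = D (\<phi> p)" "D' a * emb (\<phi> s) + emb a * D' (\<phi> s) = D' (\<phi> p)"
    using assms(1,2) unfolding ps(3)[symmetric] der_on_def by simp_all
  ultimately show ?thesis using phi[OF ps(1)] phi[OF ps(2)] by (metis add_right_cancel mult_right_cancel)
qed

end

section \<open>Bordered determinants\<close>

definition bordered_det :: "(nat \<Rightarrow> nat \<Rightarrow> 'a::comm_ring_1) \<Rightarrow> nat list \<Rightarrow> nat list \<Rightarrow> (nat \<Rightarrow> 'a) \<Rightarrow> 'a" where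
  "bordered_det M is cs w = det (mat (length is + 1) (length is + 1) (\<lambda>(s, t).
     let j = cs ! t in if s < length is then M (is ! s) j else w j))"

lemma bordered_det_row:
  assumes "length cs = length is + 1"
  shows "bordered_det M is cs (M i) = minor M (is @ [i]) cs"
  unfolding bordered_det_def minor_def using assms
  by (intro arg_cong[of _ _ det] eq_matI) (auto simp: nth_append Let_def less_Suc_eq)

lemma bordered_det_expansion:
  assumes len: "length cs = length is + 1"
  shows "\<exists>c. (\<forall>w. bordered_det M is cs w = (\<Sum>t<length is + 1. w (cs ! t) * c t)) \<and>
    c (length is) = minor M is (butlast cs)"
proof -
  let ?r = "length is"
  define A where "A w = mat (?r + 1) (?r + 1) (\<lambda>(s, t).
     let j = cs ! t in if s < length is then M (is ! s) j else w j)" for w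
  have del: "mat_delete (A w) ?r t = mat_delete (A (\<lambda>_. 0)) ?r t" for w t
    by (rule eq_matI) (auto simp: A_def mat_delete_def Let_def)
  define c where "c t = cofactor (A (\<lambda>_. 0)) ?r t" for t
  have "bordered_det M is cs w = (\<Sum>t<?r + 1. w (cs ! t) * c t)" for w
  proof -
    have "det (A w) = (\<Sum>t<?r + 1. A w $$ (?r, t) * cofactor (A w) ?r t)"
      by (rule laplace_expansion_row) (simp_all add: A_def)
    also have "\<dots> = (\<Sum>t<?r + 1. w (cs ! t) * c t)"
      by (rule sum.cong) (simp_all add: c_def cofactor_def del[of w], simp add: A_def Let_def)
    finally show ?thesis by (simp add: bordered_det_def A_def)
  qed
  moreover have "c ?r = minor M is (butlast cs)"
  proof -
    have "mat_delete (A (\<lambda>_. 0)) ?r ?r = mat ?r (length (butlast cs)) (\<lambda>(s, t). M (is ! s) (butlast cs ! t))"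
      by (rule eq_matI) (use len in \<open>auto simp: A_def mat_delete_def Let_def nth_butlast\<close>)
    then show ?thesis by (simp add: c_def cofactor_def minor_def)
  qed
  ultimately show ?thesis by blast
qed

text \<open>Expansion along the bordering row shows the determinant as a linear functional of that
  row. Its coefficients \<open>v\<close> are cofactors, hence lie in the ring itself; applied to the
  Jacobian matrix they will be the components of a tangent vector.\<close>

lemma bordered_det_vector:
  fixes M :: "nat \<Rightarrow> nat \<Rightarrow> 'a::comm_ring_1"
  assumes len: "length js = length is" and js: "set js \<subseteq> {1..n}" "distinct js" and \<nu>: "\<nu> \<in> {1..n} - set js"
  obtains v where "\<And>w. bordered_det M is (js @ [\<nu>]) w = (\<Sum>j=1..n. v j * w j)"
    "v \<nu> = minor M is js" "\<And>j. j \<notin> insert \<nu> (set js) \<Longrightarrow> v j = 0"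
proof -
  let ?cs = "js @ [\<nu>]"
  obtain c where c: "\<And>w. bordered_det M is ?cs w = (\<Sum>t<length is + 1. w (?cs ! t) * c t)"
    "c (length is) = minor M is js"
    using bordered_det_expansion[of ?cs "is" M] len by auto
  define v where "v j = (\<Sum>t<length is + 1. if ?cs ! t = j then c t else 0)" for j
  have in_range: "?cs ! t \<in> {1..n}" if "t < length is + 1" for t
  proof -
    have "?cs ! t \<in> set ?cs" using that len by (intro nth_mem) simp
    then show ?thesis using js \<nu> by auto
  qed
  show ?thesis
  proof (rule that)
    fix w :: "nat \<Rightarrow> 'a"
    have "(\<Sum>j=1..n. v j * w j) = (\<Sum>t<length is + 1. \<Sum>j=1..n. if ?cs ! t = j then c t * w j else 0)"
      unfolding v_def sum_distrib_right by (subst sum.swap) (intro sum.cong, auto)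
    also have "\<dots> = (\<Sum>t<length is + 1. w (?cs ! t) * c t)"
      by (rule sum.cong) (use in_range in \<open>auto simp: mult.commute\<close>)
    finally show "bordered_det M is ?cs w = (\<Sum>j=1..n. v j * w j)" by (simp add: c)
  next
    have "v \<nu> = (\<Sum>t<length is + 1. if t = length is then c t else 0)"
      unfolding v_def
    proof (rule sum.cong)
      fix t assume t: "t \<in> {..<length is + 1}"
      have "js ! t \<noteq> \<nu>" if "t < length js" using \<nu> that nth_mem by blast
      then show "(if ?cs ! t = \<nu> then c t else 0) = (if t = length is then c t else 0)"
        using t len by (auto simp: nth_append)
    qed simp
    then show "v \<nu> = minor M is js" using c(2) by simp
  next
    fix j assume j: "j \<notin> insert \<nu> (set js)"
    have "?cs ! t \<noteq> j" if "t < length is + 1" for t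
    proof -
      have "?cs ! t \<in> set ?cs" using that len by (intro nth_mem) simp
      then show ?thesis using j by auto
    qed
    then show "v j = 0" by (simp add: v_def)
  qed
qed

lemma incr_tuplesD:
  assumes "is \<in> incr_tuples k N"
  shows "length is = k" "set is \<subseteq> {1..N}" "distinct is"
  using assms strict_sorted_iff[of "is"] by (auto simp: incr_tuples_def)

context poisson_affine
begin

definition Jr :: nat where "Jr = frac_rank m n (jacobian \<phi> f)"

text \<open>Bordering with a row of the Jacobian matrix itself yields a minor of order r + 1, which
  vanishes by the choice of r.\<close>

lemma tangent_bordered:
  assumes "is": "is \<in> incr_tuples Jr m" and js: "js \<in> incr_tuples Jr n" and \<nu>: "\<nu> \<in> {1..n} - set js"
    and v: "\<And>w. bordered_det (jacobian \<phi> f) is (js @ [\<nu>]) w = (\<Sum>j=1..n. v j * w j)"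
  shows "tangent (\<lambda>j. emb (v j))"
  unfolding tangent_def
proof
  fix i assume i: "i \<in> {1..m}"
  have "Del (\<lambda>j. emb (v j)) (f i) = emb (\<Sum>j=1..n. v j * jacobian \<phi> f i j)"
    by (simp add: Del_def jacobian_def emb_sum emb_simps)
  also have "(\<Sum>j=1..n. v j * jacobian \<phi> f i j) = minor (jacobian \<phi> f) (is @ [i]) (js @ [\<nu>])"
    unfolding v[symmetric] by (rule bordered_det_row) (use incr_tuplesD[OF "is"] incr_tuplesD[OF js] in simp)
  also have "\<dots> = 0"
    by (rule minor_zero_above_rank[where m = m and n = n])
       (use i \<nu> incr_tuplesD[OF "is"] incr_tuplesD[OF js] in \<open>auto simp: Jr_def\<close>)
  finally show "Del (\<lambda>j. emb (v j)) (f i) = 0" by (simp add: emb_simps)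
qed

lemma linear_scaleI:
  assumes "\<And>a b. D (a + b) = D a + D b" "\<And>a b. D (a * b) = D a * b + a * D b" "\<And>c. D (scale c 1) = 0"
  shows "Vector_Spaces.linear scale scale D"
proof -
  have "D (scale c a) = scale c (D a)" for c a
  proof -
    have "D (scale c 1 * a) = scale c 1 * D a" by (simp only: assms) simp
    then show ?thesis by (simp add: scale_mult_left)
  qed
  then show ?thesis
    using assms(1) vector_space_axioms
    by (simp add: Vector_Spaces.linear_def module_hom_iff module_iff_vector_space)
qed

lemma derivationsD:
  assumes "D \<in> derivations scale"
  shows "der_on UNIV (\<lambda>a. emb (D a))" "D (scale c 1) = 0"
proof -
  have *: "D (a + b) = D a + D b" "D (scale c a) = scale c (D a)" "D (a * b) = D a * b + a * D b" for a b c
    using assms by (auto simp: derivations_def Vector_Spaces.linear_def module_hom_iff)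
  show "der_on UNIV (\<lambda>a. emb (D a))" by (simp add: der_on_def * emb_simps)
  have "D 1 = D 1 + D 1" using *(3)[of 1 1] by (simp only: mult_1 mult_1_right)
  then have "D 1 = 0" by (metis add.right_neutral add_left_cancel)
  then show "D (scale c 1) = 0" using *(2)[of c 1] by simp
qed

text \<open>Existence comes from the tangent vector of cofactors, uniqueness from the values on the
  variables. Thus the definite description in the definition denotes a derivation.\<close>

lemma jacobian_derivation:
  assumes "is": "is \<in> incr_tuples Jr m" and js: "js \<in> incr_tuples Jr n" and \<nu>: "\<nu> \<in> {1..n} - set js"
  shows "jacobian_derivation scale n \<phi> f is js \<nu> \<in> derivations scale"
proof -
  let ?M = "jacobian \<phi> f"
  have len: "length js = length is" using incr_tuplesD[OF "is"] incr_tuplesD[OF js] by simp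
  obtain v where v: "\<And>w. bordered_det ?M is (js @ [\<nu>]) w = (\<Sum>j=1..n. v j * w j)"
    using bordered_det_vector[OF len incr_tuplesD(2,3)[OF js] \<nu>, of ?M] by blast
  obtain \<Delta> where \<Delta>: "fract_derivation \<Delta>" "\<And>p. p \<in> C \<Longrightarrow> \<Delta> (emb (\<phi> p)) = Del (\<lambda>j. emb (v j)) p"
    using tangent_derivation[OF tangent_bordered[OF assms v]] by blast
  interpret \<Delta>: fract_derivation \<Delta> by (rule \<Delta>)
  \<comment> \<open>The derivation maps the algebra to itself and not only to the fraction field:
    the cofactors are in the algebra, and the denominators are units there.\<close>
  have "\<exists>b. \<Delta> (emb a) = emb b" for a
  proof -
    obtain p s where ps: "p \<in> C" "s \<in> C" "a * \<phi> s = \<phi> p" "\<phi> s dvd 1" by (rule fraction_rep)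
    obtain u where u: "\<phi> s * u = 1" using ps(4) by (metis dvdE)
    have range: "\<exists>b. \<Delta> (emb (\<phi> p)) = emb b" if "p \<in> C" for p
    proof -
      have "\<Delta> (emb (\<phi> p)) = emb (\<Sum>j=1..n. v j * \<phi> (partial_deriv j p))"
        by (simp add: \<Delta>(2)[OF that] Del_def emb_sum emb_simps)
      then show ?thesis by blast
    qed
    obtain bp bs where b: "\<Delta> (emb (\<phi> p)) = emb bp" "\<Delta> (emb (\<phi> s)) = emb bs" using range ps by blast
    have "\<Delta> (emb a) * emb (\<phi> s) + emb a * \<Delta> (emb (\<phi> s)) = \<Delta> (emb (\<phi> p))"
      by (simp only: ps(3)[symmetric] emb_simps \<Delta>.mult)
    then have "\<Delta> (emb a) * emb (\<phi> s) = emb (bp - a * bs)" by (simp add: b emb_simps algebra_simps)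
    then have "\<Delta> (emb a) * emb (\<phi> s) * emb u = emb ((bp - a * bs) * u)" by (simp add: emb_simps)
    moreover have "emb (\<phi> s) * emb u = 1" using u by (metis emb_simps(2,6))
    ultimately show ?thesis by (metis mult.assoc mult.right_neutral)
  qed
  then obtain D where D: "\<And>a. \<Delta> (emb a) = emb (D a)" by metis
  have const: "D (scale c 1) = 0" for c
    using \<Delta>(2)[OF pconst_carrier[of c]] D[of "scale c 1"] by (simp add: phi_const Del_const emb_simps)
  have Dmem: "D \<in> derivations scale"
  proof -
    have "D (a + b) = D a + D b" "D (a * b) = D a * b + a * D b" for a b
      using \<Delta>.add[of "emb a" "emb b"] \<Delta>.mult[of "emb a" "emb b"]
      unfolding emb_simps(1,2)[symmetric] D emb_simps(7) .
    then show ?thesis using const by (simp add: derivations_def linear_scaleI)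
  qed
  let ?Q = "\<lambda>D. D \<in> derivations scale \<and> (\<forall>p\<in>C. D (\<phi> p) = bordered_det ?M is (js @ [\<nu>]) (\<lambda>j. \<phi> (partial_deriv j p)))"
  have val: "D (\<phi> p) = bordered_det ?M is (js @ [\<nu>]) (\<lambda>j. \<phi> (partial_deriv j p))" if "p \<in> C" for p
  proof -
    have "emb (D (\<phi> p)) = emb (\<Sum>j=1..n. v j * \<phi> (partial_deriv j p))"
      using \<Delta>(2)[OF that] D by (simp add: Del_def emb_sum emb_simps)
    then show ?thesis using v by (simp add: emb_simps)
  qed
  have "jacobian_derivation scale n \<phi> f is js \<nu> = (THE D. ?Q D)"
    unfolding jacobian_derivation_def bordered_det_def using len by simp
  also have "\<dots> = D"
  proof (rule the_equality)
    show "?Q D" using Dmem val by blast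
    fix D' assume D': "?Q D'"
    have "emb (D' a) = emb (D a)" for a
    proof (rule derivation_eqI[of "\<lambda>a. emb (D' a)" "\<lambda>a. emb (D a)"])
      show "der_on UNIV (\<lambda>a. emb (D' a))" "der_on UNIV (\<lambda>a. emb (D a))"
        using derivationsD(1) D' Dmem by blast+
      show "emb (D' (scale c 1)) = 0" "emb (D (scale c 1)) = 0" for c
        using derivationsD(2) D' Dmem by (simp_all add: emb_simps)
      show "emb (D' (x j)) = emb (D (x j))" if "j \<in> {1..n}" for j
      proof -
        have "pvar j \<in> C" by (rule pvar_carrier[OF that])
        then have "D' (\<phi> (pvar j)) = D (\<phi> (pvar j))" using D' val by simp
        then show ?thesis by (simp add: phi_var)
      qed
    qed
    then show "D' = D" by (simp add: fun_eq_iff emb_simps)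
  qed
  finally show ?thesis using Dmem by simp
qed

text \<open>The bordered determinants of a nonzero maximal minor of the Jacobian matrix are, up to that
  minor, dual to the variables outside of its columns.\<close>

lemma ex_frame:
  obtains t z D where "poisson_frame scale bracket t z D" "t = n - Jr" "Jr \<le> n"
    "\<And>k. k < t \<Longrightarrow> z k \<in> x ` {1..n}"
    "\<And>d a. der_on UNIV d \<Longrightarrow> (\<And>c. d (scale c 1) = 0) \<Longrightarrow> d a = (\<Sum>k<t. d (z k) * D k (emb a))"
proof -
  let ?M = "jacobian \<phi> f"
  obtain "is" js where "is": "is \<in> incr_tuples Jr m" and js: "js \<in> incr_tuples Jr n" and \<mu>: "minor ?M is js \<noteq> 0"
    using ex_minor_frac_rank[of m n ?M] unfolding Jr_def by blast
  note isD = incr_tuplesD[OF "is"] and jsD = incr_tuplesD[OF js]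
  define J where "J = {1..n} - set js"
  define jl where "jl = sorted_list_of_set J"
  define t where "t = length jl"
  have "card (set js) = Jr" using jsD by (simp add: distinct_card)
  then have t: "t = n - Jr" and le: "Jr \<le> n"
    using jsD card_mono[of "{1..n}" "set js"] by (simp_all add: t_def jl_def J_def card_Diff_subset)
  have jl: "set jl = J" "distinct jl" by (simp_all add: jl_def J_def)
  have jlJ: "jl ! k \<in> J" if "k < t" for k using that jl(1) nth_mem unfolding t_def by blast
  define z where "z k = (if k < t then x (jl ! k) else 0)" for k
  \<comment> \<open>A tangent vector is determined by its components outside of \<open>js\<close>,
    because the equations of the rows \<open>is\<close> have an invertible coefficient matrix in the
    columns \<open>js\<close>.\<close>
  have zero: "v j = 0" if v: "tangent v" "\<And>j. j \<in> J \<Longrightarrow> v j = 0" and j: "j \<in> {1..n}" for v j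
  proof -
    have "(\<Sum>u<Jr. emb (?M (is ! s) (js ! u)) * v (js ! u)) = 0" if s: "s < Jr" for s
    proof -
      have "is ! s \<in> {1..m}" by (rule subsetD[OF isD(2) nth_mem]) (use s isD(1) in simp)
      then have "0 = (\<Sum>j=1..n. v j * emb (?M (is ! s) j))"
        using v(1) by (simp add: tangent_def Del_def jacobian_def)
      also have "\<dots> = (\<Sum>j\<in>set js. v j * emb (?M (is ! s) j))"
        by (rule sum.mono_neutral_right) (use jsD v(2) in \<open>auto simp: J_def\<close>)
      also have "\<dots> = (\<Sum>u<Jr. v (js ! u) * emb (?M (is ! s) (js ! u)))"
        using sum.reindex_bij_betw[OF bij_betw_nth[OF jsD(3) refl refl], of "\<lambda>j. v j * emb (?M (is ! s) j)"] jsD(1) by simp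
      finally show ?thesis by (simp add: mult.commute)
    qed
    have "det (mat Jr Jr (\<lambda>(s, u). emb (?M (is ! s) (js ! u)))) \<noteq> 0"
      using \<mu> minor_emb[of ?M "is" js] isD jsD by (simp add: minor_def emb_simps)
    have js0: "v (js ! u) = 0" if "u < Jr" for u
    proof (rule ccontr)
      assume "v (js ! u) \<noteq> 0"
      then have "det (mat Jr Jr (\<lambda>(s, u). emb (?M (is ! s) (js ! u)))) = 0"
        unfolding det_right_kernel using that \<open>\<And>s. s < Jr \<Longrightarrow> (\<Sum>u<Jr. emb (?M (is ! s) (js ! u)) * v (js ! u)) = 0\<close>
        by (intro exI[of _ "\<lambda>u. v (js ! u)"]) auto
      with \<open>det _ \<noteq> 0\<close> show False ..
    qed
    show ?thesis
    proof (cases "j \<in> set js")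
      case True
      then show ?thesis using js0 jsD(1) by (auto simp: in_set_conv_nth)
    qed (use j v(2) in \<open>auto simp: J_def\<close>)
  qed
  have "\<exists>\<Delta>. fract_derivation \<Delta> \<and> (\<forall>c. \<Delta> (emb (scale c 1)) = 0) \<and>
      (\<forall>j\<in>J. \<Delta> (emb (x j)) = (if j = \<nu> then 1 else 0))" if \<nu>: "\<nu> \<in> J" for \<nu>
  proof -
    have len: "length js = length is" using isD jsD by simp
    obtain v where v: "\<And>w. bordered_det ?M is (js @ [\<nu>]) w = (\<Sum>j=1..n. v j * w j)"
      "v \<nu> = minor ?M is js" "\<And>j. j \<notin> insert \<nu> (set js) \<Longrightarrow> v j = 0"
      using bordered_det_vector[OF len jsD(2,3) \<nu>[unfolded J_def]] by blast
    have "tangent (\<lambda>j. emb (v j))" by (rule tangent_bordered[OF "is" js \<nu>[unfolded J_def] v(1)])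
    then obtain \<Delta> where \<Delta>: "fract_derivation \<Delta>" "\<And>p. p \<in> C \<Longrightarrow> \<Delta> (emb (\<phi> p)) = Del (\<lambda>j. emb (v j)) p"
      using tangent_derivation by blast
    interpret \<Delta>: fract_derivation \<Delta> by (rule \<Delta>)
    define \<Delta>' where "\<Delta>' y = \<Delta> y / emb (minor ?M is js)" for y
    have "fract_derivation \<Delta>'"
      by unfold_locales (simp_all add: \<Delta>'_def \<Delta>.add \<Delta>.mult add_divide_distrib)
    moreover have "\<Delta>' (emb (scale c 1)) = 0" for c
      using \<Delta>(2)[OF pconst_carrier[of c]] by (simp add: \<Delta>'_def phi_const Del_const)
    moreover have "\<Delta>' (emb (x j)) = (if j = \<nu> then 1 else 0)" if j: "j \<in> J" for j
    proof -
      have j': "j \<in> {1..n}" "j \<notin> set js" using j by (auto simp: J_def)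
      have "\<Delta> (emb (x j)) = emb (v j)" using \<Delta>(2)[OF pvar_carrier[OF j'(1)]] Del_var[OF j'(1)] by (simp add: phi_var)
      then show ?thesis using v(2,3) j' \<mu> by (auto simp: \<Delta>'_def emb_simps)
    qed
    ultimately show ?thesis by blast
  qed
  then obtain E where E: "\<And>\<nu>. \<nu> \<in> J \<Longrightarrow> fract_derivation (E \<nu>)" "\<And>\<nu> c. \<nu> \<in> J \<Longrightarrow> E \<nu> (emb (scale c 1)) = 0"
    "\<And>\<nu> j. \<nu> \<in> J \<Longrightarrow> j \<in> J \<Longrightarrow> E \<nu> (emb (x j)) = (if j = \<nu> then 1 else 0)"
    by metis
  define D where "D k = (if k < t then E (jl ! k) else (\<lambda>_. 0))" for k
  have D_deriv: "fract_derivation (D k)" for k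
    using E(1) jlJ by (cases "k < t") (auto simp: D_def fract_derivation_def)
  have D_const: "D k (emb (scale c 1)) = 0" for k c
    using E(2) jlJ by (simp add: D_def)
  have D_dual: "D k (emb (z i)) = (if i = k then 1 else 0)" if "i < t" "k < t" for i k
    using that E(3)[OF jlJ jlJ, of k i] jl(2) by (simp add: D_def z_def t_def nth_eq_iff_index_eq)
  \<comment> \<open>A derivation into the fraction field that kills the frame is zero. Applied to
    differences it gives the expansion of every derivation, applied to commutators the commutation
    of the \<open>D k\<close>.\<close>
  have zero': "d a = 0" if d: "der_on UNIV d" "\<And>c. d (scale c 1) = 0" "\<And>k. k < t \<Longrightarrow> d (z k) = 0" for d a
  proof -
    have tan: "tangent (\<lambda>j. d (x j))" by (rule derivation_tangent[OF d(1)]) (use d(2) in auto)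
    have "d (x j) = 0" if "j \<in> J" for j
    proof -
      obtain k where "k < t" "j = jl ! k" using \<open>j \<in> J\<close> jl(1) unfolding t_def by (auto simp: in_set_conv_nth)
      then show ?thesis using d(3)[of k] by (simp add: z_def)
    qed
    then have "d (x j) = 0" if "j \<in> {1..n}" for j using zero[OF tan _ that] by blast
    then show ?thesis
      using derivation_eqI[OF d(1), of "\<lambda>_. 0" a] d(2) by (simp add: der_on_def)
  qed
  have expand: "d a = (\<Sum>k<t. d (z k) * D k (emb a))" if d: "der_on UNIV d" "\<And>c. d (scale c 1) = 0" for d a
  proof -
    define e where "e a = d a - (\<Sum>k<t. d (z k) * D k (emb a))" for a
    have "e a = 0"
    proof (rule zero')
      show "der_on UNIV e"
        using d(1) unfolding der_on_def e_def
        by (simp add: emb_simps fract_derivation.add[OF D_deriv] fract_derivation.mult[OF D_deriv]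
            sum.distrib sum_distrib_left sum_distrib_right algebra_simps)
      show "e (scale c 1) = 0" for c using d(2) D_const by (simp add: e_def)
      show "e (z i) = 0" if i: "i < t" for i
      proof -
        have "(\<Sum>k<t. d (z k) * D k (emb (z i))) = (\<Sum>k<t. if i = k then d (z k) else 0)"
          by (rule sum.cong) (use D_dual[OF i] in auto)
        then show ?thesis using i by (simp add: e_def)
      qed
    qed
    then show ?thesis by (simp add: e_def)
  qed
  have br: "der_on UNIV (\<lambda>b. emb (bracket a b))" "emb (bracket a (scale c 1)) = 0" for a c
    by (simp_all add: der_on_def bracket_add_right bracket_leibniz bracket_const emb_simps)
  have frame: "poisson_frame scale bracket t z D"
  proof (intro poisson_frame.intro poisson_frame_axioms.intro poisson_algebra_axioms)
    show "D k y = 0" "z k = 0" if "t \<le> k" for k y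
      using that by (simp_all add: D_def z_def)
    show "D i (D j y) = D j (D i y)" for i j y
    proof -
      interpret Di: fract_derivation "D i" by (rule D_deriv)
      interpret Dj: fract_derivation "D j" by (rule D_deriv)
      have comm: "fract_derivation (\<lambda>y. D i (D j y) - D j (D i y))"
        by unfold_locales (simp_all add: Di.add Dj.add Di.mult Dj.mult algebra_simps)
      have "D i (D j y) - D j (D i y) = 0"
      proof (rule fract_derivation_eqI[OF comm])
        show "fract_derivation (\<lambda>_. 0)" by unfold_locales simp_all
        fix a
        have dd: "D k (D l (emb (z i))) = 0" if "i < t" for i k l
          using D_dual[OF that, of l] that
          by (cases "l < t") (simp_all add: fract_derivation.zero[OF D_deriv] fract_derivation.one[OF D_deriv] D_def[of l])
        show "D i (D j (emb a)) - D j (D i (emb a)) = 0"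
          by (rule zero'[OF fract_derivation_der_on[OF comm]]) (simp_all add: D_const Di.zero Dj.zero dd)
      qed
      then show ?thesis by simp
    qed
    show "emb (bracket a b) = (\<Sum>k<t. \<Sum>l<t. D k (emb a) * D l (emb b) * emb (bracket (z k) (z l)))" for a b
    proof -
      \<comment> \<open>\<open>expand\<close> treats the second argument of the bracket; skew
        symmetry carries the expansion over to the first.\<close>
      have "emb (bracket a (z l)) = (\<Sum>k<t. emb (bracket (z k) (z l)) * D k (emb a))" for l
      proof -
        have "emb (bracket a (z l)) = - emb (bracket (z l) a)"
          by (subst bracket_skew) (simp add: emb_simps)
        also have "\<dots> = (\<Sum>k<t. - emb (bracket (z l) (z k)) * D k (emb a))"
          using expand[OF br, of "z l" a] by (simp add: sum_negf)
        also have "\<dots> = (\<Sum>k<t. emb (bracket (z k) (z l)) * D k (emb a))"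
          by (rule sum.cong) (simp_all add: bracket_skew[of "z l"] emb_simps)
        finally show ?thesis .
      qed
      then have "emb (bracket a b) = (\<Sum>l<t. \<Sum>k<t. D k (emb a) * D l (emb b) * emb (bracket (z k) (z l)))"
        using expand[OF br, of a b] by (simp add: sum_distrib_right sum_distrib_left mult_ac)
      then show ?thesis by (subst sum.swap)
    qed
  qed (use D_deriv D_const D_dual in auto)
  show ?thesis
    by (rule that[OF frame t le _ expand]) (use jlJ in \<open>auto simp: z_def J_def\<close>)
qed

end

section \<open>Normal forms in the enveloping algebra\<close>

locale poisson_domain = poisson_algebra scale bracket
  for scale :: "'k::field \<Rightarrow> 'a::idom \<Rightarrow> 'a" and bracket
begin

abbreviation eqq (infix \<open>\<doteq>\<close> 50) where "p \<doteq> q \<equiv> pea_cong scale bracket p q"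
abbreviation AA where "AA a \<equiv> (free_var (Alpha a) :: 'a pea_gen list \<Rightarrow>\<^sub>0 'k)"
abbreviation BB where "BB a \<equiv> (free_var (Beta a) :: 'a pea_gen list \<Rightarrow>\<^sub>0 'k)"

end

text \<open>Here the \<open>z k\<close> are local generators of the differentials at P and need not
  be variables. Generation holds after multiplication by an element outside of P, while the
  independence of the Hamiltonian derivations is global; it is what separates normal forms.\<close>

locale local_frame = poisson_domain scale bracket
  for scale :: "'k::field \<Rightarrow> 'a::idom \<Rightarrow> 'a" and bracket +
  fixes P :: "'a set" and t :: nat and z :: "nat \<Rightarrow> 'a"
  assumes prime: "primeish P"
    and local_generators: "\<exists>s c. s \<notin> P \<and> AA s * BB b \<doteq> (\<Sum>k<t. AA (c k) * BB (z k))"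
    and hamiltonian_independent: "(\<And>b. (\<Sum>k<t. c k * bracket (z k) b) = 0) \<Longrightarrow> k < t \<Longrightarrow> c k = 0"
    and char0: "of_nat (Suc j) \<noteq> (0::'a)"
begin

lemmas rel = cong_relations[of scale bracket]

lemma lmult: "p \<doteq> q \<Longrightarrow> r * p \<doteq> r * q" and rmult: "p \<doteq> q \<Longrightarrow> p * r \<doteq> q * r"
  by (simp_all add: cong_mult)

lemma zero_diff: "p \<doteq> q \<Longrightarrow> 0 \<doteq> p - q"
  using cong_sym[OF cong_diff[OF _ cong_refl[of _ _ q]], of scale bracket p q] by simp

lemma A_commute: "AA a * AA b \<doteq> AA b * AA a"
  using cong_trans[OF cong_sym[OF rel(3)[of a b]]] rel(3)[of b a] by (simp add: mult.commute)

section \<open>Sorted monomials and straightening\<close>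

definition W :: "nat multiset \<Rightarrow> 'a pea_gen list \<Rightarrow>\<^sub>0 'k" where
  "W \<gamma> = prod_list (map (\<lambda>k. BB (z k)) (sorted_list_of_multiset \<gamma>))"

lemma W_empty: "W {#} = 1"
  by (simp add: W_def)

lemma W_add: "\<forall>j\<in>#\<gamma>. k \<le> j \<Longrightarrow> W (add_mset k \<gamma>) = BB (z k) * W \<gamma>"
  by (simp add: W_def insort_is_Cons)

definition std :: "(nat multiset \<Rightarrow>\<^sub>0 'a) \<Rightarrow> 'a pea_gen list \<Rightarrow>\<^sub>0 'k" where
  "std \<tau> = (\<Sum>\<gamma>\<in>Poly_Mapping.keys \<tau>. AA (Poly_Mapping.lookup \<tau> \<gamma>) * W \<gamma>)"

lemma std_superset:
  assumes "finite K" "Poly_Mapping.keys \<tau> \<subseteq> K"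
  shows "std \<tau> \<doteq> (\<Sum>\<gamma>\<in>K. AA (Poly_Mapping.lookup \<tau> \<gamma>) * W \<gamma>)"
proof -
  have "(\<Sum>\<gamma>\<in>K - Poly_Mapping.keys \<tau>. AA (Poly_Mapping.lookup \<tau> \<gamma>) * W \<gamma>) \<doteq> (\<Sum>\<gamma>\<in>K - Poly_Mapping.keys \<tau>. 0)"
  proof (rule cong_sum)
    fix \<gamma> assume "\<gamma> \<in> K - Poly_Mapping.keys \<tau>"
    then have "Poly_Mapping.lookup \<tau> \<gamma> = 0" by (simp add: in_keys_iff)
    then show "AA (Poly_Mapping.lookup \<tau> \<gamma>) * W \<gamma> \<doteq> 0" using rmult[OF Av_0, of "W \<gamma>"] by simp
  qed
  then have "(\<Sum>\<gamma>\<in>K - Poly_Mapping.keys \<tau>. AA (Poly_Mapping.lookup \<tau> \<gamma>) * W \<gamma>) + std \<tau> \<doteq> 0 + std \<tau>"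
    by (intro cong_add) simp_all
  then have "(\<Sum>\<gamma>\<in>K. AA (Poly_Mapping.lookup \<tau> \<gamma>) * W \<gamma>) \<doteq> std \<tau>"
    unfolding std_def by (subst (asm) sum.subset_diff[OF assms(2,1), symmetric]) simp
  then show ?thesis by (rule cong_sym)
qed

lemma std_add: "std (\<tau> + \<tau>') \<doteq> std \<tau> + std \<tau>'"
proof -
  let ?K = "Poly_Mapping.keys \<tau> \<union> Poly_Mapping.keys \<tau>'"
  have "std (\<tau> + \<tau>') \<doteq> (\<Sum>\<gamma>\<in>?K. AA (Poly_Mapping.lookup (\<tau> + \<tau>') \<gamma>) * W \<gamma>)"
    by (rule std_superset) (simp_all add: Poly_Mapping.keys_add)
  also have "\<dots> \<doteq> (\<Sum>\<gamma>\<in>?K. AA (Poly_Mapping.lookup \<tau> \<gamma>) * W \<gamma> + AA (Poly_Mapping.lookup \<tau>' \<gamma>) * W \<gamma>)"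
    unfolding lookup_add distrib_right[symmetric] by (intro cong_sum rmult rel)
  also have "\<dots> \<doteq> std \<tau> + std \<tau>'"
    unfolding sum.distrib by (intro cong_add cong_sym[OF std_superset]) simp_all
  finally show ?thesis .
qed

lemma std_single: "std (Poly_Mapping.single \<gamma> a) \<doteq> AA a * W \<gamma>"
  using std_superset[of "{\<gamma>}" "Poly_Mapping.single \<gamma> a"] by simp

lemma std_cst_mult: "std (cst a * \<tau>) \<doteq> AA a * std \<tau>"
proof (induction \<tau> rule: pm_induct)
  case zero
  then show ?case by (simp add: std_def)
next
  case (add \<gamma> b \<tau>)
  have "std (cst a * Poly_Mapping.single \<gamma> b) \<doteq> AA a * std (Poly_Mapping.single \<gamma> b)"
    unfolding cst_mult_single
    using cong_trans[OF cong_trans[OF std_single rmult[OF rel(3)]] lmult[OF cong_sym[OF std_single[of \<gamma> b]], of "AA a", folded mult.assoc]] .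
  then have "std (cst a * Poly_Mapping.single \<gamma> b) + std (cst a * \<tau>) \<doteq> AA a * std (Poly_Mapping.single \<gamma> b) + AA a * std \<tau>"
    using add by (intro cong_add)
  then have "std (cst a * (Poly_Mapping.single \<gamma> b + \<tau>)) \<doteq> AA a * (std (Poly_Mapping.single \<gamma> b) + std \<tau>)"
    unfolding distrib_left using std_add cong_trans by blast
  then show ?case using lmult[OF cong_sym[OF std_add]] cong_trans by blast
qed

definition valid :: "nat \<Rightarrow> (nat multiset \<Rightarrow>\<^sub>0 'a) \<Rightarrow> bool" where
  "valid p \<tau> \<longleftrightarrow> (\<forall>\<gamma>\<in>Poly_Mapping.keys \<tau>. size \<gamma> \<le> p \<and> set_mset \<gamma> \<subseteq> {..<t})"

lemma valid_add: "valid p \<tau> \<Longrightarrow> valid p \<tau>' \<Longrightarrow> valid p (\<tau> + \<tau>')"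
  using Poly_Mapping.keys_add[of \<tau> \<tau>'] unfolding valid_def by blast

lemma valid_cst_mult: "valid p \<tau> \<Longrightarrow> valid p (cst a * \<tau>)"
  by (auto simp: valid_def dest!: subsetD[OF keys_mult] split: if_splits)

text \<open>The order filtration, localized at P: some multiple by an element outside of P is a
  combination of sorted monomials of length at most p. Elements outside of P play the part of
  denominators.\<close>

definition nf :: "nat \<Rightarrow> ('a pea_gen list \<Rightarrow>\<^sub>0 'k) \<Rightarrow> bool" where
  "nf p u \<longleftrightarrow> (\<exists>s \<tau>. s \<notin> P \<and> valid p \<tau> \<and> AA s * u \<doteq> std \<tau>)"

lemma one_notin: "1 \<notin> P"
  using prime by (simp add: primeish_def)

lemma nf_cong: "nf p u \<Longrightarrow> u \<doteq> u' \<Longrightarrow> nf p u'"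
proof -
  assume "nf p u" and u: "u \<doteq> u'"
  then obtain s \<tau> where s: "s \<notin> P" "valid p \<tau>" "AA s * u \<doteq> std \<tau>" by (auto simp: nf_def)
  have "AA s * u' \<doteq> std \<tau>" using cong_trans[OF cong_sym[OF lmult[OF u]] s(3)] .
  then show "nf p u'" unfolding nf_def using s by blast
qed

lemma nf_mono: "nf p u \<Longrightarrow> p \<le> p' \<Longrightarrow> nf p' u"
  unfolding nf_def valid_def by (meson order.trans)

lemma nf_local: "s \<notin> P \<Longrightarrow> nf p (AA s * u) \<Longrightarrow> nf p u"
proof -
  assume s: "s \<notin> P" and "nf p (AA s * u)"
  then obtain s' \<tau> where s': "s' \<notin> P" "valid p \<tau>" "AA s' * (AA s * u) \<doteq> std \<tau>" by (auto simp: nf_def)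
  have "AA (s' * s) * u \<doteq> AA s' * (AA s * u)" using rmult[OF rel(3)] by (simp add: mult.assoc)
  then show "nf p u" unfolding nf_def using s' cong_trans primeish_mult[OF prime s'(1) s] by blast
qed

lemma nf_A: "nf p u \<Longrightarrow> nf p (AA a * u)"
proof -
  assume "nf p u"
  then obtain s \<tau> where s: "s \<notin> P" "valid p \<tau>" "AA s * u \<doteq> std \<tau>" by (auto simp: nf_def)
  have "AA s * (AA a * u) \<doteq> AA a * (AA s * u)" using rmult[OF A_commute[of s a], of u] by (simp add: mult.assoc)
  also have "\<dots> \<doteq> AA a * std \<tau>" by (rule lmult[OF s(3)])
  also have "\<dots> \<doteq> std (cst a * \<tau>)" by (rule cong_sym[OF std_cst_mult])
  finally show "nf p (AA a * u)" unfolding nf_def using s(1) valid_cst_mult[OF s(2)] by blast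
qed

lemma nf_add: "nf p u \<Longrightarrow> nf p v \<Longrightarrow> nf p (u + v)"
proof -
  assume "nf p u" "nf p v"
  then obtain s \<tau> s' \<tau>' where s: "s \<notin> P" "valid p \<tau>" "AA s * u \<doteq> std \<tau>"
    and s': "s' \<notin> P" "valid p \<tau>'" "AA s' * v \<doteq> std \<tau>'" by (auto simp: nf_def)
  have "AA s' * (AA s * (u + v)) = AA s' * (AA s * u) + AA s' * AA s * v" by (simp add: distrib_left mult.assoc)
  also have "\<dots> \<doteq> AA s' * (AA s * u) + AA s * (AA s' * v)"
    unfolding mult.assoc[symmetric] by (intro cong_add cong_refl rmult A_commute)
  also have "\<dots> \<doteq> std (cst s' * \<tau>) + std (cst s * \<tau>')"
    by (intro cong_add cong_trans[OF lmult cong_sym[OF std_cst_mult]] s s')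
  also have "\<dots> \<doteq> std (cst s' * \<tau> + cst s * \<tau>')" by (rule cong_sym[OF std_add])
  finally have "nf p (AA s * (u + v))"
    unfolding nf_def using s'(1) valid_add[OF valid_cst_mult[OF s(2)] valid_cst_mult[OF s'(2)]] by blast
  then show "nf p (u + v)" by (rule nf_local[OF s(1)])
qed

lemma nf_0: "nf p 0"
  unfolding nf_def by (rule exI[of _ 1], rule exI[of _ 0]) (simp add: one_notin valid_def std_def)

lemma nf_uminus: "nf p u \<Longrightarrow> nf p (- u)"
proof (rule nf_cong[OF nf_A[of p u "-1"]])
  have "AA (- 1) * u \<doteq> - AA 1 * u" by (rule rmult[OF Av_uminus])
  also have "\<dots> \<doteq> - u" using cong_diff[OF cong_refl rmult[OF rel(1), of u], of 0] by simp
  finally show "AA (- 1) * u \<doteq> - u" .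
qed

lemma nf_diff: "nf p u \<Longrightarrow> nf p v \<Longrightarrow> nf p (u - v)"
  using nf_add[of p u "- v"] nf_uminus by simp

lemma nf_sum: "(\<And>i. i \<in> S \<Longrightarrow> nf p (f i)) \<Longrightarrow> nf p (sum f S)"
  by (induction S rule: infinite_finite_induct) (auto simp: nf_0 nf_add)

lemma nf_W: "set_mset \<gamma> \<subseteq> {..<t} \<Longrightarrow> nf (size \<gamma>) (W \<gamma>)"
  unfolding nf_def using cong_sym[OF std_single[of \<gamma> 1]]
  by (intro exI[of _ 1] exI[of _ "mon \<gamma>"]) (simp add: one_notin valid_def)

text \<open>Denominators are cleared twice, for u and for the form db. Moving db past the
  denominator s of u costs only {b, s} u, which has no larger order than u. What remains is the
  product of a generator and a sorted monomial.\<close>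

lemma nf_B_step:
  assumes mono: "\<And>k \<gamma>. k < t \<Longrightarrow> set_mset \<gamma> \<subseteq> {..<t} \<Longrightarrow> size \<gamma> \<le> p \<Longrightarrow> nf (Suc p) (BB (z k) * W \<gamma>)"
    and u: "nf p u"
  shows "nf (Suc p) (BB b * u)"
proof -
  obtain s \<tau> where s: "s \<notin> P" "valid p \<tau>" "AA s * u \<doteq> std \<tau>" using u by (auto simp: nf_def)
  obtain s' c where s': "s' \<notin> P" "AA s' * BB b \<doteq> (\<Sum>k<t. AA (c k) * BB (z k))" using local_generators by blast
  have std: "nf (Suc p) (BB (z k) * std \<tau>)" if k: "k < t" for k
    unfolding std_def sum_distrib_left
  proof (rule nf_sum)
    fix \<gamma> assume \<gamma>: "\<gamma> \<in> Poly_Mapping.keys \<tau>"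
    let ?a = "Poly_Mapping.lookup \<tau> \<gamma>"
    have "nf (Suc p) (AA ?a * (BB (z k) * W \<gamma>) + AA (bracket (z k) ?a) * W \<gamma>)"
      using s(2) \<gamma> k by (intro nf_add nf_A mono nf_mono[OF nf_W]) (auto simp: valid_def)
    moreover have "AA ?a * (BB (z k) * W \<gamma>) + AA (bracket (z k) ?a) * W \<gamma> \<doteq> BB (z k) * (AA ?a * W \<gamma>)"
      using cong_sym[OF rmult[OF Bv_Av[of scale bracket "z k" ?a], of "W \<gamma>"]] by (simp add: distrib_right mult.assoc)
    ultimately show "nf (Suc p) (BB (z k) * (AA ?a * W \<gamma>))" by (rule nf_cong)
  qed
  have "nf (Suc p) (\<Sum>k<t. AA (c k) * (BB (z k) * std \<tau>))" by (intro nf_sum nf_A std) simp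
  moreover have "(\<Sum>k<t. AA (c k) * (BB (z k) * std \<tau>)) \<doteq> AA s' * (BB b * (AA s * u))"
    using cong_sym[OF cong_mult[OF s'(2) s(3)]] by (simp add: sum_distrib_right mult.assoc)
  ultimately have "nf (Suc p) (BB b * (AA s * u))" using nf_cong nf_local[OF s'(1)] by blast
  moreover have "nf (Suc p) (AA (bracket b s) * u)" by (intro nf_A nf_mono[OF u]) simp
  ultimately have "nf (Suc p) (BB b * (AA s * u) - AA (bracket b s) * u)" by (rule nf_diff)
  moreover have "BB b * (AA s * u) - AA (bracket b s) * u \<doteq> AA s * (BB b * u)"
    using cong_diff[OF rmult[OF Bv_Av[of scale bracket b s], of u] cong_refl, of "AA (bracket b s) * u"]
    by (simp add: distrib_right mult.assoc)
  ultimately show ?thesis using nf_cong nf_local[OF s(1)] by blast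
qed

text \<open>Inserting a generator at its sorted place changes a product only in lower order, and
  multiplying by db raises the order by at most one. Each claim feeds the other: insertion at order
  p + 1 uses both claims at order p, and the product claim then follows by
  \<open>nf_B_step\<close>.\<close>

lemma nf_straighten:
  "(k < t \<longrightarrow> set_mset \<gamma> \<subseteq> {..<t} \<longrightarrow> size \<gamma> \<le> p \<longrightarrow> nf p (BB (z k) * W \<gamma> - W (add_mset k \<gamma>))) \<and>
   (nf p u \<longrightarrow> nf (Suc p) (BB b * u))"
proof (induction p arbitrary: k \<gamma> b u)
  have step: "nf (Suc p) (BB b * u)"
    if *: "\<And>k \<gamma>. k < t \<Longrightarrow> set_mset \<gamma> \<subseteq> {..<t} \<Longrightarrow> size \<gamma> \<le> p \<Longrightarrow> nf p (BB (z k) * W \<gamma> - W (add_mset k \<gamma>))"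
      and u: "nf p u" for p b u
  proof (rule nf_B_step[OF _ u])
    fix k \<gamma> assume k: "k < t" "set_mset \<gamma> \<subseteq> {..<t}" "size \<gamma> \<le> p"
    have "nf (Suc p) (BB (z k) * W \<gamma> - W (add_mset k \<gamma>) + W (add_mset k \<gamma>))"
      by (intro nf_add nf_mono[OF *[OF k]] nf_mono[OF nf_W]) (use k in auto)
    then show "nf (Suc p) (BB (z k) * W \<gamma>)" by simp
  qed
  {
    case 0
    have 1: "nf 0 (BB (z k) * W \<gamma> - W (add_mset k \<gamma>))" if "size \<gamma> \<le> 0" for k \<gamma>
      using that by (simp add: W_add nf_0)
    then show ?case using step[of 0 u b] by blast
  next
    case (Suc p)
    have IH1: "nf p (BB (z k) * W \<gamma> - W (add_mset k \<gamma>))" if "k < t" "set_mset \<gamma> \<subseteq> {..<t}" "size \<gamma> \<le> p" for k \<gamma>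
      using Suc that by blast
    have IH2: "nf (Suc p) (BB b * u)" if "nf p u" for b u using Suc that by blast
    have 1: "nf (Suc p) (BB (z k) * W \<gamma> - W (add_mset k \<gamma>))" if k: "k < t" "set_mset \<gamma> \<subseteq> {..<t}" "size \<gamma> \<le> Suc p" for k \<gamma>
    proof (cases "\<forall>j\<in>#\<gamma>. k \<le> j")
      case True
      then show ?thesis by (simp add: W_add nf_0)
    next
      case False
      then obtain j0 where "j0 \<in># \<gamma>" "j0 < k" by (auto simp: not_le)
      note Min = Min_mset_less[OF this]
      define j where "j = Min_mset \<gamma>"
      define \<gamma>' where "\<gamma>' = \<gamma> - {#j#}"
      have \<gamma>: "\<gamma> = add_mset j \<gamma>'" "\<forall>l\<in>#\<gamma>'. j \<le> l" "j < k" "set_mset \<gamma>' \<subseteq> {..<t}" "size \<gamma>' \<le> p"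
        using Min k by (auto simp: \<gamma>'_def j_def size_Diff_singleton dest: in_diffD)
      have W1: "W \<gamma> = BB (z j) * W \<gamma>'" "W (add_mset k \<gamma>) = BB (z j) * W (add_mset k \<gamma>')"
        using \<gamma>(2,3) by (simp_all add: \<gamma>(1) W_add add_mset_commute[of k j])
      \<comment> \<open>With j minimal, swap the two front factors: the error consists of
        \<open>z j\<close> times the insertion error for the shorter monomial and of a commutator
        term, both of order at most p + 1.\<close>
      have "nf (Suc p) (BB (z j) * (BB (z k) * W \<gamma>' - W (add_mset k \<gamma>')) + BB (bracket (z k) (z j)) * W \<gamma>')"
        by (intro nf_add IH2 IH1 nf_mono[OF nf_W] k \<gamma>)
      moreover have "BB (z j) * (BB (z k) * W \<gamma>' - W (add_mset k \<gamma>')) + BB (bracket (z k) (z j)) * W \<gamma>'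
          \<doteq> BB (z k) * W \<gamma> - W (add_mset k \<gamma>)"
        using cong_diff[OF cong_sym[OF rmult[OF Bv_Bv[of scale bracket "z k" "z j"], of "W \<gamma>'"]] cong_refl,
            of "BB (z j) * W (add_mset k \<gamma>')"]
        by (simp add: W1 algebra_simps)
      ultimately show ?thesis by (rule nf_cong)
    qed
    then show ?case using step[of "Suc p" u b] by blast
  }
qed

lemma ex_nf: "\<exists>p. nf p u"
proof (induction u rule: pea_induct[of scale bracket])
  case (add p q)
  then obtain a b where "nf a p" "nf b q" by blast
  then have "nf (max a b) (p + q)" by (intro nf_add nf_mono[of _ _ "max a b"]) auto
  then show ?case by blast
next
  case one
  show ?case using nf_W[of "{#}"] by (auto simp: W_empty)
qed (use nf_cong nf_A nf_straighten in blast)+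

section \<open>Symbols\<close>

text \<open>The partial derivative with respect to the k-th indeterminate, where multisets are the
  monomials.\<close>

definition pdm :: "nat \<Rightarrow> (nat multiset \<Rightarrow>\<^sub>0 'a) \<Rightarrow> nat multiset \<Rightarrow>\<^sub>0 'a" where
  "pdm k \<sigma> = (\<Sum>\<gamma>\<in>Poly_Mapping.keys \<sigma>. Poly_Mapping.single (\<gamma> - {#k#}) (of_nat (count \<gamma> k) * Poly_Mapping.lookup \<sigma> \<gamma>))"

lemma pdm_add: "pdm k (\<sigma> + \<sigma>') = pdm k \<sigma> + pdm k \<sigma>'"
  unfolding pdm_def by (rule sum_keys_add) (simp_all add: distrib_left single_add)

lemma pdm_single: "pdm k (Poly_Mapping.single \<gamma> a) = Poly_Mapping.single (\<gamma> - {#k#}) (of_nat (count \<gamma> k) * a)"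
  unfolding pdm_def by (subst sum_keys_single) simp_all

lemma pdm_0: "pdm k 0 = 0"
  by (simp add: pdm_def)

lemma pdm_cst_mult: "pdm k (cst a * \<sigma>) = cst a * pdm k \<sigma>"
  by (induction \<sigma> rule: pm_induct)
     (simp_all add: pdm_0 pdm_add pdm_single distrib_left cst_mult_single mult.left_commute)

lemma pdm_gen_mult: "pdm k (mon {#l#} * \<sigma>) = mon {#l#} * pdm k \<sigma> + (if k = l then \<sigma> else 0)"
proof (induction \<sigma> rule: pm_induct)
  case (add \<gamma> a \<sigma>)
  have "pdm k (mon {#l#} * Poly_Mapping.single \<gamma> a) = mon {#l#} * pdm k (Poly_Mapping.single \<gamma> a) +
      (if k = l then Poly_Mapping.single \<gamma> a else 0)"
  proof (cases "k \<in># \<gamma>")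
    case True
    then have "add_mset l \<gamma> - {#k#} = add_mset l (\<gamma> - {#k#})" by (simp add: multiset_eq_iff)
    then show ?thesis using True
      by (auto simp: mult_single pdm_single distrib_right single_add insert_DiffM)
  next
    case False
    then have "count \<gamma> k = 0" by (simp add: count_eq_zero_iff)
    then show ?thesis by (auto simp: mult_single pdm_single)
  qed
  with add show ?case by (simp add: distrib_left pdm_add algebra_simps)
qed (simp add: pdm_0)

lemma lookup_pdm: "Poly_Mapping.lookup (pdm k \<sigma>) \<gamma> = of_nat (Suc (count \<gamma> k)) * Poly_Mapping.lookup \<sigma> (add_mset k \<gamma>)"
proof (induction \<sigma> rule: pm_induct)
  case (add v a \<sigma>)
  have "Poly_Mapping.lookup (pdm k (Poly_Mapping.single v a)) \<gamma> =
    of_nat (Suc (count \<gamma> k)) * Poly_Mapping.lookup (Poly_Mapping.single v a) (add_mset k \<gamma>)"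
  proof (cases "k \<in># v")
    case True
    then have "v - {#k#} = \<gamma> \<longleftrightarrow> v = add_mset k \<gamma>" by (metis add_mset_remove_trivial insert_DiffM)
    then show ?thesis by (auto simp: pdm_single lookup_single when_def)
  next
    case False
    then have "count v k = 0" "v \<noteq> add_mset k \<gamma>" by (auto simp: count_eq_zero_iff)
    then show ?thesis by (simp add: pdm_single lookup_single when_def)
  qed
  with add show ?case by (simp add: pdm_add lookup_add distrib_left del: of_nat_Suc)
qed (simp add: pdm_0)

text \<open>The commutator with \<open>b\<close> acts on symbols as a derivation that lowers the degree.\<close>

definition nab :: "'a \<Rightarrow> (nat multiset \<Rightarrow>\<^sub>0 'a) \<Rightarrow> nat multiset \<Rightarrow>\<^sub>0 'a" where
  "nab b \<sigma> = (\<Sum>k<t. cst (bracket (z k) b) * pdm k \<sigma>)"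

lemma nab_add: "nab b (\<sigma> + \<sigma>') = nab b \<sigma> + nab b \<sigma>'"
  by (simp add: nab_def pdm_add distrib_left sum.distrib)

lemma nab_0: "nab b 0 = 0"
  by (simp add: nab_def pdm_0)

lemma nab_cst_mult: "nab b (cst a * \<sigma>) = cst a * nab b \<sigma>"
  by (simp add: nab_def pdm_cst_mult sum_distrib_left mult.left_commute)

lemma nab_cst: "nab b (cst a) = 0"
  by (simp add: nab_def pdm_single)

lemma nab_gen_mult: "l < t \<Longrightarrow> nab b (mon {#l#} * \<sigma>) = mon {#l#} * nab b \<sigma> + cst (bracket (z l) b) * \<sigma>"
proof -
  assume l: "l < t"
  have "nab b (mon {#l#} * \<sigma>) = (\<Sum>k<t. mon {#l#} * (cst (bracket (z k) b) * pdm k \<sigma>)) +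
      (\<Sum>k<t. if k = l then cst (bracket (z k) b) * \<sigma> else 0)"
    unfolding nab_def pdm_gen_mult sum.distrib[symmetric]
    by (rule sum.cong) (auto simp: distrib_left mult.left_commute)
  then show ?thesis using l by (simp add: nab_def sum_distrib_left)
qed

text \<open>\<open>sym p u \<sigma>\<close>: \<open>u\<close> has order at most \<open>p\<close> and \<open>\<sigma>\<close> is its symbol of order \<open>p\<close>.\<close>

inductive sym :: "nat \<Rightarrow> ('a pea_gen list \<Rightarrow>\<^sub>0 'k) \<Rightarrow> (nat multiset \<Rightarrow>\<^sub>0 'a) \<Rightarrow> bool" where
  sym_const: "sym 0 1 1"
| sym_zero: "sym p 0 0"
| sym_add: "sym p u \<sigma> \<Longrightarrow> sym p u' \<sigma>' \<Longrightarrow> sym p (u + u') (\<sigma> + \<sigma>')"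
| sym_low: "sym p u \<sigma> \<Longrightarrow> sym (Suc p) u 0"
| sym_gen: "k < t \<Longrightarrow> sym p u \<sigma> \<Longrightarrow> sym (Suc p) (BB (z k) * u) (mon {#k#} * \<sigma>)"
| sym_scal: "sym p u \<sigma> \<Longrightarrow> sym p (AA a * u) (cst a * \<sigma>)"
| sym_cong: "sym p u \<sigma> \<Longrightarrow> u \<doteq> u' \<Longrightarrow> sym p u' \<sigma>"

lemma sym_order_0: "sym p u \<sigma> \<Longrightarrow> p = 0 \<Longrightarrow> \<exists>a. u \<doteq> AA a \<and> \<sigma> = cst a"
proof (induction rule: sym.induct)
  case sym_const
  show ?case using cong_sym[OF rel(1)] by (auto simp: cst_1 intro!: exI[of _ 1])
next
  case (sym_zero p)
  show ?case using cong_sym[OF Av_0] by (auto intro!: exI[of _ 0])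
next
  case (sym_add p u \<sigma> u' \<sigma>')
  then obtain a a' where "u \<doteq> AA a" "\<sigma> = cst a" "u' \<doteq> AA a'" "\<sigma>' = cst a'" by blast
  then have "u + u' \<doteq> AA (a + a')" "\<sigma> + \<sigma>' = cst (a + a')"
    by (auto simp: single_add intro: cong_trans[OF cong_add cong_sym[OF rel(2)]])
  then show ?case by blast
next
  case (sym_scal p u \<sigma> a)
  then obtain b where "u \<doteq> AA b" "\<sigma> = cst b" by blast
  then have "AA a * u \<doteq> AA (a * b)" "cst a * \<sigma> = cst (a * b)"
    by (auto simp: cst_mult intro: cong_trans[OF lmult cong_sym[OF rel(3)]])
  then show ?case by blast
next
  case (sym_cong p u \<sigma> u')
  then show ?case using cong_trans[OF cong_sym] by blast
qed auto

lemma sym_keys: "sym p u \<sigma> \<Longrightarrow> \<gamma> \<in> Poly_Mapping.keys \<sigma> \<Longrightarrow> size \<gamma> = p \<and> set_mset \<gamma> \<subseteq> {..<t}"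
proof (induction arbitrary: \<gamma> rule: sym.induct)
  case sym_const
  then show ?case by simp
next
  case (sym_add p u \<sigma> u' \<sigma>')
  then show ?case using Poly_Mapping.keys_add[of \<sigma> \<sigma>'] by blast
next
  case (sym_gen k p u \<sigma>)
  from sym_gen.prems obtain \<gamma>' where "\<gamma>' \<in> Poly_Mapping.keys \<sigma>" "\<gamma> = add_mset k \<gamma>'"
    using keys_mult[of "mon {#k#}" \<sigma>] by auto
  then show ?case using sym_gen by auto
next
  case (sym_scal p u \<sigma> a)
  have "\<gamma> \<in> Poly_Mapping.keys \<sigma>"
    using sym_scal.prems by (auto dest!: subsetD[OF keys_mult] split: if_splits)
  then show ?case by (rule sym_scal.IH)
qed auto

text \<open>The commutator of \<beta>(z_k) and b is {z_k, b}, so commutation with b obeys the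
  product rule on symbols. Order zero is a case of its own: such elements commute with b, and there
  is no order below for the symbol of the commutator.\<close>

lemma sym_commutator:
  "sym p u \<sigma> \<Longrightarrow> (p = 0 \<longrightarrow> u * AA b \<doteq> AA b * u \<and> nab b \<sigma> = 0) \<and> (\<forall>q. p = Suc q \<longrightarrow> sym q (u * AA b - AA b * u) (nab b \<sigma>))"
proof (induction rule: sym.induct)
  case sym_const
  then show ?case using nab_cst[of b 1] by (simp add: cst_1)
next
  case (sym_zero p)
  then show ?case by (simp add: nab_0 sym.sym_zero)
next
  case (sym_add p u \<sigma> u' \<sigma>')
  have "sym q ((u * AA b - AA b * u) + (u' * AA b - AA b * u')) (nab b \<sigma> + nab b \<sigma>')" if "p = Suc q" for q
    using sym_add.IH that by (intro sym.sym_add) auto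
  then show ?case using sym_add.IH
    by (auto simp: nab_add distrib_left distrib_right algebra_simps intro: cong_add)
next
  case (sym_low p u \<sigma>)
  have "sym p (u * AA b - AA b * u) 0"
  proof (cases p)
    case 0
    then have "0 \<doteq> u * AA b - AA b * u" using sym_low.IH zero_diff by blast
    then show ?thesis by (rule sym_cong[OF sym_zero])
  next
    case (Suc q)
    then show ?thesis using sym_low.IH sym.sym_low by blast
  qed
  then show ?case by (simp add: nab_0)
next
  case (sym_gen k p u \<sigma>)
  have eq: "BB (z k) * (u * AA b - AA b * u) + AA (bracket (z k) b) * u \<doteq> BB (z k) * u * AA b - AA b * (BB (z k) * u)"
    using cong_diff[OF cong_refl cong_diff[OF rmult[OF Bv_Av[of scale bracket "z k" b], of u] cong_refl,
      of "AA (bracket (z k) b) * u"], of "BB (z k) * u * AA b"]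
    by (simp add: algebra_simps)
  have "sym p (BB (z k) * (u * AA b - AA b * u)) (mon {#k#} * nab b \<sigma>)"
  proof (cases p)
    case 0
    then have "0 \<doteq> u * AA b - AA b * u" "nab b \<sigma> = 0" using sym_gen.IH zero_diff by blast+
    then have "0 \<doteq> BB (z k) * (u * AA b - AA b * u)" using lmult[of 0 "u * AA b - AA b * u" "BB (z k)"] by simp
    then show ?thesis using sym_cong[OF sym_zero] \<open>nab b \<sigma> = 0\<close> by simp
  next
    case (Suc q)
    then show ?thesis using sym_gen.IH sym.sym_gen[OF sym_gen.hyps(1)] by blast
  qed
  from sym_cong[OF sym_add[OF this sym_scal[OF sym_gen.hyps(2), of "bracket (z k) b"]] eq]
  show ?case by (simp add: nab_gen_mult sym_gen.hyps(1))
next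
  case (sym_scal p u \<sigma> a)
  have eq: "AA a * (u * AA b - AA b * u) \<doteq> AA a * u * AA b - AA b * (AA a * u)"
    using cong_diff[OF cong_refl rmult[OF A_commute[of a b], of u], of "AA a * u * AA b"] by (simp add: algebra_simps)
  have "sym q (AA a * u * AA b - AA b * (AA a * u)) (cst a * nab b \<sigma>)" if "p = Suc q" for q
    using sym_scal.IH that by (intro sym_cong[OF sym.sym_scal eq]) auto
  moreover have "AA a * u * AA b \<doteq> AA b * (AA a * u)" if "u * AA b \<doteq> AA b * u"
    using cong_trans[OF lmult[OF that, of "AA a"] rmult[OF A_commute[of a b], of u, unfolded mult.assoc]] by (simp add: mult.assoc)
  ultimately show ?case using sym_scal.IH by (auto simp: nab_cst_mult)
next
  case (sym_cong p u \<sigma> u')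
  have "u * AA b \<doteq> u' * AA b" "AA b * u \<doteq> AA b * u'" using sym_cong.hyps(2) by (auto intro: lmult rmult)
  then have e: "u' * AA b \<doteq> AA b * u'" if "u * AA b \<doteq> AA b * u"
    using that by (blast intro: cong_trans cong_sym)
  show ?case
  proof (intro conjI allI impI)
    show "u' * AA b \<doteq> AA b * u'" "nab b \<sigma> = 0" if "p = 0" using that sym_cong.IH e by blast+
    show "sym q (u' * AA b - AA b * u') (nab b \<sigma>)" if "p = Suc q" for q
      using that sym_cong.IH \<open>u * AA b \<doteq> u' * AA b\<close> \<open>AA b * u \<doteq> AA b * u'\<close>
      by (blast intro: sym.sym_cong[OF _ cong_diff])
  qed
qed

text \<open>If u acts as zero on the algebra, so does its commutator with every b, and by induction
  \<open>nab b \<sigma> = 0\<close> for all b. Independence of the Hamiltonian derivations then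
  makes all partial derivatives of \<sigma> vanish. As \<sigma> is homogeneous of positive degree
  and the characteristic is zero, \<sigma> = 0. In order zero, apply u to 1.\<close>

lemma sym_unique:
  assumes "sym p u \<sigma>" "\<And>v. pi.ev u v = 0"
  shows "\<sigma> = 0"
  using assms
proof (induction p arbitrary: u \<sigma>)
  case 0
  obtain a where a: "u \<doteq> AA a" "\<sigma> = cst a" using sym_order_0[OF 0(1)] by blast
  have "a * 1 = 0" using 0(2)[of 1] pi.ev_cong[OF a(1), of 1] by (simp add: pi.ev_gens)
  then show ?case using a(2) by simp
next
  case (Suc p)
  have "nab b \<sigma> = 0" for b
  proof (rule Suc.IH)
    show "sym p (u * AA b - AA b * u) (nab b \<sigma>)" using sym_commutator[OF Suc.prems(1)] by blast
    show "pi.ev (u * AA b - AA b * u) v = 0" for v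
      using Suc.prems(2) by (simp add: pi.ev_diff pi.ev_mult pi.ev_gens)
  qed
  then have "(\<Sum>k<t. bracket (z k) b * Poly_Mapping.lookup (pdm k \<sigma>) \<gamma>) = 0" for b \<gamma>
  proof -
    assume *: "\<And>b. nab b \<sigma> = 0"
    have "Poly_Mapping.lookup (cst a * q) \<gamma> = a * Poly_Mapping.lookup q \<gamma>" for a and q :: "nat multiset \<Rightarrow>\<^sub>0 'a"
      by (induction q rule: pm_induct) (simp_all add: distrib_left cst_mult_single lookup_add lookup_single when_def)
    then have "Poly_Mapping.lookup (nab b \<sigma>) \<gamma> = (\<Sum>k<t. bracket (z k) b * Poly_Mapping.lookup (pdm k \<sigma>) \<gamma>)"
      by (simp add: nab_def lookup_sum)
    then show ?thesis by (simp add: *)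
  qed
  then have pdm: "Poly_Mapping.lookup (pdm k \<sigma>) \<gamma> = 0" if "k < t" for k \<gamma>
    using hamiltonian_independent[of "\<lambda>k. Poly_Mapping.lookup (pdm k \<sigma>) \<gamma>" k] that by (simp add: mult.commute)
  show ?case
  proof (rule ccontr)
    assume "\<sigma> \<noteq> 0"
    then obtain \<gamma> where \<gamma>: "\<gamma> \<in> Poly_Mapping.keys \<sigma>" by (metis keys_eq_empty ex_in_conv)
    then have "size \<gamma> = Suc p" "set_mset \<gamma> \<subseteq> {..<t}" using sym_keys[OF Suc.prems(1)] by auto
    then obtain k \<gamma>' where "\<gamma> = add_mset k \<gamma>'" "k < t" by (auto simp: size_eq_Suc_imp_eq_union dest!: size_eq_Suc_imp_eq_union)
    then show False using pdm[of k \<gamma>'] char0 \<gamma> unfolding lookup_pdm by (simp add: in_keys_iff del: of_nat_Suc)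
  qed
qed

lemma sym_W: "set_mset \<gamma> \<subseteq> {..<t} \<Longrightarrow> sym (size \<gamma>) (W \<gamma>) (mon \<gamma>)"
proof -
  have "set ks \<subseteq> {..<t} \<Longrightarrow> sym (length ks) (prod_list (map (\<lambda>k. BB (z k)) ks)) (mon (mset ks))" for ks
  proof (induction ks)
    case Nil
    show ?case using sym_const by (simp add: cst_1)
  next
    case (Cons k ks)
    then show ?case using sym_gen[of k "length ks" _ "mon (mset ks)"] by (simp add: mult_single)
  qed
  from this[of "sorted_list_of_multiset \<gamma>"] show "set_mset \<gamma> \<subseteq> {..<t} \<Longrightarrow> ?thesis"
    by (simp add: W_def flip: size_mset)
qed

lemma sym_raise: "sym p u \<sigma> \<Longrightarrow> p < q \<Longrightarrow> sym q u 0"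
proof (induction q)
  case (Suc q)
  then show ?case using sym_low by (cases "p = q") auto
qed simp

text \<open>The symbol is the homogeneous part of degree p; shorter monomials contribute zero by
  \<open>sym_low\<close>.\<close>

lemma sym_std:
  assumes "valid p \<tau>"
  shows "sym p (std \<tau>) (\<Sum>\<gamma>\<in>Poly_Mapping.keys \<tau>. if size \<gamma> = p then Poly_Mapping.single \<gamma> (Poly_Mapping.lookup \<tau> \<gamma>) else 0)"
proof -
  have "sym p (\<Sum>\<gamma>\<in>K. AA (Poly_Mapping.lookup \<tau> \<gamma>) * W \<gamma>)
      (\<Sum>\<gamma>\<in>K. if size \<gamma> = p then Poly_Mapping.single \<gamma> (Poly_Mapping.lookup \<tau> \<gamma>) else 0)"
    if "finite K" "K \<subseteq> Poly_Mapping.keys \<tau>" for K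
    using that
  proof (induction K)
    case (insert \<gamma> K)
    let ?a = "Poly_Mapping.lookup \<tau> \<gamma>"
    have \<gamma>: "size \<gamma> \<le> p" "set_mset \<gamma> \<subseteq> {..<t}" using assms insert.prems by (auto simp: valid_def)
    have s: "sym (size \<gamma>) (AA ?a * W \<gamma>) (Poly_Mapping.single \<gamma> ?a)"
      using sym_scal[OF sym_W[OF \<gamma>(2)], of ?a] by (simp add: cst_mult_single)
    have "sym p (AA ?a * W \<gamma>) (if size \<gamma> = p then Poly_Mapping.single \<gamma> ?a else 0)"
      using s sym_raise[OF s] \<gamma>(1) by auto
    then show ?case using insert by (simp add: sym_add)
  qed (simp add: sym_zero)
  then show ?thesis unfolding std_def by simp
qed

text \<open>The top homogeneous part is the symbol of an element acting as zero, so it vanishes and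
  the order bound drops by one.\<close>

lemma std_injective: "valid p \<tau> \<Longrightarrow> (\<And>v. pi.ev (std \<tau>) v = 0) \<Longrightarrow> \<tau> = 0"
proof (induction p)
  have no_top: "size \<gamma> \<noteq> p" if "valid p \<tau>" "\<And>v. pi.ev (std \<tau>) v = 0" "\<gamma> \<in> Poly_Mapping.keys \<tau>" for p \<gamma>
  proof
    assume p: "size \<gamma> = p"
    have "Poly_Mapping.lookup (\<Sum>\<gamma>\<in>Poly_Mapping.keys \<tau>. if size \<gamma> = p then Poly_Mapping.single \<gamma> (Poly_Mapping.lookup \<tau> \<gamma>) else 0) \<gamma> = 0"
      using sym_unique[OF sym_std[OF that(1)] that(2)] by simp
    also have "Poly_Mapping.lookup (\<Sum>\<gamma>\<in>Poly_Mapping.keys \<tau>. if size \<gamma> = p then Poly_Mapping.single \<gamma> (Poly_Mapping.lookup \<tau> \<gamma>) else 0) \<gamma>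
      = (\<Sum>\<gamma>'\<in>Poly_Mapping.keys \<tau>. if \<gamma>' = \<gamma> then Poly_Mapping.lookup \<tau> \<gamma> else 0)"
      unfolding lookup_sum by (rule sum.cong) (use p in \<open>auto simp: lookup_single when_def\<close>)
    finally show False using that(3) by (simp add: in_keys_iff)
  qed
  {
    case 0
    then have "Poly_Mapping.keys \<tau> = {}" using no_top[of 0] by (fastforce simp: valid_def)
    then show ?case by simp
  next
    case (Suc p)
    have "valid p \<tau>" using Suc.prems(1) no_top[OF Suc.prems] by (fastforce simp: valid_def le_Suc_eq)
    then show ?case using Suc by blast
  }
qed

theorem locally_faithful:
  assumes "\<And>v. pi.ev u v = 0"
  shows "\<exists>s. s \<notin> P \<and> AA s * u \<doteq> 0"
proof -
  obtain p s \<tau> where s: "s \<notin> P" "valid p \<tau>" "AA s * u \<doteq> std \<tau>" using ex_nf[of u] by (auto simp: nf_def)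
  have "pi.ev (std \<tau>) v = 0" for v
    using pi.ev_cong[OF s(3), of v] assms by (simp add: pi.ev_mult pi.ev_gens)
  then have "\<tau> = 0" by (rule std_injective[OF s(2)])
  then show ?thesis using s by (auto simp: std_def)
qed

end

section \<open>Maximal ideals\<close>

text \<open>A maximal element among the proper ideals above J is prime. In the application J is the
  ideal of those elements that annihilate a given element of the enveloping algebra.\<close>

lemma ex_prime_above:
  fixes J :: "'a::comm_ring_1 set"
  assumes J: "0 \<in> J" "\<And>a b. a \<in> J \<Longrightarrow> b \<in> J \<Longrightarrow> a + b \<in> J" "\<And>a r. a \<in> J \<Longrightarrow> r * a \<in> J" "1 \<notin> J"
  shows "\<exists>P. primeideal P class_ring \<and> J \<subseteq> P"
proof -
  define idl :: "'a set \<Rightarrow> bool" where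
    "idl I \<longleftrightarrow> J \<subseteq> I \<and> 1 \<notin> I \<and> (\<forall>a\<in>I. \<forall>b\<in>I. a + b \<in> I) \<and> (\<forall>a\<in>I. \<forall>r. r * a \<in> I)" for I
  have "\<exists>P\<in>{I. idl I}. \<forall>I\<in>{I. idl I}. P \<subseteq> I \<longrightarrow> I = P"
  proof (rule subset_Zorn_nonempty)
    show "{I. idl I} \<noteq> {}" using J by (auto simp: idl_def intro!: exI[of _ J])
    fix CC assume CC: "CC \<noteq> {}" "subset.chain {I. idl I} CC"
    then have idl: "I \<in> CC \<Longrightarrow> idl I" and total: "I \<in> CC \<Longrightarrow> I' \<in> CC \<Longrightarrow> I \<subseteq> I' \<or> I' \<subseteq> I" for I I'
      by (auto simp: subset.chain_def)
    have "a + b \<in> \<Union>CC" if ab: "a \<in> \<Union>CC" "b \<in> \<Union>CC" for a b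
    proof -
      obtain I I' where I: "I \<in> CC" "a \<in> I" "I' \<in> CC" "b \<in> I'" using ab by blast
      have "a \<in> I' \<and> b \<in> I' \<or> a \<in> I \<and> b \<in> I" using total[OF I(1,3)] I by blast
      then show ?thesis using idl I unfolding idl_def by blast
    qed
    moreover have "J \<subseteq> \<Union>CC" using CC(1) idl unfolding idl_def by blast
    moreover have "1 \<notin> \<Union>CC" "\<forall>a\<in>\<Union>CC. \<forall>r. r * a \<in> \<Union>CC" using idl unfolding idl_def by blast+
    ultimately show "\<Union>CC \<in> {I. idl I}" by (simp add: idl_def)
  qed
  then obtain P where P: "idl P" and max: "\<And>I. idl I \<Longrightarrow> P \<subseteq> I \<Longrightarrow> I = P" by auto
  have P0: "0 \<in> P" and Padd: "a \<in> P \<Longrightarrow> b \<in> P \<Longrightarrow> a + b \<in> P" and Pmult: "a \<in> P \<Longrightarrow> r * a \<in> P" and P1: "1 \<notin> P" for a b r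
    using P J(1) unfolding idl_def by blast+
  have prime: "a \<in> P \<or> b \<in> P" if "a * b \<in> P" for a b
  proof (rule ccontr)
    assume ab: "\<not> (a \<in> P \<or> b \<in> P)"
    define Q where "Q = {p + r * a | p r. p \<in> P}"
    have "p = p + 0 * a" for p by simp
    then have PQ: "P \<subseteq> Q" unfolding Q_def by blast
    have "a = 0 + 1 * a" by simp
    then have "a \<in> Q" unfolding Q_def using P0 by blast
    have "1 \<in> Q"
    proof (rule ccontr)
      assume "1 \<notin> Q"
      moreover have "u + v \<in> Q" if uv: "u \<in> Q" "v \<in> Q" for u v
      proof -
        obtain p r p' r' where "u = p + r * a" "p \<in> P" "v = p' + r' * a" "p' \<in> P" using uv by (auto simp: Q_def)
        then have "u + v = (p + p') + (r + r') * a \<and> p + p' \<in> P" using Padd by (simp add: algebra_simps)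
        then show ?thesis unfolding Q_def by blast
      qed
      moreover have "s * u \<in> Q" if u: "u \<in> Q" for s u
      proof -
        obtain p r where "u = p + r * a" "p \<in> P" using u by (auto simp: Q_def)
        then have "s * u = s * p + (s * r) * a \<and> s * p \<in> P" using Pmult by (simp add: algebra_simps)
        then show ?thesis unfolding Q_def by blast
      qed
      ultimately have "idl Q" using PQ P unfolding idl_def by blast
      then show False using max[OF _ PQ] \<open>a \<in> Q\<close> ab by blast
    qed
    then obtain p r where pr: "1 = p + r * a" "p \<in> P" by (auto simp: Q_def)
    have "b = b * (p + r * a)" by (simp flip: pr(1))
    then have "b = b * p + r * (a * b)" by (simp add: algebra_simps)
    moreover have "\<dots> \<in> P" using Padd Pmult pr(2) that by blast
    ultimately show False using ab by simp
  qed
  have "ideal P class_ring"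
  proof (rule idealI[OF class_ring.ring_axioms])
    show "subgroup P (add_monoid class_ring)"
    proof (rule group.subgroupI[OF abelian_group.a_group[OF ring.is_abelian_group[OF class_ring.ring_axioms]]])
      fix a assume a: "a \<in> P"
      have "- a \<in> P" using Pmult[OF a, of "- 1"] by simp
      moreover have "inv\<^bsub>add_monoid class_ring\<^esub> a = - a"
        using abelian_group.minus_equality[OF ring.is_abelian_group[OF class_ring.ring_axioms], of "- a" a] by (simp add: a_inv_def)
      ultimately show "inv\<^bsub>add_monoid class_ring\<^esub> a \<in> P" by simp
    qed (use P0 Padd in auto)
  qed (use Pmult in \<open>auto simp: mult.commute\<close>)
  moreover have "cring (class_ring :: 'a ring)"
    by (intro cring.intro class_ring.ring_axioms comm_monoid.intro ring.is_monoid[OF class_ring.ring_axioms]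
        comm_monoid_axioms.intro) (simp add: mult.commute)
  ultimately have "primeideal P class_ring"
    by (intro primeidealI) (use P1 prime in auto)
  then show ?thesis using P unfolding idl_def by blast
qed

text \<open>In the permutation expansion every permutation other than the identity moves some i and
  so contributes an off-diagonal factor in P, while the product of the diagonal stays outside of
  P.\<close>

lemma det_mod_prime:
  assumes P: "primeish P" and diag: "\<And>i. i < n \<Longrightarrow> N i i \<notin> P"
    and off: "\<And>i j. i < n \<Longrightarrow> j < n \<Longrightarrow> i \<noteq> j \<Longrightarrow> N i j \<in> P"
  shows "det (mat n n (\<lambda>(i, j). N i j)) \<notin> (P :: 'a::comm_ring_1 set)"
proof
  have P': "0 \<in> P" "a \<in> P \<Longrightarrow> b \<in> P \<Longrightarrow> a + b \<in> P" "a \<in> P \<Longrightarrow> r * a \<in> P" for a b r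
    using P by (auto simp: primeish_def)
  let ?S = "{p. p permutes {0..<n}}"
  have fin: "finite ?S" by (rule finite_permutations) simp
  define F where "F p = signof p * (\<Prod>i=0..<n. N i (p i))" for p
  have det: "det (mat n n (\<lambda>(i, j). N i j)) = (\<Sum>p\<in>?S. F p)"
    unfolding det_def'[OF mat_carrier] F_def
  proof (intro sum.cong refl arg_cong2[of _ _ _ _ times] prod.cong)
    fix p i assume p: "p \<in> ?S" and i: "i \<in> {0..<n}"
    then have "p i \<in> {0..<n}" by (simp add: permutes_in_image del: atLeastLessThan_iff)
    then show "mat n n (\<lambda>(i, j). N i j) $$ (i, p i) = N i (p i)" using i by simp
  qed
  have "F p \<in> P" if p: "p \<in> ?S - {id}" for p
  proof -
    obtain i where i: "p i \<noteq> i" using p by (auto simp: fun_eq_iff)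
    then have "i < n" using p by (metis DiffD1 atLeastLessThan_iff mem_Collect_eq permutes_not_in zero_le)
    then have "p i < n" using p by (metis DiffD1 atLeastLessThan_iff mem_Collect_eq permutes_in_image zero_le)
    have "F p = (signof p * (\<Prod>i\<in>{0..<n} - {i}. N i (p i))) * N i (p i)"
      unfolding F_def using \<open>i < n\<close> by (subst prod.remove[of _ i]) (auto simp: mult_ac)
    then show ?thesis using P'(3)[OF off[OF \<open>i < n\<close> \<open>p i < n\<close>]] i by simp
  qed
  moreover have "sum F T \<in> P" if "finite T" "\<And>p. p \<in> T \<Longrightarrow> F p \<in> P" for T
    using that by (induction T) (auto intro: P')
  ultimately have rest: "sum F (?S - {id}) \<in> P" using fin by blast
  assume "det (mat n n (\<lambda>(i, j). N i j)) \<in> P"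
  moreover have "det (mat n n (\<lambda>(i, j). N i j)) = F id + sum F (?S - {id})"
    unfolding det using fin by (intro sum.remove) (auto simp: permutes_id)
  ultimately have "F id + sum F (?S - {id}) + (- 1) * sum F (?S - {id}) \<in> P"
    by (intro P'(2)[OF _ P'(3)[OF rest]]) simp
  then have "F id \<in> P" by simp
  moreover have "(\<Prod>i=0..<n. N i i) \<notin> P" by (rule primeish_prod[OF P]) (use diag in auto)
  ultimately show False by (simp add: F_def)
qed

section \<open>Local generators of the differentials\<close>

context poisson_domain
begin

text \<open>The set of allowed coefficients is a parameter because two cases interact: arbitrary
  coefficients, and coefficients in the prime for the error terms of Nakayama's lemma.\<close>

definition lin :: "'a set \<Rightarrow> 'a set \<Rightarrow> ('a pea_gen list \<Rightarrow>\<^sub>0 'k) \<Rightarrow> bool" where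
  "lin I Z u \<longleftrightarrow> (\<exists>c. (\<forall>z\<in>Z. c z \<in> I) \<and> u \<doteq> (\<Sum>z\<in>Z. AA (c z) * BB z))"

lemma lin_cong: "lin I Z u \<Longrightarrow> u \<doteq> v \<Longrightarrow> lin I Z v"
proof -
  assume "lin I Z u" and uv: "u \<doteq> v"
  then obtain c where c: "\<forall>z\<in>Z. c z \<in> I" "u \<doteq> (\<Sum>z\<in>Z. AA (c z) * BB z)" unfolding lin_def by blast
  then show "lin I Z v" unfolding lin_def using cong_trans[OF cong_sym[OF uv] c(2)] by blast
qed

lemma lin_add:
  assumes I: "\<And>a b. a \<in> I \<Longrightarrow> b \<in> I \<Longrightarrow> a + b \<in> I" and u: "lin I Z u" and v: "lin I Z v"
  shows "lin I Z (u + v)"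
proof -
  obtain c c' where c: "\<forall>z\<in>Z. c z \<in> I" "u \<doteq> (\<Sum>z\<in>Z. AA (c z) * BB z)"
    and c': "\<forall>z\<in>Z. c' z \<in> I" "v \<doteq> (\<Sum>z\<in>Z. AA (c' z) * BB z)" using u v unfolding lin_def by blast
  have "u + v \<doteq> (\<Sum>z\<in>Z. AA (c z) * BB z + AA (c' z) * BB z)"
    unfolding sum.distrib by (rule cong_add[OF c(2) c'(2)])
  also have "\<dots> \<doteq> (\<Sum>z\<in>Z. AA (c z + c' z) * BB z)"
    unfolding distrib_right[symmetric] by (intro cong_sum cong_mult cong_sym[OF cong_relations(2)] cong_refl)
  finally show ?thesis unfolding lin_def using c(1) c'(1) I by (intro exI[of _ "\<lambda>z. c z + c' z"]) blast
qed

lemma lin_A: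
  assumes I: "\<And>b. b \<in> I \<Longrightarrow> a * b \<in> I'" and u: "lin I Z u"
  shows "lin I' Z (AA a * u)"
proof -
  obtain c where c: "\<forall>z\<in>Z. c z \<in> I" "u \<doteq> (\<Sum>z\<in>Z. AA (c z) * BB z)" using u unfolding lin_def by blast
  have "AA a * u \<doteq> (\<Sum>z\<in>Z. AA a * AA (c z) * BB z)"
    using cong_mult[OF cong_refl c(2), of "AA a"] by (simp add: sum_distrib_left mult.assoc)
  also have "\<dots> \<doteq> (\<Sum>z\<in>Z. AA (a * c z) * BB z)"
    by (intro cong_sum cong_mult cong_sym[OF cong_relations(3)] cong_refl)
  finally show ?thesis unfolding lin_def using c(1) I by (intro exI[of _ "\<lambda>z. a * c z"]) blast
qed

lemma lin_0: "0 \<in> I \<Longrightarrow> lin I Z 0"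
proof -
  assume "0 \<in> I"
  have "(\<Sum>z\<in>Z. 0 * BB z) \<doteq> (\<Sum>z\<in>Z. AA 0 * BB z)"
    by (intro cong_sum cong_mult cong_sym[OF Av_0] cong_refl)
  then show ?thesis unfolding lin_def using \<open>0 \<in> I\<close> by (intro exI[of _ "\<lambda>_. 0"]) simp
qed

lemma lin_mono:
  assumes "lin I Z u" "Z \<subseteq> Z'" "finite Z'" "0 \<in> I"
  shows "lin I Z' u"
proof -
  obtain c where c: "\<forall>z\<in>Z. c z \<in> I" "u \<doteq> (\<Sum>z\<in>Z. AA (c z) * BB z)" using assms(1) unfolding lin_def by blast
  have "(\<Sum>z\<in>Z' - Z. 0 * BB z) \<doteq> (\<Sum>z\<in>Z' - Z. AA 0 * BB z)"
    by (intro cong_sum cong_mult cong_sym[OF Av_0] cong_refl)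
  then have "(\<Sum>z\<in>Z' - Z. 0) + u \<doteq> (\<Sum>z\<in>Z' - Z. AA 0 * BB z) + (\<Sum>z\<in>Z. AA (c z) * BB z)"
    by (intro cong_add c(2)) simp
  also have "\<dots> = (\<Sum>z\<in>Z' - Z. AA (if z \<in> Z then c z else 0) * BB z) + (\<Sum>z\<in>Z. AA (if z \<in> Z then c z else 0) * BB z)"
    by (intro arg_cong2[of _ _ _ _ "(+)"] sum.cong) auto
  also have "\<dots> = (\<Sum>z\<in>Z'. AA (if z \<in> Z then c z else 0) * BB z)"
    by (rule sum.subset_diff[OF assms(2,3), symmetric])
  finally show ?thesis unfolding lin_def using c(1) assms(4)
    by (intro exI[of _ "\<lambda>z. if z \<in> Z then c z else 0"]) auto
qed

lemma lin_gen: "finite Z \<Longrightarrow> z \<in> Z \<Longrightarrow> lin UNIV Z (BB z)"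
proof (rule lin_mono[of _ "{z}"])
  have "1 * BB z \<doteq> AA 1 * BB z" by (intro cong_mult cong_sym[OF cong_relations(1)] cong_refl)
  then show "lin UNIV {z} (BB z)" unfolding lin_def by (intro exI[of _ "\<lambda>_. 1"]) simp
qed auto

lemma lin_uminus:
  assumes "\<And>b. b \<in> I \<Longrightarrow> - b \<in> I" "lin I Z u"
  shows "lin I Z (- u)"
proof (rule lin_cong[OF lin_A[of I "-1" I, OF _ assms(2)]])
  have "AA (- 1) * u \<doteq> - AA 1 * u" by (rule cong_mult[OF Av_uminus cong_refl])
  also have "\<dots> \<doteq> - u" using cong_diff[OF cong_refl cong_mult[OF cong_relations(1)[of scale bracket] cong_refl[of scale bracket u]], of 0] by simp
  finally show "AA (- 1) * u \<doteq> - u" .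
qed (use assms in simp)

lemma lin_sum: "0 \<in> I \<Longrightarrow> (\<And>a b. a \<in> I \<Longrightarrow> b \<in> I \<Longrightarrow> a + b \<in> I) \<Longrightarrow> (\<And>s. s \<in> S \<Longrightarrow> lin I Z (f s)) \<Longrightarrow> lin I Z (sum f S)"
proof (induction S rule: infinite_finite_induct)
  case (insert s S)
  then have "lin I Z (f s + sum f S)" by (intro lin_add) auto
  then show ?case using insert.hyps by simp
qed (simp_all add: lin_0)

lemma linU:
  "lin UNIV Z u \<Longrightarrow> lin UNIV Z v \<Longrightarrow> lin UNIV Z (u + v)"
  "lin UNIV Z u \<Longrightarrow> lin UNIV Z v \<Longrightarrow> lin UNIV Z (u - v)"
  "lin UNIV Z u \<Longrightarrow> lin UNIV Z (AA a * u)"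
proof -
  show 1: "lin UNIV Z u \<Longrightarrow> lin UNIV Z v \<Longrightarrow> lin UNIV Z (u + v)" for u v
    by (rule lin_add) simp_all
  show "lin UNIV Z (AA a * u)" if "lin UNIV Z u"
    by (rule lin_A[OF _ that]) simp
  show "lin UNIV Z (u - v)" if u: "lin UNIV Z u" and v: "lin UNIV Z v"
    using 1[OF u lin_uminus[OF _ v]] by simp
qed

lemma B_const: "BB (scale x 1) \<doteq> 0"
proof -
  have "BB (1 * 1) \<doteq> AA 1 * BB 1 + AA 1 * BB 1" by (rule cong_relations(7))
  also have "\<dots> \<doteq> 1 * BB 1 + 1 * BB 1" by (intro cong_add cong_mult cong_relations(1) cong_refl)
  finally have "BB 1 - BB 1 \<doteq> (BB 1 + BB 1) - BB 1" by (intro cong_diff) simp_all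
  then have "BB 1 \<doteq> 0" by (simp add: cong_sym)
  then have "free_const x * BB 1 \<doteq> free_const x * 0" by (rule cong_mult[OF cong_refl])
  then show ?thesis using cong_trans[OF cong_relations(9)] by simp
qed

text \<open>The chain rule: d(Q(y)) is Q'(y) dy plus a combination of the differentials of the
  coefficients.\<close>

lemma B_poly:
  assumes E: "0 \<in> E" "\<And>e. e \<in> E \<Longrightarrow> lin UNIV Z (BB e)" and Q: "Q \<in> pol E"
  shows "lin UNIV Z (BB (poly Q y) - AA (poly (pderiv Q) y) * BB y)"
  using Q
proof (induction Q)
  case 0
  have "0 - 0 * BB y \<doteq> BB 0 - AA 0 * BB y"
    by (intro cong_diff cong_mult cong_sym[OF Av_0] cong_sym[OF Bv_0] cong_refl)
  then show ?case using lin_cong[OF lin_0[of UNIV]] by simp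
next
  case (pCons a q)
  let ?q = "poly q y" and ?q' = "poly (pderiv q) y"
  have a: "a \<in> E" "q \<in> pol E" using pCons.prems E(1) by (simp_all add: pol_pCons)
  have "BB (a + y * ?q) \<doteq> BB a + (AA y * BB ?q + AA ?q * BB y)"
    by (intro cong_trans[OF cong_relations(4)] cong_add cong_refl cong_relations(7))
  moreover have "AA (?q + y * ?q') * BB y \<doteq> (AA ?q + AA y * AA ?q') * BB y"
    by (intro cong_mult cong_refl cong_trans[OF cong_relations(2)] cong_add cong_relations(3))
  ultimately have "BB (a + y * ?q) - AA (?q + y * ?q') * BB y \<doteq>
      BB a + (AA y * BB ?q + AA ?q * BB y) - (AA ?q + AA y * AA ?q') * BB y" by (rule cong_diff)
  also have "\<dots> = BB a + AA y * (BB ?q - AA ?q' * BB y)" by (simp add: algebra_simps)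
  finally have "BB a + AA y * (BB ?q - AA ?q' * BB y) \<doteq> BB (a + y * ?q) - AA (?q + y * ?q') * BB y"
    by (rule cong_sym)
  moreover have "lin UNIV Z (BB a + AA y * (BB ?q - AA ?q' * BB y))"
    by (intro linU E(2) a pCons.IH)
  ultimately show ?case using lin_cong by (simp add: pderiv_pCons)
qed

lemma lin_adjoins:
  assumes "subalg E" "\<And>e. e \<in> E \<Longrightarrow> lin UNIV Z (BB e)" "set ys \<subseteq> Z" "finite Z" "e \<in> adjoins E ys"
  shows "lin UNIV Z (BB e)"
  using assms
proof (induction ys arbitrary: E)
  case (Cons y ys)
  have step: "lin UNIV Z (BB e)" if e: "e \<in> adjoin E y" for e
  proof -
    obtain Q where Q: "Q \<in> pol E" "e = poly Q y" using e by (auto simp: adjoin_def)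
    have "lin UNIV Z (BB e - AA (poly (pderiv Q) y) * BB y)"
      unfolding Q(2) by (rule B_poly) (use Cons.prems Q subalg_0 in auto)
    moreover have "lin UNIV Z (AA (poly (pderiv Q) y) * BB y)"
      using Cons.prems by (intro linU lin_gen) auto
    ultimately have "lin UNIV Z (BB e - AA (poly (pderiv Q) y) * BB y + AA (poly (pderiv Q) y) * BB y)" by (rule linU(1))
    then show ?thesis by simp
  qed
  have "set ys \<subseteq> Z" "e \<in> adjoins (adjoin E y) ys" using Cons.prems(3,5) by simp_all
  then show ?case
    by (intro Cons.IH[of "adjoin E y"] subalg_adjoin Cons.prems(1,4)) (auto intro: step)
next
  case Nil
  show ?case by (rule Nil.prems(2)) (use Nil.prems(5) in \<open>simp only: adjoins.simps\<close>)
qed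

end

sublocale poisson_affine \<subseteq> poisson_domain
  by unfold_locales

context poisson_affine
begin

section \<open>Algebraic independence over the ground field\<close>

definition E0 :: "'a set" where "E0 = range (\<lambda>c. scale c 1)"

lemma scale_hom: "scale c 1 * scale c' 1 = scale (c * c') 1" "scale c 1 + scale c' 1 = scale (c + c') 1"
  "- scale c 1 = scale (- c) 1" "scale 1 1 = 1"
  by (simp_all add: scale_mult_left scale_left_distrib)

lemma subalg_E0: "subalg E0"
  unfolding subalg_def E0_def
proof (intro conjI ballI)
  show "0 \<in> range (\<lambda>c. scale c 1)" by (rule range_eqI[of _ _ 0]) simp
  show "1 \<in> range (\<lambda>c. scale c 1)" by (rule range_eqI[of _ _ 1]) simp
next
  fix a assume "a \<in> range (\<lambda>c. scale c 1)"
  then obtain c where a: "a = scale c 1" by blast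
  show "- a \<in> range (\<lambda>c. scale c 1)" unfolding a scale_hom by blast
  fix b assume "b \<in> range (\<lambda>c. scale c 1)"
  then obtain c' where b: "b = scale c' 1" by blast
  show "a + b \<in> range (\<lambda>c. scale c 1)" "a * b \<in> range (\<lambda>c. scale c 1)"
    unfolding a b scale_hom by blast+
qed

lemma char0: "of_nat (Suc j) \<noteq> (0::'a)"
proof -
  have "of_nat j = scale (of_nat j) 1" for j
    by (induction j) (simp_all add: scale_left_distrib)
  then have "of_nat (Suc j) = scale (of_nat (Suc j)) 1" by blast
  then show ?thesis by (simp del: of_nat_Suc)
qed

lemma E0_prime: "primeish P \<Longrightarrow> E0 \<inter> P = {0}"
proof -
  assume P: "primeish P"
  have "c = 0" if "scale c 1 \<in> P" for c
  proof (rule ccontr)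
    assume "c \<noteq> 0"
    then have "scale (inverse c) 1 * scale c 1 = 1" by (simp add: scale_hom)
    then show False using P that by (metis primeish_def)
  qed
  then show ?thesis using P subalg_0[OF subalg_E0] by (auto simp: E0_def primeish_def)
qed

lemma phi_subset:
  assumes "subalg B" "E0 \<subseteq> B" "x ` {1..n} \<subseteq> B"
  shows "\<phi> ` C \<subseteq> B"
proof
  fix a assume "a \<in> \<phi> ` C"
  then obtain p where "p \<in> C" "a = \<phi> p" by blast
  from this(1) have "\<phi> p \<in> B"
  proof (induction rule: mpoly_induct)
    case (const c)
    then show ?case using assms(2) by (auto simp: phi_const E0_def)
  next
    case (var i)
    then show ?case using assms(3) by (auto simp: phi_var)
  qed (simp_all add: phi_add phi_mult subalg_add subalg_mult assms(1))
  then show "a \<in> B" using \<open>a = \<phi> p\<close> by simp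
qed

text \<open>An algebraically independent family has dual derivations, so its size is bounded by the number
  of derivations.\<close>

lemma tower_bound:
  assumes expand: "\<And>d a. der_on UNIV d \<Longrightarrow> (\<And>c. d (scale c 1) = 0) \<Longrightarrow> d a = (\<Sum>k<t. d (z k) * D k (emb a))"
    and tower: "tower E0 ws {0}"
  shows "length ws \<le> t"
proof -
  define xs where "xs = map x [1..<Suc n]"
  define B where "B = adjoins (adjoins E0 ws) xs"
  have sub: "subalg (adjoins E0 ws)" "subalg B" by (simp_all add: B_def subalg_adjoins subalg_E0)
  have wsB: "set ws \<subseteq> B" using set_subset_adjoins[OF subalg_E0, of ws] subset_adjoins[OF sub(1), of xs] by (auto simp: B_def)
  have phiB: "\<phi> ` C \<subseteq> B"
  proof (rule phi_subset[OF sub(2)])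
    show "E0 \<subseteq> B" using subset_adjoins[OF subalg_E0, of ws] subset_adjoins[OF sub(1), of xs] by (auto simp: B_def)
    have "x ` {1..n} = set xs" by (auto simp: xs_def)
    then show "x ` {1..n} \<subseteq> B" using set_subset_adjoins[OF sub(1), of xs] by (simp add: B_def)
  qed
  \<comment> \<open>Prescribe values on \<open>ws\<close>, extend along the variables to reach all
    images of polynomials, and pass to the fraction field by way of the resulting tangent
    vector.\<close>
  have ex: "\<exists>d. der_on UNIV d \<and> (\<forall>c. d (scale c 1) = 0) \<and> (\<forall>l<length ws. d (ws ! l) = \<eta> l)" for \<eta>
  proof -
    have "der_on E0 (\<lambda>_. 0 :: 'a fract)" by (simp add: der_on_def)
    from tower_derivation[OF char0 subalg_E0 this, where ys = ws and \<eta> = \<eta>]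
    obtain D1 where D1: "der_on (adjoins E0 ws) D1" "\<And>a. a \<in> E0 \<Longrightarrow> D1 a = 0"
      "\<And>l. l < length ws \<Longrightarrow> D1 (ws ! l) = \<eta> l" using tower by metis
    from tower_derivation[OF char0 sub(1) D1(1), where ys = xs]
    obtain D2 where D2: "der_on B D2" "\<And>a. a \<in> adjoins E0 ws \<Longrightarrow> D2 a = D1 a" unfolding B_def by metis
    have const: "D2 (scale c 1) = 0" for c
      using D2(2)[OF subsetD[OF subset_adjoins[OF subalg_E0]]] D1(2) by (auto simp: E0_def)
    obtain \<Delta> where \<Delta>: "fract_derivation \<Delta>" "\<And>p. p \<in> C \<Longrightarrow> \<Delta> (emb (\<phi> p)) = Del (\<lambda>j. D2 (x j)) p"
      using tangent_derivation[OF derivation_tangent[OF D2(1) phiB const]] by blast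
    have \<Delta>phi: "\<Delta> (emb (\<phi> p)) = D2 (\<phi> p)" if "p \<in> C" for p
      using \<Delta>(2)[OF that] derivation_phi[OF D2(1) phiB const that] by simp
    \<comment> \<open>The new derivation is known only on images of polynomials, whereas the
      elements of \<open>ws\<close> are fractions of such images; the product rule transports the
      agreement.\<close>
    have "\<Delta> (emb a) = D2 a" if a: "a \<in> B" for a
    proof -
      obtain p s where ps: "p \<in> C" "s \<in> C" "a * \<phi> s = \<phi> p" "\<phi> s dvd 1" by (rule fraction_rep)
      have nz: "emb (\<phi> s) \<noteq> 0" using ps(4) by (auto simp: emb_simps)
      have "D2 (a * \<phi> s) = D2 a * emb (\<phi> s) + emb a * D2 (\<phi> s)"
        using D2(1) a phiB ps(2) unfolding der_on_def by blast
      moreover have "\<Delta> (emb (a * \<phi> s)) = \<Delta> (emb a) * emb (\<phi> s) + emb a * \<Delta> (emb (\<phi> s))"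
        by (simp add: emb_simps fract_derivation.mult[OF \<Delta>(1)])
      ultimately have "\<Delta> (emb a) * emb (\<phi> s) = D2 a * emb (\<phi> s)"
        using \<Delta>phi[OF ps(1)] \<Delta>phi[OF ps(2)] ps(3) by (metis add_right_cancel)
      then show ?thesis using nz by simp
    qed
    then have "\<Delta> (emb (ws ! l)) = \<eta> l" if "l < length ws" for l
      using that wsB D2(2)[OF subsetD[OF set_subset_adjoins[OF subalg_E0]]] D1(3) nth_mem by (metis subsetD)
    moreover have "\<Delta> (emb (scale c 1)) = 0" for c
      using \<Delta>(2)[OF pconst_carrier, of c] by (simp add: phi_const Del_const)
    ultimately show ?thesis using fract_derivation_der_on[OF \<Delta>(1)] by blast
  qed
  have "\<forall>k. \<exists>d. der_on UNIV d \<and> (\<forall>c. d (scale c 1) = 0) \<and> (\<forall>l<length ws. d (ws ! l) = (if l = k then 1 else 0))"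
    by (intro allI ex)
  then obtain d where d: "\<And>k. der_on UNIV (d k)" "\<And>k c. d k (scale c 1) = 0"
    "\<And>k l. l < length ws \<Longrightarrow> d k (ws ! l) = (if l = k then 1 else 0)" by metis
  let ?s = "length ws"
  \<comment> \<open>Expanding the dual derivations in the frame factors the identity matrix through
    t coordinates.\<close>
  have "mat ?s ?s (\<lambda>(k, l). \<Sum>i\<in>{..<t}. d k (z i) * D i (emb (ws ! l))) = 1\<^sub>m ?s"
    by (rule eq_matI) (use expand[OF d(1,2), symmetric] d(3) in auto)
  then have "det (mat ?s ?s (\<lambda>(k, l). \<Sum>i\<in>{..<t}. d k (z i) * D i (emb (ws ! l)))) \<noteq> 0" by simp
  from det_factor_card[OF this] show ?thesis by simp
qed

text \<open>For images of polynomials the product rule suffices. In general b \<phi>(s) = \<phi>(p)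
  with \<phi>(s) a unit, so the product rule can be solved for db.\<close>

lemma lin_X: "lin UNIV (x ` {1..n}) (BB b)"
proof -
  have phi: "lin UNIV (x ` {1..n}) (BB (\<phi> p))" if "p \<in> C" for p
    using that
  proof (induction rule: mpoly_induct)
    case (const c)
    show ?case unfolding phi_const by (rule lin_cong[OF lin_0 cong_sym[OF B_const]]) simp
  next
    case (var i)
    then show ?case unfolding phi_var by (intro lin_gen) auto
  next
    case (add p q)
    then show ?case
      unfolding phi_add[OF add(1,2)] by (intro lin_cong[OF linU(1) cong_sym[OF cong_relations(4)]])
  next
    case (mult p q)
    then show ?case
      unfolding phi_mult[OF mult(1,2)] by (intro lin_cong[OF linU(1)[OF linU(3) linU(3)] cong_sym[OF cong_relations(7)]])
  qed
  obtain p s where ps: "p \<in> C" "s \<in> C" "b * \<phi> s = \<phi> p" "\<phi> s dvd 1" by (rule fraction_rep)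
  obtain u where u: "\<phi> s * u = 1" using ps(4) by (metis dvdE)
  have "BB (\<phi> p) - AA b * BB (\<phi> s) \<doteq> AA (\<phi> s) * BB b"
    using cong_diff[OF cong_relations(7)[of scale bracket b "\<phi> s"] cong_refl, of "AA b * BB (\<phi> s)"] by (simp add: ps(3))
  then have "lin UNIV (x ` {1..n}) (AA (\<phi> s) * BB b)"
    by (rule lin_cong[rotated]) (intro linU phi ps)
  then have "lin UNIV (x ` {1..n}) (AA u * (AA (\<phi> s) * BB b))" by (rule linU(3))
  moreover have "AA u * (AA (\<phi> s) * BB b) \<doteq> BB b"
  proof -
    have "AA u * AA (\<phi> s) \<doteq> AA (u * \<phi> s)" by (rule cong_sym[OF cong_relations(3)])
    also have "u * \<phi> s = 1" using u by (simp add: mult.commute)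
    also have "AA 1 \<doteq> 1" by (rule cong_relations(1))
    finally show ?thesis using cong_mult[OF _ cong_refl[of _ _ "BB b"]] by (fastforce simp: mult.assoc)
  qed
  ultimately show ?thesis by (rule lin_cong)
qed

end

lemma primeish_uminus: "primeish P \<Longrightarrow> a \<in> P \<Longrightarrow> - a \<in> P"
proof -
  assume "primeish P" "a \<in> P"
  then have "(- 1) * a \<in> P" unfolding primeish_def by blast
  then show ?thesis by simp
qed

locale framed_affine = poisson_affine scale bracket n m f I S \<iota> \<phi> x + poisson_frame scale bracket t z D
  for scale :: "'k::field_char_0 \<Rightarrow> 'a::idom \<Rightarrow> 'a" and bracket n m f I S \<iota> \<phi> x t z D +
  assumes expand: "der_on UNIV d \<Longrightarrow> (\<And>c. d (scale c 1) = 0) \<Longrightarrow> d a = (\<Sum>k<t. d (z k) * D k (emb a))"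
    and z_var: "k < t \<Longrightarrow> z k \<in> x ` {1..n}"
begin

abbreviation "X0 \<equiv> x ` {1..n}"

lemma A_diff: "AA (a - b) \<doteq> AA a - AA b"
  using cong_sym[OF cong_diff[OF cong_relations(2)[of scale bracket "a - b" b] cong_refl, of "AA b"]] by simp

lemma lin_E0: "e \<in> E0 \<Longrightarrow> lin UNIV Z (BB e)"
proof -
  assume "e \<in> E0"
  then obtain c where e: "e = scale c 1" by (auto simp: E0_def)
  show ?thesis unfolding e by (rule lin_cong[OF lin_0 cong_sym[OF B_const]]) simp
qed

text \<open>Choose a relation Q of y modulo P of least degree. Its derivative is nonzero in
  characteristic zero and has smaller degree, so Q'(y) is outside of P. By the chain rule a = Q(y)
  and s = Q'(y) are as required.\<close>

lemma local_relation:
  assumes P: "primeish P" and ys: "tower E0 ys P" and y: "\<not> transc y (adjoins E0 ys) P"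
  shows "\<exists>s a. s \<notin> P \<and> a \<in> P \<and> lin UNIV (set ys) (BB a - AA s * BB y)"
proof -
  define E1 where "E1 = adjoins E0 ys"
  have 0: "0 \<in> P" using P by (simp add: primeish_def)
  have E1: "subalg E1" "E1 \<inter> P = {0}"
    unfolding E1_def using adjoins_disjoint[OF ys subalg_E0 0 E0_prime[OF P]] subalg_adjoins[OF subalg_E0] by auto
  from y obtain Q' where "Q' \<in> pol E1 \<and> poly Q' y \<in> P \<and> Q' \<noteq> 0" unfolding transc_def E1_def by blast
  from ex_has_least_nat[of "\<lambda>Q. Q \<in> pol E1 \<and> poly Q y \<in> P \<and> Q \<noteq> 0", OF this, of degree]
  obtain Q where Q: "Q \<in> pol E1" "poly Q y \<in> P" "Q \<noteq> 0"
    and min: "\<And>R. R \<in> pol E1 \<Longrightarrow> poly R y \<in> P \<Longrightarrow> R \<noteq> 0 \<Longrightarrow> degree Q \<le> degree R" by blast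
  have "degree Q \<noteq> 0"
  proof
    assume "degree Q = 0"
    then obtain a where a: "Q = [:a:]" by (rule degree_eq_zeroE)
    then have "a \<in> E1" "a \<in> P" using Q(1,2) subalg_0[OF E1(1)] by (simp_all add: pol_pCons)
    then show False using E1(2) Q(3) a by auto
  qed
  then obtain k where k: "degree Q = Suc k" using not0_implies_Suc by blast
  have "coeff Q (Suc k) \<noteq> 0" using Q(3) k by (metis leading_coeff_0_iff)
  then have "coeff (pderiv Q) k \<noteq> 0" using char0[of k] by (simp add: coeff_pderiv del: of_nat_Suc)
  then have "pderiv Q \<noteq> 0" by auto
  moreover have "degree (pderiv Q) \<le> k"
    by (rule degree_le) (simp add: coeff_pderiv coeff_eq_0 k)
  ultimately have "poly (pderiv Q) y \<notin> P"
    using min[OF pol_pderiv[OF E1(1) Q(1)]] k by fastforce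
  moreover have "lin UNIV (set ys) (BB (poly Q y) - AA (poly (pderiv Q) y) * BB y)"
    by (rule B_poly[OF subalg_0[OF E1(1)] _ Q(1)])
       (rule lin_adjoins[OF subalg_E0 lin_E0, of ys "set ys"], simp_all add: E1_def)
  ultimately show ?thesis using Q(2) by blast
qed

text \<open>By the product rule s da = d(sa) - a ds, and d(sa) is the sum of the c_i dg_i and the
  g_i dc_i. The terms with coefficient g_i or a have coefficients in P and form v; the others form
  u.\<close>

lemma prime_element_form:
  assumes P: "primeish P" and g: "\<And>i. i < h \<Longrightarrow> g i \<in> P" and a: "a \<in> P" "s * a = (\<Sum>i<h. c i * g i)"
    and Z: "finite Z" "g ` {..<h} \<subseteq> Z"
  shows "\<exists>u v. AA s * BB a \<doteq> u + v \<and> lin UNIV Z u \<and> lin P X0 v"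
proof -
  have P': "0 \<in> P" "\<And>a b. a \<in> P \<Longrightarrow> b \<in> P \<Longrightarrow> a + b \<in> P" "\<And>a b. a \<in> P \<Longrightarrow> a * b \<in> P" "\<And>b. b \<in> P \<Longrightarrow> - b \<in> P"
    using P primeish_uminus[OF P] unfolding primeish_def by (auto simp: mult.commute)
  let ?u = "\<Sum>i<h. AA (c i) * BB (g i)" and ?v = "(\<Sum>i<h. AA (g i) * BB (c i)) - AA a * BB s"
  have "BB (s * a) \<doteq> (\<Sum>i<h. BB (c i * g i))" unfolding a(2) by (rule Bv_sum)
  also have "\<dots> \<doteq> (\<Sum>i<h. AA (c i) * BB (g i) + AA (g i) * BB (c i))"
    by (intro cong_sum cong_relations)
  finally have "BB (s * a) \<doteq> ?u + (\<Sum>i<h. AA (g i) * BB (c i))" by (simp only: sum.distrib)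
  then have "BB (s * a) - AA a * BB s \<doteq> ?u + (\<Sum>i<h. AA (g i) * BB (c i)) - AA a * BB s"
    by (rule cong_diff) simp
  moreover have "AA s * BB a \<doteq> BB (s * a) - AA a * BB s"
    using cong_sym[OF cong_diff[OF cong_relations(7)[of scale bracket s a] cong_refl, of "AA a * BB s"]] by simp
  ultimately have "AA s * BB a \<doteq> ?u + (\<Sum>i<h. AA (g i) * BB (c i)) - AA a * BB s"
    by (rule cong_trans[rotated])
  then have "AA s * BB a \<doteq> ?u + ?v" by (simp only: add_diff_eq)
  moreover have "lin UNIV Z ?u" by (intro lin_sum linU lin_gen Z) (use Z in auto)
  moreover have "lin P X0 ?v"
  proof -
    have "lin P X0 (AA b * BB b')" if "b \<in> P" for b b'
      by (rule lin_A[OF _ lin_X]) (use P'(3) that in blast)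
    note l = this
    have l1: "lin P X0 (\<Sum>i<h. AA (g i) * BB (c i))"
    proof (rule lin_sum[OF P'(1,2)])
      fix i assume "i \<in> {..<h}"
      then show "lin P X0 (AA (g i) * BB (c i))" by (intro l g) simp
    qed
    have l2: "lin P X0 (- (AA a * BB s))" by (rule lin_uminus[OF P'(4) l[OF a(1)]])
    have "lin P X0 ((\<Sum>i<h. AA (g i) * BB (c i)) + - (AA a * BB s))" by (rule lin_add[OF P'(2) l1 l2])
    then show ?thesis by simp
  qed
  ultimately show ?thesis by blast
qed

text \<open>Nakayama's lemma by the determinant trick: modulo \<open>P\<close> the matrix of the relations is
  diagonal with entries outside of \<open>P\<close>.\<close>

lemma determinant_trick:
  assumes P: "primeish P"
    and rel: "\<And>y. y \<in> X0 \<Longrightarrow> \<exists>\<sigma> u v. \<sigma> \<notin> P \<and> AA \<sigma> * BB y \<doteq> u + v \<and> lin UNIV Z u \<and> lin P X0 v"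
  shows "\<exists>s. s \<notin> P \<and> (\<forall>b. lin UNIV Z (AA s * BB b))"
proof -
  have P': "0 \<in> P" "\<And>a b. a \<in> P \<Longrightarrow> b \<in> P \<Longrightarrow> a + b \<in> P" "\<And>b. b \<in> P \<Longrightarrow> - b \<in> P"
    using P primeish_uminus[OF P] unfolding primeish_def by auto
  define R where "R y q \<longleftrightarrow> fst q \<notin> P \<and>
      AA (fst q) * BB y \<doteq> fst (snd q) + (\<Sum>z\<in>X0. AA (snd (snd q) z) * BB z) \<and>
      lin UNIV Z (fst (snd q)) \<and> (\<forall>z\<in>X0. snd (snd q) z \<in> P)" for y q
  have "\<exists>q. R y q" if y: "y \<in> X0" for y
  proof -
    obtain \<sigma> u v where 1: "\<sigma> \<notin> P" "AA \<sigma> * BB y \<doteq> u + v" "lin UNIV Z u" "lin P X0 v" using rel[OF y] by blast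
    obtain c where c: "\<forall>z\<in>X0. c z \<in> P" "v \<doteq> (\<Sum>z\<in>X0. AA (c z) * BB z)" using 1(4) unfolding lin_def by blast
    have "AA \<sigma> * BB y \<doteq> u + (\<Sum>z\<in>X0. AA (c z) * BB z)"
      by (rule cong_trans[OF 1(2) cong_add[OF cong_refl c(2)]])
    then have "R y (\<sigma>, u, c)" using \<open>AA \<sigma> * BB y \<doteq> u + (\<Sum>z\<in>X0. AA (c z) * BB z)\<close> 1(1,3) c(1) unfolding R_def fst_conv snd_conv by blast
    then show ?thesis by blast
  qed
  then have "\<exists>q. \<forall>y\<in>X0. R y (q y)" by (intro bchoice) blast
  then obtain q where q: "\<And>y. y \<in> X0 \<Longrightarrow> R y (q y)" by blast
  define \<sigma> where "\<sigma> y = fst (q y)" for y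
  define u where "u y = fst (snd (q y))" for y
  define c where "c y = snd (snd (q y))" for y
  have rel': "\<sigma> y \<notin> P" "AA (\<sigma> y) * BB y \<doteq> u y + (\<Sum>z\<in>X0. AA (c y z) * BB z)"
      "lin UNIV Z (u y)" "\<And>z. z \<in> X0 \<Longrightarrow> c y z \<in> P" if "y \<in> X0" for y
    using q[OF that] unfolding R_def \<sigma>_def u_def c_def by blast+
  define N where "N = card X0"
  obtain e where e: "bij_betw e {0..<N} X0" using ex_bij_betw_nat_finite[of X0] by (auto simp: N_def)
  have eX: "e i \<in> X0" if "i < N" for i using e that by (auto simp: bij_betw_def)
  have sum_e: "(\<Sum>z\<in>X0. F z) = (\<Sum>j<N. F (e j))" for F :: "'a \<Rightarrow> 'a pea_gen list \<Rightarrow>\<^sub>0 'k"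
    using sum.reindex_bij_betw[OF e, of F] by (simp add: atLeast0LessThan)
  \<comment> \<open>The denominators \<sigma> stand on the diagonal, and the error coefficients in P
    are moved to the left-hand side.\<close>
  define M where "M i j = (if i = j then \<sigma> (e i) else 0) - c (e i) (e j)" for i j
  have row: "lin UNIV Z (\<Sum>j<N. AA (M i j) * BB (e j))" if i: "i < N" for i
  proof -
    have "(\<Sum>j<N. AA (if i = j then \<sigma> (e i) else 0) * BB (e j)) \<doteq> (\<Sum>j<N. if i = j then AA (\<sigma> (e i)) * BB (e i) else 0)"
    proof (rule cong_sum)
      fix j show "AA (if i = j then \<sigma> (e i) else 0) * BB (e j) \<doteq> (if i = j then AA (\<sigma> (e i)) * BB (e i) else 0)"
        using cong_mult[OF Av_0[of scale bracket] cong_refl[of scale bracket "BB (e j)"]] by simp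
    qed
    also have "\<dots> = AA (\<sigma> (e i)) * BB (e i)" using i by simp
    also have "\<dots> \<doteq> u (e i) + (\<Sum>j<N. AA (c (e i) (e j)) * BB (e j))" using rel'(2)[OF eX[OF i]] unfolding sum_e .
    finally have 1: "(\<Sum>j<N. AA (if i = j then \<sigma> (e i) else 0) * BB (e j)) \<doteq> u (e i) + (\<Sum>j<N. AA (c (e i) (e j)) * BB (e j))" .
    have "(\<Sum>j<N. AA (M i j) * BB (e j)) \<doteq> (\<Sum>j<N. (AA (if i = j then \<sigma> (e i) else 0) - AA (c (e i) (e j))) * BB (e j))"
      unfolding M_def by (intro cong_sum cong_mult A_diff cong_refl)
    also have "\<dots> = (\<Sum>j<N. AA (if i = j then \<sigma> (e i) else 0) * BB (e j)) - (\<Sum>j<N. AA (c (e i) (e j)) * BB (e j))"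
      by (simp only: left_diff_distrib sum_subtractf)
    also have "\<dots> \<doteq> u (e i) + (\<Sum>j<N. AA (c (e i) (e j)) * BB (e j)) - (\<Sum>j<N. AA (c (e i) (e j)) * BB (e j))"
      by (rule cong_diff[OF 1 cong_refl])
    also have "\<dots> = u (e i)" by simp
    finally show ?thesis using lin_cong[OF rel'(3)[OF eX[OF i]] cong_sym] by blast
  qed
  define Mt where "Mt = mat N N (\<lambda>(i, j). M i j)"
  have Mt: "Mt \<in> carrier_mat N N" by (simp add: Mt_def)
  have det: "det Mt \<notin> P"
    unfolding Mt_def
  proof (rule det_mod_prime[OF P])
    fix i assume i: "i < N"
    show "M i i \<notin> P"
    proof
      assume "M i i \<in> P"
      then have "M i i + c (e i) (e i) \<in> P" using P'(2)[OF _ rel'(4)[OF eX[OF i] eX[OF i]]] by blast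
      then show False using rel'(1)[OF eX[OF i]] by (simp add: M_def)
    qed
    fix j assume j: "j < N" "i \<noteq> j"
    have "c (e i) (e j) \<in> P" by (rule rel'(4)[OF eX[OF i] eX[OF j(1)]])
    then show "M i j \<in> P" using P'(3) j by (simp add: M_def)
  qed
  have gen: "lin UNIV Z (AA (det Mt) * BB y)" if y: "y \<in> X0" for y
  proof -
    have "y \<in> e ` {0..<N}" using e y unfolding bij_betw_def by blast
    then obtain k where k: "k < N" "y = e k" by auto
    let ?a = "\<lambda>i. adj_mat Mt $$ (k, i)"
    \<comment> \<open>The k-th row of the adjugate isolates det M times dy, so no inverse of the
      matrix is required.\<close>
    have adj: "(\<Sum>i<N. ?a i * M i j) = (if k = j then det Mt else 0)" if j: "j < N" for j
    proof -
      have "(adj_mat Mt * Mt) $$ (k, j) = (det Mt \<cdot>\<^sub>m 1\<^sub>m N) $$ (k, j)" by (simp only: adj_mat(3)[OF Mt])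
      moreover have "(adj_mat Mt * Mt) $$ (k, j) = (\<Sum>i<N. ?a i * M i j)"
        using adj_mat(1)[OF Mt] k j by (auto simp: scalar_prod_def atLeast0LessThan Mt_def)
      ultimately show ?thesis using k j by simp
    qed
    have "(\<Sum>i<N. AA (?a i) * (\<Sum>j<N. AA (M i j) * BB (e j))) = (\<Sum>j<N. (\<Sum>i<N. AA (?a i) * AA (M i j)) * BB (e j))"
      by (simp only: sum_distrib_left sum_distrib_right mult.assoc) (rule sum.swap)
    also have "\<dots> \<doteq> (\<Sum>j<N. AA (\<Sum>i<N. ?a i * M i j) * BB (e j))"
    proof (intro cong_sum cong_mult cong_refl)
      fix j
      have "AA (\<Sum>i<N. ?a i * M i j) \<doteq> (\<Sum>i<N. AA (?a i * M i j))" by (rule Av_sum)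
      also have "\<dots> \<doteq> (\<Sum>i<N. AA (?a i) * AA (M i j))" by (intro cong_sum cong_relations)
      finally show "(\<Sum>i<N. AA (?a i) * AA (M i j)) \<doteq> AA (\<Sum>i<N. ?a i * M i j)" by (rule cong_sym)
    qed
    also have "\<dots> = (\<Sum>j<N. AA (if k = j then det Mt else 0) * BB (e j))"
      by (rule sum.cong) (simp_all add: adj)
    also have "\<dots> \<doteq> (\<Sum>j<N. if k = j then AA (det Mt) * BB (e k) else 0)"
    proof (rule cong_sum)
      fix j show "AA (if k = j then det Mt else 0) * BB (e j) \<doteq> (if k = j then AA (det Mt) * BB (e k) else 0)"
        using cong_mult[OF Av_0[of scale bracket] cong_refl[of scale bracket "BB (e j)"]] by simp
    qed
    also have "\<dots> = AA (det Mt) * BB y" using k by simp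
    finally have *: "(\<Sum>i<N. AA (?a i) * (\<Sum>j<N. AA (M i j) * BB (e j))) \<doteq> AA (det Mt) * BB y" .
    have "lin UNIV Z (\<Sum>i<N. AA (?a i) * (\<Sum>j<N. AA (M i j) * BB (e j)))"
    proof (rule lin_sum)
      fix i assume "i \<in> {..<N}"
      then show "lin UNIV Z (AA (?a i) * (\<Sum>j<N. AA (M i j) * BB (e j)))" by (intro linU(3) row) simp
    qed simp_all
    then show ?thesis using * by (rule lin_cong)
  qed
  have "lin UNIV Z (AA (det Mt) * BB b)" for b
  proof -
    obtain a where a: "BB b \<doteq> (\<Sum>z\<in>X0. AA (a z) * BB z)" using lin_X[of b] unfolding lin_def by blast
    have "(\<Sum>z\<in>X0. AA (a z) * (AA (det Mt) * BB z)) \<doteq> AA (det Mt) * BB b"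
    proof -
      have comm: "AA p * AA q \<doteq> AA q * AA p" for p q
        using cong_trans[OF cong_sym[OF cong_relations(3)[of scale bracket p q]]] cong_relations(3)[of scale bracket q p] by (simp add: mult.commute)
      have "(\<Sum>z\<in>X0. AA (a z) * AA (det Mt) * BB z) \<doteq> (\<Sum>z\<in>X0. AA (det Mt) * AA (a z) * BB z)"
        by (intro cong_sum cong_mult comm cong_refl)
      also have "\<dots> = AA (det Mt) * (\<Sum>z\<in>X0. AA (a z) * BB z)" by (simp only: sum_distrib_left mult.assoc)
      also have "\<dots> \<doteq> AA (det Mt) * BB b" by (rule cong_mult[OF cong_refl cong_sym[OF a]])
      finally show ?thesis by (simp only: mult.assoc)
    qed
    moreover have "lin UNIV Z (\<Sum>z\<in>X0. AA (a z) * (AA (det Mt) * BB z))"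
    proof (rule lin_sum)
      fix z assume "z \<in> X0"
      then show "lin UNIV Z (AA (a z) * (AA (det Mt) * BB z))" by (intro linU(3) gen)
    qed simp_all
    ultimately show ?thesis using lin_cong by blast
  qed
  then show ?thesis using det by blast
qed

lemma local_generators:
  assumes P: "primeish P" and reg: "regular_local_ring (localization_at P)"
  shows "\<exists>Z s. finite Z \<and> card Z \<le> t \<and> s \<notin> P \<and> (\<forall>b. lin UNIV Z (AA s * BB b))"
proof -
  have 0: "0 \<in> P" using P by (simp add: primeish_def)
  from regular_local_chain[OF P reg] obtain h g Q where c: "\<forall>i<h. g i \<in> P" "\<forall>a\<in>P. \<exists>s c. s \<notin> P \<and> s * a = (\<Sum>i<h. c i * g i)"
    "\<forall>i\<le>h. primeish (Q i)" "\<forall>i<h. Q i \<subset> Q (Suc i)" "Q h \<subseteq> P"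
    by (elim exE conjE) (rule that; assumption)
  have g: "\<And>i. i < h \<Longrightarrow> g i \<in> P" and comb: "\<And>a. a \<in> P \<Longrightarrow> \<exists>s c. s \<notin> P \<and> s * a = (\<Sum>i<h. c i * g i)"
    and Q: "\<And>i. i \<le> h \<Longrightarrow> primeish (Q i)" "\<And>i. i < h \<Longrightarrow> Q i \<subset> Q (Suc i)" "Q h \<subseteq> P"
    using c by simp_all
  have alg': "\<exists>ys. set ys \<subseteq> set (map x [1..<Suc n]) \<and> tower E0 ys P \<and> (\<forall>y\<in>set (map x [1..<Suc n]). \<not> transc y (adjoins E0 ys) P)"
    by (rule maximal_tower[OF subalg_E0 0])
  from alg' obtain ys where ys: "tower E0 ys P" and alg: "\<forall>y\<in>set (map x [1..<Suc n]). \<not> transc y (adjoins E0 ys) P"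
    by (elim exE conjE) (rule that; assumption)
  have dis: "adjoins E0 ys \<inter> P = {0}" by (rule adjoins_disjoint[OF ys subalg_E0 0 E0_prime[OF P]])
  have "0 \<in> Q h" "0 \<in> Q 0" using Q(1)[of h] Q(1)[of 0] by (simp_all add: primeish_def)
  then have disQ: "adjoins E0 ys \<inter> Q h = {0}" using dis subalg_0[OF subalg_adjoins[OF subalg_E0, of ys]] Q(3) by blast
  \<comment> \<open>Only the number h of the generators g enters the bound; \<open>gs\<close> has
    the same length and is independent over the algebra of \<open>ys\<close> by
    construction.\<close>
  have "\<exists>gs. length gs = h \<and> tower (adjoins E0 ys) gs (Q 0)"
    by (rule chain_tower[OF Q(1,2) subalg_adjoins[OF subalg_E0] disQ])
  then obtain gs where gs: "length gs = h" "tower (adjoins E0 ys) gs (Q 0)" by blast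
  have "tower E0 ys {0}" "tower (adjoins E0 ys) gs {0}"
    using tower_mono[OF _ ys] tower_mono[OF _ gs(2)] 0 \<open>0 \<in> Q 0\<close> by auto
  then have tow: "tower E0 (ys @ gs) {0}" by (simp add: tower_append)
  have len: "length (ys @ gs) \<le> t" by (rule tower_bound[OF _ tow]) (rule expand)
  define Z where "Z = set ys \<union> g ` {..<h}"
  have Z: "finite Z" "set ys \<subseteq> Z" "g ` {..<h} \<subseteq> Z" by (auto simp: Z_def)
  have "card Z \<le> card (set ys) + card (g ` {..<h})" unfolding Z_def by (rule card_Un_le)
  also have "\<dots> \<le> length ys + h" using card_length[of ys] card_image_le[of "{..<h}" g] by (intro add_mono) auto
  finally have card: "card Z \<le> t" using len gs(1) by simp
  have "\<exists>\<sigma> u v. \<sigma> \<notin> P \<and> AA \<sigma> * BB y \<doteq> u + v \<and> lin UNIV Z u \<and> lin P X0 v" if y: "y \<in> X0" for y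
  proof -
    have "\<not> transc y (adjoins E0 ys) P" using bspec[OF alg, of y] y by (simp add: atLeastLessThanSuc_atLeastAtMost del: upt_Suc)
    from local_relation[OF P ys this] obtain s a where sa: "s \<notin> P" "a \<in> P" "lin UNIV (set ys) (BB a - AA s * BB y)" by blast
    obtain s' c where s': "s' \<notin> P" "s' * a = (\<Sum>i<h. c i * g i)" using comb[OF sa(2)] by blast
    obtain u v where uv: "AA s' * BB a \<doteq> u + v" "lin UNIV Z u" "lin P X0 v"
      using prime_element_form[OF P g sa(2) s'(2) Z(1,3)] by blast
    let ?w = "BB a - AA s * BB y"
    have w: "lin UNIV Z ?w" by (rule lin_mono[OF sa(3) Z(2,1)]) simp
    have "AA (s' * s) * BB y \<doteq> AA s' * AA s * BB y" by (intro cong_mult cong_relations cong_refl)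
    also have "\<dots> = AA s' * BB a - AA s' * ?w" by (simp add: right_diff_distrib mult.assoc)
    also have "\<dots> \<doteq> (u + v) - AA s' * ?w" by (rule cong_diff[OF uv(1) cong_refl])
    also have "\<dots> = (u - AA s' * ?w) + v" by simp
    finally have "AA (s' * s) * BB y \<doteq> (u - AA s' * ?w) + v" .
    moreover have "s' * s \<notin> P" by (rule primeish_mult[OF P s'(1) sa(1)])
    moreover have "lin UNIV Z (u - AA s' * ?w)" by (intro linU uv w)
    ultimately show ?thesis using uv(3) by blast
  qed
  from determinant_trick[OF P this] show ?thesis using Z(1) card by blast
qed

text \<open>By \<open>d = t\<close> a minor of order t of the Poisson matrix is nonzero, and it
  factors through the brackets of the t local generators. So their Hamiltonian derivations are
  independent.\<close>

lemma symplectic_local_frame: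
  assumes P: "primeish P" and reg: "regular_local_ring (localization_at P)"
    and d: "frac_rank n n (poisson_matrix bracket x) = t"
  shows "\<exists>w. local_frame scale bracket P t w"
proof -
  obtain Z s where Z: "finite Z" "card Z \<le> t" and s: "s \<notin> P" "\<And>b. lin UNIV Z (AA s * BB b)"
    using local_generators[OF P reg] by blast
  obtain e where e: "bij_betw e {0..<card Z} Z" using ex_bij_betw_nat_finite[OF Z(1)] by blast
  \<comment> \<open>Padding with 0 up to t generators. The independence shown below implies that in
    fact \<open>Z\<close> has exactly t elements.\<close>
  define w where "w k = (if k < card Z then e k else 0)" for k
  have gens: "\<exists>c. AA s * BB b \<doteq> (\<Sum>k<t. AA (c k) * BB (w k))" for b
  proof -
    obtain c where c: "AA s * BB b \<doteq> (\<Sum>z\<in>Z. AA (c z) * BB z)" using s(2)[of b] unfolding lin_def by blast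
    define c' where "c' k = (if k < card Z then c (e k) else 0)" for k
    have "(\<Sum>z\<in>Z. AA (c z) * BB z) = (\<Sum>k<card Z. AA (c (e k)) * BB (e k))"
      using sum.reindex_bij_betw[OF e, of "\<lambda>z. AA (c z) * BB z"] by (simp add: atLeast0LessThan)
    also have "\<dots> = (\<Sum>k<t. if k < card Z then AA (c (e k)) * BB (e k) else 0)"
      by (rule sum.mono_neutral_cong_left) (use Z(2) in auto)
    also have "\<dots> \<doteq> (\<Sum>k<t. AA (c' k) * BB (w k))"
    proof (rule cong_sum)
      fix k show "(if k < card Z then AA (c (e k)) * BB (e k) else 0) \<doteq> AA (c' k) * BB (w k)"
        using cong_sym[OF cong_mult[OF Av_0[of scale bracket] cong_refl[of scale bracket "BB 0"]]] by (simp add: c'_def w_def)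
    qed
    finally show ?thesis using cong_trans[OF c] by blast
  qed
  have s0: "emb s \<noteq> 0" using s(1) P by (auto simp: emb_simps primeish_def)
  obtain "is" js where ij: "is \<in> incr_tuples t n" "js \<in> incr_tuples t n" "minor (poisson_matrix bracket x) is js \<noteq> 0"
    using ex_minor_frac_rank[of n n "poisson_matrix bracket x"] unfolding d by blast
  \<comment> \<open>A congruence between forms becomes an identity between Hamiltonian derivations
    by evaluating it through \<pi>.\<close>
  have "\<exists>c. \<forall>v. s * bracket b v = (\<Sum>k<t. c k * bracket (w k) v)" for b
  proof -
    obtain c where c: "AA s * BB b \<doteq> (\<Sum>k<t. AA (c k) * BB (w k))" using gens by blast
    have "s * bracket b v = (\<Sum>k<t. c k * bracket (w k) v)" for v
      using pi.ev_cong[OF c, of v] by (simp add: pi.ev_mult pi.ev_sum pi.ev_gens)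
    then show ?thesis by blast
  qed
  then obtain c where c: "\<And>b v. s * bracket b v = (\<Sum>k<t. c b k * bracket (w k) v)" by metis
  have c': "emb (bracket b v) = (\<Sum>k<t. emb (c b k) / emb s * emb (bracket (w k) v))" for b v
  proof -
    have "emb s * emb (bracket b v) = (\<Sum>k<t. emb (c b k) * emb (bracket (w k) v))"
      using arg_cong[OF c[of b v], of emb] by (simp add: emb_simps emb_sum)
    then show ?thesis using s0 by (simp add: sum_divide_distrib[symmetric] nonzero_eq_divide_eq mult.commute)
  qed
  have det: "det (mat t t (\<lambda>(i, j). \<Sum>k\<in>{..<t}. emb (c (x (is ! i)) k) / emb s * emb (bracket (w k) (x (js ! j))))) \<noteq> 0"
    using ij minor_emb[of "poisson_matrix bracket x" "is" js] incr_tuplesD(1)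
    unfolding c'[symmetric] by (simp add: minor_def poisson_matrix_def emb_simps)
  have "local_frame scale bracket P t w"
  proof
    show "primeish P" by (rule P)
    show "\<exists>s c. s \<notin> P \<and> AA s * BB b \<doteq> (\<Sum>k<t. AA (c k) * BB (w k))" for b
      using gens[of b] s(1) by blast
    show "c k = 0" if 0: "\<And>b. (\<Sum>k<t. c k * bracket (w k) b) = 0" and k: "k < t" for c k
    proof -
      have "emb (c k) = 0"
      proof (rule det_factor_kernel[OF det])
        show "(\<Sum>k\<in>{..<t}. emb (c k) * emb (bracket (w k) (x (js ! j)))) = 0" for j
          using arg_cong[OF 0[of "x (js ! j)"], of emb] by (simp add: emb_sum emb_simps)
      qed (use k in auto)
      then show ?thesis by (simp add: emb_simps)
    qed
    show "of_nat (Suc j) \<noteq> (0::'a)" for j by (rule char0)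
  qed
  then show ?thesis by blast
qed

text \<open>If the annihilator J of u in the algebra were proper, it would lie in a prime P. But
  local faithfulness at P gives an element outside of P that annihilates u.\<close>

theorem pi_faithful:
  assumes reg: "regular_domain TYPE('a)" and d: "frac_rank n n (poisson_matrix bracket x) = t"
    and u: "\<And>v. pi.ev u v = 0"
  shows "u \<in> pea_ideal scale bracket"
proof -
  define J where "J = {a. AA a * u \<doteq> 0}"
  have "1 \<in> J"
  proof (rule ccontr)
    assume 1: "1 \<notin> J"
    have "\<exists>P. primeideal P class_ring \<and> J \<subseteq> P"
    proof (rule ex_prime_above[OF _ _ _ 1])
      show "0 \<in> J" using cong_mult[OF Av_0[of scale bracket] cong_refl[of scale bracket u]] by (simp add: J_def)
      show "a + b \<in> J" if "a \<in> J" "b \<in> J" for a b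
      proof -
        have "AA (a + b) * u \<doteq> (AA a + AA b) * u" by (intro cong_mult cong_relations cong_refl)
        also have "\<dots> = AA a * u + AA b * u" by (rule distrib_right)
        also have "\<dots> \<doteq> 0 + 0" using that by (intro cong_add) (simp_all add: J_def)
        finally show ?thesis by (simp add: J_def)
      qed
      show "r * a \<in> J" if "a \<in> J" for a r
      proof -
        have "AA (r * a) * u \<doteq> AA r * AA a * u" by (intro cong_mult cong_relations cong_refl)
        also have "\<dots> = AA r * (AA a * u)" by (rule mult.assoc)
        also have "\<dots> \<doteq> AA r * 0" using that by (intro cong_mult cong_refl) (simp add: J_def)
        finally show ?thesis by (simp add: J_def)
      qed
    qed
    then obtain P where P: "primeideal P class_ring" "J \<subseteq> P" by blast
    have "regular_local_ring (localization_at P)" using reg P(1) by (simp add: regular_domain_def)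
    then obtain w where "local_frame scale bracket P t w"
      using symplectic_local_frame[OF primeish_primeideal[OF P(1)] _ d] by blast
    from local_frame.locally_faithful[OF this u] obtain s where "s \<notin> P" "AA s * u \<doteq> 0" by blast
    then show False using P(2) by (auto simp: J_def)
  qed
  then have "AA 1 * u \<doteq> 0" by (simp add: J_def)
  then have "1 * u \<doteq> 0" using cong_trans[OF cong_sym[OF cong_mult[OF cong_relations(1)[of scale bracket] cong_refl[of scale bracket u]]]] by blast
  then show ?thesis by (simp add: pea_cong_def)
qed

end

section \<open>The ideal \<open>\<kappa>\<close> and the pairing\<close>

text \<open>Laplace expansion along the last column. It identifies the alternating sum that defines
  the generators of \<kappa> with a determinant, for any coefficients w in place of the
  \<delta>_i.\<close>

lemma bordered_minor_expansion:
  fixes M :: "nat \<Rightarrow> nat \<Rightarrow> 'a::comm_ring_1"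
  assumes len: "length js = length is"
  shows "minor M is js * w i + (\<Sum>s\<in>{1..length is}. (-1) ^ (s + length is + 1) *
      minor M (take (s - 1) is @ drop s is @ [i]) js * w (is ! (s - 1))) =
    det (mat (length is + 1) (length is + 1)
      (\<lambda>(s, t). if t < length is then M ((is @ [i]) ! s) (js ! t) else w ((is @ [i]) ! s)))"
proof -
  define d where "d = length is"
  define A where "A = mat (d + 1) (d + 1) (\<lambda>(s, t). if t < d then M ((is @ [i]) ! s) (js ! t) else w ((is @ [i]) ! s))"
  have A: "A \<in> carrier_mat (d + 1) (d + 1)" by (simp add: A_def)
  have last: "mat_delete A d d = mat d d (\<lambda>(s, t). M (is ! s) (js ! t))"
    by (rule eq_matI) (auto simp: A_def mat_delete_def nth_append d_def)
  have inner: "mat_delete A s d = mat d d (\<lambda>(s', t). M ((take s is @ drop (Suc s) is @ [i]) ! s') (js ! t))" if s: "s < d" for s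
  proof (rule eq_matI)
    fix u v assume uv: "u < dim_row (mat d d (\<lambda>(s', t). M ((take s is @ drop (Suc s) is @ [i]) ! s') (js ! t)))"
      "v < dim_col (mat d d (\<lambda>(s', t). M ((take s is @ drop (Suc s) is @ [i]) ! s') (js ! t)))"
    have "(take s is @ drop (Suc s) is @ [i]) ! u = (is @ [i]) ! (if u < s then u else Suc u)"
      using s uv by (auto simp: nth_append d_def)
    then show "mat_delete A s d $$ (u, v) = mat d d (\<lambda>(s', t). M ((take s is @ drop (Suc s) is @ [i]) ! s') (js ! t)) $$ (u, v)"
      using s uv by (simp add: A_def mat_delete_def)
  qed (simp_all add: A_def)
  have "det A = (\<Sum>s<d + 1. A $$ (s, d) * cofactor A s d)"
    by (rule laplace_expansion_column[OF A]) simp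
  also have "\<dots> = (\<Sum>s<d. A $$ (s, d) * cofactor A s d) + A $$ (d, d) * cofactor A d d" by simp
  also have "A $$ (d, d) * cofactor A d d = minor M is js * w i"
    using len by (simp add: cofactor_def last minor_def) (simp add: A_def d_def)
  \<comment> \<open>With rows counted from 0 the cofactor sign is \<open>(-1) ^ (s + d)\<close>. It
    is rewritten with two more factors -1 to fit the sign in the definition, where rows are counted
    from 1.\<close>
  also have "(\<Sum>s<d. A $$ (s, d) * cofactor A s d) = (\<Sum>s<d. (-1) ^ (Suc s + d + 1) *
      minor M (take s is @ drop (Suc s) is @ [i]) js * w (is ! s))"
  proof (rule sum.cong[OF refl])
    fix s assume "s \<in> {..<d}"
    then have s: "s < d" by simp
    have l: "length (take s is @ drop (Suc s) is @ [i]) = d" using s by (simp add: d_def)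
    have "cofactor A s d = (-1) ^ (s + d) * minor M (take s is @ drop (Suc s) is @ [i]) js"
      unfolding cofactor_def inner[OF s] minor_def l using len by (simp add: d_def)
    moreover have "A $$ (s, d) = w (is ! s)" using s by (simp add: A_def nth_append d_def)
    ultimately show "A $$ (s, d) * cofactor A s d = (-1) ^ (Suc s + d + 1) *
      minor M (take s is @ drop (Suc s) is @ [i]) js * w (is ! s)" by (simp add: mult_ac)
  qed
  also have "\<dots> = (\<Sum>s\<in>{1..d}. (-1) ^ (s + d + 1) * minor M (take (s - 1) is @ drop s is @ [i]) js * w (is ! (s - 1)))"
    by (simp add: sum.atLeast1_atMost_eq)
  finally show ?thesis unfolding A_def d_def by (simp add: add.commute)
qed

lemma genideal_eq_zero:
  assumes "ring R" "G \<subseteq> carrier R"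
  shows "Idl\<^bsub>R\<^esub> G = {\<zero>\<^bsub>R\<^esub>} \<longleftrightarrow> G \<subseteq> {\<zero>\<^bsub>R\<^esub>}"
proof
  interpret R: ring R by (rule assms(1))
  show "G \<subseteq> {\<zero>\<^bsub>R\<^esub>}" if "Idl\<^bsub>R\<^esub> G = {\<zero>\<^bsub>R\<^esub>}"
    using R.genideal_self[OF assms(2)] unfolding that .
  assume "G \<subseteq> {\<zero>\<^bsub>R\<^esub>}"
  then have "Idl\<^bsub>R\<^esub> G \<subseteq> {\<zero>\<^bsub>R\<^esub>}" by (rule R.genideal_minimal[OF R.zeroideal])
  moreover have "\<zero>\<^bsub>R\<^esub> \<in> Idl\<^bsub>R\<^esub> G"
    by (rule additive_subgroup.zero_closed[OF ideal.axioms(1)[OF R.genideal_ideal[OF assms(2)]]])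
  ultimately show "Idl\<^bsub>R\<^esub> G = {\<zero>\<^bsub>R\<^esub>}" by blast
qed

lemma indexed_subset:
  "{F a i b | a i b. a \<in> A \<and> b \<in> B \<and> i \<in> E a} \<subseteq> {c} \<longleftrightarrow> (\<forall>a\<in>A. \<forall>b\<in>B. \<forall>i\<in>E a. F a i b = c)"
  by auto

context framed_affine
begin

abbreviation "PM \<equiv> poisson_matrix bracket x"

text \<open>Position 0 stands for the bordering index, so that a generator of \<kappa> becomes one
  uniform sum over \<open>{0..length is}\<close> of coefficients times differentials of
  variables.\<close>

definition dterm :: "nat list \<Rightarrow> nat \<Rightarrow> nat \<Rightarrow> nat" where
  "dterm is i s = (if s = 0 then i else is ! (s - 1))"

definition dcoef :: "nat list \<Rightarrow> nat \<Rightarrow> nat list \<Rightarrow> nat \<Rightarrow> 'a" where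
  "dcoef is i js s = (if s = 0 then minor PM is js
     else (-1) ^ (s + length is + 1) * minor PM (take (s - 1) is @ drop s is @ [i]) js)"

lemma sum_dcoef:
  "(\<Sum>s\<in>{0..length is}. F (dcoef is i js s) (dterm is i s)) = F (minor PM is js) i +
    (\<Sum>s\<in>{1..length is}. F ((-1) ^ (s + length is + 1) * minor PM (take (s - 1) is @ drop s is @ [i]) js) (is ! (s - 1)))"
proof -
  have "(\<Sum>s\<in>{0..length is}. F (dcoef is i js s) (dterm is i s)) = F (dcoef is i js 0) (dterm is i 0) +
      (\<Sum>s\<in>{1..length is}. F (dcoef is i js s) (dterm is i s))"
    by (simp add: sum.atLeast_Suc_atMost)
  also have "(\<Sum>s\<in>{1..length is}. F (dcoef is i js s) (dterm is i s)) =
      (\<Sum>s\<in>{1..length is}. F ((-1) ^ (s + length is + 1) * minor PM (take (s - 1) is @ drop s is @ [i]) js) (is ! (s - 1)))"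
    by (rule sum.cong) (auto simp: dcoef_def dterm_def)
  finally show ?thesis by (simp add: dcoef_def dterm_def)
qed

definition dform :: "nat list \<Rightarrow> nat \<Rightarrow> nat list \<Rightarrow> 'a pea_gen list \<Rightarrow>\<^sub>0 'k" where
  "dform is i js = (\<Sum>s\<in>{0..length is}. AA (dcoef is i js s) * BB (x (dterm is i s)))"

lemma poisson_delta_class: "poisson_delta scale bracket x is i js = pea_class scale bracket (dform is i js)"
  unfolding dform_def sum_dcoef[of "\<lambda>a i. AA a * BB (x i)"]
  by (simp only: poisson_delta_def Let_def pea_alpha_class pea_beta_class pea_class_mult pea_class_add
      pea_class_sum[OF finite_atLeastAtMost])

text \<open>The image under \<pi> is a derivation, so its values on the variables decide. At
  \<open>x j\<close> it is the minor of the Poisson matrix bordered by row i and column j, of order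
  d + 1 and therefore zero.\<close>

lemma delta_vanishes:
  assumes "is": "set is \<subseteq> {1..n}" "length is = frac_rank n n PM"
    and js: "set js \<subseteq> {1..n}" "length js = frac_rank n n PM" and i: "i \<in> {1..n}"
  shows "pi.ev (dform is i js) v = 0"
proof -
  define \<theta> where "\<theta> v = (\<Sum>s\<in>{0..length is}. dcoef is i js s * bracket (x (dterm is i s)) v)" for v
  have ev: "pi.ev (dform is i js) v = \<theta> v" for v
    by (simp add: dform_def \<theta>_def pi.ev_sum pi.ev_mult pi.ev_gens)
  have "emb (\<theta> v) = emb 0"
  proof (rule derivation_eqI[of "\<lambda>v. emb (\<theta> v)" "\<lambda>v. emb 0"])
    show "der_on UNIV (\<lambda>v. emb (\<theta> v))"
      by (simp add: der_on_def \<theta>_def bracket_add_right bracket_leibniz emb_simps emb_sum sum.distrib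
          distrib_left sum_distrib_left sum_distrib_right mult_ac)
    show "der_on UNIV (\<lambda>v. emb 0)" by (simp add: der_on_def emb_simps)
    show "emb (\<theta> (scale c 1)) = 0" for c by (simp add: \<theta>_def bracket_const emb_simps)
    fix j assume j: "j \<in> {1..n}"
    have "\<theta> (x j) = det (mat (length is + 1) (length is + 1)
      (\<lambda>(s, t). if t < length is then PM ((is @ [i]) ! s) (js ! t) else PM ((is @ [i]) ! s) j))"
      unfolding \<theta>_def sum_dcoef[of "\<lambda>a i. a * bracket (x i) (x j)"]
      using bordered_minor_expansion[of js "is" PM "\<lambda>i. PM i j" i] "is" js by (simp add: poisson_matrix_def)
    also have "\<dots> = minor PM (is @ [i]) (js @ [j])"
      unfolding minor_def using "is" js by (intro arg_cong[of _ _ det] eq_matI) (auto simp: nth_append less_Suc_eq)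
    also have "\<dots> = 0"
      by (rule minor_zero_above_rank[of _ _ n n]) (use "is" js i j in auto)
    finally show "emb (\<theta> (x j)) = emb 0" by simp
  qed (simp add: emb_simps)
  then show ?thesis by (simp add: ev emb_simps)
qed

text \<open>The Poisson matrix factors through the t coordinates of the frame.\<close>

lemma rank_le: "frac_rank n n PM \<le> t"
proof -
  let ?d = "frac_rank n n PM"
  obtain "is" js where ij: "is \<in> incr_tuples ?d n" "js \<in> incr_tuples ?d n" "minor PM is js \<noteq> 0"
    using ex_minor_frac_rank[of n n PM] by blast
  have "det (mat ?d ?d (\<lambda>(i, j). \<Sum>k\<in>{..<t}. D k (emb (x (is ! i))) * \<rho> k (emb (x (js ! j))))) \<noteq> 0"
    using ij minor_emb[of PM "is" js] incr_tuplesD(1)[OF ij(1)] incr_tuplesD(1)[OF ij(2)]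
    unfolding emb_bracket[symmetric] by (simp add: minor_def poisson_matrix_def emb_simps)
  from det_factor_card[OF this] show ?thesis by simp
qed

text \<open>If d < t, some nonzero combination w of the \<open>D k\<close> kills the d variables of
  a nonzero maximal minor. A generator of \<kappa> that is zero in the enveloping algebra has zero
  coordinates by \<open>form_coordinates\<close>, so pairing it with w leaves the minor times the
  value of w at \<open>x i\<close>. Hence w kills all variables, among them the frame, and its
  coefficients vanish.\<close>

lemma kappa_rank:
  assumes \<kappa>: "\<And>is js i. is \<in> minor_rows n n PM (frac_rank n n PM) \<Longrightarrow> js \<in> minor_cols n n PM (frac_rank n n PM) \<Longrightarrow>
      i \<in> {1..n} - set is \<Longrightarrow> dform is i js \<in> pea_ideal scale bracket"
  shows "frac_rank n n PM = t"
proof (rule ccontr)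
  let ?d = "frac_rank n n PM"
  assume "?d \<noteq> t"
  then have dt: "?d < t" using rank_le by simp
  obtain "is" js where ij: "is \<in> incr_tuples ?d n" "js \<in> incr_tuples ?d n" "minor PM is js \<noteq> 0"
    using ex_minor_frac_rank[of n n PM] by blast
  then have mem: "is \<in> minor_rows n n PM ?d" "js \<in> minor_cols n n PM ?d"
    by (auto simp: minor_rows_def minor_cols_def)
  have len: "length is = ?d" by (rule incr_tuplesD(1)[OF ij(1)])
  obtain c where c: "\<exists>k\<in>{..<t}. c k \<noteq> 0" "\<forall>s\<in>{..<?d}. (\<Sum>k\<in>{..<t}. c k * D k (emb (x (is ! s)))) = 0"
    using underdetermined_system[of "{..<?d}" "{..<t}" "\<lambda>k s. D k (emb (x (is ! s)))"] dt by auto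
  define w where "w i = (\<Sum>k<t. c k * D k (emb (x i)))" for i
  have w0: "w (is ! s) = 0" if "s < ?d" for s using c(2) that by (simp add: w_def)
  have w: "w i = 0" if i: "i \<in> {1..n}" for i
  proof (cases "i \<in> set is")
    case True
    then show ?thesis using w0 len by (auto simp: in_set_conv_nth)
  next
    case False
    have "(\<Sum>s\<in>{0..length is}. emb (dcoef is i js s) * D k (emb (x (dterm is i s)))) = 0" for k
      by (rule form_coordinates) (use \<kappa>[OF mem, of i] i False in \<open>simp add: dform_def\<close>)
    then have "0 = (\<Sum>k<t. c k * (\<Sum>s\<in>{0..length is}. emb (dcoef is i js s) * D k (emb (x (dterm is i s)))))" by simp
    also have "\<dots> = (\<Sum>s\<in>{0..length is}. emb (dcoef is i js s) * w (dterm is i s))"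
      unfolding w_def sum_distrib_left by (subst sum.swap) (simp add: mult_ac)
    also have "\<dots> = (\<Sum>s\<in>{0}. emb (dcoef is i js s) * w (dterm is i s))"
      by (rule sum.mono_neutral_right) (use len w0 in \<open>auto simp: dterm_def\<close>)
    finally show ?thesis using ij(3) by (simp add: dcoef_def dterm_def emb_simps)
  qed
  have "c k = 0" if k: "k < t" for k
  proof -
    obtain i where i: "i \<in> {1..n}" "z k = x i" using z_var[OF k] by blast
    have "w i = (\<Sum>l<t. if k = l then c l else 0)"
      unfolding w_def i(2)[symmetric] by (rule sum.cong) (use k D_dual in auto)
    then show ?thesis using w[OF i(1)] k by simp
  qed
  then show False using c(1) by simp
qed

text \<open>For d = t the Hamiltonian derivations separate forms over the fraction field, so a form
  in the kernel of \<pi> has zero coordinates there. Every derivation is a combination of the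
  \<open>D k\<close> and pairs with it to zero.\<close>

lemma pairing_vanishes:
  assumes d: "frac_rank n n PM = t" and \<theta>: "\<theta> \<in> derivations scale"
    and b: "\<And>v. (\<Sum>i=1..n. b i * bracket (x i) v) = 0"
  shows "(\<Sum>i=1..n. b i * \<theta> (x i)) = 0"
proof -
  obtain "is" js where ij: "is \<in> incr_tuples t n" "js \<in> incr_tuples t n" "minor PM is js \<noteq> 0"
    using ex_minor_frac_rank[of n n PM] unfolding d by blast
  have det: "det (mat t t (\<lambda>(i, j). \<Sum>k\<in>{..<t}. D k (emb (x (is ! i))) * \<rho> k (emb (x (js ! j))))) \<noteq> 0"
    using ij minor_emb[of PM "is" js] incr_tuplesD(1)[OF ij(1)] incr_tuplesD(1)[OF ij(2)]
    unfolding emb_bracket[symmetric] by (simp add: minor_def poisson_matrix_def emb_simps)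
  define W where "W k = (\<Sum>i=1..n. emb (b i) * D k (emb (x i)))" for k
  have W: "W k = 0" if k: "k < t" for k
  proof (rule det_factor_kernel[OF det])
    fix j assume "j < t"
    have "(\<Sum>k\<in>{..<t}. W k * \<rho> k (emb (x (js ! j)))) = (\<Sum>i=1..n. emb (b i) * (\<Sum>k<t. D k (emb (x i)) * \<rho> k (emb (x (js ! j)))))"
      unfolding W_def sum_distrib_left sum_distrib_right by (subst sum.swap) (simp add: mult.assoc)
    also have "\<dots> = emb (\<Sum>i=1..n. b i * bracket (x i) (x (js ! j)))"
      by (simp only: emb_sum emb_simps emb_bracket)
    finally show "(\<Sum>k\<in>{..<t}. W k * \<rho> k (emb (x (js ! j)))) = 0" by (simp only: b emb_simps)
  qed (use k in auto)
  note \<theta>' = derivationsD[OF \<theta>]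
  have ex: "emb (\<theta> a) = (\<Sum>k<t. emb (\<theta> (z k)) * D k (emb a))" for a
    by (rule expand[OF \<theta>'(1)]) (simp add: \<theta>'(2) emb_simps)
  have "emb (\<Sum>i=1..n. b i * \<theta> (x i)) = (\<Sum>i=1..n. emb (b i) * emb (\<theta> (x i)))"
    by (simp only: emb_sum emb_simps)
  also have "\<dots> = (\<Sum>i=1..n. emb (b i) * (\<Sum>k<t. emb (\<theta> (z k)) * D k (emb (x i))))"
    by (intro sum.cong refl arg_cong2[of _ _ _ _ times] ex)
  also have "\<dots> = (\<Sum>k<t. emb (\<theta> (z k)) * W k)"
    unfolding W_def sum_distrib_left by (subst sum.swap) (simp add: mult_ac)
  finally show ?thesis using W by (simp add: emb_simps)
qed

text \<open>The pairing is defined by a choice of representation. Every representation of the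
  generator is killed by \<pi>, so each of them gives the value 0 and the definite description
  denotes 0.\<close>

lemma kaehler_pairing_delta:
  assumes d: "frac_rank n n PM = t" and \<theta>: "\<theta> \<in> derivations scale"
    and "is": "is \<in> incr_tuples t n" and js: "js \<in> incr_tuples t n" and i: "i \<in> {1..n}"
  shows "kaehler_pairing scale bracket n x \<theta> (poisson_delta scale bracket x is i js) = 0"
proof -
  note isD = incr_tuplesD[OF "is"] and jsD = incr_tuplesD[OF js]
  have \<omega>: "poisson_delta scale bracket x is i js = (\<Oplus>\<^bsub>pea scale bracket\<^esub>i\<in>{1..n}.
      pea_alpha scale bracket (b i) \<otimes>\<^bsub>pea scale bracket\<^esub> pea_beta scale bracket (x i)) \<longleftrightarrow>
      dform is i js \<doteq> (\<Sum>i=1..n. AA (b i) * BB (x i))" for b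
    by (simp only: poisson_delta_class pea_alpha_class pea_beta_class pea_class_mult[symmetric]
        pea_class_sum[OF finite_atLeastAtMost, symmetric] pea_class_eq_iff pea_cong_def)
  have zero: "(\<Sum>i=1..n. b i * \<theta> (x i)) = 0" if b: "dform is i js \<doteq> (\<Sum>i=1..n. AA (b i) * BB (x i))" for b
  proof (rule pairing_vanishes[OF d \<theta>])
    fix v
    have "pi.ev (dform is i js) v = 0" by (rule delta_vanishes) (use isD jsD i d in auto)
    then show "(\<Sum>i=1..n. b i * bracket (x i) v) = 0"
      using pi.ev_cong[OF b, of v] by (simp add: pi.ev_sum pi.ev_mult pi.ev_gens)
  qed
  \<comment> \<open>The definition of the pairing asks for coefficients indexed by all variables;
    terms of the generator are collected by their variable.\<close>
  define b where "b i' = (\<Sum>s\<in>{s \<in> {0..length is}. dterm is i s = i'}. dcoef is i js s)" for i'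
  have "(\<Sum>i'=1..n. AA (b i') * BB (x i')) \<doteq> (\<Sum>i'=1..n. (\<Sum>s\<in>{s \<in> {0..length is}. dterm is i s = i'}. AA (dcoef is i js s)) * BB (x i'))"
    unfolding b_def by (intro cong_sum cong_mult Av_sum cong_refl)
  also have "\<dots> = (\<Sum>i'=1..n. \<Sum>s\<in>{s \<in> {0..length is}. dterm is i s = i'}. AA (dcoef is i js s) * BB (x (dterm is i s)))"
    by (auto simp: sum_distrib_right intro!: sum.cong)
  also have "\<dots> = dform is i js"
    unfolding dform_def
  proof (rule sum.group)
    show "dterm is i ` {0..length is} \<subseteq> {1..n}"
    proof
      fix j assume "j \<in> dterm is i ` {0..length is}"
      then obtain s where s: "s \<le> length is" "j = dterm is i s" by auto
      show "j \<in> {1..n}"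
      proof (cases "s = 0")
        case False
        then have "is ! (s - 1) \<in> set is" using s by (intro nth_mem) simp
        then have "is ! (s - 1) \<in> {1..n}" using isD(2) by blast
        then show ?thesis using False s by (simp add: dterm_def)
      qed (use i s in \<open>simp add: dterm_def\<close>)
    qed
  qed simp_all
  finally have b: "dform is i js \<doteq> (\<Sum>i=1..n. AA (b i) * BB (x i))" by (rule cong_sym)
  show ?thesis
    unfolding kaehler_pairing_def \<omega>
  proof (rule the_equality)
    show "\<exists>b. dform is i js \<doteq> (\<Sum>i=1..n. AA (b i) * BB (x i)) \<and> 0 = (\<Sum>i=1..n. b i * \<theta> (x i))"
      using b zero[OF b] by auto
  qed (use zero in auto)
qed

lemma kernel_trivial_iff:
  "a_kernel (pea scale bracket) (PD_ring scale bracket) (poisson_pi scale bracket) = {\<zero>\<^bsub>pea scale bracket\<^esub>} \<longleftrightarrow>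
    (\<forall>p. (\<forall>v. pi.ev p v = 0) \<longrightarrow> p \<in> pea_ideal scale bracket)"
proof -
  have pi: "poisson_pi scale bracket (pea_class scale bracket p) = pi.ev p" for p
    by (simp add: poisson_pi_def pi.ev_def)
  have ker: "pea_class scale bracket p \<in> a_kernel (pea scale bracket) (PD_ring scale bracket) (poisson_pi scale bracket) \<longleftrightarrow>
      (\<forall>v. pi.ev p v = 0)" for p
    by (simp add: a_kernel_def' pea_class_closed pi PD_ops fun_eq_iff)
  show ?thesis
  proof
    assume K: "a_kernel (pea scale bracket) (PD_ring scale bracket) (poisson_pi scale bracket) = {\<zero>\<^bsub>pea scale bracket\<^esub>}"
    show "\<forall>p. (\<forall>v. pi.ev p v = 0) \<longrightarrow> p \<in> pea_ideal scale bracket"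
    proof (intro allI impI)
      fix p assume "\<forall>v. pi.ev p v = 0"
      then have "pea_class scale bracket p \<in> {\<zero>\<^bsub>pea scale bracket\<^esub>}" unfolding K[symmetric] ker .
      then show "p \<in> pea_ideal scale bracket" by (simp only: singleton_iff pea_class_eq_0)
    qed
  next
    assume *: "\<forall>p. (\<forall>v. pi.ev p v = 0) \<longrightarrow> p \<in> pea_ideal scale bracket"
    have "u = \<zero>\<^bsub>pea scale bracket\<^esub>" if u: "u \<in> a_kernel (pea scale bracket) (PD_ring scale bracket) (poisson_pi scale bracket)" for u
    proof -
      have "u \<in> carrier (pea scale bracket)" using u by (simp add: a_kernel_def')
      then obtain p where p: "u = pea_class scale bracket p" using pea_class_surj by blast
      have "\<forall>v. pi.ev p v = 0" using u unfolding p ker .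
      then have "p \<in> pea_ideal scale bracket" using * by blast
      then show ?thesis unfolding p by (simp only: pea_class_eq_0)
    qed
    moreover have "pea_class scale bracket 0 \<in> a_kernel (pea scale bracket) (PD_ring scale bracket) (poisson_pi scale bracket)"
      unfolding ker by (simp add: pi.ev_0)
    ultimately show "a_kernel (pea scale bracket) (PD_ring scale bracket) (poisson_pi scale bracket) = {\<zero>\<^bsub>pea scale bracket\<^esub>}"
      unfolding pea_class_0 by blast
  qed
qed

lemma kappa_trivial_iff:
  "poisson_kappa scale bracket n x = {\<zero>\<^bsub>pea scale bracket\<^esub>} \<longleftrightarrow>
    (\<forall>is\<in>minor_rows n n PM (frac_rank n n PM). \<forall>js\<in>minor_cols n n PM (frac_rank n n PM). \<forall>i\<in>{1..n} - set is.
      dform is i js \<in> pea_ideal scale bracket)"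
proof -
  let ?G = "{poisson_delta scale bracket x is i\<nu> js | is i\<nu> js.
           is \<in> minor_rows n n PM (frac_rank n n PM) \<and> js \<in> minor_cols n n PM (frac_rank n n PM) \<and> i\<nu> \<in> {1..n} - set is}"
  have \<kappa>: "poisson_kappa scale bracket n x = Idl\<^bsub>pea scale bracket\<^esub> ?G" by (simp add: poisson_kappa_def Let_def)
  have G: "?G \<subseteq> carrier (pea scale bracket)" by (auto simp: poisson_delta_class pea_class_closed)
  have "Idl\<^bsub>pea scale bracket\<^esub> ?G = {\<zero>\<^bsub>pea scale bracket\<^esub>} \<longleftrightarrow> ?G \<subseteq> {\<zero>\<^bsub>pea scale bracket\<^esub>}"
    by (rule genideal_eq_zero[OF pea_ring G])
  also have "?G \<subseteq> {\<zero>\<^bsub>pea scale bracket\<^esub>} \<longleftrightarrow> (\<forall>is\<in>minor_rows n n PM (frac_rank n n PM).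
      \<forall>js\<in>minor_cols n n PM (frac_rank n n PM). \<forall>i\<in>{1..n} - set is. poisson_delta scale bracket x is i js = \<zero>\<^bsub>pea scale bracket\<^esub>)"
    by (rule indexed_subset)
  finally show ?thesis by (simp only: \<kappa> poisson_delta_class pea_class_eq_0)
qed

end

theorem theorem1p9:
  fixes scale :: "'k::field_char_0 \<Rightarrow> 'a::idom \<Rightarrow> 'a"
    and bracket :: "'a \<Rightarrow> 'a \<Rightarrow> 'a"
    and n m d r :: nat
    and f :: "nat \<Rightarrow> 'k mpoly"
    and I :: "'k mpoly set"
    and S :: "'k mpoly set set"
    and \<iota> :: "'k mpoly set \<Rightarrow> 'a"
    and \<phi> :: "'k mpoly \<Rightarrow> 'a"
    and x :: "nat \<Rightarrow> 'a"
  assumes poisson: "poisson_algebra scale bracket"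
    and f: "\<forall>i\<in>{1..m}. f i \<in> carrier (mpoly_ring n)"
    and I: "I = Idl\<^bsub>mpoly_ring n\<^esub> (f ` {1..m})"
    and prime: "primeideal I (mpoly_ring n)"
    and not_maximal: "\<not> maximalideal I (mpoly_ring n)"
    and localization: "is_localization (mpoly_ring n Quot I) S class_ring \<iota>"
    and localization_K: "\<forall>c. \<iota> (I +>\<^bsub>mpoly_ring n\<^esub> pconst c) = scale c 1"
    and regular: "regular_domain TYPE('a)"
    and \<phi>: "\<phi> = (\<lambda>p. \<iota> (I +>\<^bsub>mpoly_ring n\<^esub> p))"
    and x: "x = (\<lambda>i. \<phi> (pvar i))"
    and d: "d = frac_rank n n (poisson_matrix bracket x)"
    and r: "r = frac_rank m n (jacobian \<phi> f)"
  defines "P1 \<equiv> a_kernel (pea scale bracket) (PD_ring scale bracket) (poisson_pi scale bracket)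
                  = {\<zero>\<^bsub>pea scale bracket\<^esub>}"
    and "P2 \<equiv> poisson_kappa scale bracket n x = {\<zero>\<^bsub>pea scale bracket\<^esub>}"
    and "P3 \<equiv> d = n - r \<and>
           (\<forall>is \<in> minor_rows m n (jacobian \<phi> f) r. \<forall>js \<in> minor_cols m n (jacobian \<phi> f) r.
            \<forall>is' \<in> minor_rows n n (poisson_matrix bracket x) d.
            \<forall>js' \<in> minor_cols n n (poisson_matrix bracket x) d.
            \<forall>j\<nu> \<in> {1..n} - set js. \<forall>i\<mu> \<in> {1..n} - set is'.
              kaehler_pairing scale bracket n x
                (jacobian_derivation scale n \<phi> f is js j\<nu>)
                (poisson_delta scale bracket x is' i\<mu> js') = 0)"
  shows "(P1 \<longleftrightarrow> P2) \<and> (P2 \<longleftrightarrow> P3)"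
proof -
  interpret A: poisson_affine scale bracket n m f I S \<iota> \<phi> x
    by (intro poisson_affine.intro poisson poisson_affine_axioms.intro f I prime localization localization_K \<phi> x)
  obtain t z D where frame: "poisson_frame scale bracket t z D" and t: "t = n - A.Jr"
    and z: "\<And>k. k < t \<Longrightarrow> z k \<in> x ` {1..n}"
    and expand: "\<And>\<theta> a. der_on UNIV \<theta> \<Longrightarrow> (\<And>c. \<theta> (scale c 1) = 0) \<Longrightarrow> \<theta> a = (\<Sum>k<t. \<theta> (z k) * D k (emb a))"
  proof (rule A.ex_frame)
    fix t z D assume h: "poisson_frame scale bracket t z D" "t = n - A.Jr"
      "\<And>k. k < t \<Longrightarrow> z k \<in> x ` {1..n}"
      "\<And>\<theta> a. der_on UNIV \<theta> \<Longrightarrow> (\<And>c. \<theta> (scale c 1) = 0) \<Longrightarrow> \<theta> a = (\<Sum>k<t. \<theta> (z k) * D k (emb a))"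
    show thesis
    proof (rule that[OF h(1,2)])
      show "z k \<in> x ` {1..n}" if "k < t" for k by (rule h(3)[OF that])
      show "\<theta> a = (\<Sum>k<t. \<theta> (z k) * D k (emb a))" if "der_on UNIV \<theta>" "\<And>c. \<theta> (scale c 1) = 0" for \<theta> a
        by (rule h(4)[OF that])
    qed
  qed
  interpret framed_affine scale bracket n m f I S \<iota> \<phi> x t z D
    by (intro framed_affine.intro A.poisson_affine_axioms frame framed_affine_axioms.intro z expand)
  have r_Jr: "r = A.Jr" by (simp add: r A.Jr_def)
  have tuples: "minor_rows m' n' M k \<subseteq> incr_tuples k m'" "minor_cols m' n' M k \<subseteq> incr_tuples k n'"
    for m' n' k and M :: "nat \<Rightarrow> nat \<Rightarrow> 'a" by (auto simp: minor_rows_def minor_cols_def)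
  have "P2" if P1
  proof -
    have faithful: "\<forall>v. A.pi.ev p v = 0 \<Longrightarrow> p \<in> pea_ideal scale bracket" for p
      using that unfolding P1_def kernel_trivial_iff by blast
    show P2
      unfolding P2_def kappa_trivial_iff
    proof (intro ballI faithful allI)
      fix "is" js i v assume "is \<in> minor_rows n n PM (frac_rank n n PM)" "js \<in> minor_cols n n PM (frac_rank n n PM)"
        and i: "i \<in> {1..n} - set is"
      then have ij: "is \<in> incr_tuples (frac_rank n n PM) n" "js \<in> incr_tuples (frac_rank n n PM) n" using tuples by blast+
      show "A.pi.ev (dform is i js) v = 0"
        by (rule delta_vanishes) (use incr_tuplesD[OF ij(1)] incr_tuplesD[OF ij(2)] i in auto)
    qed
  qed
  \<comment> \<open>Everything else passes through \<open>d = t\<close>: it follows from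
    \<open>P2\<close> and from the first clause of \<open>P3\<close>, and it implies
    \<open>P1\<close> and \<open>P3\<close>.\<close>
  moreover have "d = t" if P2
    using that kappa_rank unfolding P2_def kappa_trivial_iff d by blast
  moreover have P1 if dt: "d = t"
    unfolding P1_def kernel_trivial_iff using pi_faithful[OF regular] dt d by blast
  moreover have P3 if dt: "d = t"
  proof -
    have "kaehler_pairing scale bracket n x (jacobian_derivation scale n \<phi> f is js j) (poisson_delta scale bracket x is' i js') = 0"
      if "is \<in> minor_rows m n (jacobian \<phi> f) r" "js \<in> minor_cols m n (jacobian \<phi> f) r"
        "is' \<in> minor_rows n n PM d" "js' \<in> minor_cols n n PM d" and j: "j \<in> {1..n} - set js" and i: "i \<in> {1..n} - set is'"
      for "is" js is' js' j i
    proof (rule kaehler_pairing_delta)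
      show "jacobian_derivation scale n \<phi> f is js j \<in> derivations scale"
        by (rule A.jacobian_derivation[OF _ _ j]) (use that(1,2) tuples r_Jr in blast)+
      show "is' \<in> incr_tuples t n" "js' \<in> incr_tuples t n" using that(3,4) tuples dt by blast+
    qed (use i d dt in auto)
    then show ?thesis unfolding P3_def using dt t r_Jr by simp
  qed
  moreover have "d = t" if P3 using that t r_Jr by (simp add: P3_def)
  ultimately show ?thesis by blast
qed

end
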